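(* Let $a,\rho>0$ and $P=-\Delta-a^2\mathbf 1_\rho$ on $\mathbb R^2$, where $\mathbf 1_\rho$ is the indicator function of $\{|x|\le\rho\}$. Let $\sigma(\lambda)$ be the scattering phase of $P$ and $\gamma=-\Gamma'(1)$. Then, as $\lambda\downarrow0$: (1) If $P$ has no resonance at zero, then there is a real $b$ such that $$\sigma'(\lambda)=\frac{-1}{\lambda}\,\frac{2}{4(\log\lambda+b)^2+\pi^2}+O(\lambda).$$ (2) If $P$ has a $p$-resonance at zero, then $$\sigma'(\lambda)=\frac{-1}{\lambda}\left(\frac{2}{4(\log\lambda+\log(\rho/2)+\gamma)^2+\pi^2}+\frac{1}{(\log\lambda+\log(\rho/2)+\gamma-\frac12)^2+\frac{\pi^2}{4}}\right)+O(\lambda).$$ (3) If $P$ has an $s$-resonance at zero, then $$\sigma'(\lambda)=-\tfrac32\rho^2\lambda+O(\lambda^3\log\lambda).$$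
   Context: A solution of $Pu=0$ on $\mathbb R^2$ is outgoing if for large $r$ it has the form $u(r,\theta)=\sum_{\ell\in\mathbb Z}c_\ell r^{-|\ell|}e^{i\ell\theta}$. $P$ has a resonance at zero if there is an outgoing $u\not\equiv0$ with $Pu=0$; it has an $s$-resonance if there is such a $u$ with $c_0\ne0$, and a $p$-resonance if there is such a $u$ with $c_0=0$ and $|c_1|+|c_{-1}|>0$. Scattering phase: since the potential is radial, the scattering matrix $S(\lambda)$, $\lambda>0$, is diagonal in the basis $\{e^{i\ell\theta}\}_{\ell\in\mathbb Z}$; its eigenvalue $S_\ell(\lambda)$ on $e^{i\ell\theta}$ is $c_\ell/d_\ell$, where the nontrivial solution of $(P-\lambda^2)u=0$ on $\mathbb R^2$ of the form $u=f(r)e^{i\ell\theta}$ equals $\big(c_\ell H^{(1)}_\ell(\lambda r)+d_\ell H^{(2)}_\ell(\lambda r)\big)e^{i\ell\theta}$ for $r>\rho$ ($H^{(1)}_\ell,H^{(2)}_\ell$ Hankel functions). Then $\sigma(\lambda)=\frac1{2\pi i}\log\det S(\lambda)=\sum_{\ell\in\mathbb Z}\sigma_\ell(\lambda)$, with $e^{2\pi i\sigma_\ell}=S_\ell$ and $\sigma_\ell(0)=0$. *)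

theory Defs
  imports "HOL-Analysis.Analysis" "HOL-Library.Landau_Symbols"
begin

text \<open>The plane $\mathbb R^2$ is the type \<^typ>\<open>complex\<close>, with its Euclidean structure (orthonormal
  basis $1, i$) and Lebesgue measure \<^const>\<open>lborel\<close>; the point with polar coordinates $(r,\theta)$
  is \<^term>\<open>rcis r \<theta>\<close>.\<close>

subsection \<open>The operator and its solutions\<close>

definition partial_deriv ::
  "'a \<Rightarrow> ('a::euclidean_space \<Rightarrow> 'b::real_normed_vector) \<Rightarrow> 'a \<Rightarrow> 'b" where
  "partial_deriv b f x = vector_derivative (\<lambda>t. f (x + t *\<^sub>R b)) (at 0)"

definition C1_function :: "('a::euclidean_space \<Rightarrow> 'b::real_normed_vector) \<Rightarrow> bool" where
  "C1_function f \<longleftrightarrow>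
     (\<forall>b\<in>Basis. (\<forall>x. (\<lambda>t. f (x + t *\<^sub>R b)) differentiable (at 0)) \<and>
                continuous_on UNIV (partial_deriv b f))"

definition C2_function :: "('a::euclidean_space \<Rightarrow> 'b::real_normed_vector) \<Rightarrow> bool" where
  "C2_function f \<longleftrightarrow> C1_function f \<and> (\<forall>b\<in>Basis. C1_function (partial_deriv b f))"

definition laplacian :: "('a::euclidean_space \<Rightarrow> 'b::real_normed_vector) \<Rightarrow> 'a \<Rightarrow> 'b" where
  "laplacian f x = (\<Sum>b\<in>Basis. partial_deriv b (partial_deriv b f) x)"

definition schroedinger_op :: "real \<Rightarrow> real \<Rightarrow> (complex \<Rightarrow> real) \<Rightarrow> complex \<Rightarrow> real" where
  "schroedinger_op a \<rho> \<phi> x = - laplacian \<phi> x - a\<^sup>2 * indicator {x. norm x \<le> \<rho>} x * \<phi> x"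

definition test_function :: "(complex \<Rightarrow> real) \<Rightarrow> bool" where
  "test_function \<phi> \<longleftrightarrow> C2_function \<phi> \<and> bounded {x. \<phi> x \<noteq> 0}"

text \<open>Solutions of $(P - E)u = 0$ are understood in the sense of distributions ($P$ is symmetric and
  real). The potential being bounded, every locally integrable distributional solution has a
  continuous representative, and \<open>u\<close> denotes that representative. As \<open>u\<close> is continuous and \<open>P\<close> has
  order two, test functions of class $C^2_c$ and of class $C^\infty_c$ give the same notion.\<close>

definition weak_solution :: "real \<Rightarrow> real \<Rightarrow> real \<Rightarrow> (complex \<Rightarrow> complex) \<Rightarrow> bool" where
  "weak_solution a \<rho> E u \<longleftrightarrow>
     continuous_on UNIV u \<and>
     (\<forall>\<phi>. test_function \<phi> \<longrightarrow>
        (LINT x|lborel. u x * complex_of_real (schroedinger_op a \<rho> \<phi> x - E * \<phi> x)) = 0)"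

subsection \<open>Resonances at zero\<close>

definition outgoing_expansion :: "(complex \<Rightarrow> complex) \<Rightarrow> (int \<Rightarrow> complex) \<Rightarrow> bool" where
  "outgoing_expansion u c \<longleftrightarrow>
     (\<exists>R>0. \<forall>r>R. \<forall>\<theta>.
        ((\<lambda>l. c l * complex_of_real (r powi (- \<bar>l\<bar>)) * cis (of_int l * \<theta>))
           has_sum u (rcis r \<theta>)) UNIV)"

definition zero_resonant_state ::
  "real \<Rightarrow> real \<Rightarrow> (complex \<Rightarrow> complex) \<Rightarrow> (int \<Rightarrow> complex) \<Rightarrow> bool" where
  "zero_resonant_state a \<rho> u c \<longleftrightarrow>
     weak_solution a \<rho> 0 u \<and> u \<noteq> (\<lambda>_. 0) \<and> outgoing_expansion u c"

definition zero_resonance :: "real \<Rightarrow> real \<Rightarrow> bool" where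
  "zero_resonance a \<rho> \<longleftrightarrow> (\<exists>u c. zero_resonant_state a \<rho> u c)"

definition s_resonance :: "real \<Rightarrow> real \<Rightarrow> bool" where
  "s_resonance a \<rho> \<longleftrightarrow> (\<exists>u c. zero_resonant_state a \<rho> u c \<and> c 0 \<noteq> 0)"

definition p_resonance :: "real \<Rightarrow> real \<Rightarrow> bool" where
  "p_resonance a \<rho> \<longleftrightarrow>
     (\<exists>u c. zero_resonant_state a \<rho> u c \<and> c 0 = 0 \<and> norm (c 1) + norm (c (-1)) > 0)"

subsection \<open>Bessel and Hankel functions of integer order\<close>

definition bessel_J_nat :: "nat \<Rightarrow> real \<Rightarrow> real" where
  "bessel_J_nat n x = (\<Sum>k. (-1) ^ k / (fact k * fact (n + k)) * (x / 2) ^ (2 * k + n))"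

text \<open>For \<open>x > 0\<close>; this is the expansion 9.1.11 of Abramowitz and Stegun (10.8.1 in the DLMF).\<close>

definition bessel_Y_nat :: "nat \<Rightarrow> real \<Rightarrow> real" where
  "bessel_Y_nat n x =
     - (1 / pi) * (\<Sum>k<n. fact (n - k - 1) / fact k * (x / 2) powi (2 * int k - int n))
     + (2 / pi) * ln (x / 2) * bessel_J_nat n x
     - (1 / pi) * (\<Sum>k. (Digamma (of_nat (k + 1)) + Digamma (of_nat (n + k + 1)))
                        * ((-1) ^ k / (fact k * fact (n + k)) * (x / 2) ^ (2 * k + n)))"

text \<open>Negative integer orders: $J_{-n} = (-1)^n J_n$ and $Y_{-n} = (-1)^n Y_n$.\<close>

definition bessel_J :: "int \<Rightarrow> real \<Rightarrow> real" where
  "bessel_J l x = (if l < 0 then (-1) ^ nat \<bar>l\<bar> else 1) * bessel_J_nat (nat \<bar>l\<bar>) x"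

definition bessel_Y :: "int \<Rightarrow> real \<Rightarrow> real" where
  "bessel_Y l x = (if l < 0 then (-1) ^ nat \<bar>l\<bar> else 1) * bessel_Y_nat (nat \<bar>l\<bar>) x"

definition hankel1 :: "int \<Rightarrow> real \<Rightarrow> complex" where
  "hankel1 l x = complex_of_real (bessel_J l x) + \<i> * complex_of_real (bessel_Y l x)"

definition hankel2 :: "int \<Rightarrow> real \<Rightarrow> complex" where
  "hankel2 l x = complex_of_real (bessel_J l x) - \<i> * complex_of_real (bessel_Y l x)"

subsection \<open>Scattering matrix and scattering phase\<close>

definition partial_wave ::
  "real \<Rightarrow> real \<Rightarrow> int \<Rightarrow> real \<Rightarrow> (complex \<Rightarrow> complex) \<Rightarrow> complex \<Rightarrow> complex \<Rightarrow> bool" where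
  "partial_wave a \<rho> l \<kappa> u c d \<longleftrightarrow>
     weak_solution a \<rho> (\<kappa>\<^sup>2) u \<and> u \<noteq> (\<lambda>_. 0) \<and>
     (\<exists>f. \<forall>r\<ge>0. \<forall>\<theta>. u (rcis r \<theta>) = f r * cis (of_int l * \<theta>)) \<and>
     (\<forall>r>\<rho>. \<forall>\<theta>. u (rcis r \<theta>) =
        (c * hankel1 l (\<kappa> * r) + d * hankel2 l (\<kappa> * r)) * cis (of_int l * \<theta>))"

definition scattering_eigenvalue :: "real \<Rightarrow> real \<Rightarrow> int \<Rightarrow> real \<Rightarrow> complex" where
  "scattering_eigenvalue a \<rho> l \<kappa> = (THE s. \<exists>u c d. partial_wave a \<rho> l \<kappa> u c d \<and> s = c / d)"

text \<open>The frequency parameter is \<open>\<kappa>\<close>. The phase \<open>\<sigma>\<^sub>l\<close> is the continuous branch on $[0,\infty)$ vanishing at $0$. It is real because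
  the eigenvalues have modulus one, and its values on $[0,\infty)$ are determined by the conditions
  below; \<open>SOME\<close> only leaves open the irrelevant values at negative arguments.\<close>

definition partial_phase :: "real \<Rightarrow> real \<Rightarrow> int \<Rightarrow> real \<Rightarrow> real" where
  "partial_phase a \<rho> l =
     (SOME g. continuous_on {0..} g \<and> g 0 = 0 \<and>
        (\<forall>\<kappa>>0. exp (2 * complex_of_real pi * \<i> * complex_of_real (g \<kappa>))
                 = scattering_eigenvalue a \<rho> l \<kappa>))"

definition scattering_phase :: "real \<Rightarrow> real \<Rightarrow> real \<Rightarrow> real" where
  "scattering_phase a \<rho> \<kappa> = (\<Sum>\<^sub>\<infinity>l\<in>UNIV. partial_phase a \<rho> l \<kappa>)"

end

theory Submission
  imports Defs "HOL-Real_Asymp.Real_Asymp"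
begin

text \<open>Write $J_n(x) = (x/2)^n j_n(x^2/4)$, $Y_n(x) = (x/2)^n y_n(x^2/4)$ and $\beta = a^2\rho^2/4$,
  $\tau = \kappa^2\rho^2/4$, $\eta = \tau + \beta$. Matching the radial solutions at $|x| = \rho$ gives
  $S_l = (A - iB)/(A + iB)$ with real amplitudes $A$, $B$ that are bilinear in $j$ at $\eta$ and in
  $y$, respectively $j$, at $\tau$. Hence $\sigma_l = -\arg(A + iB)/\pi$ up to a constant, and the Wronskian of $A$ and $B$,
  which simplifies by the recurrences, makes $\kappa\sigma_l'(\kappa)$ an explicit quotient. For $n = |l|$
  it is $O(\tau^n)$ if $n \ge 1$ and $j_{n-1}(\beta) \ne 0$, it is always $O(\tau^{n-1})$ if $n \ge 2$,
  and it decays geometrically in $n$; so only $n = 0$, $n = 1$ and, for an $s$-resonance, $n = 2$ matter.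

  A $p$-resonance forces $j_0(\beta) = 0$, an $s$-resonance forces $j_1(\beta) = 0$, and either equation
  produces a resonant state. For the necessity, and for the uniqueness of the partial waves, a weak
  solution is tested against $\bar z^n k(|z|^2)$, where $k$ is a radial solution times a cut-off:
  only the derivatives of the cut-off survive, which reads off the exterior coefficients.\<close>

subsection \<open>Reduced Bessel functions\<close>

text \<open>Weak solutions are only continuous and no elliptic regularity is established, so u
  cannot be restricted to a ray and handled by ordinary differential equations. All information
  about u comes from integrals against test functions, and these are evaluated in Cartesian
  coordinates: the angular derivative replaces the orthogonality of the e^{il theta}, the divergence
  of a radial field replaces the radial integral. The variable s = |z|^2 is natural since z^n k(s)
  has no singularity at 0 and differentiating the reduced Bessel functions merely shifts their
  order. The natural test function is only C^1 on |z| = \<rho>, because the potential jumps there;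
  it is reached as a limit of C^2 functions. At low energy two points are delicate. The series over
  n must be differentiated term by term, which needs bounds uniform in n. And an error without
  logarithm must come out of expansions that have one: an error \<tau> (ln \<tau>)^2 in a
  denominator of size (ln \<tau>)^2 is a relative error \<tau>.\<close>

definition rJ :: "nat \<Rightarrow> real \<Rightarrow> real" where
  "rJ n t = (\<Sum>k. (-1) ^ k / (fact k * fact (n + k)) * t ^ k)"

definition rP :: "nat \<Rightarrow> real \<Rightarrow> real" where
  "rP n t = (\<Sum>k. (Digamma (of_nat (k + 1)) + Digamma (of_nat (n + k + 1)))
                 * ((-1) ^ k / (fact k * fact (n + k))) * t ^ k)"

definition rY_fin :: "nat \<Rightarrow> real \<Rightarrow> real" where
  "rY_fin n t = (\<Sum>k<n. fact (n - k - 1) / fact k * t powi (int k - int n))"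

text \<open>At t = (x / 2)^2 one has \<open>ln t\<close> = 2 ln (x / 2), which absorbs the factor 2
  in front of the logarithm of \<open>bessel_Y_nat\<close>.\<close>

definition rY :: "nat \<Rightarrow> real \<Rightarrow> real" where
  "rY n t = (ln t * rJ n t - rY_fin n t - rP n t) / pi"

lemma Digamma_Suc: "Digamma (of_nat (Suc (Suc k)) :: real) = Digamma (of_nat (Suc k)) + 1 / of_nat (Suc k)"
  using Digamma_plus1[of "of_nat (Suc k) :: real"] by (simp add: add_ac)

text \<open>Digamma grows only logarithmically; this crude linear bound, by induction from the value
  - \<open>euler_mascheroni\<close> at 1, suffices because a factorial absorbs it in the series
  \<open>rP\<close>.\<close>

lemma abs_Digamma_le: "\<bar>Digamma (of_nat (Suc k) :: real)\<bar> \<le> of_nat (Suc k)"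
proof (induction k)
  case 0
  have "euler_mascheroni \<le> (1::real)"
    using euler_mascheroni_less_13_over_22 by simp
  then show ?case using euler_mascheroni_pos by simp
next
  case (Suc k)
  have "\<bar>Digamma (of_nat (Suc (Suc k)) :: real)\<bar> \<le> of_nat (Suc k) + 1 / of_nat (Suc k)"
  proof -
    have "0 \<le> 1 / real (Suc k)" by simp
    with Suc.IH show ?thesis unfolding Digamma_Suc by linarith
  qed
  also have "1 / of_nat (Suc k) \<le> (1::real)" by simp
  finally show ?case by simp
qed

lemma summable_exp_real: "summable (\<lambda>k. (t::real) ^ k / fact k)"
  using summable_exp[of t] by (simp add: field_simps)

lemma summable_rJ: "summable (\<lambda>k. (-1) ^ k / (fact k * fact (n + k)) * (t::real) ^ k)"
proof (rule summable_comparison_test'[OF summable_exp_real[of "\<bar>t\<bar>"]])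
  fix k :: nat
  have "(1::real) \<le> fact (n + k)" by (simp add: fact_ge_1)
  then have "\<bar>t\<bar> ^ k / (fact k * fact (n + k)) \<le> \<bar>t\<bar> ^ k / (fact k * 1)"
    by (intro divide_left_mono mult_left_mono) auto
  then show "norm ((-1) ^ k / (fact k * fact (n + k)) * t ^ k) \<le> \<bar>t\<bar> ^ k / fact k"
    by (simp add: abs_mult power_abs)
qed

lemma summable_bp: "summable (\<lambda>k. (Digamma (of_nat (k + 1)) + Digamma (of_nat (n + k + 1)))
                 * ((-1) ^ k / (fact k * fact (n + k))) * (t::real) ^ k)"
proof (rule summable_comparison_test'[OF summable_mult[OF summable_exp_real[of "\<bar>t\<bar>"], of 4], of 1])
  fix k :: nat assume "1 \<le> k"
  have "\<bar>Digamma (of_nat (k + 1)) + Digamma (of_nat (n + k + 1) :: real)\<bar> \<le> of_nat (k + 1) + of_nat (n + k + 1)"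
    using abs_Digamma_le[of k] abs_Digamma_le[of "n+k"] by (simp add: add_ac)
  \<comment> \<open>Here k >= 1 matters: for n = k = 0 the right-hand side would vanish.\<close>
  also have "\<dots> \<le> 4 * of_nat (n + k)" using \<open>1 \<le> k\<close> by simp
  also have "of_nat (n + k) \<le> (fact (n + k) :: real)"
    using fact_ge_self[of "n+k"] by (metis of_nat_fact of_nat_mono)
  finally have D: "\<bar>Digamma (of_nat (k + 1)) + Digamma (of_nat (n + k + 1) :: real)\<bar> \<le> 4 * fact (n + k)"
    by simp
  have "norm ((Digamma (of_nat (k + 1)) + Digamma (of_nat (n + k + 1)))
                 * ((-1) ^ k / (fact k * fact (n + k))) * t ^ k)
     = \<bar>Digamma (of_nat (k + 1)) + Digamma (of_nat (n + k + 1) :: real)\<bar> * (\<bar>t\<bar> ^ k / (fact k * fact (n + k)))"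
    by (simp add: abs_mult power_abs)
  also have "\<dots> \<le> 4 * fact (n + k) * (\<bar>t\<bar> ^ k / (fact k * fact (n + k)))"
    by (rule mult_right_mono[OF D]) simp
  also have "\<dots> = 4 * (\<bar>t\<bar> ^ k / fact k)" by simp
  finally show "norm ((Digamma (of_nat (k + 1)) + Digamma (of_nat (n + k + 1)))
                 * ((-1) ^ k / (fact k * fact (n + k))) * t ^ k) \<le> 4 * (\<bar>t\<bar> ^ k / fact k)" .
qed

lemma rJ_deriv: "(rJ n has_real_derivative - rJ (Suc n) t) (at t)"
proof -
  have "((\<lambda>x. \<Sum>k. ((-1) ^ k / (fact k * fact (n + k))) * x ^ k) has_real_derivative
        (\<Sum>k. diffs (\<lambda>k. (-1) ^ k / (fact k * fact (n + k))) k * t ^ k)) (at t)"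
    by (rule termdiffs_strong_converges_everywhere) (rule summable_rJ)
  moreover have "(\<Sum>k. diffs (\<lambda>k. (-1) ^ k / (fact k * fact (n + k))) k * t ^ k)
    = (\<Sum>k. - ((-1) ^ k / (fact k * fact (Suc n + k)) * t ^ k))"
    by (intro suminf_cong) (simp add: diffs_def divide_simps)
  ultimately show ?thesis
    unfolding rJ_def using suminf_minus[OF summable_rJ[of "Suc n" t]] by simp
qed

text \<open>Besides the shift of order, passing from k to k + 1 raises the first Digamma value by 1
  / (k + 1). These increments reassemble the series of \<open>rJ n\<close> without its constant
  term, divided by t.\<close>

lemma rP_deriv:
  assumes "t \<noteq> 0"
  shows "(rP n has_real_derivative (rJ n t - 1 / fact n) / t - rP (Suc n) t) (at t)"
proof -
  let ?c = "\<lambda>n k. (Digamma (of_nat (k + 1)) + Digamma (of_nat (n + k + 1))) * ((-1) ^ k / (fact k * fact (n + k))) :: real"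
  have 1: "((\<lambda>x. \<Sum>k. ?c n k * x ^ k) has_real_derivative (\<Sum>k. diffs (?c n) k * t ^ k)) (at t)"
    by (rule termdiffs_strong_converges_everywhere) (use summable_bp in \<open>simp\<close>)
  have eq: "diffs (?c n) k * t ^ k = ((-1) ^ Suc k / (fact (Suc k) * fact (n + Suc k)) * t ^ Suc k) / t - ?c (Suc n) k * t ^ k" for k
  proof -
    define d where "d = Digamma (real (Suc k))"
    define e where "e = Digamma (real (n + k + 2))"
    have d': "Digamma (real (Suc k + 1)) = d + 1 / real (Suc k)"
      using Digamma_Suc[of k] by (simp add: d_def)
    have e': "Digamma (real (n + Suc k + 1)) = e" "Digamma (real (Suc n + k + 1)) = e"
      by (simp_all add: e_def add_ac)
    have A: "diffs (?c n) k = real (Suc k) * ((d + 1 / real (Suc k) + e) * ((-1) ^ Suc k / (fact (Suc k) * fact (n + Suc k))))"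
      unfolding diffs_def d' e' by simp
    have B: "?c (Suc n) k = (d + e) * ((-1) ^ k / (fact k * fact (Suc n + k)))"
      unfolding e' by (simp add: d_def)
    show ?thesis unfolding A B
      using assms by (simp add: divide_simps) (simp add: algebra_simps)
  qed
  have s1: "(\<lambda>k. (-1) ^ Suc k / (fact (Suc k) * fact (n + Suc k)) * t ^ Suc k) sums (rJ n t - 1 / fact n)"
    using summable_rJ[of n t] by (subst sums_Suc_iff) (simp add: rJ_def summable_sums)
  have s2: "(\<lambda>k. ?c (Suc n) k * t ^ k) sums rP (Suc n) t"
    unfolding rP_def using summable_bp[of "Suc n" t] by (intro summable_sums) simp
  have "(\<Sum>k. diffs (?c n) k * t ^ k) = (rJ n t - 1 / fact n) / t - rP (Suc n) t"
    unfolding eq using sums_diff[OF sums_divide[OF s1, of t] s2] by (rule sums_unique[symmetric])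
  moreover have "rP n = (\<lambda>x. \<Sum>k. ?c n k * x ^ k)"
    by (rule ext) (rule rP_def)
  ultimately show ?thesis using 1 by (simp only:)
qed

text \<open>The correction is the last summand k = n of \<open>rY_fin (Suc n)\<close>, which
  differentiation does not produce. It cancels the constant-term correction of
  \<open>rP_deriv\<close>, so that \<open>rY\<close> obeys the same clean rule as
  \<open>rJ\<close>.\<close>

lemma rY_fin_deriv:
  assumes "t > 0"
  shows "(rY_fin n has_real_derivative 1 / (fact n * t) - rY_fin (Suc n) t) (at t)"
proof -
  have "(rY_fin n has_real_derivative (\<Sum>k<n. fact (n - k - 1) / fact k * (of_int (int k - int n) * t powi (int k - int n - 1)))) (at t)"
    unfolding rY_fin_def using assms
    by (intro DERIV_sum DERIV_cmult) (auto intro!: derivative_eq_intros)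
  moreover have "(\<Sum>k<n. fact (n - k - 1) / fact k * (of_int (int k - int n) * t powi (int k - int n - 1)))
      = (\<Sum>k<n. - (fact (Suc n - k - 1) / fact k * t powi (int k - int (Suc n))))"
  proof (rule sum.cong)
    fix k assume "k \<in> {..<n}"
    then obtain m where n: "n = Suc (k + m)" by (metis lessThan_iff less_iff_Suc_add)
    show "fact (n - k - 1) / fact k * (of_int (int k - int n) * t powi (int k - int n - 1))
        = - (fact (Suc n - k - 1) / fact k * t powi (int k - int (Suc n)))"
      by (simp add: n algebra_simps add_divide_distrib)
  qed simp
  moreover have "rY_fin (Suc n) t = (\<Sum>k<n. fact (Suc n - k - 1) / fact k * t powi (int k - int (Suc n))) + 1 / (fact n * t)"
    by (simp add: rY_fin_def field_simps)
  ultimately show ?thesis by (simp add: sum_negf)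
qed

lemma rY_deriv:
  assumes "t > 0"
  shows "(rY n has_real_derivative - rY (Suc n) t) (at t)"
proof -
  have "((\<lambda>t. (ln t * rJ n t - rY_fin n t - rP n t) / pi) has_real_derivative
     ((rJ n t / t - ln t * rJ (Suc n) t) - (1 / (fact n * t) - rY_fin (Suc n) t) - ((rJ n t - 1 / fact n) / t - rP (Suc n) t)) / pi) (at t)"
    using assms by (auto intro!: derivative_eq_intros rJ_deriv rY_fin_deriv rP_deriv simp: field_simps)
  also have "((rJ n t / t - ln t * rJ (Suc n) t) - (1 / (fact n * t) - rY_fin (Suc n) t) - ((rJ n t - 1 / fact n) / t - rP (Suc n) t)) / pi
     = - rY (Suc n) t"
    using assms by (simp add: rY_def divide_simps) (simp add: algebra_simps)
  finally show ?thesis unfolding rY_def[abs_def] .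
qed

lemma rJ_rec: "rJ n t + t * rJ (Suc (Suc n)) t = of_nat (Suc n) * rJ (Suc n) t"
proof -
  let ?c = "\<lambda>n k. (-1) ^ k / (fact k * fact (n + k)) :: real"
  have s0: "(\<lambda>k. ?c n k * t ^ k) sums rJ n t" for n
    unfolding rJ_def by (rule summable_sums[OF summable_rJ])
  let ?f = "\<lambda>k. if k = 0 then 0 else ?c (Suc (Suc n)) (k - 1) * t ^ k"
  have "(\<lambda>k. ?f (Suc k)) sums (t * rJ (Suc (Suc n)) t)"
    using sums_mult[OF s0[of "Suc (Suc n)"], of t] by (simp add: algebra_simps)
  then have s2: "?f sums (t * rJ (Suc (Suc n)) t)"
    by (subst (asm) sums_Suc_iff) simp
  have "?c n k * t ^ k + (if k = 0 then 0 else ?c (Suc (Suc n)) (k - 1) * t ^ k) = of_nat (Suc n) * (?c (Suc n) k * t ^ k)" for k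
  proof (cases k)
    case (Suc m)
    show ?thesis unfolding Suc
      by (simp add: divide_simps) (simp add: algebra_simps)
  qed (simp add: divide_simps)
  then show ?thesis
    using sums_add[OF s0[of n] s2] sums_mult[OF s0[of "Suc n"], of "of_nat (Suc n)"] sums_unique2 by fastforce
qed

lemma rP_rec: "rP 0 t + t * rP 2 t + 1 = rP 1 t"
proof -
  let ?c = "\<lambda>n k. (Digamma (of_nat (k + 1)) + Digamma (of_nat (n + k + 1))) * ((-1) ^ k / (fact k * fact (n + k))) :: real"
  have s0: "(\<lambda>k. ?c n k * t ^ k) sums rP n t" for n
    unfolding rP_def using summable_bp by (intro summable_sums) simp
  let ?f = "\<lambda>k. if k = 0 then 1 else ?c 2 (k - 1) * t ^ k"
  have "(\<lambda>k. ?f (Suc k)) sums (t * rP 2 t)"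
    using sums_mult[OF s0[of 2], of t] by (simp add: algebra_simps)
  then have s2: "?f sums (t * rP 2 t + 1)"
    by (subst (asm) sums_Suc_iff) simp
  have eq: "?c 0 k * t ^ k + ?f k = ?c 1 k * t ^ k" for k
  proof (cases k)
    case 0
    then show ?thesis using Digamma_Suc[of 0] by (simp)
  next
    case (Suc m)
    define d where "d = Digamma (real (Suc k))"
    have d1: "Digamma (real (Suc m)) = d - 1 / real (Suc m)"
      using Digamma_Suc[of m] by (simp add: d_def Suc)
    have d2: "Digamma (real (Suc (Suc (Suc m)))) = d + 1 / real (Suc (Suc m))"
      using Digamma_Suc[of "Suc m"] by (simp add: d_def Suc)
    have A: "?c 0 k = 2 * d * ((-1) ^ k / (fact k * fact k))"
      by (simp add: d_def)
    have B: "?c 1 k = (2 * d + 1 / real (Suc (Suc m))) * ((-1) ^ k / (fact k * fact (Suc k)))"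
      using d2 by (simp add: d_def Suc)
    have C: "?c 2 (k - 1) = (2 * d + 1 / real (Suc (Suc m)) - 1 / real (Suc m)) * ((-1) ^ m / (fact m * fact (Suc (Suc m))))"
      using d1 d2 by (simp add: Suc)
    show ?thesis unfolding A B C unfolding Suc
      by (simp add: divide_simps) (simp add: algebra_simps)
  qed
  show ?thesis
    using sums_unique2[OF sums_add[OF s0[of 0] s2, unfolded eq] s0[of 1]] by simp
qed

text \<open>Only order 0 is checked on the series. Differentiating the relation of order n gives
  minus the relation of order n + 1, because of \<open>rY_deriv\<close>.\<close>

lemma rY_rec:
  assumes "t > 0"
  shows "rY n t + t * rY (Suc (Suc n)) t = of_nat (Suc n) * rY (Suc n) t"
  using assms
proof (induction n arbitrary: t)
  case 0
  have f: "rY_fin 0 t = 0" "rY_fin (Suc 0) t = 1 / t" "rY_fin (Suc (Suc 0)) t = 1 / t^2 + 1 / t"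
    by (simp_all add: rY_fin_def power_int_def field_simps)
  have J: "rJ 0 t = rJ 1 t - t * rJ 2 t"
    using rJ_rec[of 0 t] by (simp add: numeral_2_eq_2)
  have P: "rP 1 t = rP 0 t + t * rP 2 t + 1" using rP_rec[of t] by simp
  show ?case using 0 J P
    by (simp add: rY_def f numeral_2_eq_2 divide_simps) (simp add: algebra_simps power2_eq_square)
next
  case (Suc n)
  have "((\<lambda>t. rY n t + t * rY (Suc (Suc n)) t - of_nat (Suc n) * rY (Suc n) t) has_real_derivative
     - rY (Suc n) t + (rY (Suc (Suc n)) t - t * rY (Suc (Suc (Suc n))) t) + of_nat (Suc n) * rY (Suc (Suc n)) t) (at t)"
    using Suc.prems by (auto intro!: derivative_eq_intros rY_deriv)
  moreover have "((\<lambda>t. rY n t + t * rY (Suc (Suc n)) t - of_nat (Suc n) * rY (Suc n) t) has_real_derivative 0) (at t)"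
  proof (rule has_field_derivative_transform_within_open[OF DERIV_const[of 0]])
    show "open ({0<..} :: real set)" by simp
  qed (use Suc in auto)
  ultimately show ?case using DERIV_unique by (fastforce simp: algebra_simps)
qed

section \<open>Reduced functions versus Bessel functions, and behaviour at the origin\<close>

lemma bessel_J_nat_eq: "bessel_J_nat n x = (x / 2) ^ n * rJ n ((x / 2)^2)"
proof -
  have "(\<Sum>k. (x / 2) ^ n * ((-1) ^ k / (fact k * fact (n + k)) * ((x / 2)^2) ^ k)) = (x / 2) ^ n * rJ n ((x / 2)^2)"
    unfolding rJ_def by (rule suminf_mult[OF summable_rJ])
  then show ?thesis unfolding bessel_J_nat_def
    by (simp add: power_add mult_ac flip: power_mult)
qed

lemma bessel_Y_nat_eq:
  assumes "x > 0"
  shows "bessel_Y_nat n x = (x / 2) ^ n * rY n ((x / 2)^2)"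
proof -
  have 1: "(\<Sum>k. (Digamma (of_nat (k + 1)) + Digamma (of_nat (n + k + 1))) * ((-1) ^ k / (fact k * fact (n + k)) * (x / 2) ^ (2 * k + n)))
     = (x / 2) ^ n * rP n ((x / 2)^2)"
  proof -
    have "(\<Sum>k. (x / 2) ^ n * ((Digamma (of_nat (k + 1)) + Digamma (of_nat (n + k + 1))) * ((-1) ^ k / (fact k * fact (n + k))) * ((x / 2)^2) ^ k)) = (x / 2) ^ n * rP n ((x / 2)^2)"
      unfolding rP_def by (rule suminf_mult[OF summable_bp])
    then show ?thesis by (simp add: power_add mult_ac flip: power_mult)
  qed
  have 2: "(\<Sum>k<n. fact (n - k - 1) / fact k * (x / 2) powi (2 * int k - int n)) = (x / 2) ^ n * rY_fin n ((x / 2)^2)"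
    unfolding rY_fin_def sum_distrib_left
  proof (rule sum.cong)
    fix k
    have "(x / 2) powi (2 * int k - int n) = (x / 2) powi (int n + 2 * (int k - int n))"
      by (simp add: algebra_simps)
    also have "\<dots> = (x / 2) ^ n * ((x / 2)^2) powi (int k - int n)"
      using assms power_int_mult[of "x / 2" 2 "int k - int n"] by (subst power_int_add) auto
    finally show "fact (n - k - 1) / fact k * (x / 2) powi (2 * int k - int n)
       = (x / 2) ^ n * (fact (n - k - 1) / fact k * (x / 2)\<^sup>2 powi (int k - int n))" by simp
  qed simp
  have 3: "ln ((x / 2)^2) = 2 * ln (x / 2)" using assms by (simp add: ln_realpow)
  show ?thesis
    unfolding bessel_Y_nat_def 1 2 rY_def 3 bessel_J_nat_eq by (simp add: field_simps)
qed

lemma rJ_0 [simp]: "rJ n 0 = 1 / fact n"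
proof -
  have "(\<lambda>k. (-1) ^ k / (fact k * fact (n + k)) * (0::real) ^ k) sums ((-1) ^ 0 / (fact 0 * fact (n + 0)) * 0 ^ 0)"
    by (rule sums_single[THEN sums_cong[THEN iffD1, rotated]]) auto
  then show ?thesis unfolding rJ_def using sums_unique by fastforce
qed

lemma rP_differentiable: "\<exists>D. (rP n has_real_derivative D) (at t)"
proof -
  let ?c = "\<lambda>n k. (Digamma (of_nat (k + 1)) + Digamma (of_nat (n + k + 1))) * ((-1) ^ k / (fact k * fact (n + k))) :: real"
  have "((\<lambda>x. \<Sum>k. ?c n k * x ^ k) has_real_derivative (\<Sum>k. diffs (?c n) k * t ^ k)) (at t)"
    by (rule termdiffs_strong_converges_everywhere) (use summable_bp in \<open>simp\<close>)
  moreover have "rP n = (\<lambda>x. \<Sum>k. ?c n k * x ^ k)"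
    by (rule ext) (rule rP_def)
  ultimately show ?thesis by (auto simp only:)
qed

lemma rP_0_0 [simp]: "rP 0 0 = - 2 * euler_mascheroni"
proof -
  let ?f = "\<lambda>k. (Digamma (of_nat (k + 1)) + Digamma (of_nat (0 + k + 1))) * ((-1) ^ k / (fact k * fact (0 + k))) * (0::real) ^ k"
  have "?f sums ?f 0"
    by (rule sums_single[THEN sums_cong[THEN iffD1, rotated]]) auto
  then show ?thesis unfolding rP_def using sums_unique by fastforce
qed

lemma rY_0: "rY 0 t = (ln t * rJ 0 t - rP 0 t) / pi"
  by (simp add: rY_def rY_fin_def)

lemma rY_1:
  assumes "t > 0"
  shows "rY 1 t = (ln t * rJ 1 t - 1 / t - rP 1 t) / pi"
  using assms by (simp add: rY_def rY_fin_def power_int_minus divide_simps)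

lemma deriv_at_0_bigo:
  fixes f :: "real \<Rightarrow> real"
  assumes "(f has_real_derivative D) (at 0)"
  shows "(\<lambda>t. f t - f 0) \<in> O[at_right 0](\<lambda>t. t)"
proof -
  have "((\<lambda>t. (f t - f 0) / t) \<longlongrightarrow> D) (at_right 0)"
    using assms by (auto simp: has_field_derivative_iff intro: tendsto_mono at_le)
  then show ?thesis
    by (intro bigoI_tendsto) (auto simp: eventually_at_filter)
qed

lemma rJ_bigo: "(\<lambda>t. rJ n t - 1 / fact n) \<in> O[at_right 0](\<lambda>t. t)"
  using deriv_at_0_bigo[OF rJ_deriv[of n]] by simp

lemma rP_bigo: "(\<lambda>t. rP n t - rP n 0) \<in> O[at_right 0](\<lambda>t. t)"
proof -
  obtain D where "(rP n has_real_derivative D) (at 0)" using rP_differentiable by blast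
  then show ?thesis by (rule deriv_at_0_bigo)
qed

lemma bigo_ln: "(\<lambda>t. t) \<in> O[at_right 0](\<lambda>t::real. t * ln t)" "(\<lambda>t. 1) \<in> O[at_right 0](\<lambda>t::real. ln t)"
  by real_asymp+

text \<open>The constant 2 \<open>euler_mascheroni\<close> is - \<open>rP 0 0\<close>, both Digamma
  values being taken at 1. This is the source of \<gamma> in the final formulas.\<close>

lemma rY_0_bigo: "(\<lambda>t. pi * rY 0 t - (ln t + 2 * euler_mascheroni)) \<in> O[at_right 0](\<lambda>t. t * ln t)"
proof -
  have "(\<lambda>t. (rJ 0 t - 1) * ln t) \<in> O[at_right 0](\<lambda>t. t * ln t)"
    using rJ_bigo[of 0] by (intro landau_o.big.mult) auto
  moreover have "(\<lambda>t. rP 0 t - rP 0 0) \<in> O[at_right 0](\<lambda>t. t * ln t)"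
    using rP_bigo[of 0] bigo_ln(1) by (rule landau_o.big_trans)
  ultimately have "(\<lambda>t. (rJ 0 t - 1) * ln t - (rP 0 t - rP 0 0)) \<in> O[at_right 0](\<lambda>t. t * ln t)"
    by (rule sum_in_bigo)
  moreover have "pi * rY 0 t - (ln t + 2 * euler_mascheroni) = (rJ 0 t - 1) * ln t - (rP 0 t - rP 0 0)" for t
  proof -
    have "pi * rY 0 t = ln t * rJ 0 t - rP 0 t" by (simp add: rY_0)
    then show ?thesis by (simp add: algebra_simps)
  qed
  ultimately show ?thesis by (simp only:)
qed

lemma tendsto_imp_bigo_1:
  fixes f :: "real \<Rightarrow> real"
  assumes "(f \<longlongrightarrow> c) F"
  shows "f \<in> O[F](\<lambda>_. 1)"
  using assms by (intro bigoI_tendsto[of _ _ c]) auto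

lemma tendsto_0_bigo:
  fixes f g :: "real \<Rightarrow> real"
  assumes "f \<in> O[F](g)" "(g \<longlongrightarrow> 0) F"
  shows "(f \<longlongrightarrow> 0) F"
proof -
  from assms(1) obtain c where c: "eventually (\<lambda>x. norm (f x) \<le> c * norm (g x)) F"
    by (elim landau_o.bigE)
  have "((\<lambda>x. c * norm (g x)) \<longlongrightarrow> c * norm (0::real)) F"
    by (intro tendsto_intros assms)
  then show ?thesis
    by (intro Lim_null_comparison[OF c]) simp
qed

lemma rJ_tendsto: "(rJ n \<longlongrightarrow> rJ n t) (at t within S)"
  using DERIV_isCont[OF rJ_deriv[of n t]] by (auto simp: isCont_def intro: tendsto_mono at_le)

lemma rP_tendsto: "(rP n \<longlongrightarrow> rP n t) (at t within S)"
proof -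
  obtain D where "(rP n has_real_derivative D) (at t)" using rP_differentiable by blast
  from DERIV_isCont[OF this] show ?thesis by (auto simp: isCont_def intro: tendsto_mono at_le)
qed

text \<open>The limit -1 comes from the single pole of \<open>rY_fin 1\<close>; the logarithm and
  \<open>rP\<close> are of lower order.\<close>

lemma rY_1_bigo: "(\<lambda>t. pi * (t * rY 1 t) + 1) \<in> O[at_right 0](\<lambda>t. t * ln t)"
proof -
  have "(\<lambda>t. ln t * rJ 1 t) \<in> O[at_right 0](\<lambda>t. ln t)"
    using landau_o.big.mult[OF landau_o.big_refl[of ln] tendsto_imp_bigo_1[OF rJ_tendsto[of 1 0 "{0<..}"]]] by simp
  moreover have "rP 1 \<in> O[at_right 0](\<lambda>t. ln t)"
    using tendsto_imp_bigo_1[OF rP_tendsto[of 1 0 "{0<..}"]] bigo_ln(2) by (rule landau_o.big_trans)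
  ultimately have "(\<lambda>t. t * (ln t * rJ 1 t - rP 1 t)) \<in> O[at_right 0](\<lambda>t. t * ln t)"
    by (intro landau_o.big.mult sum_in_bigo) auto
  moreover have ev: "eventually (\<lambda>t. t * (ln t * rJ 1 t - rP 1 t) = pi * (t * rY 1 t) + 1) (at_right 0)"
    using eventually_at_right_less[of 0]
  proof eventually_elim
    case (elim t)
    have "pi * rY 1 t = ln t * rJ 1 t - 1 / t - rP 1 t" using elim by (simp only: rY_1) simp
    then have "t * (pi * rY 1 t) + 1 = t * (ln t * rJ 1 t - 1 / t - rP 1 t) + 1" by simp
    also have "\<dots> = t * (ln t * rJ 1 t - rP 1 t)" using elim by (simp add: right_diff_distrib)
    finally have "t * (pi * rY 1 t) + 1 = t * (ln t * rJ 1 t - rP 1 t)" .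
    then show ?case by (simp add: mult_ac)
  qed
  ultimately show ?thesis
    using landau_o.big.in_cong[OF ev] by simp
qed

lemma t_ln_tendsto: "((\<lambda>t::real. t * ln t) \<longlongrightarrow> 0) (at_right 0)"
  by real_asymp

lemma tendsto_if_bigo_diff:
  fixes f :: "real \<Rightarrow> real"
  assumes "(\<lambda>t. f t - c) \<in> O[F](g)" "(g \<longlongrightarrow> 0) F"
  shows "(f \<longlongrightarrow> c) F"
proof -
  have "((\<lambda>t. f t - c) \<longlongrightarrow> 0) F"
    using assms by (rule tendsto_0_bigo)
  then show ?thesis by (simp add: LIM_zero_iff)
qed

text \<open>For n = 0 the derivative vanishes by the recurrences, so the expression is constant, and
  its limit at 0 is determined by the pole of \<open>rY 1\<close> alone.\<close>

lemma rJ_rY_Wronskian: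
  assumes "t > 0"
  shows "t ^ Suc n * (rJ (Suc n) t * rY n t - rJ n t * rY (Suc n) t) = 1 / pi"
proof (induction n)
  case 0
  let ?w = "\<lambda>t. t * (rJ 1 t * rY 0 t - rJ 0 t * rY 1 t)"
  have d: "(?w has_real_derivative 0) (at t)" if "t > 0" for t
  proof -
    have J: "rJ 0 t = rJ 1 t - t * rJ 2 t" using rJ_rec[of 0 t] by (simp add: numeral_2_eq_2)
    have Y: "rY 0 t = rY 1 t - t * rY 2 t" using rY_rec[of t 0] that by (simp add: numeral_2_eq_2)
    have "(?w has_real_derivative (rJ 1 t * rY 0 t - rJ 0 t * rY 1 t) +
         t * (- rJ 2 t * rY 0 t + rJ 1 t * (- rY 1 t) - (- rJ 1 t * rY 1 t + rJ 0 t * (- rY 2 t)))) (at t)"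
      using that by (auto intro!: derivative_eq_intros rJ_deriv[of 0, simplified] rJ_deriv[of 1, simplified]
        rY_deriv[of _ 0, simplified] rY_deriv[of _ 1, simplified] simp: numeral_2_eq_2)
    also have "(rJ 1 t * rY 0 t - rJ 0 t * rY 1 t) +
         t * (- rJ 2 t * rY 0 t + rJ 1 t * (- rY 1 t) - (- rJ 1 t * rY 1 t + rJ 0 t * (- rY 2 t))) = 0"
      unfolding J Y by (simp add: algebra_simps)
    finally show ?thesis .
  qed
  have const: "?w s = ?w t" if "s > 0" for s
  proof -
    have "\<exists>c. \<forall>x\<in>{0<..}. ?w x = c"
    proof (rule has_field_derivative_zero_constant)
      show "(?w has_field_derivative 0) (at x within {0<..})" if "x \<in> {0<..}" for x
        using d[of x] that by (simp add: has_field_derivative_at_within)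
    qed simp
    then show ?thesis using that assms by (metis greaterThan_iff)
  qed
  have "(?w \<longlongrightarrow> 1 * 0 + 1 / pi) (at_right 0)"
  proof -
    have H1: "((\<lambda>t. pi * (t * rY 1 t)) \<longlongrightarrow> -1) (at_right 0)"
      by (rule tendsto_if_bigo_diff[OF _ t_ln_tendsto]) (use rY_1_bigo in simp)
    have "((\<lambda>t. t * (pi * rY 0 t - (ln t + 2 * euler_mascheroni)) + t * (ln t + 2 * euler_mascheroni)) \<longlongrightarrow> 0 * 0 + 0) (at_right 0)"
    proof (intro tendsto_add tendsto_mult)
      show "((\<lambda>t. pi * rY 0 t - (ln t + 2 * euler_mascheroni)) \<longlongrightarrow> 0) (at_right 0)"
        by (rule tendsto_0_bigo[OF rY_0_bigo t_ln_tendsto])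
      show "((\<lambda>t::real. t * (ln t + 2 * euler_mascheroni)) \<longlongrightarrow> 0) (at_right 0)" by real_asymp
    qed (auto intro!: tendsto_eq_intros)
    moreover have "t * (pi * rY 0 t - (ln t + 2 * euler_mascheroni)) + t * (ln t + 2 * euler_mascheroni) = pi * (t * rY 0 t)" for t
      by (simp add: algebra_simps)
    ultimately have H2: "((\<lambda>t. pi * (t * rY 0 t)) \<longlongrightarrow> 0) (at_right 0)" by simp
    have H3: "(rJ 0 \<longlongrightarrow> 1) (at_right 0)" "(rJ 1 \<longlongrightarrow> 1) (at_right 0)"
      using rJ_tendsto[of 0 0 "{0<..}"] rJ_tendsto[of 1 0 "{0<..}"] by simp_all
    have "((\<lambda>t. (rJ 1 t * (pi * (t * rY 0 t)) - rJ 0 t * (pi * (t * rY 1 t))) / pi)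
       \<longlongrightarrow> (1 * 0 - 1 * (-1)) / pi) (at_right 0)"
      by (intro tendsto_divide tendsto_diff tendsto_mult[OF H3(1) H1] tendsto_mult[OF H3(2) H2] tendsto_const) simp
    moreover have "(rJ 1 t * (pi * (t * rY 0 t)) - rJ 0 t * (pi * (t * rY 1 t))) / pi = ?w t" for t
      by (simp add: divide_simps) (simp add: algebra_simps)
    ultimately show ?thesis by simp
  qed
  moreover have "(?w \<longlongrightarrow> ?w t) (at_right 0)"
    by (rule tendsto_eventually) (use const eventually_at_right_less[of 0] in \<open>auto elim!: eventually_mono\<close>)
  ultimately have "?w t = 1 * 0 + 1 / pi"
    using tendsto_unique[OF trivial_limit_at_right_real] by blast
  then show ?case by simp
next
  case (Suc n)
  \<comment> \<open>Eliminating the order n by the recurrences turns the Wronskian of order n into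
    that of order n + 1, with one more factor t.\<close>
  have J: "rJ n t = of_nat (Suc n) * rJ (Suc n) t - t * rJ (Suc (Suc n)) t"
    using rJ_rec[of n t] by simp
  have Y: "rY n t = of_nat (Suc n) * rY (Suc n) t - t * rY (Suc (Suc n)) t"
    using rY_rec[of t n] assms by simp
  from Suc.IH show ?case
    unfolding J Y by (simp add: algebra_simps)
qed

subsection \<open>Integration of derivatives in the plane\<close>

text \<open>Both measures agree on boxes. This makes Fubini available along horizontal and vertical
  lines.\<close>

lemma lborel_complex: "lborel = distr (lborel \<Otimes>\<^sub>M lborel) borel (\<lambda>(x, y). Complex x y)"
proof (rule lborel_eqI)
  have m: "(\<lambda>(x, y). Complex x y) \<in> borel_measurable (lborel \<Otimes>\<^sub>M lborel)"
    by (auto simp: Complex_eq split_beta' intro!: borel_measurable_add borel_measurable_times)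
  fix l u :: complex
  assume le: "\<And>b. b \<in> Basis \<Longrightarrow> l \<bullet> b \<le> u \<bullet> b"
  have "(\<lambda>(x, y). Complex x y) -` box l u \<inter> space (lborel \<Otimes>\<^sub>M lborel) = {Re l<..<Re u} \<times> {Im l<..<Im u}"
    by (auto simp: box_def Basis_complex_def space_pair_measure)
  then show "emeasure (distr (lborel \<Otimes>\<^sub>M lborel) borel (\<lambda>(x, y). Complex x y)) (box l u) = ennreal (\<Prod>b\<in>Basis. (u - l) \<bullet> b)"
    using le[of 1] le[of \<i>]
    by (simp add: emeasure_distr[OF m] lborel.emeasure_pair_measure_Times Basis_complex_def ennreal_mult)
qed simp

lemma integrable_bounded_support:
  fixes w :: "'a::euclidean_space \<Rightarrow> 'b::{banach,second_countable_topology}"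
  assumes "w \<in> borel_measurable borel" "\<And>z. norm z < M \<Longrightarrow> norm (w z) \<le> C" "\<And>z. norm z \<ge> M \<Longrightarrow> w z = 0"
  shows "integrable lborel w"
proof (rule Bochner_Integration.integrable_bound)
  show "integrable lborel (\<lambda>z::'a. \<bar>C\<bar> * indicator (cball 0 M) z)"
    by (intro integrable_mult_right integrable_real_indicator) (use emeasure_lborel_cball_finite[of 0 M] in \<open>auto simp: infinity_ennreal_def\<close>)
  show "AE z in lborel. norm (w z) \<le> norm (\<bar>C\<bar> * indicator (cball 0 M) z :: real)"
  proof (rule AE_I2)
    fix z :: 'a
    show "norm (w z) \<le> norm (\<bar>C\<bar> * indicator (cball 0 M) z :: real)"
    proof (cases "norm z < M")
      case True
      then show ?thesis using assms(2)[of z] by (simp add: indicator_def)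
    next
      case False
      then show ?thesis using assms(3)[of z] by simp
    qed
  qed
qed (use assms in simp)

lemma has_vector_derivative_line:
  fixes f :: "'a::real_normed_vector \<Rightarrow> 'b::real_normed_vector"
  assumes "((\<lambda>t. f ((z + s *\<^sub>R b) + t *\<^sub>R b)) has_vector_derivative D) (at 0)"
  shows "((\<lambda>t. f (z + t *\<^sub>R b)) has_vector_derivative D) (at s)"
proof -
  have "((\<lambda>t. f ((z + s *\<^sub>R b) + t *\<^sub>R b)) \<circ> (\<lambda>t. t - s) has_vector_derivative 1 *\<^sub>R D) (at s)"
    by (rule vector_diff_chain_at) (use assms in \<open>auto intro!: derivative_eq_intros\<close>)
  then show ?thesis by (simp add: o_def algebra_simps)
qed

lemma integral_line_derivative_real:
  fixes f g :: "real \<Rightarrow> complex"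
  assumes "finite N" "continuous_on UNIV f" "\<And>t. t \<notin> N \<Longrightarrow> (f has_vector_derivative g t) (at t)"
    and "\<And>t. \<bar>t\<bar> \<ge> M \<Longrightarrow> f t = 0" "\<And>t. \<bar>t\<bar> \<ge> M \<Longrightarrow> g t = 0" "M \<ge> 0" "integrable lborel g"
  shows "(LINT t|lborel. g t) = 0"
proof -
  have "(g has_integral (f M - f (-M))) {-M..M}"
    by (rule fundamental_theorem_of_calculus_interior_strong[of N])
       (use assms in \<open>auto intro: continuous_on_subset\<close>)
  then have "(g has_integral 0) {-M..M}" using assms(4)[of M] assms(4)[of "-M"] assms(6) by simp
  then have "(g has_integral 0) UNIV"
    by (rule has_integral_on_superset) (use assms(5) in force)+
  then show ?thesis
    using integral_lborel[OF assms(7)] by (simp add: integral_unique)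
qed

lemma finite_line_circle: "finite {t. norm (Complex t y) = \<rho>}" "finite {t. norm (Complex x t) = \<rho>}"
proof -
  have "{t. norm (Complex t y) = \<rho>} \<subseteq> {sqrt (\<rho>\<^sup>2 - y\<^sup>2), - sqrt (\<rho>\<^sup>2 - y\<^sup>2)}"
    by (auto simp: cmod_def)
  then show "finite {t. norm (Complex t y) = \<rho>}" by (rule finite_subset) simp
  have "{t. norm (Complex x t) = \<rho>} \<subseteq> {sqrt (\<rho>\<^sup>2 - x\<^sup>2), - sqrt (\<rho>\<^sup>2 - x\<^sup>2)}"
    by (auto simp: cmod_def)
  then show "finite {t. norm (Complex x t) = \<rho>}" by (rule finite_subset) simp
qed

text \<open>A line parallel to an axis meets the circle |z| = \<rho> in at most two points, and the
  fundamental theorem of calculus for continuous functions tolerates finitely many points without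
  derivative. Hence a jump of w across the circle does no harm, as needed for second derivatives of
  solutions with a discontinuous potential.\<close>

lemma integral_line_derivative_zero:
  fixes F w :: "complex \<Rightarrow> complex"
  assumes b: "b \<in> Basis" and F: "continuous_on UNIV F"
    and der: "\<And>z. norm z \<noteq> \<rho> \<Longrightarrow> ((\<lambda>t. F (z + t *\<^sub>R b)) has_vector_derivative w z) (at 0)"
    and w: "w \<in> borel_measurable borel" "\<And>z. norm z < M \<Longrightarrow> norm (w z) \<le> C"
    and supp: "\<And>z. norm z \<ge> M \<Longrightarrow> F z = 0" "\<And>z. norm z \<ge> M \<Longrightarrow> w z = 0"
  shows "(LINT z|lborel. w z) = 0"
proof (cases "M > 0")
  case False
  then have "w = (\<lambda>_. 0)" using supp(2) by (metis dual_order.trans linorder_not_less norm_ge_zero)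
  then show ?thesis by simp
next
  case True
  let ?p = "lborel \<Otimes>\<^sub>M lborel :: (real \<times> real) measure"
  have m: "(\<lambda>(x, y). Complex x y) \<in> borel_measurable ?p"
    by (auto simp: Complex_eq split_beta' intro!: borel_measurable_add borel_measurable_times)
  have int: "integrable lborel w"
    by (rule integrable_bounded_support[OF w supp(2)])
  then have intp: "integrable ?p (case_prod (\<lambda>x y. w (Complex x y)))"
    using m w by (subst (asm) lborel_complex) (simp add: integrable_distr_eq split_beta')
  have eq: "(LINT z|lborel. w z) = integral\<^sup>L ?p (case_prod (\<lambda>x y. w (Complex x y)))"
    using m w by (subst lborel_complex) (simp add: integral_distr split_beta')
  have wm [measurable]: "w \<in> borel_measurable borel" by fact
  have "\<bar>x\<bar> \<le> norm (Complex x y)" "\<bar>y\<bar> \<le> norm (Complex x y)" for x y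
    using abs_Re_le_cmod[of "Complex x y"] abs_Im_le_cmod[of "Complex x y"] by simp_all
  note le = order_trans[OF _ this(1)] order_trans[OF _ this(2)]
  have cw: "norm (w z) \<le> max C 0" for z
    using w(2)[of z] supp(2)[of z] by (cases "norm z < M") auto
  from b consider "b = 1" | "b = \<i>" by (auto simp: Basis_complex_def)
  then show ?thesis
  proof cases
    case 1
    have "(LINT x|lborel. w (Complex x y)) = 0" for y
    proof (rule integral_line_derivative_real[where M = M])
      show "finite {t. norm (Complex t y) = \<rho>}" by (rule finite_line_circle)
      show "continuous_on UNIV (\<lambda>t. F (Complex t y))"
        by (rule continuous_on_compose2[OF F]) (auto simp: Complex_eq intro!: continuous_intros)
      have c: "Complex x y + t *\<^sub>R 1 = Complex (x + t) y" for x t by (simp add: complex_eq_iff)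
      show "((\<lambda>t. F (Complex t y)) has_vector_derivative w (Complex t y)) (at t)"
        if "t \<notin> {t. norm (Complex t y) = \<rho>}" for t
        using has_vector_derivative_line[of F "Complex 0 y" t 1 "w (Complex t y)"] der[of "Complex t y"] that 1
        by (simp only: c) simp
      show "integrable lborel (\<lambda>x. w (Complex x y))"
        by (rule integrable_bounded_support[of _ M "max C 0"])
           (use cw supp(2) le(1) in \<open>auto simp: Complex_eq\<close>)
    qed (use True supp le(1) in auto)
    then show ?thesis unfolding eq lborel_pair.integral_snd[OF intp, symmetric] by simp
  next
    case 2
    have "(LINT y|lborel. w (Complex x y)) = 0" for x
    proof (rule integral_line_derivative_real[where M = M])
      show "finite {t. norm (Complex x t) = \<rho>}" by (rule finite_line_circle)
      show "continuous_on UNIV (\<lambda>t. F (Complex x t))"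
        by (rule continuous_on_compose2[OF F]) (auto simp: Complex_eq intro!: continuous_intros)
      have c: "Complex x y + t *\<^sub>R \<i> = Complex x (y + t)" for y t by (simp add: complex_eq_iff)
      show "((\<lambda>t. F (Complex x t)) has_vector_derivative w (Complex x t)) (at t)"
        if "t \<notin> {t. norm (Complex x t) = \<rho>}" for t
        using has_vector_derivative_line[of F "Complex x 0" t \<i> "w (Complex x t)"] der[of "Complex x t"] that 2
        by (simp only: c) simp
      show "integrable lborel (\<lambda>y. w (Complex x y))"
        by (rule integrable_bounded_support[of _ M "max C 0"])
           (use cw supp(2) le(2) in \<open>auto simp: Complex_eq\<close>)
    qed (use True supp le(2) in auto)
    then show ?thesis unfolding eq lborel_pair.integral_fst'[OF intp, symmetric] by simp
  qed
qed

lemma C2_functionI: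
  fixes f :: "'a::euclidean_space \<Rightarrow> 'b::real_normed_vector"
  assumes D: "\<And>b z. b \<in> Basis \<Longrightarrow> ((\<lambda>t. f (z + t *\<^sub>R b)) has_vector_derivative D b z) (at 0)"
    and DD: "\<And>b c z. b \<in> Basis \<Longrightarrow> c \<in> Basis \<Longrightarrow> ((\<lambda>t. D b (z + t *\<^sub>R c)) has_vector_derivative DD b c z) (at 0)"
    and cont: "\<And>b. b \<in> Basis \<Longrightarrow> continuous_on UNIV (D b)"
      "\<And>b c. b \<in> Basis \<Longrightarrow> c \<in> Basis \<Longrightarrow> continuous_on UNIV (DD b c)"
  shows "C2_function f" "laplacian f z = (\<Sum>b\<in>Basis. DD b b z)"
proof -
  have 1: "partial_deriv b f = D b" if "b \<in> Basis" for b
    using D[OF that] by (auto simp: partial_deriv_def fun_eq_iff intro: vector_derivative_at)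
  have 2: "partial_deriv c (D b) = DD b c" if "b \<in> Basis" "c \<in> Basis" for b c
    using DD[OF that] by (auto simp: partial_deriv_def fun_eq_iff intro: vector_derivative_at)
  show "C2_function f"
    unfolding C2_function_def C1_function_def
    using differentiableI_vector[OF D] differentiableI_vector[OF DD] cont by (auto simp: 1 2)
  show "laplacian f z = (\<Sum>b\<in>Basis. DD b b z)"
    by (simp add: laplacian_def 1 2)
qed

lemma C1_functionD:
  assumes "C1_function f" "b \<in> Basis"
  shows "((\<lambda>t. f (z + t *\<^sub>R b)) has_vector_derivative partial_deriv b f z) (at 0)"
    and "continuous_on UNIV (partial_deriv b f)"
  using assms unfolding C1_function_def partial_deriv_def by (auto simp: vector_derivative_works)

subsection \<open>Weak solutions with a fixed angular momentum\<close>

text \<open>The mode of angular momentum n, with its radial factor written in |z|^2 so that no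
  coordinate singularity arises at the origin.\<close>

definition zk :: "nat \<Rightarrow> (real \<Rightarrow> real) \<Rightarrow> complex \<Rightarrow> complex" where
  "zk n k z = z ^ n * complex_of_real (k ((norm z)\<^sup>2))"

lemma norm2_line_deriv:
  fixes z b :: "'a::real_inner"
  shows "((\<lambda>t. (norm (z + t *\<^sub>R b))\<^sup>2) has_real_derivative 2 * (z \<bullet> b)) (at 0)"
proof -
  have "((\<lambda>t. z \<bullet> z + 2 * t * (z \<bullet> b) + t\<^sup>2 * (b \<bullet> b)) has_real_derivative 2 * (z \<bullet> b)) (at 0)"
    by (auto intro!: derivative_eq_intros)
  also have "(\<lambda>t. z \<bullet> z + 2 * t * (z \<bullet> b) + t\<^sup>2 * (b \<bullet> b)) = (\<lambda>t. (norm (z + t *\<^sub>R b))\<^sup>2)"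
    unfolding power2_norm_eq_inner
    by (rule ext) (simp add: inner_add_left inner_add_right inner_commute power2_eq_square algebra_simps)
  finally show ?thesis .
qed

lemma pow_line_deriv:
  fixes z b :: complex
  shows "((\<lambda>t. (z + t *\<^sub>R b) ^ n) has_vector_derivative of_nat n * b * z ^ (n - 1)) (at 0)"
proof -
  have "((\<lambda>t. z + t *\<^sub>R b) has_vector_derivative b) (at 0)"
    by (auto intro!: derivative_eq_intros)
  moreover have "((\<lambda>w. w ^ n) has_field_derivative of_nat n * z ^ (n - 1)) (at (z + 0 *\<^sub>R b))"
    by (auto intro!: derivative_eq_intros)
  ultimately have "((\<lambda>w. w ^ n) \<circ> (\<lambda>t. z + t *\<^sub>R b) has_vector_derivative b * (of_nat n * z ^ (n - 1))) (at 0)"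
    by (rule field_vector_diff_chain_at)
  then show ?thesis by (simp add: o_def mult_ac)
qed

lemma radial_line_deriv:
  assumes "(k has_real_derivative k1) (at ((norm z)\<^sup>2))"
  shows "((\<lambda>t. complex_of_real (k ((norm (z + t *\<^sub>R b))\<^sup>2))) has_vector_derivative of_real (2 * (z \<bullet> b) * k1)) (at 0)"
proof -
  have "((\<lambda>t. k ((norm (z + t *\<^sub>R b))\<^sup>2)) has_real_derivative k1 * (2 * (z \<bullet> b))) (at 0)"
    by (rule DERIV_chain2[where f = k]) (use assms norm2_line_deriv[of z b] in auto)
  then show ?thesis
    by (intro has_vector_derivative_of_real) (simp add: has_real_derivative_iff_has_vector_derivative mult_ac)
qed

lemma zk_line_deriv:
  assumes "(k has_real_derivative k1 ((norm z)\<^sup>2)) (at ((norm z)\<^sup>2))"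
  shows "((\<lambda>t. zk n k (z + t *\<^sub>R b)) has_vector_derivative
           of_nat n * b * zk (n - 1) k z + of_real (2 * (z \<bullet> b)) * zk n k1 z) (at 0)"
  unfolding zk_def
  using has_vector_derivative_mult[OF pow_line_deriv[of z b n] radial_line_deriv[of k "k1 ((norm z)\<^sup>2)" z b, OF assms]]
  by (simp add: algebra_simps)

text \<open>The first directional derivative of \<open>zk n k\<close>; \<open>zk2\<close> is the
  second. The direction b enters twice, as a complex factor from z^n and as a vector in the inner
  product. At n = 0 the truncated n - 1 is harmless, being multiplied by n.\<close>

definition zk1 :: "nat \<Rightarrow> (real \<Rightarrow> real) \<Rightarrow> (real \<Rightarrow> real) \<Rightarrow> complex \<Rightarrow> complex \<Rightarrow> complex" where
  "zk1 n k k1 b z = of_nat n * b * zk (n - 1) k z + of_real (2 * (z \<bullet> b)) * zk n k1 z"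

definition zk2 :: "nat \<Rightarrow> (real \<Rightarrow> real) \<Rightarrow> (real \<Rightarrow> real) \<Rightarrow> (real \<Rightarrow> real) \<Rightarrow> complex \<Rightarrow> complex \<Rightarrow> complex \<Rightarrow> complex" where
  "zk2 n k k1 k2 b c z = of_nat n * b * zk1 (n - 1) k k1 c z
     + (of_real (2 * (z \<bullet> b)) * zk1 n k1 k2 c z + of_real (2 * (c \<bullet> b)) * zk n k1 z)"

lemma zk1_line_deriv:
  assumes "(k has_real_derivative k1 ((norm z)\<^sup>2)) (at ((norm z)\<^sup>2))"
    and "(k1 has_real_derivative k2 ((norm z)\<^sup>2)) (at ((norm z)\<^sup>2))"
  shows "((\<lambda>t. zk1 n k k1 b (z + t *\<^sub>R c)) has_vector_derivative zk2 n k k1 k2 b c z) (at 0)"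
proof -
  have "((\<lambda>t. complex_of_real (2 * ((z + t *\<^sub>R c) \<bullet> b))) has_vector_derivative of_real (2 * (c \<bullet> b))) (at 0)"
    by (intro has_vector_derivative_of_real)
       (auto intro!: derivative_eq_intros simp: inner_add_left simp flip: has_real_derivative_iff_has_vector_derivative)
  note d = has_vector_derivative_mult[OF this zk_line_deriv[where k = k1 and ?k1.0 = k2 and n = n and b = c, OF assms(2)]]
  have "((\<lambda>t. of_nat n * b * zk (n - 1) k (z + t *\<^sub>R c)) has_vector_derivative of_nat n * b * zk1 (n - 1) k k1 c z) (at 0)"
    by (intro has_vector_derivative_mult_right) (unfold zk1_def, rule zk_line_deriv, rule assms(1))
  from has_vector_derivative_add[OF this d] show ?thesis
    by (simp add: zk1_def zk2_def)
qed

lemma continuous_zk: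
  assumes "continuous_on UNIV k"
  shows "continuous_on UNIV (zk n k)"
  unfolding zk_def
  by (intro continuous_intros continuous_on_compose2[OF assms]) auto

lemma continuous_zk1:
  assumes "continuous_on UNIV k" "continuous_on UNIV k1"
  shows "continuous_on UNIV (zk1 n k k1 b)"
  unfolding zk1_def by (intro continuous_intros continuous_zk assms)

lemma measurable_zk [measurable (raw)]:
  assumes [measurable]: "k \<in> borel_measurable borel"
  shows "zk n k \<in> borel_measurable borel"
  unfolding zk_def by measurable

text \<open>The terms with n (n - 1) cancel since 1^2 + i^2 = 0, that is, z^n is harmonic. The mixed
  terms raise the coefficient of k1 from 1 to n + 1, because the components of z along the basis add
  up to z.\<close>

lemma zk_laplacian:
  "(\<Sum>b\<in>Basis. zk2 n k k1 k2 b b z) = zk n (\<lambda>s. 4 * (s * k2 s + of_nat (Suc n) * k1 s)) z"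
proof -
  have n2: "complex_of_real ((norm z)\<^sup>2) = (of_real (Re z))\<^sup>2 + (of_real (Im z))\<^sup>2"
    by (simp add: cmod_power2)
  have p: "of_nat n * (of_real (Re z) + \<i> * of_real (Im z)) * zk (n - 1) k1 z = of_nat n * zk n k1 z" for k1
  proof -
    have z: "of_real (Re z) + \<i> * of_real (Im z) = z" by (simp flip: complex_eq)
    show ?thesis unfolding z by (cases n) (auto simp: zk_def mult_ac)
  qed
  have "(\<Sum>b\<in>Basis. zk2 n k k1 k2 b b z) = 4 * (of_nat n * (of_real (Re z) + \<i> * of_real (Im z)) * zk (n - 1) k1 z)
       + 4 * zk n k1 z + 4 * ((of_real (Re z))\<^sup>2 + (of_real (Im z))\<^sup>2) * zk n k2 z"
    by (simp add: Basis_complex_def zk2_def zk1_def algebra_simps power2_eq_square)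
  also have "\<dots> = 4 * (of_nat n * zk n k1 z) + 4 * zk n k1 z + 4 * of_real ((norm z)\<^sup>2) * zk n k2 z"
    unfolding p n2 by simp
  also have "\<dots> = zk n (\<lambda>s. 4 * (s * k2 s + of_nat (Suc n) * k1 s)) z"
    by (simp add: zk_def algebra_simps)
  finally show ?thesis .
qed

lemma test_function_bounded_support:
  fixes \<phi> :: "complex \<Rightarrow> real"
  assumes "test_function \<phi>"
  obtains M where "M > 0" "\<And>z. norm z \<ge> M \<Longrightarrow> \<phi> z = 0"
    "\<And>z b. b \<in> Basis \<Longrightarrow> norm z \<ge> M \<Longrightarrow> partial_deriv b \<phi> z = 0"
    "\<And>z b c. b \<in> Basis \<Longrightarrow> c \<in> Basis \<Longrightarrow> norm z \<ge> M \<Longrightarrow> partial_deriv c (partial_deriv b \<phi>) z = 0"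
    "continuous_on UNIV \<phi>"
proof -
  from assms obtain M0 where M0: "\<And>z. \<phi> z \<noteq> 0 \<Longrightarrow> norm z \<le> M0"
    unfolding test_function_def bounded_iff by blast
  have C1: "C1_function \<phi>" "\<And>b. b \<in> Basis \<Longrightarrow> C1_function (partial_deriv b \<phi>)"
    using assms by (auto simp: test_function_def C2_function_def)
  have loc: "partial_deriv b f z = 0" if "\<And>z. norm z > M1 \<Longrightarrow> f z = 0" "norm z > M1" for b z M1 and f :: "complex \<Rightarrow> real"
  proof -
    have "eventually (\<lambda>t. norm (z + t *\<^sub>R b) > M1) (nhds (0::real))"
    proof (rule order_tendstoD(1))
      show "((\<lambda>t. norm (z + t *\<^sub>R b)) \<longlongrightarrow> norm (z + 0 *\<^sub>R b)) (nhds (0::real))"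
        by (intro tendsto_intros filterlim_ident)
    qed (use that in simp)
    then have ev: "eventually (\<lambda>t. f (z + t *\<^sub>R b) = 0) (nhds (0::real))"
      by eventually_elim (use that in auto)
    from ev obtain S where S: "open S" "0 \<in> S" "\<And>t. t \<in> S \<Longrightarrow> f (z + t *\<^sub>R b) = 0"
      unfolding eventually_nhds by blast
    have "((\<lambda>t. f (z + t *\<^sub>R b)) has_vector_derivative 0) (at 0)"
      by (rule has_vector_derivative_transform_within_open[OF has_vector_derivative_const[of 0] S(1,2)]) (simp add: S)
    then show ?thesis by (simp add: partial_deriv_def vector_derivative_at)
  qed
  have z0: "\<phi> z = 0" if "norm z > M0" for z using M0[of z] that by fastforce
  have z1: "partial_deriv b \<phi> z = 0" if "norm z > M0" for b z using loc[of M0 \<phi>] z0 that by blast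
  have z2: "partial_deriv c (partial_deriv b \<phi>) z = 0" if "norm z > M0" for b c z
    using loc[of M0 "partial_deriv b \<phi>"] z1 that by blast
  have "\<exists>C. \<forall>z. \<bar>partial_deriv b \<phi> z\<bar> \<le> C" if "b \<in> Basis" for b
  proof -
    have "compact (partial_deriv b \<phi> ` cball 0 M0)"
      by (intro compact_continuous_image continuous_on_subset[OF C1_functionD(2)[OF C1(1) that]]) auto
    then obtain C where "\<And>z. norm z \<le> M0 \<Longrightarrow> \<bar>partial_deriv b \<phi> z\<bar> \<le> C"
      using compact_imp_bounded by (fastforce simp: bounded_iff)
    note C = this
    have "\<bar>partial_deriv b \<phi> z\<bar> \<le> max C 0" for z
    proof (cases "norm z \<le> M0")
      case True
      with C[of z] show ?thesis by linarith
    next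
      case False
      with z1[of z b] show ?thesis by simp
    qed
    then show ?thesis by blast
  qed
  then obtain C where "\<And>b z. b \<in> Basis \<Longrightarrow> \<bar>partial_deriv b \<phi> z\<bar> \<le> C b" by metis
  then have C: "\<And>z. \<bar>partial_deriv 1 \<phi> z\<bar> \<le> C 1" "\<And>z. \<bar>partial_deriv \<i> \<phi> z\<bar> \<le> C \<i>"
    by (simp_all add: Basis_complex_def)
  \<comment> \<open>\<open>C1_function\<close> asks for partial derivatives only, so the continuity
    of \<phi> has to be derived: bounded partial derivatives make \<phi> Lipschitz along both axes,
    and a nearby point is reached through one corner.\<close>
  have lip: "\<bar>\<phi> (z + s *\<^sub>R b) - \<phi> z\<bar> \<le> C b * \<bar>s\<bar>" if "b \<in> {1, \<i>}" for z s b
  proof -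
    have b: "b \<in> Basis" using that by (auto simp: Basis_complex_def)
    have "norm (\<phi> (z + s *\<^sub>R b) - \<phi> (z + 0 *\<^sub>R b)) \<le> C b * norm (s - 0)"
    proof (rule field_differentiable_bound[where S = UNIV])
      fix t :: real
      show "((\<lambda>t. \<phi> (z + t *\<^sub>R b)) has_real_derivative partial_deriv b \<phi> (z + t *\<^sub>R b)) (at t within UNIV)"
        unfolding has_real_derivative_iff_has_vector_derivative
        by (rule has_vector_derivative_line) (rule C1_functionD(1)[OF C1(1) b])
      show "norm (partial_deriv b \<phi> (z + t *\<^sub>R b)) \<le> C b" using C that by auto
    qed auto
    then show ?thesis by simp
  qed
  have "continuous_on UNIV \<phi>"
    unfolding continuous_on_iff
  proof (intro ballI allI impI)
    fix z :: complex and e :: real assume "e > 0"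
    define K where "K = \<bar>C 1\<bar> + \<bar>C \<i>\<bar> + 1"
    have "dist (\<phi> z') (\<phi> z) < e" if "dist z' z < e / K" for z'
    proof -
      define w where "w = z + Re (z' - z) *\<^sub>R 1"
      have w: "z' = w + Im (z' - z) *\<^sub>R \<i>" by (simp add: w_def complex_eq_iff)
      have "\<bar>\<phi> z' - \<phi> w\<bar> \<le> \<bar>C \<i>\<bar> * dist z' z"
        using lip[of \<i> w "Im (z' - z)"] abs_Im_le_cmod[of "z' - z"] unfolding w[symmetric]
        by (simp add: dist_norm) (meson order_trans mult_mono abs_ge_self abs_ge_zero)
      moreover have "\<bar>\<phi> w - \<phi> z\<bar> \<le> \<bar>C 1\<bar> * dist z' z"
        using lip[of 1 z "Re (z' - z)"] abs_Re_le_cmod[of "z' - z"] unfolding w_def[symmetric]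
        by (simp add: dist_norm) (meson order_trans mult_mono abs_ge_self abs_ge_zero)
      ultimately have "\<bar>\<phi> z' - \<phi> z\<bar> \<le> \<bar>C \<i>\<bar> * dist z' z + \<bar>C 1\<bar> * dist z' z" by linarith
      also have "\<dots> \<le> K * dist z' z" by (simp add: K_def algebra_simps)
      also have "\<dots> < e" using that by (simp add: K_def field_simps)
      finally show ?thesis by (simp add: dist_norm)
    qed
    moreover have "e / K > 0" using \<open>e > 0\<close> by (simp add: K_def add_nonneg_pos)
    ultimately show "\<exists>d>0. \<forall>z'\<in>UNIV. dist z' z < d \<longrightarrow> dist (\<phi> z') (\<phi> z) < e" by blast
  qed
  then show ?thesis
    by (intro that[of "max M0 0 + 1"]) (auto intro!: z0 z1 z2)
qed

lemma DERIV_glue: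
  fixes f g :: "real \<Rightarrow> real"
  assumes "(f has_real_derivative D) (at x)" "(g has_real_derivative D) (at x)" "f x = g x"
  shows "((\<lambda>t. if t \<le> x then f t else g t) has_real_derivative D) (at x)"
proof -
  let ?h = "\<lambda>t. if t \<le> x then f t else g t"
  have "((\<lambda>t. (?h t - ?h x) / (t - x)) \<longlongrightarrow> D) (at_left x)"
  proof (rule Lim_transform_eventually)
    show "((\<lambda>t. (f t - f x) / (t - x)) \<longlongrightarrow> D) (at_left x)"
      using assms(1) by (auto simp: has_field_derivative_iff intro: tendsto_mono at_le)
  qed (auto simp: eventually_at_filter)
  moreover have "((\<lambda>t. (?h t - ?h x) / (t - x)) \<longlongrightarrow> D) (at_right x)"
  proof (rule Lim_transform_eventually)
    show "((\<lambda>t. (g t - g x) / (t - x)) \<longlongrightarrow> D) (at_right x)"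
      using assms(2) by (auto simp: has_field_derivative_iff intro: tendsto_mono at_le)
  qed (use assms(3) in \<open>auto simp: eventually_at_filter\<close>)
  ultimately show ?thesis
    unfolding has_field_derivative_iff by (rule filterlim_split_at)
qed

lemma continuous_zk2:
  assumes "continuous_on UNIV k" "continuous_on UNIV k1" "continuous_on UNIV k2"
  shows "continuous_on UNIV (zk2 n k k1 k2 b c)"
  unfolding zk2_def by (intro continuous_intros continuous_zk continuous_zk1 assms)

section \<open>The radial operator and its test functions\<close>

text \<open>Read as a function of s = |z|^2 and with the energy included, so that P - E is minus the
  sum of the Laplacian and this potential.\<close>

definition pot :: "real \<Rightarrow> real \<Rightarrow> real \<Rightarrow> real \<Rightarrow> real" where
  "pot a \<rho> E s = (if s \<le> \<rho>\<^sup>2 then a\<^sup>2 else 0) + E"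

text \<open>What remains of the Laplacian plus V on z^n k(|z|^2) after z^n is taken out;
  \<open>k1\<close> and \<open>k2\<close> stand for the derivatives of k and are separate arguments,
  so that they can be supplied piecewise.\<close>

definition radop :: "nat \<Rightarrow> (real \<Rightarrow> real) \<Rightarrow> (real \<Rightarrow> real) \<Rightarrow> (real \<Rightarrow> real) \<Rightarrow> (real \<Rightarrow> real) \<Rightarrow> real \<Rightarrow> real" where
  "radop n V k k1 k2 s = 4 * (s * k2 s + of_nat (Suc n) * k1 s) + V s * k s"

lemma pot_measurable [measurable]: "pot a \<rho> E \<in> borel_measurable borel"
  unfolding pot_def by measurable

lemma schroedinger_op_pot:
  assumes "\<rho> > 0"
  shows "schroedinger_op a \<rho> \<phi> z - E * \<phi> z = - (laplacian \<phi> z + pot a \<rho> E ((norm z)\<^sup>2) * \<phi> z)"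
proof -
  have "(norm z)\<^sup>2 \<le> \<rho>\<^sup>2 \<longleftrightarrow> norm z \<le> \<rho>"
    using assms by (simp add: abs_le_square_iff[symmetric])
  then show ?thesis
    by (auto simp: schroedinger_op_def pot_def indicator_def algebra_simps)
qed

text \<open>The bounded linear L is there for Re and Im: test functions are real-valued, modes are
  complex.\<close>

lemma C2_zk:
  fixes L :: "complex \<Rightarrow> 'b::real_normed_vector"
  assumes "bounded_linear L"
    and k: "\<And>s. (k has_real_derivative k1 s) (at s)" "\<And>s. (k1 has_real_derivative k2 s) (at s)" "continuous_on UNIV k2"
  shows "C2_function (\<lambda>z. L (zk n k z))"
    and "laplacian (\<lambda>z. L (zk n k z)) z = L (zk n (\<lambda>s. 4 * (s * k2 s + of_nat (Suc n) * k1 s)) z)"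
proof -
  interpret bounded_linear L by fact
  have c: "continuous_on UNIV k" "continuous_on UNIV k1"
    using k by (auto intro!: continuous_at_imp_continuous_on DERIV_isCont)
  note L = C2_functionI[where f = "\<lambda>z. L (zk n k z)" and D = "\<lambda>b z. L (zk1 n k k1 b z)" and DD = "\<lambda>b c z. L (zk2 n k k1 k2 b c z)"]
  have 1: "((\<lambda>t. L (zk n k (z + t *\<^sub>R b))) has_vector_derivative L (zk1 n k k1 b z)) (at 0)" for b z
    unfolding zk1_def by (intro has_vector_derivative zk_line_deriv k)
  have 2: "((\<lambda>t. L (zk1 n k k1 b (z + t *\<^sub>R c))) has_vector_derivative L (zk2 n k k1 k2 b c z)) (at 0)" for b c z
    by (intro has_vector_derivative zk1_line_deriv k)
  have 3: "continuous_on UNIV (\<lambda>z. L (zk1 n k k1 b z))" "continuous_on UNIV (\<lambda>z. L (zk2 n k k1 k2 b c z))" for b c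
    by (intro continuous_on continuous_zk1 continuous_zk2 c k)+
  show "C2_function (\<lambda>z. L (zk n k z))"
    by (rule L(1)) (intro 1 2 3)+
  have "laplacian (\<lambda>z. L (zk n k z)) z = (\<Sum>b\<in>Basis. L (zk2 n k k1 k2 b b z))"
    by (rule L(2)) (intro 1 2 3)+
  then show "laplacian (\<lambda>z. L (zk n k z)) z = L (zk n (\<lambda>s. 4 * (s * k2 s + of_nat (Suc n) * k1 s)) z)"
    by (simp only: sum[symmetric] zk_laplacian)
qed

lemma continuous_bounded_ball:
  fixes u :: "'a::euclidean_space \<Rightarrow> 'b::real_normed_vector"
  assumes "continuous_on UNIV u"
  obtains C where "C \<ge> 0" "\<And>z. norm z \<le> M \<Longrightarrow> norm (u z) \<le> C"
proof -
  have "compact (u ` cball 0 M)"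
    by (intro compact_continuous_image continuous_on_subset[OF assms]) auto
  then obtain C where "\<And>z. norm z \<le> M \<Longrightarrow> norm (u z) \<le> C"
    using compact_imp_bounded by (fastforce simp: bounded_iff)
  then show ?thesis using that[of "max C 0"] by (meson max.cobounded1 max.cobounded2 order_trans)
qed

lemma integrable_continuous_mult:
  fixes u h :: "complex \<Rightarrow> complex"
  assumes u: "continuous_on UNIV u" and h [measurable]: "h \<in> borel_measurable borel"
    and b: "\<And>z. norm z < M \<Longrightarrow> norm (h z) \<le> C" "\<And>z. norm z \<ge> M \<Longrightarrow> h z = 0"
  shows "integrable lborel (\<lambda>z. u z * h z)"
proof -
  obtain D where D: "D \<ge> 0" "\<And>z. norm z \<le> M \<Longrightarrow> norm (u z) \<le> D"
    using continuous_bounded_ball[OF u] by blast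
  have [measurable]: "u \<in> borel_measurable borel" by (rule borel_measurable_continuous_onI[OF u])
  show ?thesis
  proof (rule integrable_bounded_support)
    show "norm (u z * h z) \<le> D * C" if "norm z < M" for z
      using D that b(1)[OF that] by (auto simp: norm_mult intro!: mult_mono)
  qed (use b(2) in auto)
qed

lemma norm_zk_le:
  assumes "norm z < M" "\<And>s. 0 \<le> s \<Longrightarrow> s \<le> M\<^sup>2 \<Longrightarrow> \<bar>m s\<bar> \<le> C"
  shows "norm (zk n m z) \<le> M ^ n * C"
proof -
  have "(norm z)\<^sup>2 \<le> M\<^sup>2" using assms(1) by (intro power_mono) auto
  moreover have "0 \<le> M" using norm_ge_zero[of z] assms(1) by linarith
  ultimately have "norm z ^ n * \<bar>m ((norm z)\<^sup>2)\<bar> \<le> M ^ n * C"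
    using assms by (intro mult_mono power_mono) auto
  then show ?thesis by (simp add: zk_def norm_mult norm_power)
qed

lemma zk_eq_0:
  assumes "norm z \<ge> M" "M \<ge> 0" "\<And>s. s \<ge> M\<^sup>2 \<Longrightarrow> m s = 0"
  shows "zk n m z = 0"
proof -
  have "M\<^sup>2 \<le> (norm z)\<^sup>2" using assms by (intro power_mono) auto
  then show ?thesis using assms by (simp add: zk_def)
qed

lemma integrable_mult_zk:
  assumes "continuous_on UNIV u" "m \<in> borel_measurable borel" "M \<ge> 0"
    "\<And>s. 0 \<le> s \<Longrightarrow> s \<le> M\<^sup>2 \<Longrightarrow> \<bar>m s\<bar> \<le> C" "\<And>s. s \<ge> M\<^sup>2 \<Longrightarrow> m s = 0"
  shows "integrable lborel (\<lambda>z. u z * cnj (zk n m z))"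
    and "integrable lborel (\<lambda>z. u z * of_real (Re (zk n m z)))"
    and "integrable lborel (\<lambda>z. u z * of_real (Im (zk n m z)))"
proof -
  have [measurable]: "zk n m \<in> borel_measurable borel" using assms(2) by (rule measurable_zk)
  have [measurable]: "cnj \<in> borel_measurable borel"
    by (intro borel_measurable_continuous_onI continuous_intros)
  note b = norm_zk_le[of _ M m C n, OF _ assms(4)] and z = zk_eq_0[of M _ m n, OF _ assms(3,5)]
  show "integrable lborel (\<lambda>z. u z * cnj (zk n m z))"
    by (rule integrable_continuous_mult[OF assms(1), of _ M "M ^ n * C"]) (use b z in auto)
  show "integrable lborel (\<lambda>z. u z * of_real (Re (zk n m z)))"
    by (rule integrable_continuous_mult[OF assms(1), of _ M "M ^ n * C"])
       (use b z in \<open>auto intro: order_trans[OF abs_Re_le_cmod]\<close>)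
  show "integrable lborel (\<lambda>z. u z * of_real (Im (zk n m z)))"
    by (rule integrable_continuous_mult[OF assms(1), of _ M "M ^ n * C"])
       (use b z in \<open>auto intro: order_trans[OF abs_Im_le_cmod]\<close>)
qed

lemma continuous_bounded_interval:
  fixes k :: "real \<Rightarrow> real"
  assumes "continuous_on {c..d} k"
  obtains C where "C \<ge> 0" "\<And>s. c \<le> s \<Longrightarrow> s \<le> d \<Longrightarrow> \<bar>k s\<bar> \<le> C"
proof -
  have "compact (k ` {c..d})" by (intro compact_continuous_image assms) auto
  then obtain C where "\<And>s. c \<le> s \<Longrightarrow> s \<le> d \<Longrightarrow> \<bar>k s\<bar> \<le> C"
    using compact_imp_bounded by (fastforce simp: bounded_iff)
  then show ?thesis using that[of "max C 0"] by (meson max.cobounded1 max.cobounded2 order_trans)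
qed

lemma radop_bounded:
  assumes "continuous_on UNIV k" "continuous_on UNIV k1" "continuous_on UNIV k2"
  obtains C where "\<And>s. 0 \<le> s \<Longrightarrow> s \<le> M \<Longrightarrow> \<bar>radop n (pot a \<rho> E) k k1 k2 s\<bar> \<le> C"
proof -
  let ?f = "\<lambda>s. 4 * (s * k2 s + of_nat (Suc n) * k1 s) + E * k s"
  have c: "continuous_on {0..M} ?f" "continuous_on {0..M} k"
    by (intro continuous_intros continuous_on_subset[OF assms(1)] continuous_on_subset[OF assms(2)] continuous_on_subset[OF assms(3)]; simp)+
  obtain C where C: "C \<ge> 0" "\<And>s. 0 \<le> s \<Longrightarrow> s \<le> M \<Longrightarrow> \<bar>?f s\<bar> \<le> C"
    using continuous_bounded_interval[OF c(1)] by blast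
  obtain D where D: "D \<ge> 0" "\<And>s. 0 \<le> s \<Longrightarrow> s \<le> M \<Longrightarrow> \<bar>k s\<bar> \<le> D"
    using continuous_bounded_interval[OF c(2)] by blast
  have "\<bar>radop n (pot a \<rho> E) k k1 k2 s\<bar> \<le> C + a\<^sup>2 * D" if "0 \<le> s" "s \<le> M" for s
  proof -
    have "radop n (pot a \<rho> E) k k1 k2 s = ?f s + (if s \<le> \<rho>\<^sup>2 then a\<^sup>2 else 0) * k s"
      by (simp add: radop_def pot_def algebra_simps)
    moreover have "\<bar>(if s \<le> \<rho>\<^sup>2 then a\<^sup>2 else 0) * k s\<bar> \<le> a\<^sup>2 * D"
      unfolding abs_mult using D that by (intro mult_mono) auto
    ultimately show ?thesis using C(2)[OF that] by linarith
  qed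
  then show ?thesis using that by blast
qed

text \<open>Real and imaginary part of z^n k(|z|^2) are both admissible, and cnj = Re - i Im
  recombines the two results.\<close>

lemma weak_solution_test_zk:
  assumes "weak_solution a \<rho> E u" "\<rho> > 0"
    and k: "\<And>s. (k has_real_derivative k1 s) (at s)" "\<And>s. (k1 has_real_derivative k2 s) (at s)" "continuous_on UNIV k2"
    and M: "M \<ge> 0" "\<And>s. s \<ge> M\<^sup>2 \<Longrightarrow> k s = 0" "\<And>s. s \<ge> M\<^sup>2 \<Longrightarrow> k1 s = 0" "\<And>s. s \<ge> M\<^sup>2 \<Longrightarrow> k2 s = 0"
  shows "(LINT z|lborel. u z * cnj (zk n (radop n (pot a \<rho> E) k k1 k2) z)) = 0"
proof -
  let ?m = "radop n (pot a \<rho> E) k k1 k2"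
  have c: "continuous_on UNIV k" "continuous_on UNIV k1"
    using k by (auto intro!: continuous_at_imp_continuous_on DERIV_isCont)
  have u: "continuous_on UNIV u"
    and test: "\<And>\<phi>. test_function \<phi> \<Longrightarrow> (LINT x|lborel. u x * complex_of_real (schroedinger_op a \<rho> \<phi> x - E * \<phi> x)) = 0"
    using assms(1) by (auto simp: weak_solution_def)
  have z: "zk n k z = 0" if "norm z > M" for z
    using zk_eq_0[of M z k n] that M by simp
  have L: "(LINT z|lborel. u z * of_real (L (zk n ?m z))) = 0" if L: "bounded_linear L" for L :: "complex \<Rightarrow> real"
  proof -
    interpret bounded_linear L by fact
    let ?\<phi> = "\<lambda>z. L (zk n k z)"
    have "norm z \<le> M" if "?\<phi> z \<noteq> 0" for z
      using z[of z] that zero by (metis linorder_not_less)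
    then have "test_function ?\<phi>"
      unfolding test_function_def bounded_iff using C2_zk(1)[OF L k] by auto
    from test[OF this] have "(LINT z|lborel. u z * of_real (- L (zk n ?m z))) = 0"
    proof (rule subst[rotated, of "\<lambda>f. (LINT z|lborel. f z) = 0"])
      have "zk n ?m z = zk n (\<lambda>s. 4 * (s * k2 s + of_nat (Suc n) * k1 s)) z + pot a \<rho> E ((norm z)\<^sup>2) *\<^sub>R zk n k z" for z
        by (simp add: zk_def radop_def scaleR_conv_of_real algebra_simps)
      then have "L (zk n ?m z) = laplacian ?\<phi> z + pot a \<rho> E ((norm z)\<^sup>2) * ?\<phi> z" for z
        by (simp only: add scaleR C2_zk(2)[OF L k] real_scaleR_def)
      then show "(\<lambda>x. u x * complex_of_real (schroedinger_op a \<rho> ?\<phi> x - E * ?\<phi> x)) = (\<lambda>z. u z * of_real (- L (zk n ?m z)))"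
        using schroedinger_op_pot[OF assms(2), of a ?\<phi> _ E] by (simp flip: of_real_mult of_real_diff)
    qed
    then show ?thesis by simp
  qed
  obtain C where C: "\<And>s. 0 \<le> s \<Longrightarrow> s \<le> M\<^sup>2 \<Longrightarrow> \<bar>?m s\<bar> \<le> C"
    using radop_bounded[OF c k(3)] by blast
  have m: "?m \<in> borel_measurable borel"
  proof -
    have [measurable]: "k \<in> borel_measurable borel" "k1 \<in> borel_measurable borel" "k2 \<in> borel_measurable borel"
      using c k(3) by (auto intro: borel_measurable_continuous_onI)
    show ?thesis unfolding radop_def by measurable
  qed
  have m0: "?m s = 0" if "s \<ge> M\<^sup>2" for s using M that by (simp add: radop_def)
  note int = integrable_mult_zk[OF u m M(1) C m0, of n]
  have "(LINT z|lborel. u z * cnj (zk n ?m z)) = (LINT z|lborel. u z * of_real (Re (zk n ?m z)) - \<i> * (u z * of_real (Im (zk n ?m z))))"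
    by (rule Bochner_Integration.integral_cong) (auto simp: complex_eq_iff)
  also have "\<dots> = 0"
    using int L[OF bounded_linear_Re] L[OF bounded_linear_Im]
    by (subst Bochner_Integration.integral_diff) auto
  finally show ?thesis .
qed

section \<open>A piecewise polynomial step\<close>

definition ppow :: "nat \<Rightarrow> real \<Rightarrow> real" where
  "ppow m t = (if t \<le> 0 then 0 else t ^ m)"

lemma ppow_deriv: "(ppow (Suc (Suc m)) has_real_derivative real (Suc (Suc m)) * ppow (Suc m) t) (at t)"
proof (cases t "0::real" rule: linorder_cases)
  case less
  have "(ppow (Suc (Suc m)) has_real_derivative 0) (at t)"
    by (rule has_field_derivative_transform_within_open[OF DERIV_const[of 0], of "{..<0}"]) (use less in \<open>auto simp: ppow_def\<close>)
  then show ?thesis using less by (simp add: ppow_def)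
next
  case equal
  have "((\<lambda>t. if t \<le> 0 then (\<lambda>_. 0) t else t ^ Suc (Suc m)) has_real_derivative 0) (at 0)"
    by (rule DERIV_glue) (auto intro!: derivative_eq_intros)
  then show ?thesis using equal by (simp add: ppow_def[abs_def])
next
  case greater
  have "((\<lambda>t. t ^ Suc (Suc m)) has_real_derivative real (Suc (Suc m)) * t ^ Suc m) (at t)"
    using DERIV_pow[of "Suc (Suc m)" t UNIV] by simp
  then have "(ppow (Suc (Suc m)) has_real_derivative real (Suc (Suc m)) * t ^ Suc m) (at t)"
    by (rule has_field_derivative_transform_within_open[of _ _ _ "{0<..}"]) (use greater in \<open>auto simp: ppow_def\<close>)
  then show ?thesis using greater by (simp add: ppow_def)
qed

lemma ppow_deriv_shift:
  "m \<ge> 2 \<Longrightarrow> ((\<lambda>t. ppow m (t - c)) has_real_derivative real m * ppow (m - 1) (t - c)) (at t)"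
proof -
  assume "m \<ge> 2"
  then obtain l where m: "m = Suc (Suc l)" by (metis add_2_eq_Suc le_Suc_ex)
  have "((\<lambda>t. ppow m (t - c)) has_real_derivative (real m * ppow (m - 1) (t - c)) * 1) (at t)"
    by (rule DERIV_chain2[where f = "ppow m" and g = "\<lambda>t. t - c"])
       (use ppow_deriv[of l "t - c"] in \<open>auto intro!: derivative_eq_intros simp: m\<close>)
  then show ?thesis by simp
qed

text \<open>Between 0 and 1 the step is p(t) = 35 t^4 - 84 t^5 + 70 t^6 - 20 t^7, the antiderivative
  of 140 t^3 (1 - t)^3. Since p(t) + p(1 - t) = 1 and the truncated powers of t - 1 add exactly p(1
  - t), the value is 1 beyond t = 1. The triple zeros of \<open>\<psi>1\<close> at both ends make
  \<open>\<psi>3\<close> continuous.\<close>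

lemma smooth_step:
  obtains \<psi> \<psi>1 \<psi>2 \<psi>3 :: "real \<Rightarrow> real" where
    "\<And>t. (\<psi> has_real_derivative \<psi>1 t) (at t)" "\<And>t. (\<psi>1 has_real_derivative \<psi>2 t) (at t)"
    "\<And>t. (\<psi>2 has_real_derivative \<psi>3 t) (at t)" "continuous_on UNIV \<psi>3"
    "\<And>t. t \<le> 0 \<Longrightarrow> \<psi> t = 0" "\<And>t. t \<ge> 1 \<Longrightarrow> \<psi> t = 1"
    "\<And>t. t \<le> 0 \<or> t \<ge> 1 \<Longrightarrow> \<psi>1 t = 0" "\<And>t. t \<le> 0 \<or> t \<ge> 1 \<Longrightarrow> \<psi>2 t = 0"
    "\<And>t. 0 < t \<Longrightarrow> t < 1 \<Longrightarrow> \<psi>1 t > 0"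
proof -
  let ?p = "\<lambda>m t. ppow m (t - 0)" and ?q = "\<lambda>m t. ppow m (t - 1)"
  define \<psi> where "\<psi> = (\<lambda>t. 35 * (?p 4 t + ?q 4 t) - 84 * (?p 5 t - ?q 5 t) + 70 * (?p 6 t + ?q 6 t) - 20 * (?p 7 t - ?q 7 t))"
  define \<psi>1 where "\<psi>1 = (\<lambda>t. 140 * (?p 3 t + ?q 3 t) - 420 * (?p 4 t - ?q 4 t) + 420 * (?p 5 t + ?q 5 t) - 140 * (?p 6 t - ?q 6 t))"
  define \<psi>2 where "\<psi>2 = (\<lambda>t. 420 * (?p 2 t + ?q 2 t) - 1680 * (?p 3 t - ?q 3 t) + 2100 * (?p 4 t + ?q 4 t) - 840 * (?p 5 t - ?q 5 t))"
  define \<psi>3 where "\<psi>3 = (\<lambda>t. 840 * (?p 1 t + ?q 1 t) - 5040 * (?p 2 t - ?q 2 t) + 8400 * (?p 3 t + ?q 3 t) - 4200 * (?p 4 t - ?q 4 t))"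
  note d = ppow_deriv_shift
  have 1: "(\<psi> has_real_derivative \<psi>1 t) (at t)" for t
    unfolding \<psi>_def \<psi>1_def by (rule derivative_eq_intros d refl | simp)+
  have 2: "(\<psi>1 has_real_derivative \<psi>2 t) (at t)" for t
    unfolding \<psi>2_def \<psi>1_def by (rule derivative_eq_intros d refl | simp)+
  have 3: "(\<psi>2 has_real_derivative \<psi>3 t) (at t)" for t
    unfolding \<psi>2_def \<psi>3_def by (rule derivative_eq_intros d refl | simp)+
  have "ppow 1 = (\<lambda>t. max t 0)" by (auto simp: ppow_def max_def)
  then have p1: "continuous_on UNIV (\<lambda>t. ppow 1 (t - c))" for c by (auto intro!: continuous_intros)
 have p2: "continuous_on UNIV (\<lambda>t. ppow m (t - c))" if "m \<ge> 2" for m c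
    using d[OF that] by (auto intro!: continuous_at_imp_continuous_on DERIV_isCont)
  have 4: "continuous_on UNIV \<psi>3"
    unfolding \<psi>3_def by (intro continuous_intros p1 p2) simp_all
  have 5: "\<psi> t = 0" "\<psi>1 t = 0" "\<psi>2 t = 0" if "t \<le> 0" for t
    using that by (simp_all add: \<psi>_def \<psi>1_def \<psi>2_def ppow_def)
  have pq: "?p m t = t ^ m" "?q m t = (t - 1) ^ m" if "t \<ge> 1" "m > 0" for t m
    using that by (auto simp: ppow_def)
  have 6: "\<psi> t = 1" "\<psi>1 t = 0" "\<psi>2 t = 0" if "t \<ge> 1" for t
    unfolding \<psi>_def \<psi>1_def \<psi>2_def pq[OF that zero_less_numeral] by algebra+
  have 7: "\<psi>1 t > 0" if "0 < t" "t < 1" for t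
  proof -
    have "\<psi>1 t = 140 * t ^ 3 * (1 - t) ^ 3"
      using that unfolding \<psi>1_def ppow_def by (simp add: algebra_simps power3_eq_cube) algebra
    then show ?thesis using that by simp
  qed
  show ?thesis by (rule that[of \<psi> \<psi>1 \<psi>2 \<psi>3]) (use 1 2 3 4 5 6 7 in blast)+
qed

lemma ex_bound_interval:
  fixes k :: "real \<Rightarrow> real"
  assumes "continuous_on {c..d} k"
  shows "\<exists>C\<ge>0. \<forall>s. c \<le> s \<longrightarrow> s \<le> d \<longrightarrow> \<bar>k s\<bar> \<le> C"
  by (rule continuous_bounded_interval[OF assms]) auto

lemma ex_bound_ball:
  fixes u :: "'a::euclidean_space \<Rightarrow> 'b::real_normed_vector"
  assumes "continuous_on UNIV u"
  shows "\<exists>C\<ge>0. \<forall>z. norm z \<le> M \<longrightarrow> norm (u z) \<le> C"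
  by (rule continuous_bounded_ball[OF assms]) auto

section \<open>Gluing across the circle |z| = \<rho>\<close>

text \<open>Green's identity, one basis direction at a time: u times a derivative of \<phi> minus
  \<phi> times that derivative of u is continuous across the circle, because k and its first
  derivative match. So the integral of its derivative vanishes although the second derivative of k
  may jump. Since u solves the equation on either side, the sum over the basis is the weak
  formulation.\<close>

lemma weak_solution_zkI:
  assumes "\<rho> > 0"
    and kin: "\<And>s. (kin has_real_derivative kin1 s) (at s)" "\<And>s. (kin1 has_real_derivative kin2 s) (at s)" "continuous_on UNIV kin2"
    and kout: "\<And>s. s > 0 \<Longrightarrow> (kout has_real_derivative kout1 s) (at s)"
      "\<And>s. s > 0 \<Longrightarrow> (kout1 has_real_derivative kout2 s) (at s)" "continuous_on {0<..} kout2"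
    and match: "kin (\<rho>\<^sup>2) = kout (\<rho>\<^sup>2)" "kin1 (\<rho>\<^sup>2) = kout1 (\<rho>\<^sup>2)"
    and ode_in: "\<And>s. 4 * (s * kin2 s + of_nat (Suc n) * kin1 s) + (a\<^sup>2 + E) * kin s = 0"
    and ode_out: "\<And>s. s > 0 \<Longrightarrow> 4 * (s * kout2 s + of_nat (Suc n) * kout1 s) + E * kout s = 0"
  shows "weak_solution a \<rho> E (zk n (\<lambda>s. if s \<le> \<rho>\<^sup>2 then kin s else kout s))"
proof -
  define S where "S = \<rho>\<^sup>2"
  have S: "S > 0" using assms(1) by (simp add: S_def)
  define K where "K = (\<lambda>s. if s \<le> S then kin s else kout s)"
  define K1 where "K1 = (\<lambda>s. if s \<le> S then kin1 s else kout1 s)"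
  define K2 where "K2 = (\<lambda>s. if s \<le> S then kin2 s else kout2 s)"
  have lt: "((\<lambda>s. if s \<le> S then f s else g s) has_real_derivative D) (at s)"
    if "(f has_real_derivative D) (at s)" "s < S" for f g D s
    by (rule has_field_derivative_transform_within_open[OF that(1), of "{..<S}"]) (use that in auto)
  have gt: "((\<lambda>s. if s \<le> S then f s else g s) has_real_derivative D) (at s)"
    if "(g has_real_derivative D) (at s)" "s > S" for f g D s
    by (rule has_field_derivative_transform_within_open[OF that(1), of "{S<..}"]) (use that in auto)
  have K: "(K has_real_derivative K1 s) (at s)" for s
  proof (cases s S rule: linorder_cases)
    case equal
    then show ?thesis unfolding K_def K1_def
      using DERIV_glue[of kin "kin1 S" S kout] kin(1)[of S] kout(1)[OF S] match by (simp add: S_def)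
  qed (use lt[OF kin(1)] gt[OF kout(1)] S in \<open>auto simp: K_def K1_def\<close>)
  have K1: "(K1 has_real_derivative K2 s) (at s)" if "s \<noteq> S" for s
    using that lt[OF kin(2)] gt[OF kout(2)] S by (cases "s < S") (auto simp: K2_def K1_def)
  have cK: "continuous_on UNIV K"
    using K by (auto intro!: continuous_at_imp_continuous_on DERIV_isCont)
  have cK1: "continuous_on UNIV K1"
  proof -
    have "continuous_on UNIV kin1" using kin(2) by (auto intro!: continuous_at_imp_continuous_on DERIV_isCont)
    moreover have "continuous_on {0<..} kout1"
      by (rule continuous_at_imp_continuous_on) (use kout(2) DERIV_isCont in blast)
    then have "continuous_on {s. S \<le> s} kout1"
      by (rule continuous_on_subset) (use S in auto)
    ultimately show ?thesis
      unfolding K1_def using match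
      by (intro continuous_on_cases_le) (auto intro: continuous_on_subset continuous_on_id simp: S_def)
  qed
  have mK2: "K2 \<in> borel_measurable borel"
    unfolding K2_def
    using borel_measurable_continuous_on_if[of "{..S}" kin2 kout2]
      continuous_on_subset[OF kin(3), of "{..S}"] continuous_on_subset[OF kout(3), of "{S<..}"] S
    by auto
  have bK2: "\<exists>C. \<forall>s. 0 \<le> s \<longrightarrow> s \<le> M \<longrightarrow> \<bar>K2 s\<bar> \<le> C" for M
  proof -
    have c: "continuous_on {0..M} kin2" "continuous_on {S..M} kout2"
      by (rule continuous_on_subset[OF kin(3)], simp, rule continuous_on_subset[OF kout(3)], use S in force)
    obtain C where C: "C \<ge> 0" "\<And>s. 0 \<le> s \<Longrightarrow> s \<le> M \<Longrightarrow> \<bar>kin2 s\<bar> \<le> C"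
      using ex_bound_interval[OF c(1)] by auto
    obtain D where D: "D \<ge> 0" "\<And>s. S \<le> s \<Longrightarrow> s \<le> M \<Longrightarrow> \<bar>kout2 s\<bar> \<le> D"
      using ex_bound_interval[OF c(2)] by auto
    from C D have "\<bar>K2 s\<bar> \<le> max C D" if "0 \<le> s" "s \<le> M" for s
      using that by (auto simp: K2_def le_max_iff_disj)
    then show ?thesis by blast
  qed
  let ?u = "zk n K"
  have "(LINT z|lborel. ?u z * complex_of_real (schroedinger_op a \<rho> \<phi> z - E * \<phi> z)) = 0" if test: "test_function \<phi>" for \<phi>
  proof -
    obtain M where M: "M > 0" "\<And>z. norm z \<ge> M \<Longrightarrow> \<phi> z = 0"
      "\<And>z b. b \<in> Basis \<Longrightarrow> norm z \<ge> M \<Longrightarrow> partial_deriv b \<phi> z = 0"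
      "\<And>z b c. b \<in> Basis \<Longrightarrow> c \<in> Basis \<Longrightarrow> norm z \<ge> M \<Longrightarrow> partial_deriv c (partial_deriv b \<phi>) z = 0"
      "continuous_on UNIV \<phi>"
      by (rule test_function_bounded_support[OF test]) (rule that)
    have C1: "C1_function \<phi>" "\<And>b. b \<in> Basis \<Longrightarrow> C1_function (partial_deriv b \<phi>)"
      using test by (auto simp: test_function_def C2_function_def)
    \<comment> \<open>The derivative in direction b of the Green flux \<open>?F\<close> below;
      summed over the basis it is minus the integrand of the weak formulation.\<close>
    define w where "w = (\<lambda>b z. ?u z * of_real (partial_deriv b (partial_deriv b \<phi>) z) - zk2 n K K1 K2 b b z * of_real (\<phi> z))"
    \<comment> \<open>\<open>H\<close> and \<open>Q\<close> are continuous, and \<open>K2\<close>,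
      which may jump, enters linearly with factor \<open>Q\<close>; this gives measurability and
      boundedness of \<open>w\<close>.\<close>
    define H where "H = (\<lambda>b z. ?u z * complex_of_real (partial_deriv b (partial_deriv b \<phi>) z) - zk2 n K K1 (\<lambda>_. 0) b b z * of_real (\<phi> z))"
    define Q where "Q = (\<lambda>b z. - of_real (2 * (z \<bullet> b)) * (of_real (2 * (z \<bullet> b)) * z ^ n) * complex_of_real (\<phi> z))"
    have wHQ: "w b z = H b z + Q b z * of_real (K2 ((norm z)\<^sup>2))" for b z
      by (simp add: w_def H_def Q_def zk2_def zk1_def zk_def[of _ "K2"] zk_def[of _ "\<lambda>_. 0"] algebra_simps)
    have int: "integrable lborel (w b)" and zero: "(LINT z|lborel. w b z) = 0" if b: "b \<in> Basis" for b
    proof -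
      note cpp = C1_functionD(2)[OF C1(2)[OF b] b] and cp = C1_functionD(2)[OF C1(1) b]
      have cH: "continuous_on UNIV (H b)" and cQ: "continuous_on UNIV (Q b)"
        unfolding H_def Q_def
        by (intro continuous_intros cpp continuous_zk cK continuous_zk2 cK1 continuous_on_of_real[OF cpp] continuous_on_of_real[OF M(5)])+
      obtain C where C: "C \<ge> 0" "\<And>z. norm z \<le> M \<Longrightarrow> norm (H b z) \<le> C"
        using ex_bound_ball[OF cH] by auto
      obtain D where D: "D \<ge> 0" "\<And>z. norm z \<le> M \<Longrightarrow> norm (Q b z) \<le> D"
        using ex_bound_ball[OF cQ] by auto
      obtain B where B: "\<And>s. 0 \<le> s \<Longrightarrow> s \<le> M\<^sup>2 \<Longrightarrow> \<bar>K2 s\<bar> \<le> B"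
        using bK2[of "M\<^sup>2"] by auto
      note CDB = C(2) D B
      have wb: "norm (w b z) \<le> C + D * B" if "norm z < M" for z
      proof -
        have "(norm z)\<^sup>2 \<le> M\<^sup>2" using that by (intro power_mono) auto
        then have "norm (Q b z * of_real (K2 ((norm z)\<^sup>2))) \<le> D * B"
          unfolding norm_mult using CDB that by (intro mult_mono) auto
        then show ?thesis
          unfolding wHQ using CDB(1)[of z] that by (intro order_trans[OF norm_triangle_ineq]) linarith
      qed
      have [measurable]: "H b \<in> borel_measurable borel" "Q b \<in> borel_measurable borel"
        using cH cQ by (auto intro: borel_measurable_continuous_onI)
      note mK2 [measurable]
      have mw: "w b \<in> borel_measurable borel"
        unfolding wHQ[abs_def] by measurable
      have w0: "w b z = 0" if "norm z \<ge> M" for z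
        using M that b by (simp add: w_def)
      show "integrable lborel (w b)"
        by (rule integrable_bounded_support[OF mw wb w0])
      let ?F = "\<lambda>z. ?u z * of_real (partial_deriv b \<phi> z) - zk1 n K K1 b z * of_real (\<phi> z)"
      show "(LINT z|lborel. w b z) = 0"
      proof (rule integral_line_derivative_zero[OF b _ _ mw wb _ w0])
        show "continuous_on UNIV ?F"
          by (intro continuous_intros continuous_zk cK continuous_zk1 cK1 continuous_on_of_real[OF cp] continuous_on_of_real[OF M(5)])
        show "?F z = 0" if "norm z \<ge> M" for z using M that b by simp
        fix z :: complex assume "norm z \<noteq> \<rho>"
        then have nz: "(norm z)\<^sup>2 \<noteq> S" using assms(1) by (auto simp: S_def power2_eq_iff_nonneg)
        have d1: "((\<lambda>t. complex_of_real (\<phi> (z + t *\<^sub>R b))) has_vector_derivative of_real (partial_deriv b \<phi> z)) (at 0)"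
          by (rule has_vector_derivative_of_real) (simp add: has_real_derivative_iff_has_vector_derivative C1_functionD(1)[OF C1(1) b])
        have d2: "((\<lambda>t. complex_of_real (partial_deriv b \<phi> (z + t *\<^sub>R b))) has_vector_derivative of_real (partial_deriv b (partial_deriv b \<phi>) z)) (at 0)"
          by (rule has_vector_derivative_of_real) (simp add: has_real_derivative_iff_has_vector_derivative C1_functionD(1)[OF C1(2)[OF b] b])
        have d3: "((\<lambda>t. ?u (z + t *\<^sub>R b)) has_vector_derivative zk1 n K K1 b z) (at 0)"
          unfolding zk1_def by (rule zk_line_deriv, rule K)
        have d4: "((\<lambda>t. zk1 n K K1 b (z + t *\<^sub>R b)) has_vector_derivative zk2 n K K1 K2 b b z) (at 0)"
          by (rule zk1_line_deriv, rule K, rule K1[OF nz])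
        from has_vector_derivative_diff[OF has_vector_derivative_mult[OF d3 d2] has_vector_derivative_mult[OF d4 d1]]
        show "((\<lambda>t. ?F (z + t *\<^sub>R b)) has_vector_derivative w b z) (at 0)"
          by (simp add: w_def algebra_simps)
      qed
    qed
    have "(LINT z|lborel. (\<Sum>b\<in>Basis. w b z)) = 0"
      using int zero by (subst Bochner_Integration.integral_sum) auto
    moreover have "(\<Sum>b\<in>Basis. w b z) = - (?u z * complex_of_real (schroedinger_op a \<rho> \<phi> z - E * \<phi> z))" for z
    proof -
      have "zk n (\<lambda>s. 4 * (s * K2 s + of_nat (Suc n) * K1 s)) z = - of_real (pot a \<rho> E ((norm z)\<^sup>2)) * ?u z"
      proof -
        have "4 * (s * K2 s + of_nat (Suc n) * K1 s) = - pot a \<rho> E s * K s" if "s \<ge> 0" for s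
        proof (cases "s \<le> S")
          case True
          then show ?thesis using ode_in[of s] by (simp add: K_def K1_def K2_def pot_def S_def) (simp add: algebra_simps)
        next
          case False
          then have "s > 0" using S by simp
          from ode_out[OF this] False show ?thesis by (simp add: K_def K1_def K2_def pot_def S_def)
        qed
        from this[of "(norm z)\<^sup>2"] show ?thesis unfolding zk_def by simp
      qed
      moreover have "(\<Sum>b\<in>Basis. w b z) = ?u z * of_real (laplacian \<phi> z) - zk n (\<lambda>s. 4 * (s * K2 s + of_nat (Suc n) * K1 s)) z * of_real (\<phi> z)"
        by (simp only: w_def sum_subtractf laplacian_def of_real_sum sum_distrib_left sum_distrib_right zk_laplacian[of n K K1 K2 z, symmetric])
      ultimately show ?thesis
        unfolding schroedinger_op_pot[OF assms(1)] by (simp add: algebra_simps)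
    qed
    ultimately show ?thesis by simp
  qed
  then show ?thesis
    unfolding weak_solution_def using continuous_zk[OF cK, of n] unfolding K_def S_def by blast
qed

text \<open>Test functions that are only C^1 on the circle. The difference d = kout - kin vanishes
  there to second order, so it can be switched on by a step in a layer of width 1 / N. In the layer
  d is of size 1 / N^2 and its derivative of size 1 / N, which compensates the factors N^2 and N
  from differentiating the step. Second derivatives stay bounded and dominated convergence
  applies.\<close>

lemma weak_solution_test_glue:
  assumes u: "weak_solution a \<rho> E u" "\<rho> > 0"
    and kin: "\<And>s. (kin has_real_derivative kin1 s) (at s)" "\<And>s. (kin1 has_real_derivative kin2 s) (at s)" "continuous_on UNIV kin2"
    and kout: "\<And>s. s > 0 \<Longrightarrow> (kout has_real_derivative kout1 s) (at s)"
      "\<And>s. s > 0 \<Longrightarrow> (kout1 has_real_derivative kout2 s) (at s)" "continuous_on {0<..} kout2"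
    and match: "kin (\<rho>\<^sup>2) = kout (\<rho>\<^sup>2)" "kin1 (\<rho>\<^sup>2) = kout1 (\<rho>\<^sup>2)"
    and M: "\<rho>\<^sup>2 < M" "\<And>s. s \<ge> M \<Longrightarrow> kout s = 0" "\<And>s. s \<ge> M \<Longrightarrow> kout1 s = 0" "\<And>s. s \<ge> M \<Longrightarrow> kout2 s = 0"
  shows "(LINT z|lborel. u z * cnj (zk n (\<lambda>s. if s \<le> \<rho>\<^sup>2 then radop n (pot a \<rho> E) kin kin1 kin2 s
            else radop n (pot a \<rho> E) kout kout1 kout2 s) z)) = 0"
proof -
  define S where "S = \<rho>\<^sup>2"
  have S: "S > 0" using assms(2) by (simp add: S_def)
  obtain \<psi> \<psi>1 \<psi>2 \<psi>3 :: "real \<Rightarrow> real" where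
    psi: "\<And>t. (\<psi> has_real_derivative \<psi>1 t) (at t)" "\<And>t. (\<psi>1 has_real_derivative \<psi>2 t) (at t)"
      "\<And>t. (\<psi>2 has_real_derivative \<psi>3 t) (at t)"
    and psi0: "\<And>t. t \<le> 0 \<Longrightarrow> \<psi> t = 0" "\<And>t. t \<ge> 1 \<Longrightarrow> \<psi> t = 1"
    "\<And>t. t \<le> 0 \<or> t \<ge> 1 \<Longrightarrow> \<psi>1 t = 0" "\<And>t. t \<le> 0 \<or> t \<ge> 1 \<Longrightarrow> \<psi>2 t = 0"
    by (rule smooth_step) (rule that)
  have cpsi: "continuous_on A \<psi>" "continuous_on A \<psi>1" "continuous_on A \<psi>2" for A
    using psi by (auto intro!: continuous_at_imp_continuous_on DERIV_isCont)
  obtain B where B: "B \<ge> 1" "\<And>t. \<bar>\<psi> t\<bar> \<le> B" "\<And>t. \<bar>\<psi>1 t\<bar> \<le> B" "\<And>t. \<bar>\<psi>2 t\<bar> \<le> B"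
  proof -
    from ex_bound_interval[OF cpsi(1), of 0 1] ex_bound_interval[OF cpsi(2), of 0 1] ex_bound_interval[OF cpsi(3), of 0 1]
    obtain B0 B1 B2 where b: "\<forall>s. 0 \<le> s \<longrightarrow> s \<le> 1 \<longrightarrow> \<bar>\<psi> s\<bar> \<le> B0" "\<forall>s. 0 \<le> s \<longrightarrow> s \<le> 1 \<longrightarrow> \<bar>\<psi>1 s\<bar> \<le> B1"
       "\<forall>s. 0 \<le> s \<longrightarrow> s \<le> 1 \<longrightarrow> \<bar>\<psi>2 s\<bar> \<le> B2" by auto
    define B where "B = Max {1, B0, B1, B2}"
    have le: "1 \<le> B" "B0 \<le> B" "B1 \<le> B" "B2 \<le> B" by (simp_all add: B_def)
    show ?thesis
    proof (rule that[of B])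
      fix t :: real
      consider "t \<le> 0" | "t \<ge> 1" | "0 \<le> t" "t \<le> 1" by linarith
      note cases = this
      show "\<bar>\<psi> t\<bar> \<le> B" using psi0(1,2)[of t] b(1) le by (cases rule: cases) force+
      show "\<bar>\<psi>1 t\<bar> \<le> B" using psi0(3)[of t] b(2) le by (cases rule: cases) force+
      show "\<bar>\<psi>2 t\<bar> \<le> B" using psi0(4)[of t] b(3) le by (cases rule: cases) force+
    qed fact
  qed
  define d d1 d2 where "d = (\<lambda>s. kout s - kin s)" and "d1 = (\<lambda>s. kout1 s - kin1 s)" and "d2 = (\<lambda>s. kout2 s - kin2 s)"
  have d: "(d has_real_derivative d1 s) (at s)" "(d1 has_real_derivative d2 s) (at s)" if "s > 0" for s
    unfolding d_def d1_def d2_def using that kin kout by (auto intro!: derivative_eq_intros)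
  have cd2: "continuous_on {0<..} d2"
    unfolding d2_def by (intro continuous_intros kout(3) continuous_on_subset[OF kin(3)]) auto
  have dS: "d S = 0" "d1 S = 0" using match by (auto simp: d_def d1_def S_def)
  \<comment> \<open>Even for j = 0 the switch is complete at s = S + 1 < L, and kout vanishes from M
    on; so L bounds the supports of all approximations.\<close>
  define L where "L = M + 1"
  have L: "L > S + 1" "L > 1" using M(1) S unfolding L_def S_def by linarith+
  have "continuous_on {S..L} d2" by (rule continuous_on_subset[OF cd2]) (use S in auto)
  from ex_bound_interval[OF this] obtain C where C: "C \<ge> 0" "\<And>s. S \<le> s \<Longrightarrow> s \<le> L \<Longrightarrow> \<bar>d2 s\<bar> \<le> C" by auto
  \<comment> \<open>Used twice: a bound C for d2 makes d1 of order s - S, and this makes d of order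
    (s - S)^2.\<close>
  have mv: "\<bar>g s\<bar> \<le> c * (s - S)" if g: "\<And>t. t > 0 \<Longrightarrow> (g has_real_derivative g1 t) (at t)" "g S = 0"
     "\<And>t. S \<le> t \<Longrightarrow> t \<le> s \<Longrightarrow> \<bar>g1 t\<bar> \<le> c" "S \<le> s" for g g1 s c
  proof -
    have "norm (g s - g S) \<le> c * norm (s - S)"
    proof (rule field_differentiable_bound[where S = "{S..s}" and f' = g1])
      show "(g has_field_derivative g1 t) (at t within {S..s})" if "t \<in> {S..s}" for t
        using g(1)[of t] that S by (auto intro: has_field_derivative_at_within)
    qed (use g S in auto)
    then show ?thesis using g by simp
  qed
  have bd1: "\<bar>d1 s\<bar> \<le> C * (s - S)" if "S \<le> s" "s \<le> L" for s
    by (rule mv[of d1 d2]) (use d(2) dS(2) C(2) that in simp_all)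
  have bd: "\<bar>d s\<bar> \<le> C * (s - S) * (s - S)" if "S \<le> s" "s \<le> L" for s
  proof (rule mv[of d d1])
    fix t assume t: "S \<le> t" "t \<le> s"
    then have "\<bar>d1 t\<bar> \<le> C * (t - S)" using bd1[of t] that by auto
    also have "\<dots> \<le> C * (s - S)" using t C by (intro mult_left_mono) auto
    finally show "\<bar>d1 t\<bar> \<le> C * (s - S)" .
  qed (use d(1) dS(1) that in simp_all)
  define N where "N = (\<lambda>j::nat. real (Suc j))"
  have N: "N j \<ge> 1" for j by (simp add: N_def)
  define t where "t = (\<lambda>j s. N j * (s - S))"
  define k where "k = (\<lambda>j s. kin s + d s * \<psi> (t j s))"
  define k1 where "k1 = (\<lambda>j s. kin1 s + (d1 s * \<psi> (t j s) + N j * (d s * \<psi>1 (t j s))))"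
  define k2 where "k2 = (\<lambda>j s. kin2 s + (d2 s * \<psi> (t j s) + 2 * (N j * (d1 s * \<psi>1 (t j s))) + (N j)\<^sup>2 * (d s * \<psi>2 (t j s))))"
  have t0: "t j s \<le> 0" if "s \<le> S" for j s
    using that N[of j] unfolding t_def by (intro mult_nonneg_nonpos) auto
  have inn: "k j s = kin s" "k1 j s = kin1 s" "k2 j s = kin2 s" if "s \<le> S" for j s
    using t0[OF that, of j] psi0 by (simp_all add: k_def k1_def k2_def)
  have out: "k j s = kout s" "k1 j s = kout1 s" "k2 j s = kout2 s" if "t j s \<ge> 1" for j s
    using that psi0 by (simp_all add: k_def k1_def k2_def d_def d1_def d2_def)
  have tL: "t j s \<ge> 1" if "s \<ge> S + 1" for j s
    using mult_mono[of 1 "N j" 1 "s - S"] that N[of j] by (simp add: t_def)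
  have der: "(k j has_real_derivative k1 j s) (at s)" "(k1 j has_real_derivative k2 j s) (at s)" for j s
  proof -
    have "(k j has_real_derivative k1 j s) (at s) \<and> (k1 j has_real_derivative k2 j s) (at s)"
    proof (cases "s < S")
      case True
      have "(k j has_real_derivative kin1 s) (at s)"
        by (rule has_field_derivative_transform_within_open[OF kin(1), of "{..<S}"]) (use True inn in auto)
      moreover have "(k1 j has_real_derivative kin2 s) (at s)"
        by (rule has_field_derivative_transform_within_open[OF kin(2), of "{..<S}"]) (use True inn in auto)
      ultimately show ?thesis using inn True by simp
    next
      case False
      then have s: "s > 0" using S by simp
      have "(t j has_real_derivative N j) (at s)" unfolding t_def by (auto intro!: derivative_eq_intros)
      note p = DERIV_chain2[OF psi(1) this] DERIV_chain2[OF psi(2) this]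
      show ?thesis
        unfolding k_def k1_def k2_def
        by (rule conjI; (rule derivative_eq_intros kin d[OF s] p refl | simp add: algebra_simps power2_eq_square)+)
    qed
    then show "(k j has_real_derivative k1 j s) (at s)" "(k1 j has_real_derivative k2 j s) (at s)" by auto
  qed
  have ck2: "continuous_on UNIV (k2 j)" for j
  proof -
    have "continuous_on {..<S} (k2 j)"
      by (rule continuous_on_eq[OF continuous_on_subset[OF kin(3)]]) (use inn in auto)
    moreover have "continuous_on {0<..} (k2 j)"
    proof -
      have ct: "continuous_on {0<..} (t j)" unfolding t_def by (intro continuous_intros)
      have cd: "continuous_on {0<..} d" "continuous_on {0<..} d1"
        using DERIV_isCont[OF d(1)] DERIV_isCont[OF d(2)] by (simp_all add: continuous_at_imp_continuous_on)
      have p: "continuous_on {0<..} (\<lambda>s. f (t j s))" if "continuous_on UNIV f" for f :: "real \<Rightarrow> real"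
        by (rule continuous_on_compose2[OF that ct]) auto
      show ?thesis unfolding k2_def
        by (intro continuous_intros continuous_on_subset[OF kin(3)] cd2 cd p cpsi) auto
    qed
    ultimately have "continuous_on ({..<S} \<union> {0<..}) (k2 j)"
      by (intro continuous_on_open_Un) auto
    moreover have "{..<S} \<union> {0<..} = (UNIV :: real set)" using S by auto
    ultimately show ?thesis by simp
  qed
  have supp: "k j s = 0" "k1 j s = 0" "k2 j s = 0" if "s \<ge> L" for j s
    using out[OF tL] that L M by (auto simp: L_def)
  define m where "m = (\<lambda>s. if s \<le> S then radop n (pot a \<rho> E) kin kin1 kin2 s else radop n (pot a \<rho> E) kout kout1 kout2 s)"
  define f where "f = (\<lambda>j z. u z * cnj (zk n (radop n (pot a \<rho> E) (k j) (k1 j) (k2 j)) z))"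
  have f0: "(LINT z|lborel. f j z) = 0" for j
    unfolding f_def
    by (rule weak_solution_test_zk[OF u der ck2, of "sqrt L"]) (use supp L in auto)
  \<comment> \<open>For fixed s > S the layer eventually lies below s, so the sequence is eventually
    equal to its limit.\<close>
  have lim: "(\<lambda>j. radop n (pot a \<rho> E) (k j) (k1 j) (k2 j) s) \<longlonglongrightarrow> m s" for s
  proof (rule tendsto_eventually)
    show "\<forall>\<^sub>F j in sequentially. radop n (pot a \<rho> E) (k j) (k1 j) (k2 j) s = m s"
    proof (cases "s \<le> S")
      case True
      then show ?thesis by (simp add: m_def radop_def inn)
    next
      case False
      have "\<forall>\<^sub>F j in sequentially. 1 / (s - S) \<le> real j"
        using filterlim_real_sequentially by (simp add: filterlim_at_top)
      then show ?thesis
      proof eventually_elim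
        case (elim j)
        then have "t j s \<ge> 1" using False by (simp add: t_def N_def field_simps)
        then show ?case using False by (simp add: m_def radop_def out)
      qed
    qed
  qed
  obtain A0 A1 A2 where A: "\<And>s. 0 \<le> s \<Longrightarrow> s \<le> L \<Longrightarrow> \<bar>kin s\<bar> \<le> A0" "\<And>s. 0 \<le> s \<Longrightarrow> s \<le> L \<Longrightarrow> \<bar>kin1 s\<bar> \<le> A1" "\<And>s. 0 \<le> s \<Longrightarrow> s \<le> L \<Longrightarrow> \<bar>kin2 s\<bar> \<le> A2"
  proof -
    have "continuous_on {0..L} kin" "continuous_on {0..L} kin1" "continuous_on {0..L} kin2"
      using DERIV_isCont[OF kin(1)] DERIV_isCont[OF kin(2)] continuous_on_subset[OF kin(3), of "{0..L}"]
      by (simp_all add: continuous_at_imp_continuous_on)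
    note e = this[THEN ex_bound_interval]
    obtain A0 where A0: "\<forall>s. 0 \<le> s \<longrightarrow> s \<le> L \<longrightarrow> \<bar>kin s\<bar> \<le> A0" using e(1) by auto
    obtain A1 where A1: "\<forall>s. 0 \<le> s \<longrightarrow> s \<le> L \<longrightarrow> \<bar>kin1 s\<bar> \<le> A1" using e(2) by auto
    obtain A2 where A2: "\<forall>s. 0 \<le> s \<longrightarrow> s \<le> L \<longrightarrow> \<bar>kin2 s\<bar> \<le> A2" using e(3) by auto
    show ?thesis by (rule that[of A0 A1 A2]) (use A0 A1 A2 in simp_all)
  qed
  have bnd: "\<bar>k j s\<bar> \<le> A0 + C * L * L * B" "\<bar>k1 j s\<bar> \<le> A1 + (C * L * B + C * L * B)" "\<bar>k2 j s\<bar> \<le> A2 + (C * B + 2 * (C * B) + C * B)"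
    if s: "0 \<le> s" "s \<le> L" for j s
  proof -
    have CL: "C * L \<ge> 0" "C * L * L \<ge> 0" "C * B \<ge> 0" using C L B by auto
    have e: "\<bar>d s * \<psi> (t j s)\<bar> \<le> C * L * L * B \<and> \<bar>d1 s * \<psi> (t j s)\<bar> \<le> C * L * B \<and> \<bar>d2 s * \<psi> (t j s)\<bar> \<le> C * B
      \<and> \<bar>N j * (d s * \<psi>1 (t j s))\<bar> \<le> C * L * B \<and> \<bar>N j * (d1 s * \<psi>1 (t j s))\<bar> \<le> C * B \<and> \<bar>(N j)\<^sup>2 * (d s * \<psi>2 (t j s))\<bar> \<le> C * B"
    proof (cases "s \<le> S")
      case True
      then show ?thesis using psi0 t0[OF True, of j] CL B L C by (simp add: mult_nonneg_nonneg)
    next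
      case False
      have sL: "s - S \<le> L" "0 \<le> s - S" using False s S by auto
      have e0: "\<bar>d s\<bar> \<le> C * L * L" "\<bar>d1 s\<bar> \<le> C * L" "\<bar>d2 s\<bar> \<le> C"
        using bd[of s] bd1[of s] C(2)[of s] False s sL C(1)
          mult_mono[of "C * (s - S)" "C * L" "s - S" L] mult_left_mono[of "s - S" L C] L by auto
      \<comment> \<open>Inside the layer N (s - S) \<le> 1 consumes the powers of N; beyond it the
        derivatives of the step vanish.\<close>
      have e1: "\<bar>N j * (d s * \<psi>1 (t j s))\<bar> \<le> C * L * B \<and> \<bar>N j * (d1 s * \<psi>1 (t j s))\<bar> \<le> C * B \<and> \<bar>(N j)\<^sup>2 * (d s * \<psi>2 (t j s))\<bar> \<le> C * B"
      proof (cases "t j s \<ge> 1")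
        case True
        then show ?thesis using psi0 CL B L C by simp
      next
        case F: False
        have Ns: "N j * (s - S) \<le> 1" using F by (simp add: t_def)
        have n0: "N j \<ge> 0" using N[of j] by simp
        have "N j * \<bar>d1 s\<bar> \<le> N j * (C * (s - S))" using bd1[of s] False s n0 by (intro mult_left_mono) auto
        also have "\<dots> = C * (N j * (s - S))" by simp
        also have "\<dots> \<le> C * 1" using Ns C by (intro mult_left_mono) auto
        finally have q1: "N j * \<bar>d1 s\<bar> \<le> C" by simp
        have ds: "\<bar>d s\<bar> \<le> C * (s - S) * (s - S)" using bd[of s] False s by simp
        have "N j * \<bar>d s\<bar> \<le> N j * (C * (s - S) * (s - S))" using ds n0 by (intro mult_left_mono) auto
        also have "\<dots> = (C * (s - S)) * (N j * (s - S))" by simp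
        also have "\<dots> \<le> (C * L) * 1" using Ns C sL n0 by (intro mult_mono) auto
        finally have q2: "N j * \<bar>d s\<bar> \<le> C * L" by simp
        have "(N j)\<^sup>2 * \<bar>d s\<bar> \<le> (N j)\<^sup>2 * (C * (s - S) * (s - S))" using ds by (intro mult_left_mono) auto
        also have "\<dots> = C * ((N j * (s - S)) * (N j * (s - S)))" by (simp add: power2_eq_square)
        also have "\<dots> \<le> C * (1 * 1)" using Ns C sL n0 by (intro mult_left_mono mult_mono) auto
        finally have q3: "(N j)\<^sup>2 * \<bar>d s\<bar> \<le> C" by simp
        show ?thesis
          using mult_mono[OF q1 B(3)[of "t j s"]] mult_mono[OF q2 B(3)[of "t j s"]] mult_mono[OF q3 B(4)[of "t j s"]] CL C n0
          by (simp add: abs_mult mult.assoc)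
      qed
      then show ?thesis
        using mult_mono[OF e0(1) B(2)[of "t j s"]] mult_mono[OF e0(2) B(2)[of "t j s"]] mult_mono[OF e0(3) B(2)[of "t j s"]] CL C
        by (simp add: abs_mult)
    qed
    note A' = A[OF s]
    have tri: "\<bar>x + (p + 2 * q + r)\<bar> \<le> X + (P + 2 * Q + R)"
      if "\<bar>x\<bar> \<le> X" "\<bar>p\<bar> \<le> P" "\<bar>q\<bar> \<le> Q" "\<bar>r\<bar> \<le> R" for x p q r X P Q R :: real
      using that by linarith
    show "\<bar>k j s\<bar> \<le> A0 + C * L * L * B"
      using tri[of "kin s" A0 "d s * \<psi> (t j s)" "C * L * L * B" 0 0 0 0] e A'(1) by (simp add: k_def)
    show "\<bar>k1 j s\<bar> \<le> A1 + (C * L * B + C * L * B)"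
      using tri[of "kin1 s" A1 "d1 s * \<psi> (t j s)" "C * L * B" 0 0 "N j * (d s * \<psi>1 (t j s))" "C * L * B"] e A'(2)
      by (simp add: k1_def)
    show "\<bar>k2 j s\<bar> \<le> A2 + (C * B + 2 * (C * B) + C * B)"
      unfolding k2_def using e A'(3) by (intro tri) auto
  qed
  obtain G where G: "\<And>j s. 0 \<le> s \<Longrightarrow> s \<le> L \<Longrightarrow> \<bar>radop n (pot a \<rho> E) (k j) (k1 j) (k2 j) s\<bar> \<le> G"
  proof -
    define D0 D1 D2 where "D0 = A0 + C * L * L * B" and "D1 = A1 + (C * L * B + C * L * B)" and "D2 = A2 + (C * B + 2 * (C * B) + C * B)"
    have "\<bar>radop n (pot a \<rho> E) (k j) (k1 j) (k2 j) s\<bar> \<le> 4 * (L * D2 + real (Suc n) * D1) + (a\<^sup>2 + \<bar>E\<bar>) * D0" if s: "0 \<le> s" "s \<le> L" for j s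
    proof -
      have pb: "\<bar>pot a \<rho> E s\<bar> \<le> a\<^sup>2 + \<bar>E\<bar>"
        using abs_triangle_ineq[of "a\<^sup>2" E] by (simp add: pot_def)
      have "\<bar>s * k2 j s\<bar> \<le> L * D2" "\<bar>real (Suc n) * k1 j s\<bar> \<le> real (Suc n) * D1" "\<bar>pot a \<rho> E s * k j s\<bar> \<le> (a\<^sup>2 + \<bar>E\<bar>) * D0"
        using bnd[OF s, of j] s unfolding abs_mult D0_def D1_def D2_def
        by (intro mult_mono pb; simp)+
      moreover have "\<bar>4 * (x + y) + z\<bar> \<le> 4 * (X + Y) + Z" if "\<bar>x\<bar> \<le> X" "\<bar>y\<bar> \<le> Y" "\<bar>z\<bar> \<le> Z" for x y z X Y Z :: real
        using that unfolding abs_le_iff by argo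
      ultimately show ?thesis unfolding radop_def by blast
    qed
    then show ?thesis by (rule that)
  qed
  have cu: "continuous_on UNIV u" using u(1) by (simp add: weak_solution_def)
  obtain D where D: "D \<ge> 0" "\<And>z. norm z \<le> sqrt L \<Longrightarrow> norm (u z) \<le> D"
    using ex_bound_ball[OF cu, of "sqrt L"] by auto
  have fb: "norm (f j z) \<le> D * (sqrt L ^ n * G) * indicator (cball 0 (sqrt L)) z" for j z
  proof (cases "norm z < sqrt L")
    case True
    then have "norm (zk n (radop n (pot a \<rho> E) (k j) (k1 j) (k2 j)) z) \<le> sqrt L ^ n * G"
      by (rule norm_zk_le) (use G L in auto)
    then show ?thesis
      unfolding f_def norm_mult using D True by (auto intro!: mult_mono)
  next
    case False
    have "zk n (radop n (pot a \<rho> E) (k j) (k1 j) (k2 j)) z = 0"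
      by (rule zk_eq_0[of "sqrt L"]) (use False L supp in \<open>auto simp: radop_def\<close>)
    moreover have "G \<ge> 0" using G[of 0] L by force
    ultimately show ?thesis using D L by (simp add: f_def)
  qed
  have fm: "f j \<in> borel_measurable lborel" for j
  proof -
    have c: "continuous_on UNIV (k j)" "continuous_on UNIV (k1 j)"
      using DERIV_isCont[OF der(1)] DERIV_isCont[OF der(2)] by (simp_all add: continuous_at_imp_continuous_on)
    note c [THEN borel_measurable_continuous_onI, measurable] ck2[THEN borel_measurable_continuous_onI, measurable]
      cu[THEN borel_measurable_continuous_onI, measurable]
    have [measurable]: "cnj \<in> borel_measurable borel"
      by (intro borel_measurable_continuous_onI continuous_intros)
    have [measurable]: "radop n (pot a \<rho> E) (k j) (k1 j) (k2 j) \<in> borel_measurable borel"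
      unfolding radop_def by measurable
    show ?thesis unfolding f_def by measurable
  qed
  have fl: "(\<lambda>j. f j z) \<longlonglongrightarrow> u z * cnj (zk n m z)" for z
    unfolding f_def zk_def by (intro tendsto_intros lim)
  have "(\<lambda>j. LINT z|lborel. f j z) \<longlonglongrightarrow> (LINT z|lborel. u z * cnj (zk n m z))"
  proof (rule integral_dominated_convergence)
    show "integrable lborel (\<lambda>z::complex. D * (sqrt L ^ n * G) * indicator (cball 0 (sqrt L)) z)"
      using emeasure_lborel_cball_finite[of "0::complex" "sqrt L"]
      by (intro integrable_mult_right integrable_real_indicator) (auto simp: infinity_ennreal_def)
    show "(\<lambda>z. u z * cnj (zk n m z)) \<in> borel_measurable lborel"
      using borel_measurable_LIMSEQ_metric[OF fm fl] .
  qed (use fm fl fb in auto)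
  then have "(\<lambda>j. 0) \<longlonglongrightarrow> (LINT z|lborel. u z * cnj (zk n m z))"
    unfolding f0 .
  then show ?thesis
    unfolding m_def S_def by (simp add: LIMSEQ_const_iff)
qed

subsection \<open>Pairings with cut-off radial solutions\<close>

lemma integral_continuous_nonneg_eq_0:
  fixes f :: "'a::euclidean_space \<Rightarrow> real"
  assumes f: "continuous_on UNIV f" "\<And>z. f z \<ge> 0" "integrable lborel f" "(LINT z|lborel. f z) = 0"
  shows "f z = 0"
proof (rule ccontr)
  assume z: "f z \<noteq> 0"
  have "(AE z in lborel. f z = 0)"
    by (rule iffD1[OF integral_nonneg_eq_0_iff_AE[OF f(3)] f(4)]) (rule AE_I2, rule f(2))
  have op: "open {z. f z \<noteq> 0}"
    using f(1) by (intro open_Collect_neq) simp_all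
  then have "{z. f z \<noteq> 0} \<in> sets lborel" by simp
  from AE_iff_null_sets[OF this] \<open>AE z in lborel. f z = 0\<close> have "{z. f z \<noteq> 0} \<in> null_sets lborel"
    by simp
  then have "negligible {z. f z \<noteq> 0}"
    by (simp add: negligible_iff_null_sets null_sets_completionI)
  then show False using z open_not_negligible[OF op] by blast
qed

text \<open>The strict sign of \<open>\<omega>1\<close> makes its integral over the plane nonzero.
  Three derivatives are demanded because the weight of the pairing contains \<open>\<omega>2\<close>
  and is differentiated once more.\<close>

definition cutoff :: "real \<Rightarrow> (real \<Rightarrow> real) \<Rightarrow> (real \<Rightarrow> real) \<Rightarrow> (real \<Rightarrow> real) \<Rightarrow> (real \<Rightarrow> real) \<Rightarrow> bool" where
  "cutoff c \<omega> \<omega>1 \<omega>2 \<omega>3 \<longleftrightarrow>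
     (\<forall>s. (\<omega> has_real_derivative \<omega>1 s) (at s)) \<and> (\<forall>s. (\<omega>1 has_real_derivative \<omega>2 s) (at s)) \<and>
     (\<forall>s. (\<omega>2 has_real_derivative \<omega>3 s) (at s)) \<and> continuous_on UNIV \<omega>3 \<and>
     (\<forall>s\<le>c. \<omega> s = 1) \<and> (\<forall>s\<ge>c+1. \<omega> s = 0) \<and>
     (\<forall>s. s \<le> c \<or> s \<ge> c + 1 \<longrightarrow> \<omega>1 s = 0 \<and> \<omega>2 s = 0 \<and> \<omega>3 s = 0) \<and> (\<forall>s. c < s \<and> s < c + 1 \<longrightarrow> \<omega>1 s < 0)"

lemma deriv_eq_0_if_zero_left_right:
  fixes f :: "real \<Rightarrow> real"
  assumes "(f has_real_derivative D) (at s)" "\<And>t. t \<le> c \<or> t \<ge> d \<Longrightarrow> f t = 0" "s \<le> c \<or> s \<ge> d"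
  shows "D = 0"
proof -
  from assms(3) have "((\<lambda>t. (f t - f s) / (t - s)) \<longlongrightarrow> 0) (at_left s) \<or> ((\<lambda>t. (f t - f s) / (t - s)) \<longlongrightarrow> 0) (at_right s)"
  proof
    assume "s \<le> c"
    then have "eventually (\<lambda>t. (f t - f s) / (t - s) = 0) (at_left s)"
      using assms(2) by (auto simp: eventually_at_filter)
    then show ?thesis by (intro disjI1 tendsto_eventually)
  next
    assume "s \<ge> d"
    then have "eventually (\<lambda>t. (f t - f s) / (t - s) = 0) (at_right s)"
      using assms(2) by (auto simp: eventually_at_filter)
    then show ?thesis by (intro disjI2 tendsto_eventually)
  qed
  moreover have "((\<lambda>t. (f t - f s) / (t - s)) \<longlongrightarrow> D) (at_left s)" "((\<lambda>t. (f t - f s) / (t - s)) \<longlongrightarrow> D) (at_right s)"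
    using assms(1) by (auto simp: has_field_derivative_iff intro: tendsto_mono at_le)
  ultimately show ?thesis
    using tendsto_unique[OF trivial_limit_at_left_real] tendsto_unique[OF trivial_limit_at_right_real] by blast
qed

lemma cutoff_exists: "\<exists>\<omega> \<omega>1 \<omega>2 \<omega>3. cutoff c \<omega> \<omega>1 \<omega>2 \<omega>3"
proof -
  obtain \<psi> \<psi>1 \<psi>2 \<psi>3 :: "real \<Rightarrow> real" where
    psi: "\<And>t. (\<psi> has_real_derivative \<psi>1 t) (at t)" "\<And>t. (\<psi>1 has_real_derivative \<psi>2 t) (at t)"
      "\<And>t. (\<psi>2 has_real_derivative \<psi>3 t) (at t)" "continuous_on UNIV \<psi>3"
    and psi0: "\<And>t. t \<le> 0 \<Longrightarrow> \<psi> t = 0" "\<And>t. t \<ge> 1 \<Longrightarrow> \<psi> t = 1"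
    "\<And>t. t \<le> 0 \<or> t \<ge> 1 \<Longrightarrow> \<psi>1 t = 0" "\<And>t. t \<le> 0 \<or> t \<ge> 1 \<Longrightarrow> \<psi>2 t = 0"
    "\<And>t. 0 < t \<Longrightarrow> t < 1 \<Longrightarrow> \<psi>1 t > 0"
    by (rule smooth_step) (rule that)
  have psi3: "\<psi>3 t = 0" if "t \<le> 0 \<or> t \<ge> 1" for t
    using deriv_eq_0_if_zero_left_right[OF psi(3) psi0(4) that] .
  have sh: "((\<lambda>s. f (s - c)) has_real_derivative f1 (s - c)) (at s)"
    if "\<And>t. (f has_real_derivative f1 t) (at t)" for f f1 :: "real \<Rightarrow> real" and s
  proof -
    have "((\<lambda>s. s - c) has_real_derivative 1) (at s)" by (auto intro!: derivative_eq_intros)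
    from DERIV_chain2[OF that this] show ?thesis by simp
  qed
  have "cutoff c (\<lambda>s. 1 - \<psi> (s - c)) (\<lambda>s. - \<psi>1 (s - c)) (\<lambda>s. - \<psi>2 (s - c)) (\<lambda>s. - \<psi>3 (s - c))"
    unfolding cutoff_def
    by (intro conjI allI impI continuous_intros continuous_on_compose2[OF psi(4)])
       (use psi0 psi3 in \<open>auto intro!: derivative_eq_intros sh psi\<close>)
  then show ?thesis by blast
qed

text \<open>The factor f may be singular at 0, since the other factor vanishes up to c > 0; in its
  uses \<omega> is a derivative of a cut-off.\<close>

lemma deriv_cutoff:
  assumes f: "\<And>s. s > 0 \<Longrightarrow> (f has_real_derivative f1 s) (at s)"
    and \<omega>: "\<And>s. (\<omega> has_real_derivative \<omega>1 s) (at s)" "\<And>s. s \<le> c \<Longrightarrow> \<omega> s = 0" "c > 0"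
  shows "((\<lambda>s. \<omega> s * f s) has_real_derivative \<omega>1 s * f s + \<omega> s * f1 s) (at s)"
proof (cases "s > 0")
  case True
  then show ?thesis by (auto intro!: derivative_eq_intros f \<omega>(1))
next
  case False
  then have s: "s < c" using \<omega>(3) by simp
  have "\<omega>1 s = 0"
    using deriv_eq_0_if_zero_left_right[of "\<lambda>t. if t \<le> c then \<omega> t else 0" "\<omega>1 s" s c c]
      has_field_derivative_transform_within_open[OF \<omega>(1)[of s], of "{..<c}" "\<lambda>t. if t \<le> c then \<omega> t else 0"] s \<omega>(2) by auto
  moreover have "((\<lambda>s. \<omega> s * f s) has_real_derivative 0) (at s)"
    by (rule has_field_derivative_transform_within_open[OF DERIV_const[of 0], of "{..<c}"]) (use s \<omega>(2) in auto)
  ultimately show ?thesis using \<omega>(2)[of s] s by simp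
qed

lemma continuous_cutoff:
  fixes f \<omega> :: "real \<Rightarrow> real"
  assumes f: "continuous_on {0<..} f" and \<omega>: "continuous_on UNIV \<omega>" "\<And>s. s \<le> c \<Longrightarrow> \<omega> s = 0" "c > 0"
  shows "continuous_on UNIV (\<lambda>s. \<omega> s * f s)"
proof -
  have "continuous_on {..<c} (\<lambda>s. \<omega> s * f s)"
    by (rule continuous_on_eq[OF continuous_on_const[of _ 0]]) (use \<omega>(2) in auto)
  moreover have "continuous_on {0<..} (\<lambda>s. \<omega> s * f s)"
    by (intro continuous_intros f continuous_on_subset[OF \<omega>(1)]) auto
  ultimately have "continuous_on ({..<c} \<union> {0<..}) (\<lambda>s. \<omega> s * f s)"
    by (intro continuous_on_open_Un) auto
  moreover have "{..<c} \<union> {0<..} = (UNIV :: real set)" using \<omega>(3) by auto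
  ultimately show ?thesis by simp
qed

section \<open>Angular and radial integration without polar coordinates\<close>

text \<open>The angular derivative x d_y - y d_x multiplies z^p cnj(z)^q g(|z|^2) by i (p - q). Its
  integral vanishes, because each of the two terms is a derivative along lines on which its
  coefficient is constant. This stands in for the orthogonality of the e^{il theta}.\<close>

lemma integral_rotation_zero:
  assumes g: "\<And>s. (g has_real_derivative g1 s) (at s)" "continuous_on UNIV g1"
    and M: "\<And>s. s \<ge> M \<Longrightarrow> g s = 0" "\<And>s. s \<ge> M \<Longrightarrow> g1 s = 0" "M > 0" and pq: "p \<noteq> q"
  shows "(LINT z|lborel. z ^ p * cnj z ^ q * complex_of_real (g ((norm z)\<^sup>2))) = 0"
proof -
  define G where "G = (\<lambda>z. z ^ p * cnj z ^ q * complex_of_real (g ((norm z)\<^sup>2)))"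
  define D where "D = (\<lambda>b z. of_nat p * b * z ^ (p - 1) * cnj z ^ q * complex_of_real (g ((norm z)\<^sup>2))
      + z ^ p * (of_nat q * cnj b * cnj z ^ (q - 1)) * complex_of_real (g ((norm z)\<^sup>2))
      + z ^ p * cnj z ^ q * of_real (2 * (z \<bullet> b) * g1 ((norm z)\<^sup>2)))"
  have cg: "continuous_on UNIV g"
    using DERIV_isCont[OF g(1)] by (simp add: continuous_at_imp_continuous_on)
  have cG: "continuous_on UNIV G" unfolding G_def
    by (intro continuous_intros continuous_on_compose2[OF cg]) auto
  have cD: "continuous_on UNIV (D b)" for b unfolding D_def
    by (intro continuous_intros continuous_on_compose2[OF cg] continuous_on_compose2[OF g(2)]) auto
  have d: "((\<lambda>t. G (z + t *\<^sub>R b)) has_vector_derivative D b z) (at 0)" for z b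
  proof -
    have c: "((\<lambda>t. cnj (z + t *\<^sub>R b) ^ q) has_vector_derivative of_nat q * cnj b * cnj z ^ (q - 1)) (at 0)"
      using bounded_linear.has_vector_derivative[OF bounded_linear_cnj pow_line_deriv[of z b q]] by simp
    from has_vector_derivative_mult[OF has_vector_derivative_mult[OF pow_line_deriv[of z b p] c] radial_line_deriv[OF g(1), of z b]]
    show ?thesis by (simp add: G_def D_def algebra_simps)
  qed
  have nz: "(norm z)\<^sup>2 \<ge> M" if "norm z \<ge> sqrt M" for z :: complex
    using that M(3) by (metis abs_of_nonneg norm_ge_zero real_sqrt_abs real_sqrt_le_iff)
  have z: "G z = 0" "D b z = 0" if "norm z \<ge> sqrt M" for z b
    using M nz[OF that] by (simp_all add: G_def D_def)
  have "(LINT z|lborel. - of_real (Im z) * D 1 z) = 0 \<and> integrable lborel (\<lambda>z. - of_real (Im z) * D 1 z)"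
  proof -
    have c: "continuous_on UNIV (\<lambda>z. - of_real (Im z) * D 1 z)" by (intro continuous_intros cD)
    obtain C where C: "\<And>z. norm z \<le> sqrt M \<Longrightarrow> norm (- of_real (Im z) * D 1 z) \<le> C"
      using ex_bound_ball[OF c, of "sqrt M"] by auto
    show ?thesis
    proof
      show "integrable lborel (\<lambda>z. - of_real (Im z) * D 1 z)"
        by (rule integrable_bounded_support[OF borel_measurable_continuous_onI[OF c], of "sqrt M" C]) (use C z in auto)
      show "(LINT z|lborel. - of_real (Im z) * D 1 z) = 0"
      proof (rule integral_line_derivative_zero[of 1 "\<lambda>z. - of_real (Im z) * G z" _ _ "sqrt M" C])
        show "((\<lambda>t. - of_real (Im (z + t *\<^sub>R 1)) * G (z + t *\<^sub>R 1)) has_vector_derivative - of_real (Im z) * D 1 z) (at 0)" for z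
          using has_vector_derivative_mult_right[OF d[of z 1], of "- of_real (Im z)"] by simp
      qed (use C z c in \<open>auto intro!: continuous_intros cG cD borel_measurable_continuous_onI simp: Basis_complex_def\<close>)
    qed
  qed
  moreover have "(LINT z|lborel. of_real (Re z) * D \<i> z) = 0 \<and> integrable lborel (\<lambda>z. of_real (Re z) * D \<i> z)"
  proof -
    have c: "continuous_on UNIV (\<lambda>z. of_real (Re z) * D \<i> z)" by (intro continuous_intros cD)
    obtain C where C: "\<And>z. norm z \<le> sqrt M \<Longrightarrow> norm (of_real (Re z) * D \<i> z) \<le> C"
      using ex_bound_ball[OF c, of "sqrt M"] by auto
    show ?thesis
    proof
      show "integrable lborel (\<lambda>z. of_real (Re z) * D \<i> z)"
        by (rule integrable_bounded_support[OF borel_measurable_continuous_onI[OF c], of "sqrt M" C]) (use C z in auto)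
      show "(LINT z|lborel. of_real (Re z) * D \<i> z) = 0"
      proof (rule integral_line_derivative_zero[of \<i> "\<lambda>z. of_real (Re z) * G z" _ _ "sqrt M" C])
        show "((\<lambda>t. of_real (Re (z + t *\<^sub>R \<i>)) * G (z + t *\<^sub>R \<i>)) has_vector_derivative of_real (Re z) * D \<i> z) (at 0)" for z
          using has_vector_derivative_mult_right[OF d[of z \<i>], of "of_real (Re z)"] by simp
      qed (use C z c in \<open>auto intro!: continuous_intros cG cD borel_measurable_continuous_onI simp: Basis_complex_def\<close>)
    qed
  qed
  ultimately have "(LINT z|lborel. of_real (Re z) * D \<i> z + - of_real (Im z) * D 1 z) = 0"
    by (subst Bochner_Integration.integral_add) auto
  moreover have "of_real (Re z) * D \<i> z + - of_real (Im z) * D 1 z = \<i> * (of_nat p - of_nat q) * G z" for z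
  proof -
    define x y where "x = complex_of_real (Re z)" and "y = complex_of_real (Im z)"
    have zxy: "z = x + \<i> * y" and czxy: "cnj z = x - \<i> * y"
      by (simp_all add: x_def y_def complex_eq_iff)
    have P: "of_nat p * (\<i> * x - y) * z ^ (p - 1) = of_nat p * \<i> * z ^ p"
      by (cases p) (auto simp: zxy algebra_simps)
    have Q: "of_nat q * (- \<i> * x - y) * cnj z ^ (q - 1) = - of_nat q * \<i> * cnj z ^ q"
      by (cases q) (auto simp: czxy algebra_simps)
    define g0 where "g0 = complex_of_real (g ((norm z)\<^sup>2))"
    have "x * D \<i> z + - y * D 1 z = (of_nat p * (\<i> * x - y) * z ^ (p - 1)) * cnj z ^ q * g0
       + z ^ p * (of_nat q * (- \<i> * x - y) * cnj z ^ (q - 1)) * g0"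
      by (simp add: D_def g0_def[symmetric] x_def y_def algebra_simps)
    also have "\<dots> = \<i> * (of_nat p - of_nat q) * G z"
      unfolding P Q by (simp add: G_def g0_def algebra_simps)
    finally show ?thesis by (simp add: x_def y_def)
  qed
  ultimately have "\<i> * (of_nat p - of_nat q) * (LINT z|lborel. G z) = 0" by simp
  then show ?thesis using pq by (simp add: G_def)
qed

text \<open>The integrand is half the divergence of the compactly supported field m(|z|^2)
  z.\<close>

lemma integral_radial_divergence:
  assumes m: "\<And>s. (m has_real_derivative m1 s) (at s)" "continuous_on UNIV m1"
    and M: "\<And>s. s \<ge> M \<Longrightarrow> m s = 0" "\<And>s. s \<ge> M \<Longrightarrow> m1 s = 0" "M > 0"
  shows "(LINT (z::complex)|lborel. complex_of_real (m ((norm z)\<^sup>2) + (norm z)\<^sup>2 * m1 ((norm z)\<^sup>2))) = 0"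
proof -
  define D where "D = (\<lambda>b (z::complex). complex_of_real (m ((norm z)\<^sup>2) + 2 * (z \<bullet> b)\<^sup>2 * m1 ((norm z)\<^sup>2)))"
  have cm: "continuous_on UNIV m"
    using DERIV_isCont[OF m(1)] by (simp add: continuous_at_imp_continuous_on)
  have cD: "continuous_on UNIV (D b)" for b unfolding D_def
    by (intro continuous_intros continuous_on_compose2[OF cm] continuous_on_compose2[OF m(2)]) auto
  have nz: "(norm z)\<^sup>2 \<ge> M" if "norm z \<ge> sqrt M" for z :: complex
    using that M(3) by (metis abs_of_nonneg norm_ge_zero real_sqrt_abs real_sqrt_le_iff)
  have z: "m ((norm z)\<^sup>2) = 0" "D b z = 0" if "norm z \<ge> sqrt M" for z b
    using M nz[OF that] by (simp_all add: D_def)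
  have *: "(LINT z|lborel. D b z) = 0 \<and> integrable lborel (D b)" if b: "b \<in> Basis" for b
  proof -
    obtain C where C: "\<And>z. norm z \<le> sqrt M \<Longrightarrow> norm (D b z) \<le> C"
      using ex_bound_ball[OF cD, of "sqrt M"] by auto
    let ?F = "\<lambda>z. complex_of_real (z \<bullet> b) * of_real (m ((norm z)\<^sup>2))"
    show ?thesis
    proof
      show "integrable lborel (D b)"
        by (rule integrable_bounded_support[OF borel_measurable_continuous_onI[OF cD[of b]], of "sqrt M" C]) (use C z in auto)
      show "(LINT z|lborel. D b z) = 0"
      proof (rule integral_line_derivative_zero[OF b, of ?F _ _ "sqrt M" C])
        show "((\<lambda>t. ?F (z + t *\<^sub>R b)) has_vector_derivative D b z) (at 0)" for z
        proof -
          have "((\<lambda>t. complex_of_real ((z + t *\<^sub>R b) \<bullet> b)) has_vector_derivative of_real 1) (at 0)"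
            by (intro has_vector_derivative_of_real)
               (use b in \<open>auto intro!: derivative_eq_intros simp: inner_add_left simp flip: has_real_derivative_iff_has_vector_derivative\<close>)
          from has_vector_derivative_mult[OF this radial_line_deriv[OF m(1), of z b]]
          show ?thesis by (simp add: D_def power2_eq_square algebra_simps)
        qed
        show "continuous_on UNIV ?F"
          by (intro continuous_intros continuous_on_compose2[OF cm]) auto
      qed (use C z in \<open>auto intro!: cD borel_measurable_continuous_onI\<close>)
    qed
  qed
  have "(LINT z|lborel. D 1 z + D \<i> z) = 0"
    using *[of 1] *[of \<i>] by (subst Bochner_Integration.integral_add) (auto simp: Basis_complex_def)
  moreover have "D 1 z + D \<i> z = 2 * complex_of_real (m ((norm z)\<^sup>2) + (norm z)\<^sup>2 * m1 ((norm z)\<^sup>2))" for z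
    unfolding cmod_power2 by (simp add: D_def cmod_power2 algebra_simps)
  ultimately have "(LINT (z::complex)|lborel. 2 * complex_of_real (m ((norm z)\<^sup>2) + (norm z)\<^sup>2 * m1 ((norm z)\<^sup>2))) = 0"
    by (simp only:)
  then show ?thesis unfolding integral_mult_right_zero by simp
qed

text \<open>What is left of \<open>radop\<close> on \<omega> k when k itself solves the equation:
  the terms that carry a derivative of \<omega>. It lives in the annulus where the cut-off
  varies.\<close>

definition pairing_weight :: "nat \<Rightarrow> (real \<Rightarrow> real) \<Rightarrow> (real \<Rightarrow> real) \<Rightarrow> (real \<Rightarrow> real) \<Rightarrow> (real \<Rightarrow> real) \<Rightarrow> real \<Rightarrow> real" where
  "pairing_weight n \<omega>1 \<omega>2 k k1 s = 4 * (s * \<omega>2 s * k s + 2 * s * \<omega>1 s * k1 s + of_nat (Suc n) * \<omega>1 s * k s)"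

lemma cutoffD:
  assumes "cutoff c \<omega> \<omega>1 \<omega>2 \<omega>3"
  shows "\<And>s. (\<omega> has_real_derivative \<omega>1 s) (at s)" "\<And>s. (\<omega>1 has_real_derivative \<omega>2 s) (at s)"
    "\<And>s. (\<omega>2 has_real_derivative \<omega>3 s) (at s)" "continuous_on UNIV \<omega>3"
    "continuous_on UNIV \<omega>" "continuous_on UNIV \<omega>1" "continuous_on UNIV \<omega>2"
    "\<And>s. s \<le> c \<Longrightarrow> \<omega> s = 1" "\<And>s. s \<ge> c + 1 \<Longrightarrow> \<omega> s = 0"
    "\<And>s. s \<le> c \<Longrightarrow> \<omega>1 s = 0" "\<And>s. s \<ge> c + 1 \<Longrightarrow> \<omega>1 s = 0"
    "\<And>s. s \<le> c \<Longrightarrow> \<omega>2 s = 0" "\<And>s. s \<ge> c + 1 \<Longrightarrow> \<omega>2 s = 0"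
    "\<And>s. s \<le> c \<Longrightarrow> \<omega>3 s = 0" "\<And>s. s \<ge> c + 1 \<Longrightarrow> \<omega>3 s = 0"
    "\<And>s. c < s \<Longrightarrow> s < c + 1 \<Longrightarrow> \<omega>1 s < 0"
proof -
  show d: "(\<omega> has_real_derivative \<omega>1 s) (at s)" "(\<omega>1 has_real_derivative \<omega>2 s) (at s)"
    "(\<omega>2 has_real_derivative \<omega>3 s) (at s)" for s
    using assms unfolding cutoff_def by simp_all
  show "continuous_on UNIV \<omega>" "continuous_on UNIV \<omega>1" "continuous_on UNIV \<omega>2"
    using DERIV_isCont[OF d(1)] DERIV_isCont[OF d(2)] DERIV_isCont[OF d(3)]
    by (simp_all add: continuous_at_imp_continuous_on)
qed (use assms in \<open>simp_all add: cutoff_def\<close>)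

text \<open>The inner solution needs no cut-off since \<omega> = 1 up to c > \<rho>^2. Thus u is
  tested against a global radial solution, cut off outside the disc, and only the values of u in an
  exterior annulus enter.\<close>

lemma weak_solution_pairing:
  assumes u: "weak_solution a \<rho> E u" "\<rho> > 0"
    and kin: "\<And>s. (kin has_real_derivative kin1 s) (at s)" "\<And>s. (kin1 has_real_derivative kin2 s) (at s)" "continuous_on UNIV kin2"
    and kout: "\<And>s. s > 0 \<Longrightarrow> (kout has_real_derivative kout1 s) (at s)"
      "\<And>s. s > 0 \<Longrightarrow> (kout1 has_real_derivative kout2 s) (at s)" "continuous_on {0<..} kout2"
    and match: "kin (\<rho>\<^sup>2) = kout (\<rho>\<^sup>2)" "kin1 (\<rho>\<^sup>2) = kout1 (\<rho>\<^sup>2)"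
    and ode_in: "\<And>s. 4 * (s * kin2 s + of_nat (Suc n) * kin1 s) + (a\<^sup>2 + E) * kin s = 0"
    and ode_out: "\<And>s. s > 0 \<Longrightarrow> 4 * (s * kout2 s + of_nat (Suc n) * kout1 s) + E * kout s = 0"
    and c: "c > \<rho>\<^sup>2" "cutoff c \<omega> \<omega>1 \<omega>2 \<omega>3"
  shows "(LINT z|lborel. u z * cnj (zk n (pairing_weight n \<omega>1 \<omega>2 kout kout1) z)) = 0"
proof -
  note w = cutoffD[OF c(2)]
  have S: "\<rho>\<^sup>2 > 0" using u by simp
  let ?k = "\<lambda>s. \<omega> s * kout s" and ?k1 = "\<lambda>s. \<omega>1 s * kout s + \<omega> s * kout1 s"
    and ?k2 = "\<lambda>s. \<omega>2 s * kout s + 2 * (\<omega>1 s * kout1 s) + \<omega> s * kout2 s"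
  have "(LINT z|lborel. u z * cnj (zk n (\<lambda>s. if s \<le> \<rho>\<^sup>2 then radop n (pot a \<rho> E) kin kin1 kin2 s
            else radop n (pot a \<rho> E) ?k ?k1 ?k2 s) z)) = 0"
  proof (rule weak_solution_test_glue[OF u kin, where M = "c + 1"])
    fix s :: real assume s: "s > 0"
    show "(?k has_real_derivative ?k1 s) (at s)"
      by (rule derivative_eq_intros w kout(1)[OF s] refl | simp add: algebra_simps)+
    show "(?k1 has_real_derivative ?k2 s) (at s)"
      by (rule derivative_eq_intros w kout(1)[OF s] kout(2)[OF s] refl | simp add: algebra_simps)+
  next
    have "continuous_on {0<..} kout" "continuous_on {0<..} kout1"
      using DERIV_isCont[OF kout(1)] DERIV_isCont[OF kout(2)] by (simp_all add: continuous_at_imp_continuous_on)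
    then show "continuous_on {0<..} ?k2"
      by (intro continuous_intros kout(3) continuous_on_subset[OF w(5)] continuous_on_subset[OF w(6)] continuous_on_subset[OF w(7)]) auto
  qed (use c(1) w match in auto)
  moreover have "(if s \<le> \<rho>\<^sup>2 then radop n (pot a \<rho> E) kin kin1 kin2 s else radop n (pot a \<rho> E) ?k ?k1 ?k2 s)
      = pairing_weight n \<omega>1 \<omega>2 kout kout1 s" for s
  proof (cases "s \<le> \<rho>\<^sup>2")
    case True
    then show ?thesis using ode_in[of s] c(1) w(10,12)[of s] by (simp add: radop_def pot_def pairing_weight_def)
  next
    case False
    then have "s > 0" using S by linarith
    have "radop n (pot a \<rho> E) ?k ?k1 ?k2 s = pairing_weight n \<omega>1 \<omega>2 kout kout1 s
        + \<omega> s * (4 * (s * kout2 s + of_nat (Suc n) * kout1 s) + E * kout s)"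
      using False by (simp add: radop_def pot_def pairing_weight_def algebra_simps)
    with ode_out[OF \<open>s > 0\<close>] False show ?thesis by simp
  qed
  ultimately show ?thesis by simp
qed

text \<open>With m = \<open>\<omega>1\<close> s^n h k the integrand is 4 (m + s m') + 4 \<kappa>
  \<open>\<omega>1\<close>: a divergence plus the constant weighted Wronskian of h and k. Here
  \<kappa> denotes that Wronskian and not a frequency.\<close>

lemma integral_pairing_weight:
  assumes h: "\<And>s. s > 0 \<Longrightarrow> (h has_real_derivative h1 s) (at s)" "continuous_on {0<..} h1"
    and k: "\<And>s. s > 0 \<Longrightarrow> (k has_real_derivative k1 s) (at s)" "continuous_on {0<..} k1"
    and W: "\<And>s. s > 0 \<Longrightarrow> s ^ Suc n * (h s * k1 s - h1 s * k s) = \<kappa>"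
    and c: "c > 0" "cutoff c \<omega> \<omega>1 \<omega>2 \<omega>3"
  shows "(LINT (z::complex)|lborel. complex_of_real (((norm z)\<^sup>2) ^ n * h ((norm z)\<^sup>2) * pairing_weight n \<omega>1 \<omega>2 k k1 ((norm z)\<^sup>2)))
       = complex_of_real (4 * \<kappa>) * (LINT (z::complex)|lborel. complex_of_real (\<omega>1 ((norm z)\<^sup>2)))"
proof -
  note w = cutoffD[OF c(2)]
  let ?f = "\<lambda>s. s ^ n * (h s * k s)" and ?f1 = "\<lambda>s. of_nat n * s ^ (n - 1) * (h s * k s) + s ^ n * (h1 s * k s + h s * k1 s)"
  have f: "(?f has_real_derivative ?f1 s) (at s)" if "s > 0" for s
    using that by (auto intro!: derivative_eq_intros h k simp: algebra_simps)
  have c': "continuous_on {0<..} h" "continuous_on {0<..} k"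
    using DERIV_isCont[OF h(1)] DERIV_isCont[OF k(1)] by (simp_all add: continuous_at_imp_continuous_on)
  have cf: "continuous_on {0<..} ?f" "continuous_on {0<..} ?f1"
    by (intro continuous_intros c' h k)+
  let ?m = "\<lambda>s. \<omega>1 s * ?f s" and ?m1 = "\<lambda>s. \<omega>2 s * ?f s + \<omega>1 s * ?f1 s"
  have m: "(?m has_real_derivative ?m1 s) (at s)" for s
    by (rule deriv_cutoff[OF f w(2) w(10) c(1)])
  have cm: "continuous_on UNIV ?m1"
    by (intro continuous_on_add continuous_cutoff[OF cf(1) w(7) w(12) c(1)] continuous_cutoff[OF cf(2) w(6) w(10) c(1)])
  have 0: "(LINT (z::complex)|lborel. complex_of_real (?m ((norm z)\<^sup>2) + (norm z)\<^sup>2 * ?m1 ((norm z)\<^sup>2))) = 0"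
    by (rule integral_radial_divergence[OF m cm, of "c + 1"]) (use w c in auto)
  have eq: "s ^ n * h s * pairing_weight n \<omega>1 \<omega>2 k k1 s = 4 * (?m s + s * ?m1 s) + 4 * \<kappa> * \<omega>1 s" if "s \<ge> 0" for s
  proof (cases "s > 0")
    case False
    then show ?thesis using w(10,12)[of s] c(1) by (simp add: pairing_weight_def)
  next
    case True
    show ?thesis
      unfolding W[OF True, symmetric] pairing_weight_def by (cases n) (simp_all add: algebra_simps)
  qed
  have int: "integrable lborel (\<lambda>z::complex. complex_of_real (f ((norm z)\<^sup>2)))"
    if "continuous_on UNIV f" "\<And>s. s \<ge> c + 1 \<Longrightarrow> f s = 0" for f
  proof -
    have cc: "continuous_on UNIV (\<lambda>z::complex. complex_of_real (f ((norm z)\<^sup>2)))"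
      by (intro continuous_intros continuous_on_compose2[OF that(1)]) auto
    obtain C where C: "\<And>z::complex. norm z \<le> sqrt (c + 1) \<Longrightarrow> norm (complex_of_real (f ((norm z)\<^sup>2))) \<le> C"
      using ex_bound_ball[OF cc, of "sqrt (c + 1)"] by auto
    have z: "(norm z)\<^sup>2 \<ge> c + 1" if "norm z \<ge> sqrt (c + 1)" for z :: complex
      using that c(1) by (metis abs_of_nonneg norm_ge_zero real_sqrt_abs real_sqrt_le_iff)
    show ?thesis
      by (rule integrable_bounded_support[OF borel_measurable_continuous_onI[OF cc], of "sqrt (c + 1)" C])
         (use C z that(2) in auto)
  qed
  have cmm: "continuous_on UNIV ?m"
    using DERIV_isCont[OF m] by (simp add: continuous_at_imp_continuous_on)
  have cc: "continuous_on UNIV (\<lambda>s. ?m s + s * ?m1 s)"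
    by (rule continuous_on_add[OF cmm continuous_on_mult[OF continuous_on_id cm]])
  have "?m s + s * ?m1 s = 0" if "s \<ge> c + 1" for s
    using w(11,13)[of s] that by simp
  from integrable_mult_right[OF int[OF cc this]]
  have i1: "integrable lborel (\<lambda>z::complex. 4 * complex_of_real (?m ((norm z)\<^sup>2) + (norm z)\<^sup>2 * ?m1 ((norm z)\<^sup>2)))"
    by blast
  have i2: "integrable lborel (\<lambda>z::complex. complex_of_real (4 * \<kappa>) * complex_of_real (\<omega>1 ((norm z)\<^sup>2)))"
    using integrable_mult_right[OF int[OF w(6) w(11)]] by blast
  have "(LINT (z::complex)|lborel. complex_of_real (((norm z)\<^sup>2) ^ n * h ((norm z)\<^sup>2) * pairing_weight n \<omega>1 \<omega>2 k k1 ((norm z)\<^sup>2)))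
     = (LINT (z::complex)|lborel. 4 * complex_of_real (?m ((norm z)\<^sup>2) + (norm z)\<^sup>2 * ?m1 ((norm z)\<^sup>2))
          + complex_of_real (4 * \<kappa>) * complex_of_real (\<omega>1 ((norm z)\<^sup>2)))"
    unfolding eq[OF zero_le_power2] by (rule Bochner_Integration.integral_cong) simp_all
  also have "\<dots> = 4 * (LINT (z::complex)|lborel. complex_of_real (?m ((norm z)\<^sup>2) + (norm z)\<^sup>2 * ?m1 ((norm z)\<^sup>2)))
     + complex_of_real (4 * \<kappa>) * (LINT (z::complex)|lborel. complex_of_real (\<omega>1 ((norm z)\<^sup>2)))"
    unfolding Bochner_Integration.integral_add[OF i1 i2] integral_mult_right_zero ..
  finally show ?thesis unfolding 0 by simp
qed

text \<open>The continuous function - \<open>\<omega>1\<close> is nonnegative, and positive at s = c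
  + 1 / 2.\<close>

lemma integral_cutoff_nonzero:
  assumes c: "c > 0" "cutoff c \<omega> \<omega>1 \<omega>2 \<omega>3"
  shows "(LINT (z::complex)|lborel. complex_of_real (\<omega>1 ((norm z)\<^sup>2))) \<noteq> 0"
proof
  note w = cutoffD[OF c(2)]
  assume "(LINT (z::complex)|lborel. complex_of_real (\<omega>1 ((norm z)\<^sup>2))) = 0"
  then have 0: "(LINT (z::complex)|lborel. - \<omega>1 ((norm z)\<^sup>2)) = 0" by simp
  have cc: "continuous_on UNIV (\<lambda>z::complex. - \<omega>1 ((norm z)\<^sup>2))"
    by (intro continuous_intros continuous_on_compose2[OF w(6)]) auto
  obtain C where C: "\<And>z::complex. norm z \<le> sqrt (c + 1) \<Longrightarrow> norm (- \<omega>1 ((norm z)\<^sup>2)) \<le> C"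
    using ex_bound_ball[OF cc, of "sqrt (c + 1)"] by auto
  have z: "(norm z)\<^sup>2 \<ge> c + 1" if "norm z \<ge> sqrt (c + 1)" for z :: complex
    using that c(1) by (metis abs_of_nonneg norm_ge_zero real_sqrt_abs real_sqrt_le_iff)
  have int: "integrable lborel (\<lambda>z::complex. - \<omega>1 ((norm z)\<^sup>2))"
    by (rule integrable_bounded_support[OF borel_measurable_continuous_onI[OF cc], of "sqrt (c + 1)" C])
       (use C z w in auto)
  have nn: "- \<omega>1 s \<ge> 0" for s
    using w(10,11,16)[of s] by (cases "s \<le> c"; cases "s \<ge> c + 1") auto
  have "- \<omega>1 ((norm (complex_of_real (sqrt (c + 1 / 2))))\<^sup>2) = 0"
    by (rule integral_continuous_nonneg_eq_0[OF cc nn int 0])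
  moreover have "(norm (complex_of_real (sqrt (c + 1 / 2))))\<^sup>2 = c + 1 / 2" using c(1) by simp
  ultimately show False using w(16)[of "c + 1 / 2"] by simp
qed

text \<open>The last claim is the recurrence \<open>rJ_rec\<close>, read as the radial equation with
  constant potential q.\<close>

lemma rJ_scaled:
  shows "((\<lambda>s. rJ n (q * s / 4)) has_real_derivative - (q / 4) * rJ (Suc n) (q * s / 4)) (at s)"
    and "((\<lambda>s. - (q / 4) * rJ (Suc n) (q * s / 4)) has_real_derivative (q / 4)\<^sup>2 * rJ (Suc (Suc n)) (q * s / 4)) (at s)"
    and "continuous_on A (\<lambda>s. (q / 4)\<^sup>2 * rJ (Suc (Suc n)) (q * s / 4))"
    and "4 * (s * ((q / 4)\<^sup>2 * rJ (Suc (Suc n)) (q * s / 4)) + of_nat (Suc n) * (- (q / 4) * rJ (Suc n) (q * s / 4))) + q * rJ n (q * s / 4) = 0"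
proof -
  have 1: "((\<lambda>s. rJ n (q * s / 4)) has_real_derivative - (q / 4) * rJ (Suc n) (q * s / 4)) (at s)" for n s
  proof -
    have "((\<lambda>s. q * s / 4) has_real_derivative q / 4) (at s)" by (auto intro!: derivative_eq_intros)
    from DERIV_chain2[where f = "rJ n", OF rJ_deriv this] show ?thesis by (simp add: mult_ac)
  qed
  then show "((\<lambda>s. rJ n (q * s / 4)) has_real_derivative - (q / 4) * rJ (Suc n) (q * s / 4)) (at s)" .
  show "((\<lambda>s. - (q / 4) * rJ (Suc n) (q * s / 4)) has_real_derivative (q / 4)\<^sup>2 * rJ (Suc (Suc n)) (q * s / 4)) (at s)"
    using DERIV_cmult[OF 1[of "Suc n" s], of "- (q / 4)"] by (simp add: power2_eq_square mult_ac)
  have "continuous_on UNIV (\<lambda>s. rJ (Suc (Suc n)) (q * s / 4))"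
    using DERIV_isCont[OF 1] by (simp add: continuous_at_imp_continuous_on)
  then show "continuous_on A (\<lambda>s. (q / 4)\<^sup>2 * rJ (Suc (Suc n)) (q * s / 4))"
    by (intro continuous_intros) (rule continuous_on_subset, auto)
  show "4 * (s * ((q / 4)\<^sup>2 * rJ (Suc (Suc n)) (q * s / 4)) + of_nat (Suc n) * (- (q / 4) * rJ (Suc n) (q * s / 4))) + q * rJ n (q * s / 4) = 0"
  proof -
    have J: "rJ n (q * s / 4) = of_nat (Suc n) * rJ (Suc n) (q * s / 4) - (q * s / 4) * rJ (Suc (Suc n)) (q * s / 4)"
      using rJ_rec[of n "q * s / 4"] by linarith
    show ?thesis unfolding J by (simp add: power2_eq_square algebra_simps)
  qed
qed

lemma rY_scaled:
  assumes "q > 0" "s > 0"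
  shows "((\<lambda>s. rY n (q * s / 4)) has_real_derivative - (q / 4) * rY (Suc n) (q * s / 4)) (at s)"
    and "((\<lambda>s. - (q / 4) * rY (Suc n) (q * s / 4)) has_real_derivative (q / 4)\<^sup>2 * rY (Suc (Suc n)) (q * s / 4)) (at s)"
    and "4 * (s * ((q / 4)\<^sup>2 * rY (Suc (Suc n)) (q * s / 4)) + of_nat (Suc n) * (- (q / 4) * rY (Suc n) (q * s / 4))) + q * rY n (q * s / 4) = 0"
proof -
  have p: "q * s / 4 > 0" using assms by simp
  have 1: "((\<lambda>s. rY n (q * s / 4)) has_real_derivative - (q / 4) * rY (Suc n) (q * s / 4)) (at s)" for n
  proof -
    have "((\<lambda>s. q * s / 4) has_real_derivative q / 4) (at s)" by (auto intro!: derivative_eq_intros)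
    from DERIV_chain2[where f = "rY n", OF rY_deriv[OF p] this] show ?thesis by (simp add: mult_ac)
  qed
  then show "((\<lambda>s. rY n (q * s / 4)) has_real_derivative - (q / 4) * rY (Suc n) (q * s / 4)) (at s)" .
  show "((\<lambda>s. - (q / 4) * rY (Suc n) (q * s / 4)) has_real_derivative (q / 4)\<^sup>2 * rY (Suc (Suc n)) (q * s / 4)) (at s)"
    using DERIV_cmult[OF 1[of "Suc n"], of "- (q / 4)"] by (simp add: power2_eq_square mult_ac)
  have J: "rY n (q * s / 4) = of_nat (Suc n) * rY (Suc n) (q * s / 4) - (q * s / 4) * rY (Suc (Suc n)) (q * s / 4)"
    using rY_rec[OF p, of n] by linarith
  show "4 * (s * ((q / 4)\<^sup>2 * rY (Suc (Suc n)) (q * s / 4)) + of_nat (Suc n) * (- (q / 4) * rY (Suc n) (q * s / 4))) + q * rY n (q * s / 4) = 0"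
    unfolding J by (simp add: power2_eq_square algebra_simps)
qed

lemma rJ_not_both_0:
  assumes "t > 0" "rJ n t = 0"
  shows "rJ (Suc n) t \<noteq> 0"
  using rJ_rY_Wronskian[OF assms(1), of n] assms(2) by auto

subsection \<open>Resonances at zero\<close>

definition outgoing_mode :: "int \<Rightarrow> complex \<Rightarrow> complex" where
  "outgoing_mode l z = of_real (norm z powi (- \<bar>l\<bar>)) * cis (of_int l * Arg z)"

text \<open>Brings the mode into the form that \<open>integral_rotation_zero\<close> handles, a
  power of z or of its conjugate times a function of |z|^2.\<close>

lemma outgoing_mode_eq:
  assumes "z \<noteq> 0"
  shows "outgoing_mode l z = (if l \<ge> 0 then z else cnj z) ^ nat \<bar>l\<bar> * of_real (1 / ((norm z)\<^sup>2) ^ nat \<bar>l\<bar>)"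
proof -
  define m where "m = nat \<bar>l\<bar>"
  have z: "z = of_real (norm z) * cis (Arg z)" using rcis_cmod_Arg[of z] by (simp add: rcis_def)
  then have "cnj z = cnj (of_real (norm z) * cis (Arg z))" by simp
  then have zc: "cnj z = of_real (norm z) * cis (- Arg z)" by (simp add: cis_cnj)
  have c: "cis (of_int l * Arg z) = (if l \<ge> 0 then cis (Arg z) else cis (- Arg z)) ^ m"
  proof (cases "l \<ge> 0")
    case True
    then have "of_int l * Arg z = real m * Arg z" by (simp add: m_def)
    then show ?thesis using True Complex.DeMoivre[of "Arg z" m] by (simp only: if_True)
  next
    case False
    then have "of_int l * Arg z = real m * (- Arg z)" by (simp add: m_def)
    then show ?thesis using False Complex.DeMoivre[of "- Arg z" m] by (simp only: if_False)
  qed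
  have r: "norm z powi (- \<bar>l\<bar>) = norm z ^ m * (1 / ((norm z)\<^sup>2) ^ m)"
  proof -
    have "norm z powi (- \<bar>l\<bar>) = 1 / norm z ^ m"
      by (simp add: power_int_minus m_def power_int_def divide_inverse power_inverse)
    also have "\<dots> = norm z ^ m * (1 / ((norm z)\<^sup>2) ^ m)"
      using assms by (simp add: power2_eq_square power_mult_distrib)
    finally show ?thesis .
  qed
  have p: "(if l \<ge> 0 then z else cnj z) ^ m = of_real (norm z ^ m) * (if l \<ge> 0 then cis (Arg z) else cis (- Arg z)) ^ m"
  proof (cases "l \<ge> 0")
    case True
    have "z ^ m = (of_real (norm z) * cis (Arg z)) ^ m" using z by simp
    then show ?thesis using True by (simp add: power_mult_distrib)
  next
    case False
    have "cnj z ^ m = (of_real (norm z) * cis (- Arg z)) ^ m" using zc by simp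
    then show ?thesis using False by (simp add: power_mult_distrib)
  qed
  show ?thesis
    unfolding outgoing_mode_def m_def[symmetric] p c r by (simp add: mult_ac)
qed

text \<open>Whatever the sign of l, the exponents satisfy p - q = l - n, so that only the mode l = n
  can survive integration.\<close>

lemma mode_pairing_form:
  fixes n :: nat and l :: int
  assumes k: "\<And>s. s > 0 \<Longrightarrow> (k has_real_derivative k1 s) (at s)"
      "\<And>s. s > 0 \<Longrightarrow> (k1 has_real_derivative k2 s) (at s)" "continuous_on {0<..} k2"
    and c: "c > 0" "cutoff c \<omega> \<omega>1 \<omega>2 \<omega>3"
  obtains p q g g1 where "\<And>s. (g has_real_derivative g1 s) (at s)" "continuous_on UNIV g1"
    "\<And>s. s \<ge> c + 1 \<Longrightarrow> g s = 0" "\<And>s. s \<ge> c + 1 \<Longrightarrow> g1 s = 0" "l \<noteq> int n \<Longrightarrow> p \<noteq> q"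
    "\<And>z. outgoing_mode l z * cnj (zk n (pairing_weight n \<omega>1 \<omega>2 k k1) z) = z ^ p * cnj z ^ q * complex_of_real (g ((norm z)\<^sup>2))"
proof -
  note w = cutoffD[OF c(2)]
  define m where "m = nat \<bar>l\<bar>"
  let ?A = "\<lambda>s. 4 * s * k s / s ^ m" and ?B = "\<lambda>s. 4 * (2 * s * k1 s + of_nat (Suc n) * k s) / s ^ m"
  define A1 where "A1 = (\<lambda>s. ((4 * k s + 4 * s * k1 s) * s ^ m - (4 * s * k s) * (of_nat m * s ^ (m - 1))) / (s ^ m * s ^ m))"
  define B1 where "B1 = (\<lambda>s. (4 * (2 * k1 s + 2 * s * k2 s + of_nat (Suc n) * k1 s) * s ^ m
      - 4 * (2 * s * k1 s + of_nat (Suc n) * k s) * (of_nat m * s ^ (m - 1))) / (s ^ m * s ^ m))"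
  have ck: "continuous_on {0<..} k" "continuous_on {0<..} k1"
    using DERIV_isCont[OF k(1)] DERIV_isCont[OF k(2)] by (simp_all add: continuous_at_imp_continuous_on)
  have dA: "(?A has_real_derivative A1 s) (at s)" and dB: "(?B has_real_derivative B1 s) (at s)" if "s > 0" for s
    unfolding A1_def B1_def using that
    by (auto intro!: derivative_eq_intros k(1,2)[OF that] simp: algebra_simps)
  have cA: "continuous_on {0<..} ?A" "continuous_on {0<..} ?B" "continuous_on {0<..} A1" "continuous_on {0<..} B1"
    unfolding A1_def B1_def by (intro continuous_intros ck k(3); simp)+
  let ?g = "\<lambda>s. \<omega>2 s * ?A s + \<omega>1 s * ?B s"
  let ?g1 = "\<lambda>s. (\<omega>3 s * ?A s + \<omega>2 s * A1 s) + (\<omega>2 s * ?B s + \<omega>1 s * B1 s)"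
  have g: "(?g has_real_derivative ?g1 s) (at s)" for s
    by (intro DERIV_add deriv_cutoff[OF dA w(3) w(12) c(1)] deriv_cutoff[OF dB w(2) w(10) c(1)])
  have cg: "continuous_on UNIV ?g1"
    by (intro continuous_on_add continuous_cutoff[OF cA(1) w(4) w(14) c(1)] continuous_cutoff[OF cA(3) w(7) w(12) c(1)]
        continuous_cutoff[OF cA(2) w(7) w(12) c(1)] continuous_cutoff[OF cA(4) w(6) w(10) c(1)])
  define p q where "p = (if l \<ge> 0 then m else 0)" and "q = (if l \<ge> 0 then n else m + n)"
  have pq: "p \<noteq> q" if "l \<noteq> int n" using that by (auto simp: p_def q_def m_def)
  have e: "outgoing_mode l z * cnj (zk n (pairing_weight n \<omega>1 \<omega>2 k k1) z) = z ^ p * cnj z ^ q * complex_of_real (?g ((norm z)\<^sup>2))" for z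
  proof (cases "z = 0")
    case True
    then show ?thesis using w(10,12)[of 0] c(1) by (simp add: zk_def pairing_weight_def)
  next
    case False
    have eqg: "pairing_weight n \<omega>1 \<omega>2 k k1 s / s ^ m = ?g s" for s
      by (simp add: pairing_weight_def add_divide_distrib algebra_simps)
    have e: "complex_of_real (?g ((norm z)\<^sup>2)) = of_real (1 / ((norm z)\<^sup>2) ^ m) * of_real (pairing_weight n \<omega>1 \<omega>2 k k1 ((norm z)\<^sup>2))"
      unfolding eqg[symmetric] by simp
    show ?thesis
      unfolding outgoing_mode_eq[OF False] e zk_def m_def[symmetric] complex_cnj_mult complex_cnj_power complex_cnj_complex_of_real
      by (auto simp: p_def q_def power_add)
  qed
  show ?thesis
    by (rule that[OF g cg _ _ pq e]) (use w(11,13,15) in auto)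
qed

text \<open>\<kappa> is the Wronskian of s^(-n) with the exterior solution k, so it measures the
  part of k that is not outgoing. The pairing of u with the cut-off k is 4 \<kappa> c_n times a
  nonzero integral, and it is 0 because u is a weak solution. The expansion is not integrated as a
  whole: finitely many modes are, and the remainder is estimated uniformly.\<close>

lemma outgoing_coeff_eq_0:
  fixes n :: nat
  assumes st: "zero_resonant_state a \<rho> u c" and \<rho>: "\<rho> > 0"
    and kin: "\<And>s. (kin has_real_derivative kin1 s) (at s)" "\<And>s. (kin1 has_real_derivative kin2 s) (at s)" "continuous_on UNIV kin2"
    and k: "\<And>s. s > 0 \<Longrightarrow> (k has_real_derivative k1 s) (at s)"
      "\<And>s. s > 0 \<Longrightarrow> (k1 has_real_derivative k2 s) (at s)" "continuous_on {0<..} k2"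
    and match: "kin (\<rho>\<^sup>2) = k (\<rho>\<^sup>2)" "kin1 (\<rho>\<^sup>2) = k1 (\<rho>\<^sup>2)"
    and ode_in: "\<And>s. 4 * (s * kin2 s + of_nat (Suc n) * kin1 s) + a\<^sup>2 * kin s = 0"
    and ode_out: "\<And>s. s > 0 \<Longrightarrow> s * k2 s + of_nat (Suc n) * k1 s = 0"
    and W: "\<And>s. s > 0 \<Longrightarrow> s * k1 s + of_nat n * k s = \<kappa>" "\<kappa> \<noteq> 0"
  shows "c (int n) = 0"
proof -
  from st have u: "weak_solution a \<rho> 0 u" and out: "outgoing_expansion u c"
    by (auto simp: zero_resonant_state_def)
  from out obtain R where R: "R > 0" "\<And>r \<theta>. r > R \<Longrightarrow> ((\<lambda>l. c l * complex_of_real (r powi (- \<bar>l\<bar>)) * cis (of_int l * \<theta>)) has_sum u (rcis r \<theta>)) UNIV"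
    unfolding outgoing_expansion_def by blast
  \<comment> \<open>Beyond this radius both the expansion holds and the potential vanishes; the
    cut-off starts to decrease at \<open>r0\<close> squared.\<close>
  define r0 where "r0 = R + \<rho> + 1"
  define c0 where "c0 = r0\<^sup>2"
  have r0: "r0 > R" "r0 > \<rho>" "r0 > 0" using R(1) \<rho> by (auto simp: r0_def)
  have c0: "c0 > \<rho>\<^sup>2" "c0 > 0" using r0 \<rho> by (auto simp: c0_def intro: power_strict_mono)
  obtain \<omega> \<omega>1 \<omega>2 \<omega>3 where cut: "cutoff c0 \<omega> \<omega>1 \<omega>2 \<omega>3" using cutoff_exists by blast
  note w = cutoffD[OF cut]
  define P where "P = pairing_weight n \<omega>1 \<omega>2 k k1"
  define Q where "Q = (\<lambda>z. cnj (zk n P z))"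
  have uQ: "(LINT z|lborel. u z * Q z) = 0"
    unfolding Q_def P_def
    by (rule weak_solution_pairing[OF u \<rho> kin k match _ _ c0(1) cut]) (use ode_in ode_out in auto)
  have cu: "continuous_on UNIV u" using u by (simp add: weak_solution_def)
  have ck: "continuous_on {0<..} k" "continuous_on {0<..} k1"
    using DERIV_isCont[OF k(1)] DERIV_isCont[OF k(2)] by (simp_all add: continuous_at_imp_continuous_on)
  have cP: "continuous_on UNIV P"
  proof -
    have "continuous_on UNIV (\<lambda>s. \<omega>2 s * (4 * s * k s) + \<omega>1 s * (4 * (2 * s * k1 s + of_nat (Suc n) * k s)))"
      by (intro continuous_on_add continuous_cutoff[OF _ w(7) w(12) c0(2)] continuous_cutoff[OF _ w(6) w(10) c0(2)] continuous_intros ck)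
    then show ?thesis unfolding P_def pairing_weight_def[abs_def] by (simp add: algebra_simps)
  qed
  have P0: "P s = 0" if "s \<le> c0 \<or> s \<ge> c0 + 1" for s
    using that w(10-13)[of s] by (auto simp: P_def pairing_weight_def)
  have cQ: "continuous_on UNIV Q" unfolding Q_def by (intro continuous_intros continuous_zk cP)
  have Q0: "Q z = 0" if "(norm z)\<^sup>2 \<le> c0 \<or> (norm z)\<^sup>2 \<ge> c0 + 1" for z
    using P0[OF that] by (simp add: Q_def zk_def)
  have int: "integrable lborel f" if f: "continuous_on UNIV f" "\<And>z. (norm z)\<^sup>2 \<ge> c0 + 1 \<Longrightarrow> f z = 0" for f :: "complex \<Rightarrow> complex"
  proof -
    obtain C where C: "\<And>z::complex. norm z \<le> sqrt (c0 + 1) \<Longrightarrow> norm (f z) \<le> C"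
      using ex_bound_ball[OF f(1), of "sqrt (c0 + 1)"] by auto
    have z: "(norm z)\<^sup>2 \<ge> c0 + 1" if "norm z \<ge> sqrt (c0 + 1)" for z :: complex
      using that c0(2) by (metis abs_of_nonneg norm_ge_zero real_sqrt_abs real_sqrt_le_iff)
    show ?thesis
      by (rule integrable_bounded_support[OF borel_measurable_continuous_onI[OF f(1)], of "sqrt (c0 + 1)" C])
         (use C z f(2) in auto)
  qed
  have iu: "integrable lborel (\<lambda>z. u z * Q z)" by (rule int) (use cu cQ Q0 in \<open>auto intro!: continuous_intros\<close>)
  have iQ: "integrable lborel Q" by (rule int) (use cQ Q0 in auto)
  have ie: "integrable lborel (\<lambda>z. outgoing_mode l z * Q z)" and e0: "l \<noteq> int n \<Longrightarrow> (LINT z|lborel. outgoing_mode l z * Q z) = 0" for l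
  proof -
    obtain p q g g1 where g: "\<And>s. (g has_real_derivative g1 s) (at s)" "continuous_on UNIV g1"
      "\<And>s. s \<ge> c0 + 1 \<Longrightarrow> g s = 0" "\<And>s. s \<ge> c0 + 1 \<Longrightarrow> g1 s = 0" "l \<noteq> int n \<Longrightarrow> p \<noteq> q"
      "\<And>z. outgoing_mode l z * cnj (zk n (pairing_weight n \<omega>1 \<omega>2 k k1) z) = z ^ p * cnj z ^ q * complex_of_real (g ((norm z)\<^sup>2))"
      by (rule mode_pairing_form[OF k c0(2) cut, where l = l and n = n]) (assumption, assumption, rule that)
    have eq: "outgoing_mode l z * Q z = z ^ p * cnj z ^ q * complex_of_real (g ((norm z)\<^sup>2))" for z
      using g(6)[of z] by (simp add: Q_def P_def)
    have cg: "continuous_on UNIV g"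
      using DERIV_isCont[OF g(1)] by (simp add: continuous_at_imp_continuous_on)
    have "continuous_on UNIV (\<lambda>z. z ^ p * cnj z ^ q * complex_of_real (g ((norm z)\<^sup>2)))"
      by (intro continuous_intros continuous_on_compose2[OF cg]) auto
    then show "integrable lborel (\<lambda>z. outgoing_mode l z * Q z)"
      unfolding eq by (rule int) (use g(3) in auto)
    show "(LINT z|lborel. outgoing_mode l z * Q z) = 0" if "l \<noteq> int n"
      unfolding eq by (rule integral_rotation_zero[OF g(1,2), of "c0 + 1"]) (use g(3,4,5) c0 that in auto)
  qed
  define X where "X = (LINT (z::complex)|lborel. complex_of_real (\<omega>1 ((norm z)\<^sup>2)))"
  have X: "X \<noteq> 0" unfolding X_def by (rule integral_cutoff_nonzero[OF c0(2) cut])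
  have en: "(LINT z|lborel. outgoing_mode (int n) z * Q z) = of_real (4 * \<kappa>) * X"
  proof -
    have "(LINT (z::complex)|lborel. complex_of_real (((norm z)\<^sup>2) ^ n * (1 / ((norm z)\<^sup>2) ^ n) * P ((norm z)\<^sup>2))) = of_real (4 * \<kappa>) * X"
      unfolding X_def P_def
    proof (rule integral_pairing_weight[where ?h1.0 = "\<lambda>s. - of_nat n / s ^ Suc n"])
      show "((\<lambda>s. 1 / s ^ n) has_real_derivative - of_nat n / s ^ Suc n) (at s)" if "s > 0" for s :: real
      proof -
        have "((\<lambda>s. 1 / s ^ n) has_real_derivative (0 * s ^ n - 1 * (real n * s ^ (n - 1))) / (s ^ n * s ^ n)) (at s)"
          using that by (intro DERIV_divide DERIV_const) (auto intro!: derivative_eq_intros)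
        moreover have "(0 * s ^ n - 1 * (real n * s ^ (n - 1))) / (s ^ n * s ^ n) = - of_nat n / s ^ Suc n"
        proof (cases n)
          case (Suc m)
          then show ?thesis using that by (simp add: divide_simps)
        qed simp
        ultimately show ?thesis by simp
      qed
      show "s ^ Suc n * (1 / s ^ n * k1 s - - of_nat n / s ^ Suc n * k s) = \<kappa>" if "s > 0" for s
        using W(1)[OF that] that by (simp add: field_simps)
    qed (use k c0 cut ck in \<open>auto intro!: continuous_intros\<close>)
    moreover have "outgoing_mode (int n) z * Q z = complex_of_real (((norm z)\<^sup>2) ^ n * (1 / ((norm z)\<^sup>2) ^ n) * P ((norm z)\<^sup>2))" for z
    proof (cases "z = 0")
      case True
      then show ?thesis using P0[of 0] c0 by (simp add: Q_def zk_def)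
    next
      case False
      have zz: "z ^ n * cnj z ^ n = of_real (((norm z)\<^sup>2) ^ n)"
        by (simp only: of_real_power[of "(norm z)\<^sup>2" n] complex_norm_square power_mult_distrib)
      have "outgoing_mode (int n) z * Q z = (z ^ n * cnj z ^ n) * (of_real (1 / ((norm z)\<^sup>2) ^ n) * of_real (P ((norm z)\<^sup>2)))"
        using outgoing_mode_eq[OF False, of "int n"] by (simp add: Q_def zk_def)
      then show ?thesis unfolding zz by simp
    qed
    ultimately show ?thesis by simp
  qed
  \<comment> \<open>A majorant for all |z| > \<open>r0\<close> at once: r powi (- |l|) does not
    increase with r, so absolute summability at this one radius controls the tail.\<close>
  define g where "g = (\<lambda>l. norm (c l) * r0 powi (- \<bar>l\<bar>))"
  have "g summable_on UNIV"
  proof -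
    have "(\<lambda>l. c l * complex_of_real (r0 powi (- \<bar>l\<bar>)) * cis (of_int l * 0)) summable_on UNIV"
      using R(2)[OF r0(1), of 0] by (rule has_sum_imp_summable)
    then have "(\<lambda>l. norm (c l * complex_of_real (r0 powi (- \<bar>l\<bar>)) * cis (of_int l * 0))) summable_on UNIV"
      by (simp only: summable_on_iff_abs_summable_on_complex)
    then show ?thesis using r0 by (simp add: g_def norm_mult norm_power_int)
  qed
  then obtain G where G: "(g has_sum G) UNIV" by (auto simp: summable_on_def)
  define K where "K = (LINT z|lborel. norm (Q z))"
  have K: "K \<ge> 0" by (simp add: K_def)
  have "norm (c (int n) * (of_real (4 * \<kappa>) * X)) \<le> e * K" if "e > 0" for e
  proof -
    obtain F0 where F0: "finite F0" "dist (sum g F0) G \<le> e"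
      using has_sum_finite_approximation[OF G \<open>e > 0\<close>] by blast
    define F where "F = insert (int n) F0"
    have F: "finite F" "int n \<in> F" using F0 by (auto simp: F_def)
    have g0: "g l \<ge> 0" for l using r0 by (simp add: g_def)
    have "sum g F0 \<le> sum g F" using F0 g0 by (intro sum_mono2) (auto simp: F_def)
    moreover have tail: "(g has_sum (G - sum g F)) (UNIV - F)"
      by (rule has_sum_Diff[OF G has_sum_finite]) (use F in auto)
    ultimately have Ge: "G - sum g F \<le> e" using F0(2) by (auto simp: dist_real_def)
    have uF: "norm (u z - (\<Sum>l\<in>F. c l * outgoing_mode l z)) \<le> e" if z: "(norm z)\<^sup>2 > c0" for z
    proof -
      have nz: "norm z > r0" using z r0 unfolding c0_def by (simp add: power2_less_imp_less)
      have "((\<lambda>l. c l * outgoing_mode l z) has_sum u z) UNIV"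
        using R(2)[of "norm z" "Arg z"] nz r0 by (simp add: rcis_cmod_Arg outgoing_mode_def mult.assoc)
      then have hs: "((\<lambda>l. c l * outgoing_mode l z) has_sum (u z - (\<Sum>l\<in>F. c l * outgoing_mode l z))) (UNIV - F)"
        by (rule has_sum_Diff[OF _ has_sum_finite]) (use F in auto)
      have "norm (c l * outgoing_mode l z) \<le> g l" for l
      proof -
        have "norm z powi (- \<bar>l\<bar>) \<le> r0 powi (- \<bar>l\<bar>)"
          using nz r0 by (auto simp: power_int_minus power_int_def intro!: le_imp_inverse_le power_mono)
        then show ?thesis
          using nz r0 by (auto simp: norm_mult norm_power_int g_def outgoing_mode_def intro!: mult_left_mono)
      qed
      then have "norm (u z - (\<Sum>l\<in>F. c l * outgoing_mode l z)) \<le> G - sum g F"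
        by (rule norm_infsum_le[OF hs tail])
      then show ?thesis using Ge by linarith
    qed
    have iF: "integrable lborel (\<lambda>z. (\<Sum>l\<in>F. c l * (outgoing_mode l z * Q z)))"
      by (intro Bochner_Integration.integrable_sum integrable_mult_right ie)
    have LF: "(LINT z|lborel. (\<Sum>l\<in>F. c l * (outgoing_mode l z * Q z))) = c (int n) * (of_real (4 * \<kappa>) * X)"
    proof -
      have "(LINT z|lborel. (\<Sum>l\<in>F. c l * (outgoing_mode l z * Q z))) = (\<Sum>l\<in>F. c l * (LINT z|lborel. outgoing_mode l z * Q z))"
        by (subst Bochner_Integration.integral_sum) (auto intro: integrable_mult_right ie)
      also have "\<dots> = (\<Sum>l\<in>F. if l = int n then c (int n) * (of_real (4 * \<kappa>) * X) else 0)"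
        by (intro sum.cong) (auto simp: en e0)
      finally show ?thesis using F by simp
    qed
    have "norm (c (int n) * (of_real (4 * \<kappa>) * X)) = norm (LINT z|lborel. u z * Q z - (\<Sum>l\<in>F. c l * (outgoing_mode l z * Q z)))"
      unfolding Bochner_Integration.integral_diff[OF iu iF] uQ LF by simp
    also have "\<dots> \<le> (LINT z|lborel. norm (u z * Q z - (\<Sum>l\<in>F. c l * (outgoing_mode l z * Q z))))"
      by (rule integral_norm_bound)
    also have "\<dots> \<le> (LINT z|lborel. e * norm (Q z))"
    proof (rule integral_mono)
      show "integrable lborel (\<lambda>z. norm (u z * Q z - (\<Sum>l\<in>F. c l * (outgoing_mode l z * Q z))))"
        by (intro integrable_norm Bochner_Integration.integrable_diff iu iF)
      show "integrable lborel (\<lambda>z. e * norm (Q z))" by (intro integrable_mult_right integrable_norm iQ)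
      fix z
      have "u z * Q z - (\<Sum>l\<in>F. c l * (outgoing_mode l z * Q z)) = (u z - (\<Sum>l\<in>F. c l * outgoing_mode l z)) * Q z"
        by (simp add: left_diff_distrib sum_distrib_right mult.assoc)
      moreover have "norm ((u z - (\<Sum>l\<in>F. c l * outgoing_mode l z)) * Q z) \<le> e * norm (Q z)"
      proof (cases "(norm z)\<^sup>2 > c0")
        case True
        then show ?thesis unfolding norm_mult by (intro mult_right_mono uF) auto
      next
        case False
        then show ?thesis using Q0[of z] by simp
      qed
      ultimately show "norm (u z * Q z - (\<Sum>l\<in>F. c l * (outgoing_mode l z * Q z))) \<le> e * norm (Q z)" by simp
    qed
    also have "\<dots> = e * K" by (simp add: K_def)
    finally show ?thesis .
  qed
  note bound = this
  have "norm (c (int n) * (of_real (4 * \<kappa>) * X)) \<le> 0"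
  proof (rule field_le_epsilon)
    fix e :: real assume "e > 0"
    have "norm (c (int n) * (of_real (4 * \<kappa>) * X)) \<le> e / (K + 1) * K"
      using \<open>e > 0\<close> K by (intro bound) auto
    also have "\<dots> \<le> e" using \<open>e > 0\<close> K by (simp add: field_simps)
    finally show "norm (c (int n) * (of_real (4 * \<kappa>) * X)) \<le> 0 + e" by simp
  qed
  then show ?thesis using X W(2) by simp
qed

section \<open>Uniqueness for solutions that vanish outside the disc\<close>

lemma integral_continuous_compact_support:
  fixes f :: "complex \<Rightarrow> 'b::{banach,second_countable_topology}"
  assumes "continuous_on UNIV f" "\<And>z. norm z > M \<Longrightarrow> f z = 0"
  shows "integrable lborel f"
proof -
  obtain C where C: "\<And>z::complex. norm z \<le> M + 1 \<Longrightarrow> norm (f z) \<le> C"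
    using ex_bound_ball[OF assms(1), of "M + 1"] by auto
  show ?thesis
    by (rule integrable_bounded_support[OF borel_measurable_continuous_onI[OF assms(1)], of "M + 1" C])
       (use C assms(2) in auto)
qed

text \<open>All moments of \<open>u\<close> against \<open>cnj z ^ n * norm z ^ (2 * m)\<close> vanish: the test function
  \<open>norm z ^ (2 * m)\<close> relates the moments \<open>m\<close> and \<open>m - 1\<close>, and the moment \<open>0\<close> is killed by the
  constant test function.\<close>

lemma weak_solution_moments:
  fixes n :: nat
  assumes u: "weak_solution a \<rho> E u" "\<rho> > 0" and supp: "\<And>z. norm z > \<rho> \<Longrightarrow> u z = 0" and q: "a\<^sup>2 + E > 0"
  shows "(LINT z|lborel. u z * (cnj z ^ n * complex_of_real (((norm z)\<^sup>2) ^ m))) = 0"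
proof (induction m)
  define c where "c = \<rho>\<^sup>2 + 1"
  have c: "c > \<rho>\<^sup>2" "c > 0" by (auto simp: c_def add_nonneg_pos)
  obtain \<omega> \<omega>1 \<omega>2 \<omega>3 where cut: "cutoff c \<omega> \<omega>1 \<omega>2 \<omega>3" using cutoff_exists by blast
  note w = cutoffD[OF cut]
  have cu: "continuous_on UNIV u" using u by (simp add: weak_solution_def)
  have q0: "complex_of_real (a\<^sup>2 + E) \<noteq> 0" using q by (simp only: of_real_eq_0_iff)
  let ?I = "\<lambda>m. (LINT z|lborel. u z * (cnj z ^ n * complex_of_real (((norm z)\<^sup>2) ^ m)))"
  have int: "integrable lborel (\<lambda>z. u z * (cnj z ^ n * complex_of_real (((norm z)\<^sup>2) ^ m)))" for m
    by (rule integral_continuous_compact_support[of _ \<rho>]) (use supp cu in \<open>auto intro!: continuous_intros\<close>)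
  have test: "(LINT z|lborel. u z * cnj (zk n (\<lambda>s. 4 * (s * p2 s + of_nat (Suc n) * p1 s) + (a\<^sup>2 + E) * p s) z)) = 0"
    if p: "\<And>s. (p has_real_derivative p1 s) (at s)" "\<And>s. (p1 has_real_derivative p2 s) (at s)" "continuous_on UNIV p2"
    for p p1 p2
  proof -
    \<comment> \<open>The cut-off merely gives p compact support; where it differs from 1, u
      vanishes anyway.\<close>
    let ?k = "\<lambda>s. \<omega> s * p s" and ?k1 = "\<lambda>s. \<omega>1 s * p s + \<omega> s * p1 s"
      and ?k2 = "\<lambda>s. \<omega>2 s * p s + 2 * (\<omega>1 s * p1 s) + \<omega> s * p2 s"
    have cp: "continuous_on UNIV p" "continuous_on UNIV p1"
      using DERIV_isCont[OF p(1)] DERIV_isCont[OF p(2)] by (simp_all add: continuous_at_imp_continuous_on)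
    have "(LINT z|lborel. u z * cnj (zk n (radop n (pot a \<rho> E) ?k ?k1 ?k2) z)) = 0"
    proof (rule weak_solution_test_zk[OF u, where M = "sqrt (c + 1)"])
      show "(?k has_real_derivative ?k1 s) (at s)" for s
        by (rule derivative_eq_intros w p(1) refl | simp add: algebra_simps)+
      show "(?k1 has_real_derivative ?k2 s) (at s)" for s
        by (rule derivative_eq_intros w p(1) p(2) refl | simp add: algebra_simps)+
      show "continuous_on UNIV ?k2" by (intro continuous_intros w cp p)
    qed (use w c in auto)
    moreover have "u z * cnj (zk n (radop n (pot a \<rho> E) ?k ?k1 ?k2) z)
       = u z * cnj (zk n (\<lambda>s. 4 * (s * p2 s + of_nat (Suc n) * p1 s) + (a\<^sup>2 + E) * p s) z)" for z
    proof (cases "norm z > \<rho>")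
      case False
      then have "(norm z)\<^sup>2 \<le> \<rho>\<^sup>2" by (intro power_mono) auto
      then show ?thesis using w(8,10,12)[of "(norm z)\<^sup>2"] c(1)
        by (simp add: zk_def radop_def pot_def)
    qed (use supp in simp)
    ultimately show ?thesis by simp
  qed
  {
    case 0
    have "(LINT z|lborel. u z * cnj (zk n (\<lambda>s. 4 * (s * 0 + of_nat (Suc n) * 0) + (a\<^sup>2 + E) * 1) z)) = 0"
      by (rule test) (auto intro!: derivative_eq_intros)
    then have "(LINT z|lborel. complex_of_real (a\<^sup>2 + E) * (u z * (cnj z ^ n * complex_of_real (((norm z)\<^sup>2) ^ 0)))) = 0"
      by (simp add: zk_def mult_ac)
    then have "complex_of_real (a\<^sup>2 + E) * ?I 0 = 0" by (simp only: integral_mult_right_zero)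
    then show ?case using q0 mult_eq_0_iff by blast
  next
    case (Suc m)
    define A where "A = 4 * (real (Suc m) * real m + real (Suc n) * real (Suc m))"
    have "(LINT z|lborel. u z * cnj (zk n (\<lambda>s. 4 * (s * (real (Suc m) * (real m * s ^ (m - 1))) + of_nat (Suc n) * (real (Suc m) * s ^ m)) + (a\<^sup>2 + E) * s ^ Suc m) z)) = 0"
    proof (rule test)
      show "((\<lambda>s. s ^ Suc m) has_real_derivative real (Suc m) * s ^ m) (at s)" for s
        using DERIV_pow[of "Suc m" s UNIV] by simp
      show "((\<lambda>s. real (Suc m) * s ^ m) has_real_derivative real (Suc m) * (real m * s ^ (m - 1))) (at s)" for s
        using DERIV_cmult[OF DERIV_pow[of m s UNIV], of "real (Suc m)"] by simp
    qed (intro continuous_intros)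
    moreover have "4 * (s * (real (Suc m) * (real m * s ^ (m - 1))) + of_nat (Suc n) * (real (Suc m) * s ^ m)) + (a\<^sup>2 + E) * s ^ Suc m
        = A * s ^ m + (a\<^sup>2 + E) * s ^ Suc m" for s
      by (cases m) (simp_all add: A_def algebra_simps)
    ultimately have "(LINT z|lborel. u z * cnj (zk n (\<lambda>s. A * s ^ m + (a\<^sup>2 + E) * s ^ Suc m) z)) = 0"
      by (simp only:)
    moreover have "u z * cnj (zk n (\<lambda>s. A * s ^ m + (a\<^sup>2 + E) * s ^ Suc m) z)
       = complex_of_real A * (u z * (cnj z ^ n * complex_of_real (((norm z)\<^sup>2) ^ m)))
         + complex_of_real (a\<^sup>2 + E) * (u z * (cnj z ^ n * complex_of_real (((norm z)\<^sup>2) ^ Suc m)))" for z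
      by (simp add: zk_def algebra_simps)
    ultimately have "complex_of_real A * ?I m + complex_of_real (a\<^sup>2 + E) * ?I (Suc m) = 0"
      using Bochner_Integration.integral_add[OF integrable_mult_right[OF int[of m], of "complex_of_real A"] integrable_mult_right[OF int[of "Suc m"], of "complex_of_real (a\<^sup>2 + E)"]]
      by (simp only: integral_mult_right_zero)
    then have "complex_of_real (a\<^sup>2 + E) * ?I (Suc m) = 0" unfolding Suc.IH by simp
    then show ?case using q0 mult_eq_0_iff by blast
  }
qed

text \<open>Replaces unique continuation. The function v = u cnj(z)^n is a continuous function G of
  |z|^2, and by the moments it is orthogonal to all polynomials in |z|^2. By Weierstrass
  approximation on [0, \<rho>^2] it is then orthogonal to the real and the imaginary part of G, so v
  = 0. At z = 0, where v = 0 gives nothing for n > 0, the continuity of u concludes.\<close>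

lemma weak_solution_eq_0:
  fixes n :: nat
  assumes u: "weak_solution a \<rho> E u" "\<rho> > 0" and supp: "\<And>z. norm z > \<rho> \<Longrightarrow> u z = 0" and q: "a\<^sup>2 + E > 0"
    and f: "\<And>r \<theta>. r \<ge> 0 \<Longrightarrow> u (rcis r \<theta>) = f r * cis (of_int (int n) * \<theta>)"
  shows "u = (\<lambda>_. 0)"
proof -
  have cu: "continuous_on UNIV u" using u by (simp add: weak_solution_def)
  define G where "G = (\<lambda>s. u (of_real (sqrt s)) * of_real (sqrt s) ^ n)"
  have cG: "continuous_on A G" for A unfolding G_def
    by (intro continuous_intros continuous_on_compose2[OF cu]) auto
  define v where "v = (\<lambda>z. u z * cnj z ^ n)"
  have cv: "continuous_on UNIV v" unfolding v_def by (intro continuous_intros cu)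
  have vG: "v z = G ((norm z)\<^sup>2)" for z
  proof -
    have z: "z = rcis (norm z) (Arg z)" by (simp add: rcis_cmod_Arg)
    have "cnj z = of_real (norm z) * cis (- Arg z)"
      by (subst z) (simp add: rcis_def cis_cnj)
    then have "cnj z ^ n = of_real (norm z) ^ n * cis (real n * (- Arg z))"
      by (simp only: power_mult_distrib Complex.DeMoivre)
    moreover have "u z = f (norm z) * cis (real n * Arg z)"
      using f[of "norm z" "Arg z"] z by simp
    ultimately have "v z = f (norm z) * of_real (norm z) ^ n * (cis (real n * Arg z) * cis (real n * (- Arg z)))"
      by (simp only: v_def mult_ac)
    also have "cis (real n * Arg z) * cis (real n * (- Arg z)) = 1" by (simp add: cis_mult)
    also have "f (norm z) = u (of_real (norm z))" using f[of "norm z" 0] by (simp add: rcis_def)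
    finally show ?thesis by (simp add: G_def)
  qed
  have v0: "v z = 0" if "norm z > \<rho>" for z using supp[OF that] by (simp add: v_def)
  have iv: "integrable lborel v" by (rule integral_continuous_compact_support[OF cv v0])
  have poly: "(LINT z|lborel. v z * complex_of_real (\<Sum>i\<le>N. b i * ((norm z)\<^sup>2) ^ i)) = 0" for b N
  proof -
    have int: "integrable lborel (\<lambda>z. v z * complex_of_real (((norm z)\<^sup>2) ^ i))" for i
      by (rule integral_continuous_compact_support[of _ \<rho>]) (use v0 cv in \<open>auto intro!: continuous_intros\<close>)
    have m0: "(LINT z|lborel. v z * complex_of_real (((norm z)\<^sup>2) ^ i)) = 0" for i
      using weak_solution_moments[OF u supp q, of n i] by (simp add: v_def mult_ac)
    have "(LINT z|lborel. (\<Sum>i\<le>N. complex_of_real (b i) * (v z * complex_of_real (((norm z)\<^sup>2) ^ i)))) = 0"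
      by (subst Bochner_Integration.integral_sum) (auto intro!: integrable_mult_right int simp only: m0 integral_mult_right_zero mult_zero_right sum.neutral_const)
    then show ?thesis by (simp add: sum_distrib_left mult_ac)
  qed
  have zero: "(LINT z|lborel. v z * complex_of_real (g ((norm z)\<^sup>2))) = 0" if g: "\<And>A. continuous_on A g" for g
  proof -
    define K where "K = (LINT z|lborel. norm (v z))"
    have K: "K \<ge> 0" by (simp add: K_def)
    have ig: "integrable lborel (\<lambda>z. v z * complex_of_real (g ((norm z)\<^sup>2)))"
      by (rule integral_continuous_compact_support[of _ \<rho>])
         (use v0 cv in \<open>auto intro!: continuous_intros continuous_on_compose2[OF g[of UNIV]]\<close>)
    have b: "norm (LINT z|lborel. v z * complex_of_real (g ((norm z)\<^sup>2))) \<le> e * K" if "e > 0" for e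
    proof -
      obtain p where p: "polynomial_function p" "\<And>s. s \<in> {0..\<rho>\<^sup>2} \<Longrightarrow> norm (g s - p s) < e"
        using Stone_Weierstrass_polynomial_function[of "{0..\<rho>\<^sup>2}" g e] g \<open>e > 0\<close> by auto
      then obtain b N where pb: "p = (\<lambda>x. \<Sum>i\<le>N. b i * x ^ i)"
        by (auto simp: real_polynomial_function_eq[symmetric] real_polynomial_function_iff_sum)
      have ip: "integrable lborel (\<lambda>z. v z * complex_of_real (p ((norm z)\<^sup>2)))"
        unfolding pb by (rule integral_continuous_compact_support[of _ \<rho>])
         (use v0 cv in \<open>auto intro!: continuous_intros\<close>)
      have p0: "(LINT z|lborel. v z * complex_of_real (p ((norm z)\<^sup>2))) = 0" unfolding pb by (rule poly)
      have "norm (LINT z|lborel. v z * complex_of_real (g ((norm z)\<^sup>2)))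
         = norm (LINT z|lborel. v z * complex_of_real (g ((norm z)\<^sup>2)) - v z * complex_of_real (p ((norm z)\<^sup>2)))"
        unfolding Bochner_Integration.integral_diff[OF ig ip] p0 by simp
      also have "\<dots> \<le> (LINT z|lborel. norm (v z * complex_of_real (g ((norm z)\<^sup>2)) - v z * complex_of_real (p ((norm z)\<^sup>2))))"
        by (rule integral_norm_bound)
      also have "\<dots> \<le> (LINT z|lborel. e * norm (v z))"
      proof (rule integral_mono)
        show "integrable lborel (\<lambda>z. norm (v z * complex_of_real (g ((norm z)\<^sup>2)) - v z * complex_of_real (p ((norm z)\<^sup>2))))"
          by (intro integrable_norm Bochner_Integration.integrable_diff ig ip)
        show "integrable lborel (\<lambda>z. e * norm (v z))" by (intro integrable_mult_right integrable_norm iv)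
        fix z
        have "v z * complex_of_real (g ((norm z)\<^sup>2)) - v z * complex_of_real (p ((norm z)\<^sup>2)) = of_real (g ((norm z)\<^sup>2) - p ((norm z)\<^sup>2)) * v z"
          by (simp add: algebra_simps)
        moreover have "norm (of_real (g ((norm z)\<^sup>2) - p ((norm z)\<^sup>2)) * v z) \<le> e * norm (v z)"
        proof (cases "norm z > \<rho>")
          case False
          then have "(norm z)\<^sup>2 \<le> \<rho>\<^sup>2" by (intro power_mono) auto
          then have "\<bar>g ((norm z)\<^sup>2) - p ((norm z)\<^sup>2)\<bar> \<le> e" using p(2)[of "(norm z)\<^sup>2"] by simp
          then show ?thesis unfolding norm_mult norm_of_real by (rule mult_right_mono) simp
        qed (use v0 in simp)
        ultimately show "norm (v z * complex_of_real (g ((norm z)\<^sup>2)) - v z * complex_of_real (p ((norm z)\<^sup>2))) \<le> e * norm (v z)"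
          by (simp only:)
      qed
      also have "\<dots> = e * K" by (simp add: K_def)
      finally show ?thesis .
    qed
    have "norm (LINT z|lborel. v z * complex_of_real (g ((norm z)\<^sup>2))) \<le> 0"
    proof (rule field_le_epsilon)
      fix e :: real assume "e > 0"
      have "norm (LINT z|lborel. v z * complex_of_real (g ((norm z)\<^sup>2))) \<le> e / (K + 1) * K"
        using \<open>e > 0\<close> K by (intro b) auto
      also have "\<dots> \<le> e" using \<open>e > 0\<close> K by (simp add: field_simps)
      finally show "norm (LINT z|lborel. v z * complex_of_real (g ((norm z)\<^sup>2))) \<le> 0 + e" by simp
    qed
    then show ?thesis by simp
  qed
  have cR: "continuous_on A (\<lambda>s. Re (G s))" "continuous_on A (\<lambda>s. Im (G s))" for A
    by (intro continuous_intros cG)+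
  have i: "integrable lborel (\<lambda>z. v z * complex_of_real (g ((norm z)\<^sup>2)))" if "\<And>A. continuous_on A g" for g
    by (rule integral_continuous_compact_support[of _ \<rho>])
       (use v0 cv in \<open>auto intro!: continuous_intros continuous_on_compose2[OF that[of UNIV]]\<close>)
  have "(LINT z|lborel. complex_of_real ((norm (v z))\<^sup>2)) = 0"
  proof -
    have "complex_of_real ((norm (v z))\<^sup>2) = v z * complex_of_real (Re (G ((norm z)\<^sup>2))) - \<i> * (v z * complex_of_real (Im (G ((norm z)\<^sup>2))))" for z
    proof -
      have "complex_of_real ((norm (v z))\<^sup>2) = v z * cnj (v z)" by (rule complex_norm_square)
      also have "cnj (v z) = complex_of_real (Re (G ((norm z)\<^sup>2))) - \<i> * complex_of_real (Im (G ((norm z)\<^sup>2)))"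
        unfolding vG by (simp add: complex_eq_iff)
      finally show ?thesis by (simp add: algebra_simps)
    qed
    then show ?thesis
      using Bochner_Integration.integral_diff[OF i[OF cR(1)] integrable_mult_right[OF i[OF cR(2)], of \<i>]] zero[OF cR(1)] zero[OF cR(2)]
      by (simp only: integral_mult_right_zero) simp
  qed
  then have 0: "(LINT z|lborel. (norm (v z))\<^sup>2) = 0"
    unfolding integral_complex_of_real by simp
  have iv2: "integrable lborel (\<lambda>z. (norm (v z))\<^sup>2)"
    by (rule integral_continuous_compact_support[of _ \<rho>]) (use v0 cv in \<open>auto intro!: continuous_intros\<close>)
  have vz: "v z = 0" for z
  proof -
    have "(norm (v z))\<^sup>2 = 0"
      by (rule integral_continuous_nonneg_eq_0[OF _ _ iv2 0]) (use cv in \<open>auto intro!: continuous_intros\<close>)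
    then show ?thesis by simp
  qed
  have uz: "u z = 0" if "z \<noteq> 0" for z using vz[of z] that by (simp add: v_def)
  have "u 0 = 0"
  proof -
    have "(u \<longlongrightarrow> u 0) (at 0)" using cu by (simp add: continuous_on_def)
    moreover have "(u \<longlongrightarrow> 0) (at 0)"
      by (rule tendsto_eventually) (use uz in \<open>auto simp: eventually_at_filter\<close>)
    ultimately show ?thesis using tendsto_unique[of "at (0::complex)"] by auto
  qed
  then have "u z = 0" for z using uz[of z] by (cases "z = 0") auto
  then show ?thesis by (rule ext)
qed

lemma weak_solution_cnj:
  assumes "weak_solution a \<rho> E u"
  shows "weak_solution a \<rho> E (\<lambda>z. cnj (u z))"
  unfolding weak_solution_def
proof (intro conjI allI impI)
  show "continuous_on UNIV (\<lambda>z. cnj (u z))"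
    using assms by (auto simp: weak_solution_def intro!: continuous_intros)
  fix \<phi> assume "test_function \<phi>"
  then have "(LINT x|lborel. u x * complex_of_real (schroedinger_op a \<rho> \<phi> x - E * \<phi> x)) = 0"
    using assms by (auto simp: weak_solution_def)
  moreover have "cnj (u x) * complex_of_real r = cnj (u x * complex_of_real r)" for x r
    by simp
  ultimately show "(LINT x|lborel. cnj (u x) * complex_of_real (schroedinger_op a \<rho> \<phi> x - E * \<phi> x)) = 0"
    by (simp only: Bochner_Integration.integral_cnj complex_cnj_zero)
qed

text \<open>Conjugation exchanges the roles of l and -l, so that coefficients of negative order
  reduce to those of positive order.\<close>

lemma zero_resonant_state_cnj:
  assumes "zero_resonant_state a \<rho> u c"
  shows "zero_resonant_state a \<rho> (\<lambda>z. cnj (u z)) (\<lambda>l. cnj (c (- l)))"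
proof -
  from assms obtain R where R: "R > 0" "\<And>r \<theta>. r > R \<Longrightarrow> ((\<lambda>l. c l * complex_of_real (r powi (- \<bar>l\<bar>)) * cis (of_int l * \<theta>)) has_sum u (rcis r \<theta>)) UNIV"
    unfolding zero_resonant_state_def outgoing_expansion_def by blast
  have "((\<lambda>l. cnj (c (- l)) * complex_of_real (r powi (- \<bar>l\<bar>)) * cis (of_int l * \<theta>)) has_sum cnj (u (rcis r \<theta>))) UNIV" if "r > R" for r \<theta>
  proof -
    have "((\<lambda>l. cnj (c l * complex_of_real (r powi (- \<bar>l\<bar>)) * cis (of_int l * \<theta>))) has_sum cnj (u (rcis r \<theta>))) UNIV"
      using R(2)[OF that, of \<theta>] by (simp only: has_sum_cnj_iff)
    moreover have "bij_betw uminus (UNIV :: int set) UNIV"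
      by (rule bij_betwI[of _ _ _ uminus]) auto
    ultimately have "((\<lambda>l. cnj (c (- l) * complex_of_real (r powi (- \<bar>- l\<bar>)) * cis (of_int (- l) * \<theta>))) has_sum cnj (u (rcis r \<theta>))) UNIV"
      using has_sum_reindex_bij_betw[of uminus "UNIV :: int set" UNIV "\<lambda>l. cnj (c l * complex_of_real (r powi (- \<bar>l\<bar>)) * cis (of_int l * \<theta>))"]
      by simp
    then show ?thesis by (simp add: cis_cnj)
  qed
  then show ?thesis
    using assms R(1) weak_solution_cnj unfolding zero_resonant_state_def outgoing_expansion_def
    by (auto simp: fun_eq_iff)
qed

section \<open>Resonances and the zeros of \<open>rJ 0\<close> and \<open>rJ 1\<close>\<close>

lemma s_resonance_imp:
  assumes "s_resonance a \<rho>" "\<rho> > 0" "a > 0"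
  shows "rJ 1 (a\<^sup>2 * \<rho>\<^sup>2 / 4) = 0"
proof (rule ccontr)
  define \<beta> where "\<beta> = a\<^sup>2 * \<rho>\<^sup>2 / 4"
  assume "rJ 1 (a\<^sup>2 * \<rho>\<^sup>2 / 4) \<noteq> 0"
  then have J: "rJ 1 \<beta> \<noteq> 0" by (simp add: \<beta>_def)
  from assms obtain u c where st: "zero_resonant_state a \<rho> u c" and c: "c 0 \<noteq> 0"
    by (auto simp: s_resonance_def)
  \<comment> \<open>Radial zero-energy solutions outside are p + q ln s. Equal first derivatives at
    s = \<rho>^2 force this q, equal values force p, and a nonzero q is the logarithm that no
    outgoing state may contain.\<close>
  define q where "q = - \<beta> * rJ 1 \<beta>"
  have q: "q \<noteq> 0" using J assms(2,3) by (simp add: q_def \<beta>_def)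
  define p where "p = rJ 0 \<beta> - q * ln (\<rho>\<^sup>2)"
  have "c (int 0) = 0"
  proof (rule outgoing_coeff_eq_0[OF st assms(2), where k = "\<lambda>s. p + q * ln s" and ?k1.0 = "\<lambda>s. q / s" and ?k2.0 = "\<lambda>s. - q / s\<^sup>2" and \<kappa> = q])
    show "((\<lambda>s. rJ 0 (a\<^sup>2 * s / 4)) has_real_derivative - (a\<^sup>2 / 4) * rJ (Suc 0) (a\<^sup>2 * s / 4)) (at s)" for s
      by (rule rJ_scaled(1))
    show "((\<lambda>s. - (a\<^sup>2 / 4) * rJ (Suc 0) (a\<^sup>2 * s / 4)) has_real_derivative (a\<^sup>2 / 4)\<^sup>2 * rJ (Suc (Suc 0)) (a\<^sup>2 * s / 4)) (at s)" for s
      by (rule rJ_scaled(2))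
    show "continuous_on UNIV (\<lambda>s. (a\<^sup>2 / 4)\<^sup>2 * rJ (Suc (Suc 0)) (a\<^sup>2 * s / 4))"
      by (rule rJ_scaled(3))
    show "4 * (s * ((a\<^sup>2 / 4)\<^sup>2 * rJ (Suc (Suc 0)) (a\<^sup>2 * s / 4)) + real (Suc 0) * (- (a\<^sup>2 / 4) * rJ (Suc 0) (a\<^sup>2 * s / 4))) + a\<^sup>2 * rJ 0 (a\<^sup>2 * s / 4) = 0" for s
      by (rule rJ_scaled(4))
    show "((\<lambda>s. p + q * ln s) has_real_derivative q / s) (at s)" if "s > 0" for s
      using that by (auto intro!: derivative_eq_intros)
    show "((\<lambda>s. q / s) has_real_derivative - q / s\<^sup>2) (at s)" if "s > 0" for s
      using that by (auto intro!: derivative_eq_intros simp: power2_eq_square)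
    show "continuous_on {0<..} (\<lambda>s. - q / s\<^sup>2)" by (auto intro!: continuous_intros)
    show "rJ 0 (a\<^sup>2 * \<rho>\<^sup>2 / 4) = p + q * ln (\<rho>\<^sup>2)" by (simp add: p_def \<beta>_def)
    show "- (a\<^sup>2 / 4) * rJ (Suc 0) (a\<^sup>2 * \<rho>\<^sup>2 / 4) = q / \<rho>\<^sup>2"
      using assms(2) by (simp add: q_def \<beta>_def)
    show "s * (- q / s\<^sup>2) + real (Suc 0) * (q / s) = 0" if "s > 0" for s
      using that by (simp add: power2_eq_square)
    show "s * (q / s) + real 0 * (p + q * ln s) = q" if "s > 0" for s using that by simp
  qed (rule q)
  then show False using c by simp
qed

lemma zero_resonant_state_coeff_1:
  assumes st: "zero_resonant_state a \<rho> u c" and "\<rho> > 0" and J: "rJ 0 (a\<^sup>2 * \<rho>\<^sup>2 / 4) \<noteq> 0"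
  shows "c 1 = 0"
proof -
  define \<beta> where "\<beta> = a\<^sup>2 * \<rho>\<^sup>2 / 4"
  \<comment> \<open>Outside, the radial factors of order 1 are constant + q / s. Equal first
    derivatives fix q, and the recurrence then identifies the constant, the amplitude of the growing
    solution z, as \<open>rJ 0 \<beta>\<close>.\<close>
  define q where "q = \<rho>\<^sup>2 * (\<beta> * rJ 2 \<beta>)"
  have rec: "rJ 1 \<beta> - \<beta> * rJ 2 \<beta> = rJ 0 \<beta>"
    using rJ_rec[of 0 \<beta>] by (simp add: numeral_2_eq_2)
  have "c (int 1) = 0"
  proof (rule outgoing_coeff_eq_0[OF st assms(2), where k = "\<lambda>s. rJ 0 \<beta> + q / s" and ?k1.0 = "\<lambda>s. - q / s\<^sup>2" and ?k2.0 = "\<lambda>s. 2 * q / s ^ 3" and \<kappa> = "rJ 0 \<beta>"])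
    show "((\<lambda>s. rJ 1 (a\<^sup>2 * s / 4)) has_real_derivative - (a\<^sup>2 / 4) * rJ (Suc 1) (a\<^sup>2 * s / 4)) (at s)" for s
      by (rule rJ_scaled(1))
    show "((\<lambda>s. - (a\<^sup>2 / 4) * rJ (Suc 1) (a\<^sup>2 * s / 4)) has_real_derivative (a\<^sup>2 / 4)\<^sup>2 * rJ (Suc (Suc 1)) (a\<^sup>2 * s / 4)) (at s)" for s
      by (rule rJ_scaled(2))
    show "continuous_on UNIV (\<lambda>s. (a\<^sup>2 / 4)\<^sup>2 * rJ (Suc (Suc 1)) (a\<^sup>2 * s / 4))"
      by (rule rJ_scaled(3))
    show "4 * (s * ((a\<^sup>2 / 4)\<^sup>2 * rJ (Suc (Suc 1)) (a\<^sup>2 * s / 4)) + real (Suc 1) * (- (a\<^sup>2 / 4) * rJ (Suc 1) (a\<^sup>2 * s / 4))) + a\<^sup>2 * rJ 1 (a\<^sup>2 * s / 4) = 0" for s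
      by (rule rJ_scaled(4))
    show "((\<lambda>s. rJ 0 \<beta> + q / s) has_real_derivative - q / s\<^sup>2) (at s)" if "s > 0" for s
      using that by (auto intro!: derivative_eq_intros simp: power2_eq_square)
    show "((\<lambda>s. - q / s\<^sup>2) has_real_derivative 2 * q / s ^ 3) (at s)" if "s > 0" for s
      using that by (auto intro!: derivative_eq_intros simp: power2_eq_square power3_eq_cube divide_simps)
    show "continuous_on {0<..} (\<lambda>s. 2 * q / s ^ 3)" by (auto intro!: continuous_intros)
    show "rJ 1 (a\<^sup>2 * \<rho>\<^sup>2 / 4) = rJ 0 \<beta> + q / \<rho>\<^sup>2"
      using assms(2) rec by (simp add: q_def \<beta>_def)
    show "- (a\<^sup>2 / 4) * rJ (Suc 1) (a\<^sup>2 * \<rho>\<^sup>2 / 4) = - q / (\<rho>\<^sup>2)\<^sup>2"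
      using assms(2) by (simp add: q_def \<beta>_def numeral_2_eq_2 power2_eq_square)
    show "s * (2 * q / s ^ 3) + real (Suc 1) * (- q / s\<^sup>2) = 0" if "s > 0" for s
      using that by (simp add: power2_eq_square power3_eq_cube)
    show "s * (- q / s\<^sup>2) + real 1 * (rJ 0 \<beta> + q / s) = rJ 0 \<beta>" if "s > 0" for s
      using that by (simp add: power2_eq_square)
  qed (use J in \<open>simp add: \<beta>_def\<close>)
  then show ?thesis by simp
qed

lemma p_resonance_imp:
  assumes "p_resonance a \<rho>" "\<rho> > 0"
  shows "rJ 0 (a\<^sup>2 * \<rho>\<^sup>2 / 4) = 0"
proof (rule ccontr)
  assume J: "rJ 0 (a\<^sup>2 * \<rho>\<^sup>2 / 4) \<noteq> 0"
  from assms obtain u c where st: "zero_resonant_state a \<rho> u c" and c: "norm (c 1) + norm (c (-1)) > 0"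
    by (auto simp: p_resonance_def)
  from zero_resonant_state_coeff_1[OF st assms(2) J] have "c 1 = 0" .
  moreover from zero_resonant_state_coeff_1[OF zero_resonant_state_cnj[OF st] assms(2) J] have "c (-1) = 0" by simp
  ultimately show False using c by simp
qed

lemma outgoing_expansion_single:
  assumes "\<And>r \<theta>. r > R \<Longrightarrow> u (rcis r \<theta>) = q * complex_of_real (r powi (- \<bar>l\<bar>)) * cis (of_int l * \<theta>)" "R > 0"
  shows "outgoing_expansion u (\<lambda>j. if j = l then q else 0)"
  unfolding outgoing_expansion_def
proof (intro exI conjI allI impI)
  fix r \<theta> :: real assume "r > R"
  have "((\<lambda>j. (if j = l then q else 0) * complex_of_real (r powi (- \<bar>j\<bar>)) * cis (of_int j * \<theta>)) has_sum
    (\<Sum>j\<in>{l}. (if j = l then q else 0) * complex_of_real (r powi (- \<bar>j\<bar>)) * cis (of_int j * \<theta>))) {l}"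
    by (rule has_sum_finite) simp
  then have "((\<lambda>j. (if j = l then q else 0) * complex_of_real (r powi (- \<bar>j\<bar>)) * cis (of_int j * \<theta>)) has_sum u (rcis r \<theta>)) {l}"
    using assms(1)[OF \<open>r > R\<close>] by simp
  then show "((\<lambda>j. (if j = l then q else 0) * complex_of_real (r powi (- \<bar>j\<bar>)) * cis (of_int j * \<theta>)) has_sum u (rcis r \<theta>)) UNIV"
    by (rule has_sum_cong_neutral[THEN iffD1, rotated -1]) auto
qed (rule assms(2))

text \<open>The states are explicit. If \<open>rJ 1 \<beta>\<close> = 0, the regular solution of
  order 0 has zero radial derivative at the edge and continues as a constant. If
  \<open>rJ 0 \<beta>\<close> = 0, the regular solution of order 1 continues as a multiple of z /
  |z|^2.\<close>

lemma zero_resonanceI: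
  assumes "\<rho> > 0" "a > 0" "rJ 0 (a\<^sup>2 * \<rho>\<^sup>2 / 4) = 0 \<or> rJ 1 (a\<^sup>2 * \<rho>\<^sup>2 / 4) = 0"
  shows "zero_resonance a \<rho>"
proof -
  define \<beta> where "\<beta> = a\<^sup>2 * \<rho>\<^sup>2 / 4"
  have \<beta>: "\<beta> > 0" using assms by (simp add: \<beta>_def)
  have rc: "(norm (rcis r \<theta>))\<^sup>2 = r\<^sup>2" for r \<theta> by (simp add: rcis_def norm_mult)
  have gt: "\<not> r\<^sup>2 \<le> \<rho>\<^sup>2" if "r > \<rho>" for r
    using that assms(1) by (auto simp: abs_le_square_iff[symmetric])
  show ?thesis
  proof (cases "rJ 1 \<beta> = 0")
    case True
    define u where "u = zk 0 (\<lambda>s. if s \<le> \<rho>\<^sup>2 then rJ 0 (a\<^sup>2 * s / 4) else rJ 0 \<beta>)"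
    have "weak_solution a \<rho> 0 u" unfolding u_def
    proof (rule weak_solution_zkI[OF assms(1) rJ_scaled(1,2,3)])
      show "- (a\<^sup>2 / 4) * rJ (Suc 0) (a\<^sup>2 * \<rho>\<^sup>2 / 4) = 0" using True by (simp add: \<beta>_def)
      show "4 * (s * ((a\<^sup>2 / 4)\<^sup>2 * rJ (Suc (Suc 0)) (a\<^sup>2 * s / 4)) + real (Suc 0) * (- (a\<^sup>2 / 4) * rJ (Suc 0) (a\<^sup>2 * s / 4))) + (a\<^sup>2 + 0) * rJ 0 (a\<^sup>2 * s / 4) = 0" for s
        using rJ_scaled(4)[of s "a\<^sup>2" 0] by simp
      show "((\<lambda>_. 0) has_real_derivative 0) (at s)" for s :: real by simp
    qed (auto simp: \<beta>_def)
    moreover have "outgoing_expansion u (\<lambda>j. if j = 0 then of_real (rJ 0 \<beta>) else 0)"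
      by (rule outgoing_expansion_single[of \<rho>]) (use gt assms(1) in \<open>auto simp: u_def zk_def rc\<close>)
    moreover have "u \<noteq> (\<lambda>_. 0)"
    proof
      assume "u = (\<lambda>_. 0)"
      then have "u 0 = 0" by simp
      then show False by (simp add: u_def zk_def)
    qed
    ultimately show ?thesis unfolding zero_resonance_def zero_resonant_state_def by blast
  next
    case False
    then have J0: "rJ 0 \<beta> = 0" using assms(3) by (simp add: \<beta>_def)
    have rec: "rJ 1 \<beta> = \<beta> * rJ 2 \<beta>"
      using rJ_rec[of 0 \<beta>] J0 by (simp add: numeral_2_eq_2)
    define q where "q = \<rho>\<^sup>2 * rJ 1 \<beta>"
    define u where "u = zk 1 (\<lambda>s. if s \<le> \<rho>\<^sup>2 then rJ 1 (a\<^sup>2 * s / 4) else q / s)"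
    have "weak_solution a \<rho> 0 u" unfolding u_def
    proof (rule weak_solution_zkI[OF assms(1) rJ_scaled(1,2,3), where ?kout1.0 = "\<lambda>s. - q / s\<^sup>2" and ?kout2.0 = "\<lambda>s. 2 * q / s ^ 3"])
      show "((\<lambda>s. q / s) has_real_derivative - q / s\<^sup>2) (at s)" if "s > 0" for s
        using that by (auto intro!: derivative_eq_intros simp: power2_eq_square)
      show "((\<lambda>s. - q / s\<^sup>2) has_real_derivative 2 * q / s ^ 3) (at s)" if "s > 0" for s
        using that by (auto intro!: derivative_eq_intros simp: power2_eq_square power3_eq_cube divide_simps)
      show "continuous_on {0<..} (\<lambda>s. 2 * q / s ^ 3)" by (auto intro!: continuous_intros)
      show "rJ 1 (a\<^sup>2 * \<rho>\<^sup>2 / 4) = q / \<rho>\<^sup>2" using assms(1) by (simp add: q_def \<beta>_def)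
      show "- (a\<^sup>2 / 4) * rJ (Suc 1) (a\<^sup>2 * \<rho>\<^sup>2 / 4) = - q / (\<rho>\<^sup>2)\<^sup>2"
        unfolding q_def rec using assms(1) by (simp add: \<beta>_def numeral_2_eq_2 power2_eq_square)
      show "4 * (s * ((a\<^sup>2 / 4)\<^sup>2 * rJ (Suc (Suc 1)) (a\<^sup>2 * s / 4)) + real (Suc 1) * (- (a\<^sup>2 / 4) * rJ (Suc 1) (a\<^sup>2 * s / 4))) + (a\<^sup>2 + 0) * rJ 1 (a\<^sup>2 * s / 4) = 0" for s
        using rJ_scaled(4)[of s "a\<^sup>2" 1] by simp
      show "4 * (s * (2 * q / s ^ 3) + real (Suc 1) * (- q / s\<^sup>2)) + 0 * (q / s) = 0" if "s > 0" for s
        using that by (simp add: power2_eq_square power3_eq_cube)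
    qed
    moreover have ur: "u (rcis r \<theta>) = of_real q * complex_of_real (r powi (- \<bar>1\<bar>)) * cis (of_int 1 * \<theta>)" if "r > \<rho>" for r \<theta>
      using gt[OF that] that assms(1)
      by (simp add: u_def zk_def rc) (simp add: rcis_def power2_eq_square power_int_minus divide_simps)
    moreover from ur have "outgoing_expansion u (\<lambda>j. if j = 1 then of_real q else 0)"
      by (rule outgoing_expansion_single) (use assms(1) in auto)
    moreover have "u \<noteq> (\<lambda>_. 0)"
    proof
      assume "u = (\<lambda>_. 0)"
      then have "of_real q * complex_of_real ((2 * \<rho>) powi (- \<bar>1\<bar>)) * cis (of_int 1 * 0) = 0"
        using ur[of "2 * \<rho>" 0] assms(1) by simp
      then show False using False assms(1) by (simp add: q_def)
    qed
    ultimately show ?thesis unfolding zero_resonance_def zero_resonant_state_def by blast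
  qed
qed

subsection \<open>Scattering eigenvalues\<close>

text \<open>Up to the common factor - \<tau>^n, \<open>ampA\<close> and \<open>ampB\<close> are the
  coefficients of \<open>rJ\<close> and \<open>rY\<close> in the exterior continuation of the
  regular interior solution, see \<open>amp_match\<close>. A common real factor does not change the
  eigenvalue.\<close>

definition ampA :: "nat \<Rightarrow> real \<Rightarrow> real \<Rightarrow> real" where
  "ampA n \<tau> \<eta> = pi * (\<tau> * rJ n \<eta> * rY (Suc n) \<tau> - \<eta> * rJ (Suc n) \<eta> * rY n \<tau>)"

definition ampB :: "nat \<Rightarrow> real \<Rightarrow> real \<Rightarrow> real" where
  "ampB n \<tau> \<eta> = pi * (\<eta> * rJ n \<tau> * rJ (Suc n) \<eta> - \<tau> * rJ (Suc n) \<tau> * rJ n \<eta>)"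

text \<open>Cramer's rule for the two matching conditions at the edge; the determinant is given by
  \<open>rJ_rY_Wronskian\<close>.\<close>

lemma amp_match:
  assumes "\<tau> > 0"
  shows "- (\<tau> ^ n) * (ampA n \<tau> \<eta> * rJ n \<tau> + ampB n \<tau> \<eta> * rY n \<tau>) = rJ n \<eta>"
    and "- (\<tau> ^ n) * (\<tau> * (ampA n \<tau> \<eta> * rJ (Suc n) \<tau> + ampB n \<tau> \<eta> * rY (Suc n) \<tau>)) = \<eta> * rJ (Suc n) \<eta>"
proof -
  have W: "pi * (\<tau> ^ Suc n * (rJ (Suc n) \<tau> * rY n \<tau> - rJ n \<tau> * rY (Suc n) \<tau>)) = 1"
    unfolding rJ_rY_Wronskian[OF assms] by simp
  have "- (\<tau> ^ n) * (ampA n \<tau> \<eta> * rJ n \<tau> + ampB n \<tau> \<eta> * rY n \<tau>)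
     = rJ n \<eta> * (pi * (\<tau> ^ Suc n * (rJ (Suc n) \<tau> * rY n \<tau> - rJ n \<tau> * rY (Suc n) \<tau>)))"
    by (simp add: ampA_def ampB_def algebra_simps)
  then show "- (\<tau> ^ n) * (ampA n \<tau> \<eta> * rJ n \<tau> + ampB n \<tau> \<eta> * rY n \<tau>) = rJ n \<eta>"
    unfolding W by simp
  have "- (\<tau> ^ n) * (\<tau> * (ampA n \<tau> \<eta> * rJ (Suc n) \<tau> + ampB n \<tau> \<eta> * rY (Suc n) \<tau>))
     = \<eta> * rJ (Suc n) \<eta> * (pi * (\<tau> ^ Suc n * (rJ (Suc n) \<tau> * rY n \<tau> - rJ n \<tau> * rY (Suc n) \<tau>)))"
    by (simp add: ampA_def ampB_def algebra_simps)
  then show "- (\<tau> ^ n) * (\<tau> * (ampA n \<tau> \<eta> * rJ (Suc n) \<tau> + ampB n \<tau> \<eta> * rY (Suc n) \<tau>)) = \<eta> * rJ (Suc n) \<eta>"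
    unfolding W by simp
qed

lemma amp_not_both_0:
  assumes "\<tau> > 0" "\<eta> > 0"
  shows "ampA n \<tau> \<eta> \<noteq> 0 \<or> ampB n \<tau> \<eta> \<noteq> 0"
proof (rule ccontr)
  assume "\<not> ?thesis"
  then have "rJ n \<eta> = 0" "rJ (Suc n) \<eta> = 0"
    using amp_match[OF assms(1), of n \<eta>] assms(2) by auto
  then show False using rJ_not_both_0[OF assms(2)] by blast
qed

lemma amp_complex_nonzero:
  assumes "\<tau> > 0" "\<eta> > 0"
  shows "of_real (ampA n \<tau> \<eta>) + \<i> * of_real (ampB n \<tau> \<eta>) \<noteq> 0"
  using amp_not_both_0[OF assms, of n] by (auto simp: complex_eq_iff)

definition amp_ratio :: "nat \<Rightarrow> real \<Rightarrow> real \<Rightarrow> complex" where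
  "amp_ratio n \<tau> \<eta> = (of_real (ampA n \<tau> \<eta>) - \<i> * of_real (ampB n \<tau> \<eta>)) / (of_real (ampA n \<tau> \<eta>) + \<i> * of_real (ampB n \<tau> \<eta>))"

locale square_well =
  fixes a \<rho> \<kappa> :: real
  assumes a: "a > 0" and \<rho>: "\<rho> > 0" and \<kappa>: "\<kappa> > 0"
begin

text \<open>\<tau> and \<eta> are the values, at the edge |z| = \<rho>, of the exterior and of the
  interior Bessel variable.\<close>

definition \<tau> where "\<tau> = \<kappa>\<^sup>2 * \<rho>\<^sup>2 / 4"
definition \<eta> where "\<eta> = (a\<^sup>2 + \<kappa>\<^sup>2) * \<rho>\<^sup>2 / 4"

lemma \<tau>: "\<tau> > 0" and \<eta>: "\<eta> > 0"
  using a \<rho> \<kappa> by (auto simp: \<tau>_def \<eta>_def intro!: mult_pos_pos add_pos_pos)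

definition hJ where "hJ n s = rJ n (\<kappa>\<^sup>2 * s / 4)"
definition hY where "hY n s = rY n (\<kappa>\<^sup>2 * s / 4)"

definition cA where "cA n = - (\<tau> ^ n) * ampA n \<tau> \<eta>"
definition cB where "cB n = - (\<tau> ^ n) * ampB n \<tau> \<eta>"

definition k_in where "k_in n s = rJ n ((a\<^sup>2 + \<kappa>\<^sup>2) * s / 4)"
definition k_in1 where "k_in1 n s = - ((a\<^sup>2 + \<kappa>\<^sup>2) / 4) * rJ (Suc n) ((a\<^sup>2 + \<kappa>\<^sup>2) * s / 4)"
definition k_in2 where "k_in2 n s = ((a\<^sup>2 + \<kappa>\<^sup>2) / 4)\<^sup>2 * rJ (Suc (Suc n)) ((a\<^sup>2 + \<kappa>\<^sup>2) * s / 4)"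

definition k_out where "k_out n s = cA n * hJ n s + cB n * hY n s"
definition k_out1 where "k_out1 n s = cA n * (- (\<kappa>\<^sup>2 / 4) * hJ (Suc n) s) + cB n * (- (\<kappa>\<^sup>2 / 4) * hY (Suc n) s)"
definition k_out2 where "k_out2 n s = cA n * ((\<kappa>\<^sup>2 / 4)\<^sup>2 * hJ (Suc (Suc n)) s) + cB n * ((\<kappa>\<^sup>2 / 4)\<^sup>2 * hY (Suc (Suc n)) s)"

lemma k_in:
  shows "(k_in n has_real_derivative k_in1 n s) (at s)" "(k_in1 n has_real_derivative k_in2 n s) (at s)"
    "continuous_on UNIV (k_in2 n)" "4 * (s * k_in2 n s + of_nat (Suc n) * k_in1 n s) + (a\<^sup>2 + \<kappa>\<^sup>2) * k_in n s = 0"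
  unfolding k_in_def[abs_def] k_in1_def[abs_def] k_in2_def[abs_def] by (rule rJ_scaled)+

lemma hJ_deriv: "(hJ n has_real_derivative - (\<kappa>\<^sup>2 / 4) * hJ (Suc n) s) (at s)"
  unfolding hJ_def[abs_def] by (rule rJ_scaled)

lemma hY_deriv: "s > 0 \<Longrightarrow> (hY n has_real_derivative - (\<kappa>\<^sup>2 / 4) * hY (Suc n) s) (at s)"
  unfolding hY_def[abs_def] using \<kappa> by (intro rY_scaled) auto

lemma continuous_hJ: "continuous_on A (hJ n)"
  using DERIV_isCont[OF hJ_deriv] by (auto intro: continuous_at_imp_continuous_on)

lemma continuous_hY: "continuous_on {0<..} (hY n)"
  using DERIV_isCont[OF hY_deriv] by (simp add: continuous_at_imp_continuous_on)

lemma k_out: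
  shows "s > 0 \<Longrightarrow> (k_out n has_real_derivative k_out1 n s) (at s)"
    "s > 0 \<Longrightarrow> (k_out1 n has_real_derivative k_out2 n s) (at s)"
    "continuous_on {0<..} (k_out2 n)" "continuous_on {0<..} (k_out1 n)"
    "s > 0 \<Longrightarrow> 4 * (s * k_out2 n s + of_nat (Suc n) * k_out1 n s) + \<kappa>\<^sup>2 * k_out n s = 0"
proof -
  show "s > 0 \<Longrightarrow> (k_out n has_real_derivative k_out1 n s) (at s)"
    unfolding k_out_def[abs_def] k_out1_def by (intro DERIV_add DERIV_cmult hJ_deriv hY_deriv)
  assume s: "s > 0"
  have "(k_out1 n has_real_derivative cA n * (- (\<kappa>\<^sup>2 / 4) * (- (\<kappa>\<^sup>2 / 4) * hJ (Suc (Suc n)) s)) + cB n * (- (\<kappa>\<^sup>2 / 4) * (- (\<kappa>\<^sup>2 / 4) * hY (Suc (Suc n)) s))) (at s)"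
    unfolding k_out1_def[abs_def] by (intro DERIV_add DERIV_cmult hJ_deriv hY_deriv s)
  then show "(k_out1 n has_real_derivative k_out2 n s) (at s)"
    by (simp add: k_out2_def power2_eq_square mult.assoc)
next
  show "continuous_on {0<..} (k_out2 n)" "continuous_on {0<..} (k_out1 n)"
    unfolding k_out2_def[abs_def] k_out1_def[abs_def] by (intro continuous_intros continuous_hJ continuous_hY)+
next
  assume s: "s > 0"
  have "4 * (s * ((\<kappa>\<^sup>2 / 4)\<^sup>2 * hJ (Suc (Suc n)) s) + of_nat (Suc n) * (- (\<kappa>\<^sup>2 / 4) * hJ (Suc n) s)) + \<kappa>\<^sup>2 * hJ n s = 0"
    unfolding hJ_def by (rule rJ_scaled)
  moreover have "4 * (s * ((\<kappa>\<^sup>2 / 4)\<^sup>2 * hY (Suc (Suc n)) s) + of_nat (Suc n) * (- (\<kappa>\<^sup>2 / 4) * hY (Suc n) s)) + \<kappa>\<^sup>2 * hY n s = 0"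
    unfolding hY_def using s \<kappa> by (intro rY_scaled) auto
  moreover have "4 * (s * k_out2 n s + of_nat (Suc n) * k_out1 n s) + \<kappa>\<^sup>2 * k_out n s
     = cA n * (4 * (s * ((\<kappa>\<^sup>2 / 4)\<^sup>2 * hJ (Suc (Suc n)) s) + of_nat (Suc n) * (- (\<kappa>\<^sup>2 / 4) * hJ (Suc n) s)) + \<kappa>\<^sup>2 * hJ n s)
     + cB n * (4 * (s * ((\<kappa>\<^sup>2 / 4)\<^sup>2 * hY (Suc (Suc n)) s) + of_nat (Suc n) * (- (\<kappa>\<^sup>2 / 4) * hY (Suc n) s)) + \<kappa>\<^sup>2 * hY n s)"
    by (simp add: k_out_def k_out1_def k_out2_def algebra_simps)
  ultimately show "4 * (s * k_out2 n s + of_nat (Suc n) * k_out1 n s) + \<kappa>\<^sup>2 * k_out n s = 0" by simp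
qed

lemma k_match: "k_in n (\<rho>\<^sup>2) = k_out n (\<rho>\<^sup>2)" "k_in1 n (\<rho>\<^sup>2) = k_out1 n (\<rho>\<^sup>2)"
proof -
  have h: "hJ m (\<rho>\<^sup>2) = rJ m \<tau>" "hY m (\<rho>\<^sup>2) = rY m \<tau>" for m by (simp_all add: hJ_def hY_def \<tau>_def)
  show "k_in n (\<rho>\<^sup>2) = k_out n (\<rho>\<^sup>2)"
  proof -
    have "k_in n (\<rho>\<^sup>2) = rJ n \<eta>" by (simp add: k_in_def \<eta>_def)
    then show ?thesis
      unfolding amp_match(1)[OF \<tau>, of n \<eta>, symmetric] by (simp add: k_out_def h cA_def cB_def algebra_simps)
  qed
  have "(\<rho>\<^sup>2) * k_in1 n (\<rho>\<^sup>2) = - (\<eta> * rJ (Suc n) \<eta>)"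
    by (simp add: k_in1_def \<eta>_def)
  also have "\<dots> = (\<rho>\<^sup>2) * k_out1 n (\<rho>\<^sup>2)"
    unfolding amp_match(2)[OF \<tau>, of n \<eta>, symmetric] k_out1_def h
    by (simp add: cA_def cB_def \<tau>_def algebra_simps)
  finally show "k_in1 n (\<rho>\<^sup>2) = k_out1 n (\<rho>\<^sup>2)" using \<rho> by simp
qed

lemma hankel_eq:
  assumes "r > 0"
  shows "hankel1 (int n) (\<kappa> * r) = of_real ((\<kappa> * r / 2) ^ n) * (of_real (hJ n (r\<^sup>2)) + \<i> * of_real (hY n (r\<^sup>2)))"
    and "hankel2 (int n) (\<kappa> * r) = of_real ((\<kappa> * r / 2) ^ n) * (of_real (hJ n (r\<^sup>2)) - \<i> * of_real (hY n (r\<^sup>2)))"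
proof -
  have x: "\<kappa> * r > 0" using assms \<kappa> by simp
  have sq: "(\<kappa> * r / 2)\<^sup>2 = \<kappa>\<^sup>2 * r\<^sup>2 / 4" by (simp add: power_divide power_mult_distrib)
  have J: "bessel_J (int n) (\<kappa> * r) = (\<kappa> * r / 2) ^ n * hJ n (r\<^sup>2)"
    using bessel_J_nat_eq[of n "\<kappa> * r"] unfolding sq by (simp add: bessel_J_def hJ_def)
  have Y: "bessel_Y (int n) (\<kappa> * r) = (\<kappa> * r / 2) ^ n * hY n (r\<^sup>2)"
    using bessel_Y_nat_eq[OF x, of n] unfolding sq by (simp add: bessel_Y_def hY_def)
  show "hankel1 (int n) (\<kappa> * r) = of_real ((\<kappa> * r / 2) ^ n) * (of_real (hJ n (r\<^sup>2)) + \<i> * of_real (hY n (r\<^sup>2)))"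
    "hankel2 (int n) (\<kappa> * r) = of_real ((\<kappa> * r / 2) ^ n) * (of_real (hJ n (r\<^sup>2)) - \<i> * of_real (hY n (r\<^sup>2)))"
    unfolding hankel1_def hankel2_def J Y by (simp_all add: algebra_simps)
qed

lemma rcis_power: "rcis r \<theta> ^ n = of_real (r ^ n) * cis (of_int (int n) * \<theta>)"
  by (simp add: rcis_def power_mult_distrib Complex.DeMoivre)

lemma norm_rcis2: "(norm (rcis r \<theta>))\<^sup>2 = r\<^sup>2"
  by (simp add: rcis_def norm_mult)

lemma outside_eq:
  assumes "r > 0"
  shows "(c * hankel1 (int n) (\<kappa> * r) + d * hankel2 (int n) (\<kappa> * r)) * cis (of_int (int n) * \<theta>)
    = of_real ((\<kappa> / 2) ^ n) * rcis r \<theta> ^ n * ((c + d) * of_real (hJ n (r\<^sup>2)) + \<i> * (c - d) * of_real (hY n (r\<^sup>2)))"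
proof -
  have "(\<kappa> * r / 2) ^ n = (\<kappa> / 2) ^ n * r ^ n" by (simp add: power_mult_distrib[symmetric] mult_ac)
  then show ?thesis
    unfolding hankel_eq[OF assms] rcis_power by (simp add: algebra_simps)
qed

text \<open>The factor (2 / \<kappa>)^n undoes the (\<kappa> / 2)^n of \<open>hankel_eq\<close>.
  What remains are the solutions of c + d = \<open>cA n\<close> and i (c - d) = \<open>cB n\<close>,
  the passage between Hankel functions and the pair J, Y.\<close>

lemma partial_wave_nat_exists:
  "\<exists>u. partial_wave a \<rho> (int n) \<kappa> u (of_real ((2 / \<kappa>) ^ n) * (of_real (cA n) - \<i> * of_real (cB n)) / 2)
                               (of_real ((2 / \<kappa>) ^ n) * (of_real (cA n) + \<i> * of_real (cB n)) / 2)"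
proof -
  define K where "K = (\<lambda>s. if s \<le> \<rho>\<^sup>2 then k_in n s else k_out n s)"
  define u where "u = zk n K"
  define c d where "c = of_real ((2 / \<kappa>) ^ n) * (of_real (cA n) - \<i> * of_real (cB n)) / 2"
    and "d = of_real ((2 / \<kappa>) ^ n) * (of_real (cA n) + \<i> * of_real (cB n)) / 2"
  have p: "of_real ((\<kappa> / 2) ^ n) * complex_of_real ((2 / \<kappa>) ^ n) = 1"
    using \<kappa> by (simp flip: of_real_mult power_mult_distrib)
  have cd: "of_real ((\<kappa> / 2) ^ n) * (c + d) = of_real (cA n)" "of_real ((\<kappa> / 2) ^ n) * (\<i> * (c - d)) = of_real (cB n)"
  proof -
    have "c + d = of_real ((2 / \<kappa>) ^ n) * of_real (cA n)" "\<i> * (c - d) = of_real ((2 / \<kappa>) ^ n) * of_real (cB n)"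
      by (simp_all add: c_def d_def algebra_simps add_divide_distrib diff_divide_distrib)
    then show "of_real ((\<kappa> / 2) ^ n) * (c + d) = of_real (cA n)" "of_real ((\<kappa> / 2) ^ n) * (\<i> * (c - d)) = of_real (cB n)"
      using p by (simp_all only: mult.assoc[symmetric] mult_1)
  qed
  have "weak_solution a \<rho> (\<kappa>\<^sup>2) u"
    unfolding u_def K_def by (rule weak_solution_zkI[OF \<rho> k_in(1,2,3) k_out(1,2,3) k_match k_in(4) k_out(5)])
  \<comment> \<open>For n > 0 the value u(0) is 0, so the radial factor is examined instead: it
    tends to \<open>k_in n 0\<close> = 1 / n! at the origin.\<close>
  moreover have "u \<noteq> (\<lambda>_. 0)"
  proof
    assume 0: "u = (\<lambda>_. 0)"
    have "K s = 0" if "s > 0" for s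
    proof -
      have "u (of_real (sqrt s)) = 0" using 0 by simp
      then show ?thesis using that by (simp add: u_def zk_def)
    qed
    then have "k_in n s = 0" if "0 < s" "s < \<rho>\<^sup>2" for s
      using that by (force simp: K_def)
    moreover have "eventually (\<lambda>s. 0 < s \<and> s < \<rho>\<^sup>2) (at_right (0::real))"
      using eventually_at_right_real[of 0 "\<rho>\<^sup>2"] \<rho> by (auto elim: eventually_mono)
    ultimately have "eventually (\<lambda>s. k_in n s = 0) (at_right 0)" by (auto elim: eventually_mono)
    then have "(k_in n \<longlongrightarrow> 0) (at_right 0)" by (rule tendsto_eventually)
    moreover have "(k_in n \<longlongrightarrow> k_in n 0) (at_right 0)"
      using DERIV_isCont[OF k_in(1)[of n 0]] by (auto simp: isCont_def intro: tendsto_mono at_le)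
    ultimately have "k_in n 0 = 0" using tendsto_unique[OF trivial_limit_at_right_real] by blast
    then show False by (simp add: k_in_def)
  qed
  moreover have "\<exists>f. \<forall>r\<ge>0. \<forall>\<theta>. u (rcis r \<theta>) = f r * cis (of_int (int n) * \<theta>)"
    by (rule exI[of _ "\<lambda>r. of_real (r ^ n) * of_real (K (r\<^sup>2))"]) (simp add: u_def zk_def rcis_power norm_rcis2)
  moreover have "u (rcis r \<theta>) = (c * hankel1 (int n) (\<kappa> * r) + d * hankel2 (int n) (\<kappa> * r)) * cis (of_int (int n) * \<theta>)"
    if "r > \<rho>" for r \<theta>
  proof -
    have r: "r > 0" "\<not> r\<^sup>2 \<le> \<rho>\<^sup>2" using that \<rho> by (auto simp: abs_le_square_iff[symmetric])
    have "of_real ((\<kappa> / 2) ^ n) * rcis r \<theta> ^ n * ((c + d) * of_real (hJ n (r\<^sup>2)) + \<i> * (c - d) * of_real (hY n (r\<^sup>2)))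
      = rcis r \<theta> ^ n * ((of_real ((\<kappa> / 2) ^ n) * (c + d)) * of_real (hJ n (r\<^sup>2)) + (of_real ((\<kappa> / 2) ^ n) * (\<i> * (c - d))) * of_real (hY n (r\<^sup>2)))"
      by (simp add: algebra_simps)
    then show ?thesis
      unfolding outside_eq[OF r(1)] cd using r by (simp add: u_def zk_def norm_rcis2 K_def k_out_def)
  qed
  ultimately have "partial_wave a \<rho> (int n) \<kappa> u c d"
    unfolding partial_wave_def by blast
  then show ?thesis unfolding c_def d_def by blast
qed

lemma Wronskian_scaled:
  assumes "s > 0"
  shows "s ^ Suc n * ((\<kappa>\<^sup>2 / 4) * (hJ (Suc n) s * hY n s - hJ n s * hY (Suc n) s)) = (4 / \<kappa>\<^sup>2) ^ n / pi"
proof -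
  define t where "t = \<kappa>\<^sup>2 * s / 4"
  have t: "t > 0" using assms \<kappa> by (simp add: t_def)
  have "s = 4 / \<kappa>\<^sup>2 * t" using \<kappa> by (simp add: t_def)
  then have "s ^ Suc n * (\<kappa>\<^sup>2 / 4) = (4 / \<kappa>\<^sup>2 * t) ^ Suc n * (\<kappa>\<^sup>2 / 4)" by simp
  also have "\<dots> = (4 / \<kappa>\<^sup>2) ^ n * t ^ Suc n"
    using \<kappa> unfolding power_mult_distrib by simp
  finally have e: "s ^ Suc n * (\<kappa>\<^sup>2 / 4) = (4 / \<kappa>\<^sup>2) ^ n * t ^ Suc n" .
  have "s ^ Suc n * ((\<kappa>\<^sup>2 / 4) * (hJ (Suc n) s * hY n s - hJ n s * hY (Suc n) s))
     = (s ^ Suc n * (\<kappa>\<^sup>2 / 4)) * (rJ (Suc n) t * rY n t - rJ n t * rY (Suc n) t)"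
    by (simp add: hJ_def hY_def t_def mult_ac)
  also have "\<dots> = (4 / \<kappa>\<^sup>2) ^ n * (t ^ Suc n * (rJ (Suc n) t * rY n t - rJ n t * rY (Suc n) t))"
    unfolding e by (simp add: mult_ac)
  finally show ?thesis unfolding rJ_rY_Wronskian[OF t] by simp
qed

text \<open>Uniqueness up to scaling without solving the equation for u. Pairing u with the cut-off
  of the matched solution \<open>k_out\<close> sees only the exterior form of u and gives one linear
  relation between c + d and c - d, whose coefficients are the Wronskians of \<open>hJ\<close> and
  of \<open>hY\<close> with \<open>k_out\<close>.\<close>

lemma partial_wave_nat_ratio:
  assumes pw: "partial_wave a \<rho> (int n) \<kappa> u c d"
  shows "c / d = amp_ratio n \<tau> \<eta>"
proof -
  from pw obtain f where u: "weak_solution a \<rho> (\<kappa>\<^sup>2) u" and nz: "u \<noteq> (\<lambda>_. 0)"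
    and f: "\<And>r \<theta>. r \<ge> 0 \<Longrightarrow> u (rcis r \<theta>) = f r * cis (of_int (int n) * \<theta>)"
    and out: "\<And>r \<theta>. r > \<rho> \<Longrightarrow> u (rcis r \<theta>) = (c * hankel1 (int n) (\<kappa> * r) + d * hankel2 (int n) (\<kappa> * r)) * cis (of_int (int n) * \<theta>)"
    unfolding partial_wave_def by blast
  have out': "u z = of_real ((\<kappa> / 2) ^ n) * z ^ n * ((c + d) * of_real (hJ n ((norm z)\<^sup>2)) + \<i> * (c - d) * of_real (hY n ((norm z)\<^sup>2)))"
    if "norm z > \<rho>" for z
  proof -
    have r: "norm z > 0" using that \<rho> by linarith
    show ?thesis
      using out[OF that, of "Arg z"] unfolding outside_eq[OF r] by (simp add: rcis_cmod_Arg)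
  qed
  define c0 where "c0 = \<rho>\<^sup>2 + 1"
  have c0: "c0 > \<rho>\<^sup>2" "c0 > 0" by (auto simp: c0_def add_nonneg_pos)
  obtain \<omega> \<omega>1 \<omega>2 \<omega>3 where cut: "cutoff c0 \<omega> \<omega>1 \<omega>2 \<omega>3" using cutoff_exists by blast
  note w = cutoffD[OF cut]
  define P where "P = pairing_weight n \<omega>1 \<omega>2 (k_out n) (k_out1 n)"
  have uP: "(LINT z|lborel. u z * cnj (zk n P z)) = 0"
    unfolding P_def by (rule weak_solution_pairing[OF u \<rho> k_in(1,2,3) k_out(1,2,3) k_match k_in(4) k_out(5) c0(1) cut])
  have ck: "continuous_on {0<..} (k_out n)"
    using DERIV_isCont[OF k_out(1)] by (simp add: continuous_at_imp_continuous_on)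
  have P0: "P s = 0" if "s \<le> c0 \<or> s \<ge> c0 + 1" for s
    using that w(10-13)[of s] by (auto simp: P_def pairing_weight_def)
  define X where "X = (LINT (z::complex)|lborel. complex_of_real (\<omega>1 ((norm z)\<^sup>2)))"
  have X: "X \<noteq> 0" unfolding X_def by (rule integral_cutoff_nonzero[OF c0(2) cut])
  have int: "integrable lborel (\<lambda>z::complex. complex_of_real (((norm z)\<^sup>2) ^ n * h ((norm z)\<^sup>2) * P ((norm z)\<^sup>2)))"
    if h: "continuous_on {0<..} h" for h
  proof -
    have cP: "continuous_on UNIV (\<lambda>s. s ^ n * h s * P s)"
    proof -
      have "continuous_on UNIV (\<lambda>s. \<omega>2 s * (s ^ n * h s * (4 * s * k_out n s)) + \<omega>1 s * (s ^ n * h s * (4 * (2 * s * k_out1 n s + of_nat (Suc n) * k_out n s))))"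
        by (intro continuous_on_add continuous_cutoff[OF _ w(7) w(12) c0(2)] continuous_cutoff[OF _ w(6) w(10) c0(2)] continuous_intros ck k_out h)
      then show ?thesis unfolding P_def pairing_weight_def[abs_def] by (simp add: algebra_simps)
    qed
    have z: "(norm z)\<^sup>2 \<ge> c0 + 1" if "norm z > sqrt (c0 + 1)" for z :: complex
      using that c0(2) by (metis abs_of_nonneg less_imp_le norm_ge_zero real_sqrt_abs real_sqrt_le_iff)
    have "continuous_on UNIV (\<lambda>z::complex. (norm z)\<^sup>2)" by (intro continuous_intros)
    from continuous_on_of_real[OF continuous_on_compose2[OF cP this]]
    have cc: "continuous_on UNIV (\<lambda>z::complex. complex_of_real (((norm z)\<^sup>2) ^ n * h ((norm z)\<^sup>2) * P ((norm z)\<^sup>2)))"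
      by simp
    show ?thesis
      by (rule integral_continuous_compact_support[OF cc, of "sqrt (c0 + 1)"]) (use z P0 in simp)
  qed
  define W0 where "W0 = (4 / \<kappa>\<^sup>2) ^ n / pi"
  have W0: "W0 \<noteq> 0" using \<kappa> by (simp add: W0_def)
  have LJ: "(LINT (z::complex)|lborel. complex_of_real (((norm z)\<^sup>2) ^ n * hJ n ((norm z)\<^sup>2) * P ((norm z)\<^sup>2))) = of_real (4 * (cB n * W0)) * X"
    unfolding P_def X_def
  proof (rule integral_pairing_weight[OF _ _ _ _ _ c0(2) cut])
    show "(hJ n has_real_derivative - (\<kappa>\<^sup>2 / 4) * hJ (Suc n) s) (at s)" for s by (rule hJ_deriv)
    show "s ^ Suc n * (hJ n s * k_out1 n s - - (\<kappa>\<^sup>2 / 4) * hJ (Suc n) s * k_out n s) = cB n * W0" if "s > 0" for s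
      unfolding W0_def Wronskian_scaled[OF that, of n, symmetric] by (simp add: k_out_def k_out1_def algebra_simps)
  qed (use k_out in \<open>auto intro!: continuous_intros continuous_hJ\<close>)
  have LY: "(LINT (z::complex)|lborel. complex_of_real (((norm z)\<^sup>2) ^ n * hY n ((norm z)\<^sup>2) * P ((norm z)\<^sup>2))) = of_real (4 * (- cA n * W0)) * X"
    unfolding P_def X_def
  proof (rule integral_pairing_weight[OF _ _ _ _ _ c0(2) cut])
    show "(hY n has_real_derivative - (\<kappa>\<^sup>2 / 4) * hY (Suc n) s) (at s)" if "s > 0" for s by (rule hY_deriv[OF that])
    show "s ^ Suc n * (hY n s * k_out1 n s - - (\<kappa>\<^sup>2 / 4) * hY (Suc n) s * k_out n s) = - cA n * W0" if "s > 0" for s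
      unfolding W0_def Wronskian_scaled[OF that, of n, symmetric] by (simp add: k_out_def k_out1_def algebra_simps)
  qed (use k_out in \<open>auto intro!: continuous_intros continuous_hY\<close>)
  let ?p = "complex_of_real ((\<kappa> / 2) ^ n)"
  have eq: "u z * cnj (zk n P z) = (?p * (c + d)) * complex_of_real (((norm z)\<^sup>2) ^ n * hJ n ((norm z)\<^sup>2) * P ((norm z)\<^sup>2))
      + (?p * (\<i> * (c - d))) * complex_of_real (((norm z)\<^sup>2) ^ n * hY n ((norm z)\<^sup>2) * P ((norm z)\<^sup>2))" for z
  proof (cases "norm z > \<rho>")
    case True
    have zz: "complex_of_real (((norm z)\<^sup>2) ^ n) = z ^ n * cnj z ^ n"
      by (simp only: of_real_power[of "(norm z)\<^sup>2" n] complex_norm_square power_mult_distrib)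
    show ?thesis
      unfolding out'[OF True] of_real_mult zz zk_def by (simp add: algebra_simps)
  next
    case False
    then have "(norm z)\<^sup>2 \<le> \<rho>\<^sup>2" by (intro power_mono) auto
    then have "P ((norm z)\<^sup>2) = 0" using P0 c0(1) by simp
    then show ?thesis by (simp add: zk_def)
  qed
  have "(?p * (c + d)) * (of_real (4 * (cB n * W0)) * X) + (?p * (\<i> * (c - d))) * (of_real (4 * (- cA n * W0)) * X) = 0"
  proof -
    have L0: "(LINT (z::complex)|lborel. (?p * (c + d)) * complex_of_real (((norm z)\<^sup>2) ^ n * hJ n ((norm z)\<^sup>2) * P ((norm z)\<^sup>2))
      + (?p * (\<i> * (c - d))) * complex_of_real (((norm z)\<^sup>2) ^ n * hY n ((norm z)\<^sup>2) * P ((norm z)\<^sup>2))) = 0"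
      using uP unfolding eq .
    have ih: "integrable lborel (\<lambda>z::complex. (?p * (c + d)) * complex_of_real (((norm z)\<^sup>2) ^ n * hJ n ((norm z)\<^sup>2) * P ((norm z)\<^sup>2)))"
      "integrable lborel (\<lambda>z::complex. (?p * (\<i> * (c - d))) * complex_of_real (((norm z)\<^sup>2) ^ n * hY n ((norm z)\<^sup>2) * P ((norm z)\<^sup>2)))"
      by (intro integrable_mult_right int continuous_hJ continuous_hY)+
    show ?thesis
      using L0 unfolding Bochner_Integration.integral_add[OF ih] integral_mult_right_zero LJ LY .
  qed
  moreover have "(?p * (c + d)) * (of_real (4 * (cB n * W0)) * X) + (?p * (\<i> * (c - d))) * (of_real (4 * (- cA n * W0)) * X)
     = (- (?p * of_real (4 * W0) * X * of_real (\<tau> ^ n))) * ((c + d) * of_real (ampB n \<tau> \<eta>) - \<i> * (c - d) * of_real (ampA n \<tau> \<eta>))"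
    by (simp add: cA_def cB_def algebra_simps)
  ultimately have "(- (?p * of_real (4 * W0) * X * of_real (\<tau> ^ n))) * ((c + d) * of_real (ampB n \<tau> \<eta>) - \<i> * (c - d) * of_real (ampA n \<tau> \<eta>)) = 0"
    by (simp only:)
  moreover have "- (?p * of_real (4 * W0) * X * of_real (\<tau> ^ n)) \<noteq> 0" using X W0 \<kappa> \<tau> by simp
  ultimately have "(c + d) * of_real (ampB n \<tau> \<eta>) - \<i> * (c - d) * of_real (ampA n \<tau> \<eta>) = 0"
    using mult_eq_0_iff by blast
  then have "\<i> * ((c + d) * of_real (ampB n \<tau> \<eta>) - \<i> * (c - d) * of_real (ampA n \<tau> \<eta>)) = 0" by simp
  then have rel: "c * (of_real (ampA n \<tau> \<eta>) + \<i> * of_real (ampB n \<tau> \<eta>)) = d * (of_real (ampA n \<tau> \<eta>) - \<i> * of_real (ampB n \<tau> \<eta>))"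
    by (simp add: algebra_simps)
  note q0 = amp_complex_nonzero[OF \<tau> \<eta>, of n]
  \<comment> \<open>If d = 0, the relation makes c = 0 as well, and u would vanish outside the disc,
    which \<open>weak_solution_eq_0\<close> excludes.\<close>
  have "d \<noteq> 0"
  proof
    assume "d = 0"
    then have "c = 0" using rel q0 by simp
    then have "u z = 0" if "norm z > \<rho>" for z using out'[OF that] \<open>d = 0\<close> by simp
    from weak_solution_eq_0[OF u \<rho> this _ f] nz a show False by (simp add: add_pos_nonneg)
  qed
  then show ?thesis using rel q0 unfolding amp_ratio_def by (simp add: divide_simps)
qed

text \<open>Conjugation swaps the two Hankel functions and also l and -l; the sign is that of J_{-l}
  = (-1)^l J_l and of the same rule for Y.\<close>

lemma partial_wave_cnj:
  assumes "partial_wave a \<rho> l \<kappa> u c d"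
  shows "partial_wave a \<rho> (- l) \<kappa> (\<lambda>z. cnj (u z)) ((-1) ^ nat \<bar>l\<bar> * cnj d) ((-1) ^ nat \<bar>l\<bar> * cnj c)"
proof -
  from assms obtain f where u: "weak_solution a \<rho> (\<kappa>\<^sup>2) u" and nz: "u \<noteq> (\<lambda>_. 0)"
    and f: "\<And>r \<theta>. r \<ge> 0 \<Longrightarrow> u (rcis r \<theta>) = f r * cis (of_int l * \<theta>)"
    and out: "\<And>r \<theta>. r > \<rho> \<Longrightarrow> u (rcis r \<theta>) = (c * hankel1 l (\<kappa> * r) + d * hankel2 l (\<kappa> * r)) * cis (of_int l * \<theta>)"
    unfolding partial_wave_def by blast
  have J: "bessel_J l x = (-1) ^ nat \<bar>l\<bar> * bessel_J (- l) x" and Y: "bessel_Y l x = (-1) ^ nat \<bar>l\<bar> * bessel_Y (- l) x" for x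
    by (cases "l = 0"; auto simp: bessel_J_def bessel_Y_def mult.assoc[symmetric] simp flip: power_mult_distrib)+
  have h: "cnj (hankel1 l x) = (-1) ^ nat \<bar>l\<bar> * hankel2 (- l) x" "cnj (hankel2 l x) = (-1) ^ nat \<bar>l\<bar> * hankel1 (- l) x" for x
    by (simp_all add: hankel1_def hankel2_def J Y algebra_simps)
  have "\<exists>f. \<forall>r\<ge>0. \<forall>\<theta>. cnj (u (rcis r \<theta>)) = f r * cis (of_int (- l) * \<theta>)"
    by (rule exI[of _ "\<lambda>r. cnj (f r)"]) (simp add: f cis_cnj)
  moreover have "cnj (u (rcis r \<theta>)) = ((-1) ^ nat \<bar>l\<bar> * cnj d * hankel1 (- l) (\<kappa> * r) + (-1) ^ nat \<bar>l\<bar> * cnj c * hankel2 (- l) (\<kappa> * r)) * cis (of_int (- l) * \<theta>)"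
    if "r > \<rho>" for r \<theta>
    unfolding out[OF that] by (simp add: h cis_cnj algebra_simps)
  ultimately show ?thesis
    using weak_solution_cnj[OF u] nz unfolding partial_wave_def by (auto simp: fun_eq_iff)
qed

lemma amp_ratio_mult_cnj: "amp_ratio n \<tau> \<eta> * cnj (amp_ratio n \<tau> \<eta>) = 1"
proof -
  define q where "q = of_real (ampA n \<tau> \<eta>) + \<i> * complex_of_real (ampB n \<tau> \<eta>)"
  have "q \<noteq> 0" unfolding q_def by (rule amp_complex_nonzero[OF \<tau> \<eta>])
  moreover have "amp_ratio n \<tau> \<eta> = cnj q / q" by (simp add: amp_ratio_def q_def)
  ultimately show ?thesis by simp
qed

theorem scattering_eigenvalue_eq: "scattering_eigenvalue a \<rho> l \<kappa> = amp_ratio (nat \<bar>l\<bar>) \<tau> \<eta>"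
proof -
  have ratio: "c / d = amp_ratio (nat \<bar>l\<bar>) \<tau> \<eta>" if "partial_wave a \<rho> l \<kappa> u c d" for u c d
  proof (cases "l \<ge> 0")
    case True
    then show ?thesis using partial_wave_nat_ratio[of "nat l" u c d] that by simp
  next
    case False
    \<comment> \<open>Conjugation yields the reciprocal of the conjugate ratio, and this is the
      ratio itself since its modulus is one.\<close>
    then have "- l = int (nat \<bar>l\<bar>)" by simp
    then have "(-1) ^ nat \<bar>l\<bar> * cnj d / ((-1) ^ nat \<bar>l\<bar> * cnj c) = amp_ratio (nat \<bar>l\<bar>) \<tau> \<eta>"
      using partial_wave_nat_ratio partial_wave_cnj[OF that] by metis
    then have "cnj (d / c) = amp_ratio (nat \<bar>l\<bar>) \<tau> \<eta>" by simp
    then have "d / c = cnj (amp_ratio (nat \<bar>l\<bar>) \<tau> \<eta>)" by (metis complex_cnj_cnj)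
    then have "c / d = inverse (cnj (amp_ratio (nat \<bar>l\<bar>) \<tau> \<eta>))" by (metis inverse_divide)
    then show ?thesis using amp_ratio_mult_cnj[of "nat \<bar>l\<bar>"] by (metis inverse_unique mult.commute)
  qed
  have ex: "\<exists>u c d. partial_wave a \<rho> l \<kappa> u c d"
  proof (cases "l \<ge> 0")
    case True
    then show ?thesis using partial_wave_nat_exists[of "nat l"] by auto
  next
    case False
    then have l: "l = - int (nat \<bar>l\<bar>)" by simp
    show ?thesis using partial_wave_nat_exists[of "nat \<bar>l\<bar>"] partial_wave_cnj l by metis
  qed
  show ?thesis
    unfolding scattering_eigenvalue_def
  proof (rule the_equality)
    show "\<exists>u c d. partial_wave a \<rho> l \<kappa> u c d \<and> amp_ratio (nat \<bar>l\<bar>) \<tau> \<eta> = c / d"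
      using ex ratio by metis
  qed (use ratio in metis)
qed

end

subsection \<open>Derivatives of phases\<close>

lemma exp_2pi_i_eq_1_small:
  assumes "exp (2 * complex_of_real pi * \<i> * complex_of_real x) = 1" "\<bar>x\<bar> < 1"
  shows "x = 0"
proof -
  from assms(1) obtain k :: int where "2 * pi * x = of_int (2 * k) * pi"
    unfolding exp_eq_1 by auto
  then have "x = of_int k" by simp
  with assms(2) show ?thesis by simp
qed

text \<open>A continuous phase of \<open>cnj q / q\<close> is, locally and up to a constant, \<open>- arg q / pi\<close>.\<close>

lemma phase_has_derivative:
  fixes A B g :: "real \<Rightarrow> real"
  assumes g: "continuous (at x) g"
    and S: "eventually (\<lambda>y. exp (2 * complex_of_real pi * \<i> * complex_of_real (g y)) = (of_real (A y) - \<i> * of_real (B y)) / (of_real (A y) + \<i> * of_real (B y))) (nhds x)"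
    and AB: "(A has_real_derivative A') (at x)" "(B has_real_derivative B') (at x)"
    and nz: "A x \<noteq> 0 \<or> B x \<noteq> 0"
  shows "(g has_real_derivative - (A x * B' - A' * B x) / (pi * ((A x)\<^sup>2 + (B x)\<^sup>2))) (at x)"
proof -
  define q where "q = (\<lambda>y. complex_of_real (A y) + \<i> * of_real (B y))"
  have q0: "q x \<noteq> 0" using nz by (auto simp: q_def complex_eq_iff)
  have dq: "(q has_vector_derivative (of_real A' + \<i> * of_real B')) (at x)"
    unfolding q_def
    by (intro has_vector_derivative_add has_vector_derivative_mult_right has_vector_derivative_of_real AB)
  \<comment> \<open>Division by \<open>q x\<close> keeps the argument of \<open>Ln\<close> near 1,
    away from the branch cut.\<close>
  define \<theta> where "\<theta> = (\<lambda>y. Im (Ln (q y / q x)))"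
  have dL: "((\<lambda>y. Ln (q y / q x)) has_vector_derivative (of_real A' + \<i> * of_real B') / q x) (at x)"
  proof -
    have 1: "((\<lambda>y. q y / q x) has_vector_derivative (of_real A' + \<i> * of_real B') / q x) (at x)"
      using has_vector_derivative_mult_left[OF dq, of "1 / q x"] by simp
    have "(Ln has_field_derivative inverse 1) (at (q x / q x))"
      using q0 has_field_derivative_Ln[of 1] by simp
    from field_vector_diff_chain_at[OF 1 this] show ?thesis by (simp add: o_def)
  qed
  have d\<theta>: "(\<theta> has_real_derivative (A x * B' - A' * B x) / ((A x)\<^sup>2 + (B x)\<^sup>2)) (at x)"
  proof -
    have "(\<theta> has_vector_derivative Im ((of_real A' + \<i> * of_real B') / q x)) (at x)"
      unfolding \<theta>_def by (rule bounded_linear.has_vector_derivative[OF bounded_linear_Im dL])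
    moreover have "Im ((of_real A' + \<i> * of_real B') / q x) = (A x * B' - A' * B x) / ((A x)\<^sup>2 + (B x)\<^sup>2)"
      by (simp add: q_def Im_divide power2_eq_square algebra_simps)
    ultimately show ?thesis by (simp add: has_real_derivative_iff_has_vector_derivative)
  qed
  have \<theta>0: "\<theta> x = 0" using q0 by (simp add: \<theta>_def)
  have cq: "continuous (at x) q" using dq has_vector_derivative_continuous by blast
  have "((\<lambda>y. q y) \<longlongrightarrow> q x) (nhds x)" using cq by (simp add: isCont_def tendsto_at_iff_tendsto_nhds)
  then have evq: "eventually (\<lambda>y. q y \<noteq> 0) (nhds x)"
    using q0 by (rule tendsto_imp_eventually_ne)
  have c\<theta>: "(\<theta> \<longlongrightarrow> \<theta> x) (nhds x)"
    using DERIV_isCont[OF d\<theta>] by (simp add: isCont_def tendsto_at_iff_tendsto_nhds)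
  have cg: "(g \<longlongrightarrow> g x) (nhds x)"
    using g by (simp add: isCont_def tendsto_at_iff_tendsto_nhds)
  \<comment> \<open>This combination is continuous, vanishes at x and takes integer values near x,
    so it vanishes near x.\<close>
  have "((\<lambda>y. g y - g x + \<theta> y / pi) \<longlongrightarrow> g x - g x + \<theta> x / pi) (nhds x)"
    by (intro tendsto_intros cg c\<theta>) simp
  then have "((\<lambda>y. \<bar>g y - g x + \<theta> y / pi\<bar>) \<longlongrightarrow> \<bar>0\<bar>) (nhds x)"
    by (intro tendsto_rabs) (simp add: \<theta>0)
  then have small: "eventually (\<lambda>y. \<bar>g y - g x + \<theta> y / pi\<bar> < 1) (nhds x)"
    by (rule order_tendstoD(2)) simp
  have "eventually (\<lambda>y. g y = g x - \<theta> y / pi) (nhds x)"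
    using small S evq
  proof eventually_elim
    case (elim y)
    let ?e = "\<lambda>t. exp (2 * complex_of_real pi * \<i> * complex_of_real t)"
    have S': "?e (g y) = cnj (q y) / q y" using elim(2) by (simp add: q_def)
    have Sx: "?e (g x) = cnj (q x) / q x"
      using eventually_nhds_x_imp_x[OF S] by (simp add: q_def)
    define L where "L = Ln (q y / q x)"
    have eL: "exp L = q y / q x" unfolding L_def using elim(3) q0 by simp
    have "2 * \<i> * complex_of_real (Im L) = L - cnj L" by (simp add: complex_eq_iff)
    then have "exp (2 * \<i> * complex_of_real (Im L)) = exp L / cnj (exp L)"
      by (simp add: exp_diff exp_cnj)
    then have E: "?e (\<theta> y / pi) = (q y / q x) / cnj (q y / q x)"
      unfolding eL[symmetric] by (simp add: \<theta>_def L_def mult_ac)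
    have "?e (g y - g x + \<theta> y / pi) = ?e (g y) / ?e (g x) * ?e (\<theta> y / pi)"
      by (simp add: exp_diff exp_add algebra_simps)
    also have "\<dots> = 1"
      unfolding S' Sx E using elim(3) q0 by (simp add: field_simps)
    finally have "g y - g x + \<theta> y / pi = 0"
      using elim(1) by (intro exp_2pi_i_eq_1_small) auto
    then show ?case by simp
  qed
  then have ev: "eventually (\<lambda>y. g x - \<theta> y / pi = g y) (nhds x)" by (auto elim: eventually_mono)
  have "((\<lambda>y. g x - \<theta> y / pi) has_real_derivative 0 - (A x * B' - A' * B x) / ((A x)\<^sup>2 + (B x)\<^sup>2) / pi) (at x)"
    by (intro DERIV_diff DERIV_const DERIV_cdivide d\<theta>)
  then have "(g has_real_derivative 0 - (A x * B' - A' * B x) / ((A x)\<^sup>2 + (B x)\<^sup>2) / pi) (at x)"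
    using DERIV_cong_ev[OF refl ev refl] by simp
  moreover have "0 - X / D / pi = - X / (pi * D)" for X D :: real by (simp add: mult.commute)
  ultimately show ?thesis by (simp only:)
qed

text \<open>The energy moves \<tau> and \<eta> together, with \<eta> - \<tau> = \<beta> fixed.
  Differentiation raises the order, and the recurrences bring order n + 2 back to n and n + 1; only
  terms with a factor \<beta> or n remain.\<close>

lemma amp_deriv:
  assumes "\<tau> > 0"
  shows "((\<lambda>\<tau>. ampA n \<tau> (\<tau> + \<beta>)) has_real_derivative
      pi * (\<beta> * rJ (Suc n) (\<tau> + \<beta>) * rY (Suc n) \<tau> - of_nat n * rJ n (\<tau> + \<beta>) * rY (Suc n) \<tau> + of_nat n * rJ (Suc n) (\<tau> + \<beta>) * rY n \<tau>)) (at \<tau>)"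
    and "((\<lambda>\<tau>. ampB n \<tau> (\<tau> + \<beta>)) has_real_derivative
      - pi * (\<beta> * rJ (Suc n) (\<tau> + \<beta>) * rJ (Suc n) \<tau> - of_nat n * rJ n (\<tau> + \<beta>) * rJ (Suc n) \<tau> + of_nat n * rJ (Suc n) (\<tau> + \<beta>) * rJ n \<tau>)) (at \<tau>)"
proof -
  have J: "rJ n t = of_nat (Suc n) * rJ (Suc n) t - t * rJ (Suc (Suc n)) t" for t
    using rJ_rec[of n t] by linarith
  have Y: "rY n \<tau> = of_nat (Suc n) * rY (Suc n) \<tau> - \<tau> * rY (Suc (Suc n)) \<tau>"
    using rY_rec[OF assms, of n] by linarith
  have JE: "(\<tau> + \<beta>) * rJ (Suc (Suc n)) (\<tau> + \<beta>) = (1 + real n) * rJ (Suc n) (\<tau> + \<beta>) - rJ n (\<tau> + \<beta>)"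
    and JT: "\<tau> * rJ (Suc (Suc n)) \<tau> = (1 + real n) * rJ (Suc n) \<tau> - rJ n \<tau>"
    and YT: "\<tau> * rY (Suc (Suc n)) \<tau> = (1 + real n) * rY (Suc n) \<tau> - rY n \<tau>"
    using J[of "\<tau> + \<beta>"] J[of \<tau>] Y by (simp_all add: algebra_simps)
  have e: "((\<lambda>\<tau>. rJ m (\<tau> + \<beta>)) has_real_derivative - rJ (Suc m) (\<tau> + \<beta>)) (at \<tau>)" for m
    using DERIV_shift[of "rJ m" "- rJ (Suc m) (\<tau> + \<beta>)" \<tau> \<beta>] rJ_deriv by simp
  have i: "((\<lambda>\<tau>. \<tau> + \<beta>) has_real_derivative 1) (at \<tau>)" by (auto intro!: derivative_eq_intros)
  show "((\<lambda>\<tau>. ampA n \<tau> (\<tau> + \<beta>)) has_real_derivative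
      pi * (\<beta> * rJ (Suc n) (\<tau> + \<beta>) * rY (Suc n) \<tau> - of_nat n * rJ n (\<tau> + \<beta>) * rY (Suc n) \<tau> + of_nat n * rJ (Suc n) (\<tau> + \<beta>) * rY n \<tau>)) (at \<tau>)"
    unfolding ampA_def
    by (rule DERIV_cong[OF DERIV_cmult[OF DERIV_diff[OF DERIV_mult[OF DERIV_mult[OF DERIV_ident e] rY_deriv[OF assms]]
            DERIV_mult[OF DERIV_mult[OF i e] rY_deriv[OF assms]]]]])
       (use JE YT in algebra)
  show "((\<lambda>\<tau>. ampB n \<tau> (\<tau> + \<beta>)) has_real_derivative
      - pi * (\<beta> * rJ (Suc n) (\<tau> + \<beta>) * rJ (Suc n) \<tau> - of_nat n * rJ n (\<tau> + \<beta>) * rJ (Suc n) \<tau> + of_nat n * rJ (Suc n) (\<tau> + \<beta>) * rJ n \<tau>)) (at \<tau>)"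
    unfolding ampB_def
    by (rule DERIV_cong[OF DERIV_cmult[OF DERIV_diff[OF DERIV_mult[OF DERIV_mult[OF i rJ_deriv] e]
            DERIV_mult[OF DERIV_mult[OF DERIV_ident rJ_deriv] e]]]])
       (use JE JT in algebra)
qed

text \<open>The amplitude A and minus the amplitude B are the same expression in a solution at
  \<tau>, taken at \<open>rY\<close> and at \<open>rJ\<close>. So their Wronskian is a multiple of
  that of \<open>rJ\<close> and \<open>rY\<close>, and only quantities at \<eta> remain.\<close>

lemma amp_Wronskian:
  fixes \<tau> \<beta> :: real and n :: nat
  defines "\<eta> \<equiv> \<tau> + \<beta>"
  assumes "\<tau> > 0"
  shows "\<tau> ^ Suc n * (ampA n \<tau> \<eta> * (- pi * (\<beta> * rJ (Suc n) \<eta> * rJ (Suc n) \<tau> - of_nat n * rJ n \<eta> * rJ (Suc n) \<tau> + of_nat n * rJ (Suc n) \<eta> * rJ n \<tau>))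
      - (pi * (\<beta> * rJ (Suc n) \<eta> * rY (Suc n) \<tau> - of_nat n * rJ n \<eta> * rY (Suc n) \<tau> + of_nat n * rJ (Suc n) \<eta> * rY n \<tau>)) * ampB n \<tau> \<eta>)
    = - pi * (\<beta> * rJ (Suc n) \<eta> * (of_nat n * rJ n \<eta> - \<eta> * rJ (Suc n) \<eta>))"
proof -
  define F G J J1 Y Y1 N where "F = rJ (Suc n) \<eta>" "G = rJ n \<eta>" "J = rJ n \<tau>" "J1 = rJ (Suc n) \<tau>" "Y = rY n \<tau>" "Y1 = rY (Suc n) \<tau>" "N = real n"
  note d = this
  have W: "\<tau> ^ Suc n * (J1 * Y - J * Y1) = 1 / pi"
    unfolding d by (rule rJ_rY_Wronskian[OF assms(2)])
  have "ampA n \<tau> \<eta> * (- pi * (\<beta> * F * J1 - N * G * J1 + N * F * J)) - (pi * (\<beta> * F * Y1 - N * G * Y1 + N * F * Y)) * ampB n \<tau> \<eta>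
     = - pi\<^sup>2 * (\<beta> * F * (N * G - \<eta> * F)) * (J1 * Y - J * Y1)"
    unfolding ampA_def ampB_def d(1-6)[symmetric]
    by (simp add: \<eta>_def power2_eq_square algebra_simps)
  then have "\<tau> ^ Suc n * (ampA n \<tau> \<eta> * (- pi * (\<beta> * F * J1 - N * G * J1 + N * F * J)) - (pi * (\<beta> * F * Y1 - N * G * Y1 + N * F * Y)) * ampB n \<tau> \<eta>)
     = - pi\<^sup>2 * (\<beta> * F * (N * G - \<eta> * F)) * (\<tau> ^ Suc n * (J1 * Y - J * Y1))"
    by (simp only: mult_ac)
  also have "\<dots> = - pi * (\<beta> * F * (N * G - \<eta> * F))"
    unfolding W by (simp add: power2_eq_square)
  finally show ?thesis unfolding d .
qed

subsection \<open>Low-energy asymptotics of the partial phases\<close>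

text \<open>This is \<kappa> times the \<kappa>-derivative of the partial phase of order n, see
  \<open>partial_phase_deriv\<close>; the factor 2 comes from \<kappa> d\<tau>/d\<kappa> = 2
  \<tau>.\<close>

definition phase_term :: "real \<Rightarrow> nat \<Rightarrow> real \<Rightarrow> real" where
  "phase_term \<beta> n \<tau> = 2 * \<beta> * rJ (Suc n) (\<tau> + \<beta>) * (of_nat n * rJ n (\<tau> + \<beta>) - (\<tau> + \<beta>) * rJ (Suc n) (\<tau> + \<beta>))
     / (\<tau> ^ n * ((ampA n \<tau> (\<tau> + \<beta>))\<^sup>2 + (ampB n \<tau> (\<tau> + \<beta>))\<^sup>2))"

text \<open>Lowering the orders exhibits \<open>rJ m \<eta>\<close> as the coefficient of the most
  singular factor \<open>rY (Suc m) \<tau>\<close>; its vanishing at \<beta> is what makes the order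
  m + 1 resonant.\<close>

lemma ampA_Suc:
  assumes "\<tau> > 0"
  shows "ampA (Suc m) \<tau> \<eta> = pi * (rJ m \<eta> * rY (Suc m) \<tau> - rJ (Suc m) \<eta> * rY m \<tau>)"
proof -
  have Y: "\<tau> * rY (Suc (Suc m)) \<tau> = of_nat (Suc m) * rY (Suc m) \<tau> - rY m \<tau>"
    using rY_rec[OF assms, of m] by linarith
  have J: "\<eta> * rJ (Suc (Suc m)) \<eta> = of_nat (Suc m) * rJ (Suc m) \<eta> - rJ m \<eta>"
    using rJ_rec[of m \<eta>] by linarith
  have "ampA (Suc m) \<tau> \<eta> = pi * (rJ (Suc m) \<eta> * (\<tau> * rY (Suc (Suc m)) \<tau>) - (\<eta> * rJ (Suc (Suc m)) \<eta>) * rY (Suc m) \<tau>)"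
    by (simp add: ampA_def mult_ac)
  then show ?thesis unfolding Y J by (simp add: algebra_simps)
qed

lemma phase_term_Suc:
  "phase_term \<beta> (Suc m) \<tau> = 2 * \<beta> * rJ (Suc (Suc m)) (\<tau> + \<beta>) * rJ m (\<tau> + \<beta>)
     / (\<tau> ^ Suc m * ((ampA (Suc m) \<tau> (\<tau> + \<beta>))\<^sup>2 + (ampB (Suc m) \<tau> (\<tau> + \<beta>))\<^sup>2))"
proof -
  have "of_nat (Suc m) * rJ (Suc m) (\<tau> + \<beta>) - (\<tau> + \<beta>) * rJ (Suc (Suc m)) (\<tau> + \<beta>) = rJ m (\<tau> + \<beta>)"
    using rJ_rec[of m "\<tau> + \<beta>"] by linarith
  then show ?thesis unfolding phase_term_def by simp
qed

section \<open>Growth of the singular solutions, uniformly in the order\<close>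

text \<open>The sign makes all orders positive for small \<tau>.\<close>

definition uY :: "nat \<Rightarrow> real \<Rightarrow> real" where "uY n \<tau> = - (pi * rY n \<tau>)"

lemma uY_0_tendsto: "filterlim (uY 0) at_top (at_right 0)"
proof -
  have "((\<lambda>t. pi * rY 0 t - (ln t + 2 * euler_mascheroni)) \<longlongrightarrow> 0) (at_right 0)"
    by (rule tendsto_0_bigo[OF rY_0_bigo t_ln_tendsto])
  then have "((\<lambda>t. - (pi * rY 0 t - (ln t + 2 * euler_mascheroni))) \<longlongrightarrow> - 0) (at_right 0)"
    by (rule tendsto_minus)
  moreover have "filterlim (\<lambda>t::real. - (ln t + 2 * euler_mascheroni)) at_top (at_right 0)"
    by real_asymp
  ultimately have "filterlim (\<lambda>t. - (pi * rY 0 t - (ln t + 2 * euler_mascheroni)) + - (ln t + 2 * euler_mascheroni)) at_top (at_right 0)"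
    by (rule filterlim_tendsto_add_at_top)
  then show ?thesis by (simp add: uY_def[abs_def])
qed

lemma t_uY_0_tendsto: "((\<lambda>t. t * uY 0 t) \<longlongrightarrow> 0) (at_right 0)"
proof -
  have "((\<lambda>t. t * (pi * rY 0 t - (ln t + 2 * euler_mascheroni)) + t * (ln t + 2 * euler_mascheroni)) \<longlongrightarrow> 0 * 0 + 0) (at_right 0)"
  proof (intro tendsto_add tendsto_mult)
    show "((\<lambda>t. pi * rY 0 t - (ln t + 2 * euler_mascheroni)) \<longlongrightarrow> 0) (at_right 0)"
      by (rule tendsto_0_bigo[OF rY_0_bigo t_ln_tendsto])
    show "((\<lambda>t::real. t * (ln t + 2 * euler_mascheroni)) \<longlongrightarrow> 0) (at_right 0)" by real_asymp
  qed (auto intro!: tendsto_eq_intros)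
  from tendsto_minus[OF this] show ?thesis by (simp add: uY_def algebra_simps)
qed

lemma t_uY_1_tendsto: "((\<lambda>t. t * uY 1 t) \<longlongrightarrow> 1) (at_right 0)"
proof -
  have "((\<lambda>t. pi * (t * rY 1 t)) \<longlongrightarrow> -1) (at_right 0)"
    by (rule tendsto_if_bigo_diff[OF _ t_ln_tendsto]) (use rY_1_bigo in simp)
  from tendsto_minus[OF this] show ?thesis by (simp add: uY_def mult_ac)
qed

lemma uY_rec:
  assumes "\<tau> > 0"
  shows "uY (Suc (Suc n)) \<tau> = (of_nat (Suc n) * uY (Suc n) \<tau> - uY n \<tau>) / \<tau>"
proof -
  have Y: "\<tau> * rY (Suc (Suc n)) \<tau> = of_nat (Suc n) * rY (Suc n) \<tau> - rY n \<tau>"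
    using rY_rec[OF assms, of n] by linarith
  have "uY (Suc (Suc n)) \<tau> = - pi * (\<tau> * rY (Suc (Suc n)) \<tau>) / \<tau>"
    using assms by (simp add: uY_def)
  then show ?thesis unfolding Y uY_def by (simp add: algebra_simps)
qed

text \<open>A condition on orders 0 and 1 only, from which the recurrence propagates bounds to all
  orders at once; the sum over n needs this uniformity. The bound 1 / 8 keeps the ratio 4 \<tau> of
  the tail estimate below 1 / 2.\<close>

definition uY_small :: "real \<Rightarrow> bool" where
  "uY_small \<tau> \<longleftrightarrow> 0 < \<tau> \<and> \<tau> < 1 / 8 \<and> uY 0 \<tau> > 1 \<and> uY 1 \<tau> \<ge> 2 * uY 0 \<tau> \<and> uY 1 \<tau> \<ge> 1 / (2 * \<tau>)"

lemma eventually_uY_small: "eventually uY_small (at_right 0)"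
proof -
  have "eventually (\<lambda>t. uY 0 t > 1) (at_right 0)"
    using uY_0_tendsto by (simp add: filterlim_at_top_dense)
  moreover have "eventually (\<lambda>t. t * uY 1 t > 1 / 2) (at_right 0)"
    using t_uY_1_tendsto by (rule order_tendstoD) simp
  moreover have "eventually (\<lambda>t. t * uY 0 t < 1 / 4) (at_right 0)"
    using t_uY_0_tendsto by (rule order_tendstoD) simp
  moreover have "eventually (\<lambda>t. t \<in> {0<..<1/8}) (at_right (0::real))"
    by (rule eventually_at_right_real) simp
  ultimately show ?thesis
  proof eventually_elim
    case (elim t)
    then have t: "t > 0" "t < 1 / 8" by auto
    have "t * (2 * uY 0 t) \<le> t * uY 1 t" using elim by linarith
    then have "2 * uY 0 t \<le> uY 1 t" using t by simp
    moreover have "uY 1 t \<ge> 1 / (2 * t)" using elim t by (simp add: field_simps)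
    ultimately show ?case using elim t by (simp add: uY_small_def)
  qed
qed

text \<open>As \<open>uY n \<tau>\<close> is at most half of \<open>uY (Suc n) \<tau>\<close>, at
  least half of the leading term of \<open>uY_rec\<close> survives the subtraction, and the division
  by \<tau> gives the factor 1 / (2 \<tau>).\<close>

lemma uY_growth:
  assumes "uY_small \<tau>"
  shows "uY (Suc n) \<tau> \<ge> 2 * uY n \<tau> \<and> uY n \<tau> > 0"
    and "uY (Suc (Suc n)) \<tau> \<ge> uY (Suc n) \<tau> / (2 * \<tau>)"
    and "uY (Suc n) \<tau> \<ge> (1 / (2 * \<tau>)) ^ Suc n"
proof -
  from assms have t: "\<tau> > 0" "\<tau> < 1 / 8" and u0: "uY 0 \<tau> > 1" "uY 1 \<tau> \<ge> 2 * uY 0 \<tau>" "uY 1 \<tau> \<ge> 1 / (2 * \<tau>)"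
    by (auto simp: uY_small_def)
  have step: "uY (Suc (Suc n)) \<tau> \<ge> uY (Suc n) \<tau> / (2 * \<tau>)" if "uY (Suc n) \<tau> \<ge> 2 * uY n \<tau>" "uY n \<tau> > 0" for n
  proof -
    have "1 * uY (Suc n) \<tau> \<le> of_nat (Suc n) * uY (Suc n) \<tau>"
      using that by (intro mult_right_mono) auto
    then have "uY (Suc n) \<tau> / 2 \<le> of_nat (Suc n) * uY (Suc n) \<tau> - uY n \<tau>"
      using that by linarith
    then have "uY (Suc n) \<tau> / 2 / \<tau> \<le> uY (Suc (Suc n)) \<tau>"
      unfolding uY_rec[OF t(1)] using t by (intro divide_right_mono) auto
    then show ?thesis by simp
  qed
  have ind: "uY (Suc n) \<tau> \<ge> 2 * uY n \<tau> \<and> uY n \<tau> > 0" for n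
  proof (induction n)
    case 0
    then show ?case using u0 by simp
  next
    case (Suc n)
    then have p: "uY (Suc n) \<tau> > 0" by linarith
    have "2 * uY (Suc n) \<tau> \<le> uY (Suc n) \<tau> / (2 * \<tau>)" using p t by (simp add: field_simps)
    then show ?case using step[of n] Suc p by linarith
  qed
  then show "uY (Suc n) \<tau> \<ge> 2 * uY n \<tau> \<and> uY n \<tau> > 0" .
  show st: "uY (Suc (Suc n)) \<tau> \<ge> uY (Suc n) \<tau> / (2 * \<tau>)" for n using step ind by blast
  show "uY (Suc n) \<tau> \<ge> (1 / (2 * \<tau>)) ^ Suc n"
  proof (induction n)
    case 0
    then show ?case using u0 by simp
  next
    case (Suc n)
    have "(1 / (2 * \<tau>)) ^ Suc (Suc n) = (1 / (2 * \<tau>)) ^ Suc n / (2 * \<tau>)" by simp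
    also have "\<dots> \<le> uY (Suc n) \<tau> / (2 * \<tau>)" using Suc t by (intro divide_right_mono) auto
    also have "\<dots> \<le> uY (Suc (Suc n)) \<tau>" by (rule st)
    finally show ?case .
  qed
qed

lemma ampA_Suc_uY:
  assumes "\<tau> > 0"
  shows "ampA (Suc m) \<tau> \<eta> = - (rJ m \<eta> * uY (Suc m) \<tau> - rJ (Suc m) \<eta> * uY m \<tau>)"
  unfolding ampA_Suc[OF assms] by (simp add: uY_def algebra_simps)

text \<open>Relative to the leading coefficient 1 / n! the remainder is at most exp |t| / (n + 1),
  hence small for large orders, uniformly for bounded t.\<close>

lemma rJ_bound: "\<bar>rJ n t - 1 / fact n\<bar> \<le> exp \<bar>t\<bar> / (fact n * real (Suc n))"
proof -
  let ?c = "\<lambda>k. (-1) ^ k / (fact k * fact (n + k)) * t ^ k :: real"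
  have "(\<lambda>k. ?c (Suc k)) sums (rJ n t - ?c 0)"
    using summable_sums[OF summable_rJ[of n t]] unfolding rJ_def by (subst sums_Suc_iff) simp
  then have s: "(\<Sum>k. ?c (Suc k)) = rJ n t - 1 / fact n" using sums_unique by fastforce
  have e: "(\<lambda>k. \<bar>t\<bar> ^ k / fact k) sums exp \<bar>t\<bar>"
    using exp_converges[of "\<bar>t\<bar>"] by (simp add: field_simps)
  define E where "E = 1 / (fact n * real (Suc n))"
  have b: "norm (?c (Suc k)) \<le> E * (\<bar>t\<bar> ^ Suc k / fact (Suc k))" for k
  proof -
    have "fact n * real (Suc n) \<le> fact (n + Suc k)"
      using fact_mono[of "Suc n" "n + Suc k", where 'a = real] by (simp add: mult.commute)
    then have "1 / fact (n + Suc k) \<le> E" unfolding E_def by (intro divide_left_mono) auto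
    then have "1 / fact (n + Suc k) * (\<bar>t\<bar> ^ Suc k / fact (Suc k)) \<le> E * (\<bar>t\<bar> ^ Suc k / fact (Suc k))"
      by (intro mult_right_mono) auto
    moreover have "norm (?c (Suc k)) = 1 / fact (n + Suc k) * (\<bar>t\<bar> ^ Suc k / fact (Suc k))"
      by (simp add: abs_mult power_abs)
    ultimately show ?thesis by simp
  qed
  have se: "(\<lambda>k. E * (\<bar>t\<bar> ^ Suc k / fact (Suc k))) sums (E * (exp \<bar>t\<bar> - 1))"
    using e by (intro sums_mult) (subst sums_Suc_iff, simp)
  have "norm (\<Sum>k. ?c (Suc k)) \<le> (\<Sum>k. E * (\<bar>t\<bar> ^ Suc k / fact (Suc k)))"
    by (rule norm_suminf_le[OF b sums_summable[OF se]])
  also have "\<dots> = E * (exp \<bar>t\<bar> - 1)" using se by (rule sums_unique[symmetric])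
  also have "\<dots> \<le> E * exp \<bar>t\<bar>" by (intro mult_left_mono) (auto simp: E_def)
  finally show ?thesis unfolding s by (simp add: E_def)
qed

lemma rJ_large_order:
  obtains N where "\<And>n t. n \<ge> N \<Longrightarrow> \<bar>t\<bar> \<le> W \<Longrightarrow> 0 < rJ n t \<and> rJ (Suc n) t \<le> rJ n t"
proof -
  \<comment> \<open>The part 2 exp W makes the relative error at most 1 / 2, so n!
    \<open>rJ n t\<close> lies between 1 / 2 and 3 / 2. With n \<ge> 3 the factor n + 1 of (n + 1)!
    outweighs the quotient 3 of these bounds.\<close>
  obtain N :: nat where N: "real N \<ge> 2 * exp W + 3" using real_arch_simple by blast
  have b: "1 / (2 * fact n) \<le> rJ n t \<and> rJ n t \<le> 3 / (2 * fact n)" if "n \<ge> N" "\<bar>t\<bar> \<le> W" for n t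
  proof -
    have "exp \<bar>t\<bar> \<le> exp W" using that by simp
    also have "\<dots> \<le> real (Suc n) / 2" using N that(1) by simp
    finally have "exp \<bar>t\<bar> / (fact n * real (Suc n)) \<le> (real (Suc n) / 2) / (fact n * real (Suc n))"
      by (intro divide_right_mono) auto
    also have "\<dots> = 1 / (2 * fact n)" by simp
    finally have "\<bar>rJ n t - 1 / fact n\<bar> \<le> 1 / (2 * fact n)" using rJ_bound[of n t] by linarith
    moreover have "1 / fact n = 2 * (1 / (2 * fact n :: real))" "3 / (2 * fact n) = 3 * (1 / (2 * fact n :: real))" by simp_all
    ultimately show ?thesis by linarith
  qed
  show ?thesis
  proof (rule that[of N])
    fix n t assume n: "n \<ge> N" "\<bar>t\<bar> \<le> W"
    have n3: "real n \<ge> 3" using N n(1) exp_gt_zero[of W] by linarith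
    have "rJ (Suc n) t \<le> 3 / (2 * fact (Suc n))" using b[of "Suc n" t] n by simp
    also have "\<dots> \<le> 3 / (2 * (3 * fact n))"
    proof -
      have "3 * fact n \<le> real (Suc n) * fact n" using n3 by (intro mult_right_mono) auto
      then have "3 * fact n \<le> (fact (Suc n) :: real)" by simp
      then show ?thesis by (intro divide_left_mono) auto
    qed
    also have "\<dots> = 1 / (2 * fact n)" by simp
    also have "\<dots> \<le> rJ n t" using b[OF n] by simp
    finally show "0 < rJ n t \<and> rJ (Suc n) t \<le> rJ n t"
      using b[OF n] by (auto intro: less_le_trans[of 0 "1 / (2 * fact n)"])
  qed
qed

text \<open>For large orders no resonance interferes: \<open>rJ\<close> is positive and does not
  increase with the order, so the leading term of \<open>ampA\<close> loses at most half to the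
  other one and |A| \<ge> j (2 \<tau>)^(-n) / 2. The factor j^2 cancels and 8 \<beta> (2 \<tau>)^(2
  n) / \<tau>^n remains.\<close>

lemma phase_term_tail_bound:
  assumes \<beta>: "\<beta> > 0"
  obtains N where "\<And>n \<tau>. n \<ge> N \<Longrightarrow> uY_small \<tau> \<Longrightarrow> \<bar>phase_term \<beta> n \<tau>\<bar> \<le> 8 * \<beta> * (4 * \<tau>) ^ n"
proof -
  obtain N where N: "\<And>n t. n \<ge> N \<Longrightarrow> \<bar>t\<bar> \<le> \<beta> + 1 \<Longrightarrow> 0 < rJ n t \<and> rJ (Suc n) t \<le> rJ n t"
    using rJ_large_order by blast
  show ?thesis
  proof (rule that[of "Suc N"])
    fix n \<tau> assume n: "n \<ge> Suc N" and s: "uY_small \<tau>"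
    then obtain m where m: "n = Suc m" "m \<ge> N" by (metis Suc_le_D Suc_le_mono)
    from s have t: "\<tau> > 0" "\<tau> < 1 / 8" by (auto simp: uY_small_def)
    define \<eta> where "\<eta> = \<tau> + \<beta>"
    have e: "\<bar>\<eta>\<bar> \<le> \<beta> + 1" using t \<beta> by (simp add: \<eta>_def)
    define j where "j = rJ m \<eta>"
    have j: "j > 0" "rJ (Suc m) \<eta> \<le> j" "0 < rJ (Suc (Suc m)) \<eta>" "rJ (Suc (Suc m)) \<eta> \<le> j" "0 < rJ (Suc m) \<eta>"
      using N[of m \<eta>] N[of "Suc m" \<eta>] N[of "Suc (Suc m)" \<eta>] m(2) e by (auto simp: j_def)
    note g = uY_growth(1)[OF s, of m] uY_growth(3)[OF s, of m]
    have up: "uY (Suc m) \<tau> > 0" using g by linarith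
    have "rJ (Suc m) \<eta> * uY m \<tau> \<le> j * (uY (Suc m) \<tau> / 2)" using j g by (intro mult_mono) auto
    then have "j * uY (Suc m) \<tau> / 2 \<le> j * uY (Suc m) \<tau> - rJ (Suc m) \<eta> * uY m \<tau>" by simp
    then have "j * uY (Suc m) \<tau> / 2 \<le> - ampA n \<tau> \<eta>" unfolding m ampA_Suc_uY[OF t(1)] j_def by simp
    moreover have "j * (1 / (2 * \<tau>)) ^ n / 2 \<le> j * uY (Suc m) \<tau> / 2"
      using g(2) j(1) unfolding m by (intro divide_right_mono mult_left_mono) auto
    ultimately have A: "j * (1 / (2 * \<tau>)) ^ n / 2 \<le> - ampA n \<tau> \<eta>" by linarith
    define D where "D = (ampA n \<tau> \<eta>)\<^sup>2 + (ampB n \<tau> \<eta>)\<^sup>2"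
    have "(j * (1 / (2 * \<tau>)) ^ n / 2)\<^sup>2 \<le> (- ampA n \<tau> \<eta>)\<^sup>2"
      using A j t by (intro power_mono) auto
    also have "\<dots> \<le> D" by (simp add: D_def)
    finally have D: "(j * (1 / (2 * \<tau>)) ^ n / 2)\<^sup>2 \<le> D" .
    have p: "0 < (j * (1 / (2 * \<tau>)) ^ n / 2)\<^sup>2" using j t by simp
    have "\<bar>phase_term \<beta> n \<tau>\<bar> = 2 * \<beta> * rJ (Suc (Suc m)) \<eta> * j / (\<tau> ^ n * D)"
      unfolding m phase_term_Suc using j \<beta> t D p
      by (simp add: \<eta>_def[symmetric] j_def[symmetric] D_def m abs_mult)
    also have "\<dots> \<le> 2 * \<beta> * j * j / (\<tau> ^ n * (j * (1 / (2 * \<tau>)) ^ n / 2)\<^sup>2)"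
      using j \<beta> t D p by (intro frac_le mult_mono mult_left_mono mult_pos_pos) auto
    also have "\<dots> = 8 * \<beta> * (4 * \<tau>) ^ n"
    proof -
      define P where "P = (2 * \<tau>) ^ n"
      have P: "P > 0" using t by (simp add: P_def)
      have q: "(4 * \<tau>) ^ n * \<tau> ^ n = P * P"
        unfolding P_def power_mult_distrib[symmetric] by (rule arg_cong[of _ _ "\<lambda>x. x ^ n"]) simp
      have r: "(1 / (2 * \<tau>)) ^ n = 1 / P" by (simp add: P_def power_divide)
      have "2 * \<beta> * j * j / (\<tau> ^ n * (j * (1 / (2 * \<tau>)) ^ n / 2)\<^sup>2) = 8 * \<beta> * (P * P) / \<tau> ^ n"
        unfolding r using j t P by (simp add: power2_eq_square field_simps)
      then show ?thesis unfolding q[symmetric] using t by simp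
    qed
    finally show "\<bar>phase_term \<beta> n \<tau>\<bar> \<le> 8 * \<beta> * (4 * \<tau>) ^ n" .
  qed
qed

section \<open>Expansions near the interior argument \<beta> and perturbation of quotients\<close>

lemma rJ_shift_tendsto: "((\<lambda>\<tau>. rJ n (\<tau> + \<beta>)) \<longlongrightarrow> rJ n \<beta>) (at_right 0)"
proof -
  have "((\<lambda>\<tau>. \<tau> + \<beta>) \<longlongrightarrow> 0 + \<beta>) (at_right (0::real))" by (intro tendsto_intros)
  then show ?thesis
    using isCont_tendsto_compose[OF DERIV_isCont[OF rJ_deriv[of n \<beta>]]] by simp
qed

lemma rJ_shift_bigo: "(\<lambda>\<tau>. rJ n (\<tau> + \<beta>) - rJ n \<beta>) \<in> O[at_right 0](\<lambda>\<tau>. \<tau>)"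
proof -
  have "((\<lambda>\<tau>. rJ n (\<tau> + \<beta>)) has_real_derivative - rJ (Suc n) \<beta>) (at 0)"
    using DERIV_shift[of "rJ n" "- rJ (Suc n) \<beta>" 0 \<beta>] rJ_deriv[of n \<beta>] by simp
  from deriv_at_0_bigo[OF this] show ?thesis by simp
qed

text \<open>Second-order Taylor expansion at the zero \<beta>, by two mean value estimates that
  start from a bound for the second derivative.\<close>

lemma rJ_shift_zero_bigo:
  assumes "rJ n \<beta> = 0"
  shows "(\<lambda>\<tau>. rJ n (\<tau> + \<beta>) / \<tau> - (- rJ (Suc n) \<beta>)) \<in> O[at_right 0](\<lambda>\<tau>. \<tau>)"
proof -
  have "continuous_on {\<beta>..\<beta> + 1} (rJ (Suc (Suc n)))"
    using DERIV_isCont[OF rJ_deriv] by (simp add: continuous_at_imp_continuous_on)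
  from ex_bound_interval[OF this] obtain C where C: "\<And>t. \<beta> \<le> t \<Longrightarrow> t \<le> \<beta> + 1 \<Longrightarrow> \<bar>rJ (Suc (Suc n)) t\<bar> \<le> C"
    by auto
  have "\<bar>rJ n (\<tau> + \<beta>) / \<tau> - (- rJ (Suc n) \<beta>)\<bar> \<le> C * \<bar>\<tau>\<bar>" if t: "0 < \<tau>" "\<tau> < 1" for \<tau>
  proof -
    have sh: "((\<lambda>t. rJ m (t + \<beta>)) has_real_derivative - rJ (Suc m) (t + \<beta>)) (at t)" for m t
      using DERIV_shift[of "rJ m" "- rJ (Suc m) (t + \<beta>)" t \<beta>] rJ_deriv by simp
    have 1: "norm (rJ (Suc n) (s + \<beta>) - rJ (Suc n) (0 + \<beta>)) \<le> C * norm (s - 0)" if s: "0 \<le> s" "s \<le> \<tau>" for s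
    proof (rule field_differentiable_bound[where S = "{0..\<tau>}" and f' = "\<lambda>t. - rJ (Suc (Suc n)) (t + \<beta>)"])
      show "((\<lambda>t. rJ (Suc n) (t + \<beta>)) has_field_derivative - rJ (Suc (Suc n)) (x + \<beta>)) (at x within {0..\<tau>})" for x
        using sh by (rule has_field_derivative_at_within)
      show "norm (- rJ (Suc (Suc n)) (x + \<beta>)) \<le> C" if "x \<in> {0..\<tau>}" for x
        using C[of "x + \<beta>"] that t by simp
    qed (use s t in auto)
    let ?d = "\<lambda>s. rJ n (s + \<beta>) + s * rJ (Suc n) \<beta>"
    have "norm (?d \<tau> - ?d 0) \<le> (C * \<tau>) * norm (\<tau> - 0)"
    proof (rule field_differentiable_bound[where S = "{0..\<tau>}" and f' = "\<lambda>t. - rJ (Suc n) (t + \<beta>) + rJ (Suc n) \<beta>"])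
      show "(?d has_field_derivative - rJ (Suc n) (x + \<beta>) + rJ (Suc n) \<beta>) (at x within {0..\<tau>})" for x
        by (rule has_field_derivative_at_within) (auto intro!: derivative_eq_intros sh)
      show "norm (- rJ (Suc n) (x + \<beta>) + rJ (Suc n) \<beta>) \<le> C * \<tau>" if x: "x \<in> {0..\<tau>}" for x
      proof -
        have "norm (- rJ (Suc n) (x + \<beta>) + rJ (Suc n) \<beta>) \<le> C * x" using 1[of x] x by (simp add: abs_minus_commute)
        also have "\<dots> \<le> C * \<tau>"
          using x C[of \<beta>] by (intro mult_left_mono) auto
        finally show ?thesis .
      qed
    qed (use t in auto)
    then have "\<bar>rJ n (\<tau> + \<beta>) + \<tau> * rJ (Suc n) \<beta>\<bar> \<le> C * \<tau> * \<tau>" using t assms by simp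
    then have "\<bar>rJ n (\<tau> + \<beta>) + \<tau> * rJ (Suc n) \<beta>\<bar> / \<tau> \<le> C * \<tau>" using t by (simp add: field_simps)
    moreover have "rJ n (\<tau> + \<beta>) / \<tau> - (- rJ (Suc n) \<beta>) = (rJ n (\<tau> + \<beta>) + \<tau> * rJ (Suc n) \<beta>) / \<tau>"
      using t by (simp add: field_simps)
    ultimately show ?thesis using t by simp
  qed
  moreover have "eventually (\<lambda>t. t \<in> {0<..<1}) (at_right (0::real))"
    by (rule eventually_at_right_real) simp
  ultimately show ?thesis
    by (intro bigoI[where c = C]) (auto elim: eventually_mono)
qed

lemma bigo_mult_const:
  fixes f g :: "real \<Rightarrow> real"
  assumes "(\<lambda>t. f t - c) \<in> O[F](e)" "(\<lambda>t. g t - d) \<in> O[F](e)" "(e \<longlongrightarrow> 0) F"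
  shows "(\<lambda>t. f t * g t - c * d) \<in> O[F](e)"
proof -
  have "(g \<longlongrightarrow> d) F" by (rule tendsto_if_bigo_diff[OF assms(2,3)])
  then have "g \<in> O[F](\<lambda>_. 1)" by (rule tendsto_imp_bigo_1)
  then have "(\<lambda>t. (f t - c) * g t) \<in> O[F](e)"
    using landau_o.big.mult[OF assms(1)] by fastforce
  moreover have "(\<lambda>t. c * (g t - d)) \<in> O[F](e)" using assms(2) by simp
  ultimately have "(\<lambda>t. (f t - c) * g t + c * (g t - d)) \<in> O[F](e)" by (rule sum_in_bigo)
  then show ?thesis by (simp add: algebra_simps)
qed

text \<open>The error of the denominator is measured relative to \<open>M0\<close>, which may be
  unbounded like a squared logarithm; this is what lets the quotient inherit the error h
  itself.\<close>

lemma bigo_divide_perturbed: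
  fixes N M N0 M0 h :: "real \<Rightarrow> real"
  assumes N: "(\<lambda>t. N t - N0 t) \<in> O[F](h)" and M: "(\<lambda>t. M t - M0 t) \<in> O[F](\<lambda>t. h t * M0 t)"
    and h: "(h \<longlongrightarrow> 0) F" and N0: "N0 \<in> O[F](\<lambda>_. 1)" and c: "c > 0" "eventually (\<lambda>t. c \<le> M0 t) F"
  shows "(\<lambda>t. N t / M t - N0 t / M0 t) \<in> O[F](h)"
proof -
  obtain C1 where C1: "C1 > 0" "eventually (\<lambda>t. norm (N t - N0 t) \<le> C1 * norm (h t)) F" using N by (elim landau_o.bigE)
  obtain C2 where C2: "C2 > 0" "eventually (\<lambda>t. norm (M t - M0 t) \<le> C2 * norm (h t * M0 t)) F" using M by (elim landau_o.bigE)
  obtain C3 where C3: "C3 > 0" "eventually (\<lambda>t. norm (N0 t) \<le> C3 * norm (1::real)) F" using N0 by (elim landau_o.bigE)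
  have "((\<lambda>t. C2 * norm (h t)) \<longlongrightarrow> C2 * norm (0::real)) F" by (intro tendsto_intros h)
  then have "eventually (\<lambda>t. C2 * norm (h t) < 1 / 2) F" by (rule order_tendstoD) simp
  with C1(2) C2(2) C3(2) c(2)
  have "eventually (\<lambda>t. norm (N t / M t - N0 t / M0 t) \<le> (2 * (C1 + C3 * C2) / c) * norm (h t)) F"
  proof eventually_elim
    case (elim t)
    have M0: "M0 t > 0" "M0 t \<ge> c" using elim c(1) by auto
    have "norm (M t - M0 t) \<le> (C2 * norm (h t)) * M0 t" using elim M0 by (simp add: abs_mult)
    also have "\<dots> \<le> 1 / 2 * M0 t" using elim M0 by (intro mult_right_mono) auto
    finally have "\<bar>M t - M0 t\<bar> \<le> 1 / 2 * M0 t" by simp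
    then have "M t \<ge> M0 t / 2" by linarith
    then have Mp: "M t \<ge> c / 2" "M t > 0" "M t \<ge> M0 t / 2" using M0 c(1) by auto
    have "N t / M t - N0 t / M0 t = (N t - N0 t) / M t - N0 t * (M t - M0 t) / (M0 t * M t)"
      using M0 Mp by (simp add: field_simps)
    also have "norm \<dots> \<le> norm ((N t - N0 t) / M t) + norm (N0 t * (M t - M0 t) / (M0 t * M t))"
      by (rule norm_triangle_ineq4)
    also have "norm ((N t - N0 t) / M t) \<le> C1 * norm (h t) / (c / 2)"
      unfolding norm_divide using elim Mp c(1) by (intro frac_le) auto
    also have "norm (N0 t * (M t - M0 t) / (M0 t * M t)) \<le> C3 * (C2 * norm (h t) * M0 t) / (M0 t * (c / 2))"
      unfolding norm_divide norm_mult
      using elim Mp M0 c(1) C3(1) by (intro frac_le mult_mono) (auto simp: abs_mult mult.assoc)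
    also have "C1 * norm (h t) / (c / 2) + C3 * (C2 * norm (h t) * M0 t) / (M0 t * (c / 2)) = (2 * (C1 + C3 * C2) / c) * norm (h t)"
      using M0 c(1) by (simp add: field_simps)
    finally show ?case by simp
  qed
  then show ?thesis by (rule bigoI)
qed

lemma uY_Suc_tendsto: "filterlim (uY (Suc m)) at_top (at_right 0)"
proof (rule filterlim_at_top_mono)
  have "eventually (\<lambda>\<tau>::real. (1 / (2 * \<tau>)) ^ Suc m \<ge> 1 / (2 * \<tau>)) (at_right 0)"
    using eventually_uY_small
  proof eventually_elim
    case (elim \<tau>)
    then have "1 / (2 * \<tau>) \<ge> 1" by (auto simp: uY_small_def)
    then show ?case using power_increasing[of 1 "Suc m" "1 / (2 * \<tau>)"] by simp
  qed
  then show "eventually (\<lambda>\<tau>. 1 / (2 * \<tau>) \<le> uY (Suc m) \<tau>) (at_right 0)"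
    using eventually_uY_small
  proof eventually_elim
    case (elim \<tau>)
    then show ?case using uY_growth(3)[of \<tau> m] by linarith
  qed
  show "filterlim (\<lambda>\<tau>::real. 1 / (2 * \<tau>)) at_top (at_right 0)" by real_asymp
qed

lemma uY_tendsto: "filterlim (uY m) at_top (at_right 0)"
  using uY_0_tendsto uY_Suc_tendsto by (cases m) auto

text \<open>Order 0 is separate because it compares a logarithm with a pole, through the expansions
  of \<open>rY 0\<close> and \<open>rY 1\<close>; from order 1 on the recurrence gives the bound 2
  \<tau>.\<close>

lemma uY_ratio_tendsto: "((\<lambda>\<tau>. uY m \<tau> / uY (Suc m) \<tau>) \<longlongrightarrow> 0) (at_right 0)"
proof (cases m)
  case 0
  have "((\<lambda>t. (t * uY 0 t) / (t * uY 1 t)) \<longlongrightarrow> 0 / 1) (at_right 0)"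
    by (intro tendsto_divide t_uY_0_tendsto t_uY_1_tendsto) simp
  moreover have "eventually (\<lambda>t. (t * uY 0 t) / (t * uY 1 t) = uY m t / uY (Suc m) t) (at_right 0)"
    using eventually_at_right_less[of 0] by eventually_elim (simp add: 0)
  ultimately show ?thesis by (simp add: Lim_transform_eventually)
next
  case (Suc l)
  show ?thesis
  proof (rule Lim_null_comparison)
    show "eventually (\<lambda>\<tau>. norm (uY m \<tau> / uY (Suc m) \<tau>) \<le> 2 * \<tau>) (at_right 0)"
      using eventually_uY_small
    proof eventually_elim
      case (elim \<tau>)
      have t: "\<tau> > 0" using elim by (simp add: uY_small_def)
      have p: "uY m \<tau> > 0" "uY (Suc m) \<tau> > 0" using uY_growth(1)[OF elim] by blast+
      have "uY m \<tau> / (2 * \<tau>) \<le> uY (Suc m) \<tau>" using uY_growth(2)[OF elim, of l] Suc by simp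
      then show ?case using p t by (simp add: field_simps)
    qed
    show "((\<lambda>\<tau>::real. 2 * \<tau>) \<longlongrightarrow> 0) (at_right 0)" by real_asymp
  qed
qed

text \<open>In the resonant case both terms of \<open>ampA_Suc_uY\<close> have the same sign for small \<open>\<tau>\<close>,
  so the smaller one still bounds \<open>ampA\<close> from below.\<close>

lemma ampA_lower_bound:
  assumes "\<beta> > 0"
  obtains c where "c > 0" "eventually (\<lambda>\<tau>. c * uY (if rJ m \<beta> = 0 then m else Suc m) \<tau> \<le> \<bar>ampA (Suc m) \<tau> (\<tau> + \<beta>)\<bar>) (at_right 0)"
proof (cases "rJ m \<beta> = 0")
  case False
  define c where "c = \<bar>rJ m \<beta>\<bar> / 2"
  have c: "c > 0" using False by (simp add: c_def)
  have "((\<lambda>\<tau>. \<bar>rJ m (\<tau> + \<beta>) - rJ (Suc m) (\<tau> + \<beta>) * (uY m \<tau> / uY (Suc m) \<tau>)\<bar>) \<longlongrightarrow> \<bar>rJ m \<beta> - rJ (Suc m) \<beta> * 0\<bar>) (at_right 0)"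
    by (intro tendsto_intros rJ_shift_tendsto uY_ratio_tendsto)
  then have "eventually (\<lambda>\<tau>. c < \<bar>rJ m (\<tau> + \<beta>) - rJ (Suc m) (\<tau> + \<beta>) * (uY m \<tau> / uY (Suc m) \<tau>)\<bar>) (at_right 0)"
    by (rule order_tendstoD) (use False in \<open>simp add: c_def\<close>)
  with eventually_uY_small have "eventually (\<lambda>\<tau>. c * uY (Suc m) \<tau> \<le> \<bar>ampA (Suc m) \<tau> (\<tau> + \<beta>)\<bar>) (at_right 0)"
  proof eventually_elim
    case (elim \<tau>)
    have t: "\<tau> > 0" using elim by (simp add: uY_small_def)
    have p: "uY (Suc m) \<tau> > 0" using uY_growth(1)[OF elim(1)] by blast
    have "c * uY (Suc m) \<tau> \<le> \<bar>rJ m (\<tau> + \<beta>) - rJ (Suc m) (\<tau> + \<beta>) * (uY m \<tau> / uY (Suc m) \<tau>)\<bar> * uY (Suc m) \<tau>"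
      using elim p by (intro mult_right_mono) auto
    also have "\<dots> = \<bar>(rJ m (\<tau> + \<beta>) - rJ (Suc m) (\<tau> + \<beta>) * (uY m \<tau> / uY (Suc m) \<tau>)) * uY (Suc m) \<tau>\<bar>"
      using p by (simp add: abs_mult)
    also have "(rJ m (\<tau> + \<beta>) - rJ (Suc m) (\<tau> + \<beta>) * (uY m \<tau> / uY (Suc m) \<tau>)) * uY (Suc m) \<tau> = - ampA (Suc m) \<tau> (\<tau> + \<beta>)"
      unfolding ampA_Suc_uY[OF t] using p by (simp add: left_diff_distrib)
    finally show ?case by simp
  qed
  with c False that show ?thesis by auto
next
  case True
  define J where "J = rJ (Suc m) \<beta>"
  have J: "J \<noteq> 0" using rJ_not_both_0[OF assms True] by (simp add: J_def)
  have "((\<lambda>\<tau>. rJ m (\<tau> + \<beta>) / \<tau>) \<longlongrightarrow> - J) (at_right 0)"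
    unfolding J_def by (rule tendsto_if_bigo_diff[OF rJ_shift_zero_bigo[OF True]]) (auto intro!: tendsto_eq_intros)
  then have "((\<lambda>\<tau>. (rJ m (\<tau> + \<beta>) / \<tau>) * rJ (Suc m) (\<tau> + \<beta>)) \<longlongrightarrow> - J * J) (at_right 0)"
    unfolding J_def by (intro tendsto_mult rJ_shift_tendsto)
  then have "eventually (\<lambda>\<tau>. (rJ m (\<tau> + \<beta>) / \<tau>) * rJ (Suc m) (\<tau> + \<beta>) < 0) (at_right 0)"
    by (rule order_tendstoD) (use J in \<open>auto simp: zero_less_mult_iff linorder_neq_iff\<close>)
  moreover have "((\<lambda>\<tau>. \<bar>rJ (Suc m) (\<tau> + \<beta>)\<bar>) \<longlongrightarrow> \<bar>J\<bar>) (at_right 0)"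
    unfolding J_def by (intro tendsto_rabs rJ_shift_tendsto)
  then have "eventually (\<lambda>\<tau>. \<bar>J\<bar> / 2 < \<bar>rJ (Suc m) (\<tau> + \<beta>)\<bar>) (at_right 0)"
    by (rule order_tendstoD) (use J in simp)
  ultimately have "eventually (\<lambda>\<tau>. \<bar>J\<bar> / 2 * uY m \<tau> \<le> \<bar>ampA (Suc m) \<tau> (\<tau> + \<beta>)\<bar>) (at_right 0)"
    using eventually_uY_small
  proof eventually_elim
    case (elim \<tau>)
    have t: "\<tau> > 0" using elim by (simp add: uY_small_def)
    have p: "uY m \<tau> > 0" "uY (Suc m) \<tau> > 0" using uY_growth(1)[OF elim(3)] by blast+
    define x y where "x = rJ m (\<tau> + \<beta>)" and "y = rJ (Suc m) (\<tau> + \<beta>)"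
    have xy: "x * y < 0" using elim(1) t by (simp add: x_def y_def field_simps)
    have "\<bar>J\<bar> / 2 * uY m \<tau> \<le> \<bar>y\<bar> * uY m \<tau>" using elim(2) p by (intro mult_right_mono) (auto simp: y_def)
    also have "\<dots> \<le> \<bar>x\<bar> * uY (Suc m) \<tau> + \<bar>y\<bar> * uY m \<tau>" using p by simp
    also have "\<dots> = \<bar>x * uY (Suc m) \<tau> - y * uY m \<tau>\<bar>"
    proof (cases "x > 0")
      case True
      then have "y < 0" using xy by (simp add: mult_less_0_iff)
      then have "0 < x * uY (Suc m) \<tau>" "y * uY m \<tau> < 0" using True p by (auto simp: mult_neg_pos)
      then show ?thesis using True \<open>y < 0\<close> by (simp add: abs_if)
    next
      case False
      then have "x < 0" "y > 0" using xy by (auto simp: mult_less_0_iff)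
      moreover then have "x * uY (Suc m) \<tau> < 0" "0 < y * uY m \<tau>" using p by (auto simp: mult_neg_pos)
      ultimately show ?thesis by (simp add: abs_if)
    qed
    also have "\<dots> = \<bar>ampA (Suc m) \<tau> (\<tau> + \<beta>)\<bar>" unfolding ampA_Suc_uY[OF t] by (simp add: x_def y_def)
    finally show ?case .
  qed
  with J True that[of "\<bar>J\<bar> / 2"] show ?thesis by auto
qed

lemma rJ_eventually_bounded:
  obtains C where "C > 0" "eventually (\<lambda>\<tau>. \<bar>rJ n (\<tau> + \<beta>)\<bar> \<le> C) (at_right 0)"
proof -
  obtain C where "C > 0" "eventually (\<lambda>\<tau>. norm (rJ n (\<tau> + \<beta>)) \<le> C * norm (1::real)) (at_right 0)"
    using tendsto_imp_bigo_1[OF rJ_shift_tendsto[of n \<beta>]] by (elim landau_o.bigE)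
  then show thesis by (intro that[of C]) simp_all
qed

text \<open>Serves two cases: k = m and f = 1 without resonance, k + 1 = m and f = \<tau> if
  \<open>rJ m \<beta>\<close> = 0. In the latter the weaker bound for \<open>ampA\<close> is partly
  repaired by the zero in the numerator.\<close>

lemma phase_term_bigo_aux:
  assumes A: "c > 0" "eventually (\<lambda>\<tau>. c * uY (Suc k) \<tau> \<le> \<bar>ampA (Suc m) \<tau> (\<tau> + \<beta>)\<bar>) (at_right 0)"
    and f: "(\<lambda>\<tau>. rJ m (\<tau> + \<beta>)) \<in> O[at_right 0](f)" and \<beta>: "\<beta> > 0"
  shows "phase_term \<beta> (Suc m) \<in> O[at_right 0](\<lambda>\<tau>. f \<tau> * \<tau> ^ (2 * Suc k) / \<tau> ^ Suc m)"
proof -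
  obtain C where C: "C > 0" "eventually (\<lambda>\<tau>. \<bar>rJ (Suc (Suc m)) (\<tau> + \<beta>)\<bar> \<le> C) (at_right 0)"
    by (rule rJ_eventually_bounded) (rule that)
  obtain D where D: "D > 0" "eventually (\<lambda>\<tau>. norm (rJ m (\<tau> + \<beta>)) \<le> D * norm (f \<tau>)) (at_right 0)"
    using f by (elim landau_o.bigE)
  have "eventually (\<lambda>\<tau>. norm (phase_term \<beta> (Suc m) \<tau>) \<le> (2 * \<beta> * C * D * 2 ^ (2 * Suc k) / c\<^sup>2) * norm (f \<tau> * \<tau> ^ (2 * Suc k) / \<tau> ^ Suc m)) (at_right 0)"
    using A(2) C(2) D(2) eventually_uY_small
  proof eventually_elim
    case (elim \<tau>)
    have t: "\<tau> > 0" using elim by (simp add: uY_small_def)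
    define M where "M = (ampA (Suc m) \<tau> (\<tau> + \<beta>))\<^sup>2 + (ampB (Suc m) \<tau> (\<tau> + \<beta>))\<^sup>2"
    have "c * (1 / (2 * \<tau>)) ^ Suc k \<le> \<bar>ampA (Suc m) \<tau> (\<tau> + \<beta>)\<bar>"
      using elim(1) uY_growth(3)[OF elim(4), of k] A(1) by (meson mult_left_mono less_imp_le order_trans)
    then have "(c * (1 / (2 * \<tau>)) ^ Suc k)\<^sup>2 \<le> \<bar>ampA (Suc m) \<tau> (\<tau> + \<beta>)\<bar>\<^sup>2"
      using A(1) t by (intro power_mono) auto
    then have M: "(c * (1 / (2 * \<tau>)) ^ Suc k)\<^sup>2 \<le> M" by (simp add: M_def add_increasing2)
    define L where "L = (c * (1 / (2 * \<tau>)) ^ Suc k)\<^sup>2"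
    have L: "L > 0" "L \<le> M" using A(1) t M by (auto simp: L_def)
    have L': "L = c\<^sup>2 / (2 ^ (2 * Suc k) * \<tau> ^ (2 * Suc k))"
      unfolding L_def power_mult_distrib power_one_over power_mult[symmetric] by (simp add: power_mult_distrib mult.commute)
    have "norm (phase_term \<beta> (Suc m) \<tau>) = (2 * \<beta> * \<bar>rJ (Suc (Suc m)) (\<tau> + \<beta>)\<bar> * \<bar>rJ m (\<tau> + \<beta>)\<bar>) / (\<tau> ^ Suc m * M)"
      unfolding phase_term_Suc M_def[symmetric] using t \<beta> L by (simp add: abs_mult)
    also have "\<dots> \<le> (2 * \<beta> * C * (D * norm (f \<tau>))) / (\<tau> ^ Suc m * L)"
      using elim t \<beta> L C(1) D(1) by (intro frac_le mult_mono mult_left_mono mult_pos_pos) auto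
    also have "\<dots> = (2 * \<beta> * C * D * 2 ^ (2 * Suc k) / c\<^sup>2) * norm (f \<tau> * \<tau> ^ (2 * Suc k) / \<tau> ^ Suc m)"
      unfolding L' using t by (simp add: abs_mult mult_ac)
    finally show ?case .
  qed
  then show ?thesis by (rule bigoI)
qed

lemma phase_term_nonresonant_bigo:
  assumes "\<beta> > 0" "rJ m \<beta> \<noteq> 0"
  shows "phase_term \<beta> (Suc m) \<in> O[at_right 0](\<lambda>\<tau>. \<tau> ^ Suc m)"
proof -
  obtain c where c: "c > 0" "eventually (\<lambda>\<tau>. c * uY (if rJ m \<beta> = 0 then m else Suc m) \<tau> \<le> \<bar>ampA (Suc m) \<tau> (\<tau> + \<beta>)\<bar>) (at_right 0)"
    by (rule ampA_lower_bound[OF assms(1)]) (rule that)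
  have "phase_term \<beta> (Suc m) \<in> O[at_right 0](\<lambda>\<tau>. 1 * \<tau> ^ (2 * Suc m) / \<tau> ^ Suc m)"
    by (rule phase_term_bigo_aux[OF c(1) _ tendsto_imp_bigo_1[OF rJ_shift_tendsto] assms(1)]) (use c(2) assms(2) in simp)
  moreover have ev: "eventually (\<lambda>\<tau>. 1 * \<tau> ^ (2 * Suc m) / \<tau> ^ Suc m = \<tau> ^ Suc m) (at_right (0::real))"
    using eventually_at_right_less[of 0] by eventually_elim (simp add: mult_2 power_add)
  ultimately show ?thesis unfolding landau_o.big.cong[OF ev] by simp
qed

lemma phase_term_resonant_bigo:
  assumes "\<beta> > 0" "rJ (Suc l) \<beta> = 0"
  shows "phase_term \<beta> (Suc (Suc l)) \<in> O[at_right 0](\<lambda>\<tau>. \<tau> ^ Suc l)"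
proof -
  obtain c where c: "c > 0" "eventually (\<lambda>\<tau>. c * uY (if rJ (Suc l) \<beta> = 0 then Suc l else Suc (Suc l)) \<tau> \<le> \<bar>ampA (Suc (Suc l)) \<tau> (\<tau> + \<beta>)\<bar>) (at_right 0)"
    by (rule ampA_lower_bound[OF assms(1)]) (rule that)
  have "phase_term \<beta> (Suc (Suc l)) \<in> O[at_right 0](\<lambda>\<tau>. \<tau> * \<tau> ^ (2 * Suc l) / \<tau> ^ Suc (Suc l))"
    by (rule phase_term_bigo_aux[OF c(1) _ _ assms(1)])
       (use c(2) assms(2) rJ_shift_bigo[of "Suc l" \<beta>] in simp_all)
  moreover have ev: "eventually (\<lambda>\<tau>. \<tau> * \<tau> ^ (2 * Suc l) / \<tau> ^ Suc (Suc l) = \<tau> ^ Suc l) (at_right (0::real))"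
    using eventually_at_right_less[of 0] by eventually_elim (simp add: mult_2 power_add)
  ultimately show ?thesis unfolding landau_o.big.cong[OF ev] by simp
qed

lemma phase_term_bigo:
  assumes "\<beta> > 0"
  shows "phase_term \<beta> (Suc (Suc l)) \<in> O[at_right 0](\<lambda>\<tau>. \<tau> ^ Suc l)"
proof (cases "rJ (Suc l) \<beta> = 0")
  case True
  then show ?thesis by (rule phase_term_resonant_bigo[OF assms])
next
  case False
  have "(\<lambda>\<tau>::real. \<tau> ^ Suc (Suc l)) \<in> O[at_right 0](\<lambda>\<tau>. \<tau> ^ Suc l)"
  proof (rule bigoI[where c = 1])
    have "eventually (\<lambda>t. t \<in> {0<..<1}) (at_right (0::real))" by (rule eventually_at_right_real) simp
    then show "eventually (\<lambda>\<tau>::real. norm (\<tau> ^ Suc (Suc l)) \<le> 1 * norm (\<tau> ^ Suc l)) (at_right 0)"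
      by eventually_elim (simp add: abs_mult mult_left_le_one_le)
  qed
  with phase_term_nonresonant_bigo[OF assms False] show ?thesis by (rule landau_o.big_trans)
qed

section \<open>Logarithmic expansions of the orders 0 and 1\<close>

text \<open>The leading part of \<pi> \<open>rY 0 \<tau>\<close> at 0, see
  \<open>rY_0_bigo\<close>.\<close>

definition logt :: "real \<Rightarrow> real" where "logt \<tau> = ln \<tau> + 2 * euler_mascheroni"

lemma const_bigo_ln: "(\<lambda>_. k) \<in> O[at_right 0](\<lambda>\<tau>::real. ln \<tau>)" for k :: real
proof -
  have "(\<lambda>_. 1) \<in> O[at_right 0](\<lambda>\<tau>::real. ln \<tau>)" by real_asymp
  then show ?thesis by (rule landau_o.big_trans[rotated]) simp
qed

lemma logt_bigo: "logt \<in> O[at_right 0](\<lambda>\<tau>. ln \<tau>)"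
  unfolding logt_def[abs_def] by (intro sum_in_bigo(1) const_bigo_ln landau_o.big_refl)

lemma bigo_mult_log:
  assumes "(\<lambda>\<tau>. f \<tau> - p) \<in> O[at_right 0](\<lambda>\<tau>. \<tau>)"
  shows "(\<lambda>\<tau>. f \<tau> * (pi * rY 0 \<tau>) - p * logt \<tau>) \<in> O[at_right 0](\<lambda>\<tau>. \<tau> * ln \<tau>)"
proof -
  have Y: "(\<lambda>\<tau>. pi * rY 0 \<tau> - logt \<tau>) \<in> O[at_right 0](\<lambda>\<tau>. \<tau> * ln \<tau>)"
    using rY_0_bigo by (simp add: logt_def)
  have "(\<lambda>\<tau>::real. \<tau> * ln \<tau>) \<in> O[at_right 0](\<lambda>\<tau>. ln \<tau>)" by real_asymp
  from landau_o.big_trans[OF Y this] have "(\<lambda>\<tau>. pi * rY 0 \<tau> - logt \<tau>) \<in> O[at_right 0](\<lambda>\<tau>. ln \<tau>)" .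
  from this logt_bigo have "(\<lambda>\<tau>. (pi * rY 0 \<tau> - logt \<tau>) + logt \<tau>) \<in> O[at_right 0](\<lambda>\<tau>. ln \<tau>)" by (rule sum_in_bigo)
  then have "(\<lambda>\<tau>. pi * rY 0 \<tau>) \<in> O[at_right 0](\<lambda>\<tau>. ln \<tau>)" by simp
  then have "(\<lambda>\<tau>. (f \<tau> - p) * (pi * rY 0 \<tau>)) \<in> O[at_right 0](\<lambda>\<tau>. \<tau> * ln \<tau>)"
    by (intro landau_o.big.mult assms)
  moreover have "(\<lambda>\<tau>. p * (pi * rY 0 \<tau> - logt \<tau>)) \<in> O[at_right 0](\<lambda>\<tau>. \<tau> * ln \<tau>)" using Y by simp
  ultimately have "(\<lambda>\<tau>. (f \<tau> - p) * (pi * rY 0 \<tau>) + p * (pi * rY 0 \<tau> - logt \<tau>)) \<in> O[at_right 0](\<lambda>\<tau>. \<tau> * ln \<tau>)"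
    by (rule sum_in_bigo)
  moreover have "(f \<tau> - p) * (pi * rY 0 \<tau>) + p * (pi * rY 0 \<tau> - logt \<tau>) = f \<tau> * (pi * rY 0 \<tau>) - p * logt \<tau>" for \<tau>
    by (simp add: algebra_simps)
  ultimately show ?thesis by (simp only:)
qed

lemma t_tendsto: "((\<lambda>t::real. t) \<longlongrightarrow> 0) (at_right 0)"
  by (rule tendsto_ident_at)

text \<open>\<open>A\<close> has size ln \<tau> and is known up to \<tau> ln \<tau>, so its square
  is known up to \<tau> (ln \<tau>)^2. Relative to a denominator of size (ln \<tau>)^2 this is an
  error \<tau>, whence no logarithm appears in the result. The condition on b reflects that the
  limit of \<open>ampB\<close> is, up to sign, \<pi> times the coefficient of the logarithm in
  \<open>ampA\<close>.\<close>

lemma bigo_log_quotient: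
  assumes N: "(\<lambda>\<tau>. N \<tau> - N0) \<in> O[at_right 0](\<lambda>\<tau>. \<tau>)"
    and A: "(\<lambda>\<tau>. A \<tau> - (x + p * logt \<tau>)) \<in> O[at_right 0](\<lambda>\<tau>. \<tau> * ln \<tau>)"
    and B: "(\<lambda>\<tau>. B \<tau> - b) \<in> O[at_right 0](\<lambda>\<tau>. \<tau>)" and p: "p \<noteq> 0" "b\<^sup>2 = pi\<^sup>2 * p\<^sup>2"
  shows "(\<lambda>\<tau>. N \<tau> / ((A \<tau>)\<^sup>2 + (B \<tau>)\<^sup>2) - N0 / ((x + p * logt \<tau>)\<^sup>2 + pi\<^sup>2 * p\<^sup>2)) \<in> O[at_right 0](\<lambda>\<tau>. \<tau>)"
proof (rule bigo_divide_perturbed[where h = "\<lambda>\<tau>. \<tau>" and c = "pi\<^sup>2 * p\<^sup>2"])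
  let ?A0 = "\<lambda>\<tau>. x + p * logt \<tau>"
  let ?M0 = "\<lambda>\<tau>. (?A0 \<tau>)\<^sup>2 + pi\<^sup>2 * p\<^sup>2"
  have ln2: "(\<lambda>\<tau>. (ln \<tau>)\<^sup>2) \<in> O[at_right 0](?M0)"
  \<comment> \<open>Solving X = x + p \<open>logt \<tau>\<close> for ln \<tau> bounds its square by
    multiples of X^2 and of 1; the constant is absorbed by \<pi>^2 p^2, so the estimate holds even
    where X vanishes.\<close>
  proof (rule bigoI[where c = "2 / p\<^sup>2 + 2 * (x / p + 2 * euler_mascheroni)\<^sup>2 / (pi\<^sup>2 * p\<^sup>2)"], rule always_eventually, rule allI)
    fix \<tau> :: real
    define X where "X = ?A0 \<tau>"
    define k where "k = x / p + 2 * (euler_mascheroni :: real)"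
    have sq: "(u - v)\<^sup>2 \<le> 2 * u\<^sup>2 + 2 * v\<^sup>2" for u v :: real
      using zero_le_power2[of "u + v"] by (simp add: power2_eq_square algebra_simps)
    have "ln \<tau> = X / p - k" using p(1) by (simp add: X_def k_def logt_def field_simps)
    moreover have "(X / p - k)\<^sup>2 \<le> 2 * (X / p)\<^sup>2 + 2 * k\<^sup>2"
      by (rule sq)
    ultimately have "(ln \<tau>)\<^sup>2 \<le> 2 / p\<^sup>2 * X\<^sup>2 + 2 * k\<^sup>2 / (pi\<^sup>2 * p\<^sup>2) * (pi\<^sup>2 * p\<^sup>2)"
      using p(1) by (simp add: power_divide)
    also have "\<dots> \<le> 2 / p\<^sup>2 * (X\<^sup>2 + pi\<^sup>2 * p\<^sup>2) + 2 * k\<^sup>2 / (pi\<^sup>2 * p\<^sup>2) * (X\<^sup>2 + pi\<^sup>2 * p\<^sup>2)"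
      by (intro add_mono mult_left_mono) auto
    also have "\<dots> = (2 / p\<^sup>2 + 2 * k\<^sup>2 / (pi\<^sup>2 * p\<^sup>2)) * (X\<^sup>2 + pi\<^sup>2 * p\<^sup>2)" by (rule distrib_right[symmetric])
    finally show "norm ((ln \<tau>)\<^sup>2) \<le> (2 / p\<^sup>2 + 2 * (x / p + 2 * euler_mascheroni)\<^sup>2 / (pi\<^sup>2 * p\<^sup>2)) * norm (?M0 \<tau>)"
      by (simp add: X_def k_def)
  qed
  have A0: "?A0 \<in> O[at_right 0](\<lambda>\<tau>. ln \<tau>)" 
    by (intro sum_in_bigo(1) const_bigo_ln) (use logt_bigo in simp)
  have "(\<lambda>\<tau>::real. \<tau> * ln \<tau>) \<in> O[at_right 0](\<lambda>\<tau>. ln \<tau>)" by real_asymp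
  from landau_o.big_trans[OF A this] have "(\<lambda>\<tau>. (A \<tau> - ?A0 \<tau>) + (?A0 \<tau> + ?A0 \<tau>)) \<in> O[at_right 0](\<lambda>\<tau>. ln \<tau>)"
    by (rule sum_in_bigo(1)[OF _ sum_in_bigo(1)[OF A0 A0]])
  from landau_o.big.mult[OF A this]
  have 1: "(\<lambda>\<tau>. (A \<tau>)\<^sup>2 - (?A0 \<tau>)\<^sup>2) \<in> O[at_right 0](\<lambda>\<tau>. \<tau> * (ln \<tau>)\<^sup>2)"
    by (simp add: power2_eq_square algebra_simps)
  have "(\<lambda>\<tau>. B \<tau> * B \<tau> - b * b) \<in> O[at_right 0](\<lambda>\<tau>. \<tau>)" by (rule bigo_mult_const[OF B B t_tendsto])
  moreover have "(\<lambda>\<tau>::real. \<tau>) \<in> O[at_right 0](\<lambda>\<tau>. \<tau> * (ln \<tau>)\<^sup>2)" by real_asymp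
  ultimately have 2: "(\<lambda>\<tau>. B \<tau> * B \<tau> - b * b) \<in> O[at_right 0](\<lambda>\<tau>. \<tau> * (ln \<tau>)\<^sup>2)" by (rule landau_o.big_trans)
  have "(\<lambda>\<tau>. ((A \<tau>)\<^sup>2 - (?A0 \<tau>)\<^sup>2) + (B \<tau> * B \<tau> - b * b)) \<in> O[at_right 0](\<lambda>\<tau>. \<tau> * (ln \<tau>)\<^sup>2)"
    using 1 2 by (rule sum_in_bigo)
  also have "(\<lambda>\<tau>. ((A \<tau>)\<^sup>2 - (?A0 \<tau>)\<^sup>2) + (B \<tau> * B \<tau> - b * b)) = (\<lambda>\<tau>. ((A \<tau>)\<^sup>2 + (B \<tau>)\<^sup>2) - ?M0 \<tau>)"
    using p(2) by (simp add: power2_eq_square algebra_simps fun_eq_iff)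
  finally have 3: "(\<lambda>\<tau>. ((A \<tau>)\<^sup>2 + (B \<tau>)\<^sup>2) - ?M0 \<tau>) \<in> O[at_right 0](\<lambda>\<tau>. \<tau> * (ln \<tau>)\<^sup>2)" .
  have "(\<lambda>\<tau>. \<tau> * (ln \<tau>)\<^sup>2) \<in> O[at_right 0](\<lambda>\<tau>. \<tau> * ?M0 \<tau>)"
    by (intro landau_o.big.mult landau_o.big_refl ln2)
  with 3 show "(\<lambda>\<tau>. ((A \<tau>)\<^sup>2 + (B \<tau>)\<^sup>2) - ?M0 \<tau>) \<in> O[at_right 0](\<lambda>\<tau>. \<tau> * ?M0 \<tau>)"
    by (rule landau_o.big_trans)
  show "(\<lambda>_. N0) \<in> O[at_right 0](\<lambda>_. 1)" by simp
  show "pi\<^sup>2 * p\<^sup>2 > 0" using p by simp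
qed (use N t_tendsto in \<open>auto intro!: always_eventually\<close>)

lemma rY_1_bigo': "(\<lambda>\<tau>. pi * (\<tau> * rY 1 \<tau>) - (-1)) \<in> O[at_right 0](\<lambda>\<tau>. \<tau> * ln \<tau>)"
  using rY_1_bigo by simp

lemma t_bigo: "f \<in> O[at_right 0](\<lambda>\<tau>. \<tau>) \<Longrightarrow> f \<in> O[at_right 0](\<lambda>\<tau>::real. \<tau> * ln \<tau>)"
  using bigo_ln(1) by (rule landau_o.big_trans[rotated])

lemma shift_bigo: "(\<lambda>\<tau>. (\<tau> + \<beta>) - \<beta>) \<in> O[at_right 0](\<lambda>\<tau>. \<tau>)"
  by simp

lemma rJ_bigo': "(\<lambda>t. rJ n t - rJ n 0) \<in> O[at_right 0](\<lambda>t. t)"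
  using rJ_bigo[of n] by simp

lemma ampB_bigo: "(\<lambda>\<tau>. ampB n \<tau> (\<tau> + \<beta>) - pi * (\<beta> * rJ (Suc n) \<beta> / fact n)) \<in> O[at_right 0](\<lambda>\<tau>. \<tau>)"
proof -
  have 0: "(\<lambda>\<tau>::real. \<tau> - 0) \<in> O[at_right 0](\<lambda>\<tau>. \<tau>)" by simp
  note m = bigo_mult_const[OF _ _ t_tendsto]
  have "(\<lambda>\<tau>. ((\<tau> + \<beta>) * rJ n \<tau> * rJ (Suc n) (\<tau> + \<beta>) - \<beta> * rJ n 0 * rJ (Suc n) \<beta>) - (\<tau> * rJ (Suc n) \<tau> * rJ n (\<tau> + \<beta>) - 0 * rJ (Suc n) 0 * rJ n \<beta>)) \<in> O[at_right 0](\<lambda>\<tau>. \<tau>)"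
    by (intro sum_in_bigo m shift_bigo rJ_bigo' rJ_shift_bigo 0)
  then have "(\<lambda>\<tau>. pi * (((\<tau> + \<beta>) * rJ n \<tau> * rJ (Suc n) (\<tau> + \<beta>) - \<beta> * rJ n 0 * rJ (Suc n) \<beta>) - (\<tau> * rJ (Suc n) \<tau> * rJ n (\<tau> + \<beta>) - 0 * rJ (Suc n) 0 * rJ n \<beta>))) \<in> O[at_right 0](\<lambda>\<tau>. \<tau>)"
    by simp
  moreover have "pi * (((\<tau> + \<beta>) * rJ n \<tau> * rJ (Suc n) (\<tau> + \<beta>) - \<beta> * rJ n 0 * rJ (Suc n) \<beta>) - (\<tau> * rJ (Suc n) \<tau> * rJ n (\<tau> + \<beta>) - 0 * rJ (Suc n) 0 * rJ n \<beta>))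
     = ampB n \<tau> (\<tau> + \<beta>) - pi * (\<beta> * rJ (Suc n) \<beta> / fact n)" for \<tau>
    by (simp add: ampB_def algebra_simps)
  ultimately show ?thesis by (simp only:)
qed

text \<open>The constant comes from the pole of \<open>rY 1\<close>; the logarithm comes from
  \<open>rY 0\<close> with its factor \<eta> \<open>rJ 1 \<eta>\<close> frozen at \<beta>.\<close>

lemma ampA_0_bigo:
  "(\<lambda>\<tau>. ampA 0 \<tau> (\<tau> + \<beta>) - (- rJ 0 \<beta> + (- (\<beta> * rJ 1 \<beta>)) * logt \<tau>)) \<in> O[at_right 0](\<lambda>\<tau>. \<tau> * ln \<tau>)"
proof -
  have 1: "(\<lambda>\<tau>. rJ 0 (\<tau> + \<beta>) * (pi * (\<tau> * rY 1 \<tau>)) - rJ 0 \<beta> * (-1)) \<in> O[at_right 0](\<lambda>\<tau>. \<tau> * ln \<tau>)"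
    by (rule bigo_mult_const[OF t_bigo[OF rJ_shift_bigo] rY_1_bigo' t_ln_tendsto])
  have 2: "(\<lambda>\<tau>. ((\<tau> + \<beta>) * rJ 1 (\<tau> + \<beta>)) * (pi * rY 0 \<tau>) - (\<beta> * rJ 1 \<beta>) * logt \<tau>) \<in> O[at_right 0](\<lambda>\<tau>. \<tau> * ln \<tau>)"
    by (rule bigo_mult_log[OF bigo_mult_const[OF shift_bigo rJ_shift_bigo t_tendsto]])
  have "(rJ 0 (\<tau> + \<beta>) * (pi * (\<tau> * rY 1 \<tau>)) - rJ 0 \<beta> * (-1)) - (((\<tau> + \<beta>) * rJ 1 (\<tau> + \<beta>)) * (pi * rY 0 \<tau>) - (\<beta> * rJ 1 \<beta>) * logt \<tau>)
     = ampA 0 \<tau> (\<tau> + \<beta>) - (- rJ 0 \<beta> + (- (\<beta> * rJ 1 \<beta>)) * logt \<tau>)" for \<tau>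
    by (simp add: ampA_def algebra_simps)
  with sum_in_bigo(2)[OF 1 2] show ?thesis by (simp only:)
qed

text \<open>Numerator and denominator are divided by (\<beta> \<open>rJ 1 \<beta>\<close>)^2. The
  shift of the logarithm is the part of the constant b that depends on a; it vanishes if
  \<open>rJ 0 \<beta>\<close> = 0.\<close>

lemma phase_term_0_log:
  assumes "\<beta> > 0" "rJ 1 \<beta> \<noteq> 0"
  shows "(\<lambda>\<tau>. phase_term \<beta> 0 \<tau> - (- 2 / ((logt \<tau> + rJ 0 \<beta> / (\<beta> * rJ 1 \<beta>))\<^sup>2 + pi\<^sup>2))) \<in> O[at_right 0](\<lambda>\<tau>. \<tau>)"
proof -
  define p where "p = \<beta> * rJ 1 \<beta>"
  have p: "p \<noteq> 0" using assms by (simp add: p_def)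
  let ?N = "\<lambda>\<tau>. (- (2 * \<beta>)) * ((\<tau> + \<beta>) * (rJ 1 (\<tau> + \<beta>) * rJ 1 (\<tau> + \<beta>)))"
  have c: "(\<lambda>\<tau>. k - k) \<in> O[at_right 0](\<lambda>\<tau>::real. \<tau>)" for k :: real by simp
  note m = bigo_mult_const[OF _ _ t_tendsto]
  have N: "(\<lambda>\<tau>. ?N \<tau> - (- (2 * \<beta>)) * (\<beta> * (rJ 1 \<beta> * rJ 1 \<beta>))) \<in> O[at_right 0](\<lambda>\<tau>. \<tau>)"
    by (intro m c shift_bigo rJ_shift_bigo)
  have B: "(\<lambda>\<tau>. ampB 0 \<tau> (\<tau> + \<beta>) - pi * p) \<in> O[at_right 0](\<lambda>\<tau>. \<tau>)"
    using ampB_bigo[of 0 \<beta>] by (simp add: p_def)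
  have A: "(\<lambda>\<tau>. ampA 0 \<tau> (\<tau> + \<beta>) - (- rJ 0 \<beta> + (- p) * logt \<tau>)) \<in> O[at_right 0](\<lambda>\<tau>. \<tau> * ln \<tau>)"
    using ampA_0_bigo[of \<beta>] by (simp add: p_def)
  have "(\<lambda>\<tau>. ?N \<tau> / ((ampA 0 \<tau> (\<tau> + \<beta>))\<^sup>2 + (ampB 0 \<tau> (\<tau> + \<beta>))\<^sup>2)
      - (- (2 * \<beta>)) * (\<beta> * (rJ 1 \<beta> * rJ 1 \<beta>)) / ((- rJ 0 \<beta> + (- p) * logt \<tau>)\<^sup>2 + pi\<^sup>2 * (- p)\<^sup>2)) \<in> O[at_right 0](\<lambda>\<tau>. \<tau>)"
    by (rule bigo_log_quotient[OF N A B]) (use p in \<open>auto simp: power_mult_distrib\<close>)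
  moreover have "?N \<tau> / ((ampA 0 \<tau> (\<tau> + \<beta>))\<^sup>2 + (ampB 0 \<tau> (\<tau> + \<beta>))\<^sup>2) = phase_term \<beta> 0 \<tau>" for \<tau>
    by (simp add: phase_term_def)
  moreover have "(- (2 * \<beta>)) * (\<beta> * (rJ 1 \<beta> * rJ 1 \<beta>)) / ((- rJ 0 \<beta> + (- p) * logt \<tau>)\<^sup>2 + pi\<^sup>2 * (- p)\<^sup>2)
     = - 2 / ((logt \<tau> + rJ 0 \<beta> / p)\<^sup>2 + pi\<^sup>2)" for \<tau>
  proof -
    have "- rJ 0 \<beta> + (- p) * logt \<tau> = (- p) * (logt \<tau> + rJ 0 \<beta> / p)" using p by (simp add: field_simps)
    then have e1: "(- rJ 0 \<beta> + (- p) * logt \<tau>)\<^sup>2 + pi\<^sup>2 * (- p)\<^sup>2 = p\<^sup>2 * ((logt \<tau> + rJ 0 \<beta> / p)\<^sup>2 + pi\<^sup>2)"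
      by (simp only: power_mult_distrib power2_minus) (simp add: distrib_left mult.commute)
    have e2: "(- (2 * \<beta>)) * (\<beta> * (rJ 1 \<beta> * rJ 1 \<beta>)) = p\<^sup>2 * (- 2)" by (simp add: p_def power2_eq_square)
    show ?thesis unfolding e1 e2 using p by (intro mult_divide_mult_cancel_left) simp
  qed
  ultimately show ?thesis by (simp only: p_def)
qed

text \<open>At a zero of \<open>rJ 0\<close> the pole of \<open>rY 1\<close> is softened to a
  constant as large as the coefficient of the logarithm, so A is j - j \<open>logt \<tau>\<close> to
  leading order. This gives the -1 here, and the -1/2 of the final formula after halving.\<close>

lemma phase_term_1_log:
  assumes "\<beta> > 0" "rJ 0 \<beta> = 0"
  shows "(\<lambda>\<tau>. phase_term \<beta> 1 \<tau> - (- 2 / ((logt \<tau> - 1)\<^sup>2 + pi\<^sup>2))) \<in> O[at_right 0](\<lambda>\<tau>. \<tau>)"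
proof -
  define j where "j = rJ 1 \<beta>"
  have j: "j \<noteq> 0" using rJ_not_both_0[OF assms] by (simp add: j_def)
  have rec: "\<beta> * rJ 2 \<beta> = j" using rJ_rec[of 0 \<beta>] assms(2) by (simp add: numeral_2_eq_2 j_def)
  have c: "(\<lambda>\<tau>. k - k) \<in> O[at_right 0](\<lambda>\<tau>::real. \<tau>)" for k :: real by simp
  note m = bigo_mult_const[OF _ _ t_tendsto] and m' = bigo_mult_const[OF _ _ t_ln_tendsto]
  have J0: "(\<lambda>\<tau>. rJ 0 (\<tau> + \<beta>) / \<tau> - (- j)) \<in> O[at_right 0](\<lambda>\<tau>. \<tau>)"
    using rJ_shift_zero_bigo[OF assms(2)] by (simp add: j_def)
  let ?N = "\<lambda>\<tau>. (2 * \<beta>) * (rJ 2 (\<tau> + \<beta>) * (rJ 0 (\<tau> + \<beta>) / \<tau>))"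
  have N: "(\<lambda>\<tau>. ?N \<tau> - (2 * \<beta>) * (rJ 2 \<beta> * (- j))) \<in> O[at_right 0](\<lambda>\<tau>. \<tau>)"
    by (intro m c J0 rJ_shift_bigo)
  have B: "(\<lambda>\<tau>. ampB 1 \<tau> (\<tau> + \<beta>) - pi * j) \<in> O[at_right 0](\<lambda>\<tau>. \<tau>)"
    using ampB_bigo[of 1 \<beta>] rec by (simp add: numeral_2_eq_2)
  have 1: "(\<lambda>\<tau>. (rJ 0 (\<tau> + \<beta>) / \<tau>) * (pi * (\<tau> * rY 1 \<tau>)) - (- j) * (-1)) \<in> O[at_right 0](\<lambda>\<tau>. \<tau> * ln \<tau>)"
    by (rule m'[OF t_bigo[OF J0] rY_1_bigo'])
  have 2: "(\<lambda>\<tau>. rJ 1 (\<tau> + \<beta>) * (pi * rY 0 \<tau>) - j * logt \<tau>) \<in> O[at_right 0](\<lambda>\<tau>. \<tau> * ln \<tau>)"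
    unfolding j_def by (rule bigo_mult_log[OF rJ_shift_bigo])
  have ev: "eventually (\<lambda>\<tau>. ((rJ 0 (\<tau> + \<beta>) / \<tau>) * (pi * (\<tau> * rY 1 \<tau>)) - (- j) * (-1)) - (rJ 1 (\<tau> + \<beta>) * (pi * rY 0 \<tau>) - j * logt \<tau>)
       = ampA 1 \<tau> (\<tau> + \<beta>) - (j + (- j) * logt \<tau>)) (at_right 0)"
    using eventually_at_right_less[of 0]
  proof eventually_elim
    case (elim \<tau>)
    then show ?case using ampA_Suc[OF elim, of 0 "\<tau> + \<beta>"] by (simp add: algebra_simps)
  qed
  have A: "(\<lambda>\<tau>. ampA 1 \<tau> (\<tau> + \<beta>) - (j + (- j) * logt \<tau>)) \<in> O[at_right 0](\<lambda>\<tau>. \<tau> * ln \<tau>)"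
    using sum_in_bigo(2)[OF 1 2] unfolding landau_o.big.in_cong[OF ev] .
  have "(\<lambda>\<tau>. ?N \<tau> / ((ampA 1 \<tau> (\<tau> + \<beta>))\<^sup>2 + (ampB 1 \<tau> (\<tau> + \<beta>))\<^sup>2)
      - (2 * \<beta>) * (rJ 2 \<beta> * (- j)) / ((j + (- j) * logt \<tau>)\<^sup>2 + pi\<^sup>2 * (- j)\<^sup>2)) \<in> O[at_right 0](\<lambda>\<tau>. \<tau>)"
    by (rule bigo_log_quotient[OF N A B]) (use j in \<open>auto simp: power_mult_distrib\<close>)
  moreover have "?N \<tau> / ((ampA 1 \<tau> (\<tau> + \<beta>))\<^sup>2 + (ampB 1 \<tau> (\<tau> + \<beta>))\<^sup>2) = phase_term \<beta> 1 \<tau>" for \<tau>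
    using phase_term_Suc[of \<beta> 0 \<tau>] by (simp add: numeral_2_eq_2)
  moreover have "(2 * \<beta>) * (rJ 2 \<beta> * (- j)) / ((j + (- j) * logt \<tau>)\<^sup>2 + pi\<^sup>2 * (- j)\<^sup>2) = - 2 / ((logt \<tau> - 1)\<^sup>2 + pi\<^sup>2)" for \<tau>
  proof -
    have e1: "(j + (- j) * logt \<tau>)\<^sup>2 + pi\<^sup>2 * (- j)\<^sup>2 = j\<^sup>2 * ((logt \<tau> - 1)\<^sup>2 + pi\<^sup>2)"
      by (simp add: power2_eq_square algebra_simps)
    have "(2 * \<beta>) * (rJ 2 \<beta> * (- j)) = - 2 * j * (\<beta> * rJ 2 \<beta>)" by (simp add: mult_ac)
    then have e2: "(2 * \<beta>) * (rJ 2 \<beta> * (- j)) = j\<^sup>2 * (- 2)" unfolding rec by (simp add: power2_eq_square)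
    show ?thesis unfolding e1 e2 using j by (intro mult_divide_mult_cancel_left) simp
  qed
  ultimately show ?thesis by (simp only:)
qed

lemma bigo_quotient_const:
  fixes N A B h :: "real \<Rightarrow> real"
  assumes N: "(\<lambda>t. N t - N0) \<in> O[F](h)" and A: "(\<lambda>t. A t - A0) \<in> O[F](h)" and B: "B \<in> O[F](h)"
    and h: "(h \<longlongrightarrow> 0) F" and A0: "A0 \<noteq> 0"
  shows "(\<lambda>t. N t / ((A t)\<^sup>2 + (B t)\<^sup>2) - N0 / A0\<^sup>2) \<in> O[F](h)"
proof (rule bigo_divide_perturbed[OF N _ h, where c = "A0\<^sup>2"])
  have "(\<lambda>t. (A t * A t - A0 * A0) + (B t * B t - 0 * 0)) \<in> O[F](h)"
    using B by (intro sum_in_bigo(1) bigo_mult_const A h) simp_all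
  then show "(\<lambda>t. (A t)\<^sup>2 + (B t)\<^sup>2 - A0\<^sup>2) \<in> O[F](\<lambda>t. h t * A0\<^sup>2)"
    using A0 by (simp add: power2_eq_square algebra_simps)
qed (use A0 in auto)

lemma t_mult_bigo: "g \<in> O[at_right 0](h) \<Longrightarrow> (\<lambda>t. t * g t) \<in> O[at_right 0](\<lambda>t::real. t * (h t :: real))"
  by (intro landau_o.big.mult landau_o.big_refl)

lemma t_rY_0_bigo:
  assumes "f \<in> O[at_right 0](\<lambda>\<tau>. \<tau>)"
  shows "(\<lambda>\<tau>. f \<tau> * (pi * rY 0 \<tau>)) \<in> O[at_right 0](\<lambda>\<tau>. \<tau> * ln \<tau>)"
proof -
  have "(\<lambda>\<tau>. f \<tau> - 0) \<in> O[at_right 0](\<lambda>\<tau>. \<tau>)" using assms by simp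
  from bigo_mult_log[OF this] show ?thesis by simp
qed

section \<open>The s-resonant case\<close>

context
  fixes \<beta> :: real
  assumes \<beta>: "\<beta> > 0" and j1: "rJ 1 \<beta> = 0"
begin

lemma rJ_0_nonzero: "rJ 0 \<beta> \<noteq> 0"
  using rJ_not_both_0[OF \<beta>, of 0] j1 by auto

lemma rJ_1_quotient_bigo: "(\<lambda>\<tau>. rJ 1 (\<tau> + \<beta>) / \<tau> - (- rJ 2 \<beta>)) \<in> O[at_right 0](\<lambda>\<tau>. \<tau>)"
  using rJ_shift_zero_bigo[OF j1] by (simp add: numeral_2_eq_2)

text \<open>The numerator contains the square of \<open>rJ 1\<close>, of size \<tau>^2, while
  \<open>ampA\<close> of order 0 tends to - \<open>rJ 0 \<beta>\<close>, which is not 0.\<close>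

lemma phase_term_0_s: "phase_term \<beta> 0 \<in> O[at_right 0](\<lambda>\<tau>. \<tau> * (\<tau> * ln \<tau>))"
proof -
  let ?N = "\<lambda>\<tau>. (- (2 * \<beta>)) * ((\<tau> + \<beta>) * ((rJ 1 (\<tau> + \<beta>) / \<tau>) * (rJ 1 (\<tau> + \<beta>) / \<tau>)))"
  let ?Q = "\<lambda>\<tau>. ?N \<tau> / ((ampA 0 \<tau> (\<tau> + \<beta>))\<^sup>2 + (ampB 0 \<tau> (\<tau> + \<beta>))\<^sup>2)"
  let ?Nz = "(- (2 * \<beta>)) * (\<beta> * ((- rJ 2 \<beta>) * (- rJ 2 \<beta>)))"
  have c: "(\<lambda>\<tau>. k - k) \<in> O[at_right 0](\<lambda>\<tau>::real. \<tau>)" for k :: real by simp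
  note m = bigo_mult_const[OF _ _ t_tendsto]
  have N: "(\<lambda>\<tau>. ?N \<tau> - ?Nz) \<in> O[at_right 0](\<lambda>\<tau>. \<tau>)"
    by (intro m c shift_bigo rJ_1_quotient_bigo)
  have A: "(\<lambda>\<tau>. ampA 0 \<tau> (\<tau> + \<beta>) - (- rJ 0 \<beta>)) \<in> O[at_right 0](\<lambda>\<tau>. \<tau> * ln \<tau>)"
    using ampA_0_bigo[of \<beta>] j1 by simp
  have B: "(\<lambda>\<tau>. ampB 0 \<tau> (\<tau> + \<beta>)) \<in> O[at_right 0](\<lambda>\<tau>. \<tau> * ln \<tau>)"
    using t_bigo[OF ampB_bigo[of 0 \<beta>]] j1 by simp
  have "(\<lambda>\<tau>. ?Q \<tau> - ?Nz / (- rJ 0 \<beta>)\<^sup>2) \<in> O[at_right 0](\<lambda>\<tau>. \<tau> * ln \<tau>)"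
    by (rule bigo_quotient_const[OF t_bigo[OF N] A B t_ln_tendsto]) (use rJ_0_nonzero in simp)
  from tendsto_imp_bigo_1[OF tendsto_if_bigo_diff[OF this t_ln_tendsto]]
  have "(\<lambda>\<tau>. \<tau>\<^sup>2 * ?Q \<tau>) \<in> O[at_right 0](\<lambda>\<tau>. \<tau>\<^sup>2 * 1)"
    by (intro landau_o.big.mult landau_o.big_refl)
  moreover have "(\<lambda>\<tau>::real. \<tau>\<^sup>2 * 1) \<in> O[at_right 0](\<lambda>\<tau>. \<tau> * (\<tau> * ln \<tau>))" by real_asymp
  ultimately have *: "(\<lambda>\<tau>. \<tau>\<^sup>2 * ?Q \<tau>) \<in> O[at_right 0](\<lambda>\<tau>. \<tau> * (\<tau> * ln \<tau>))" by (rule landau_o.big_trans)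
  have ev: "eventually (\<lambda>\<tau>. \<tau>\<^sup>2 * ?Q \<tau> = phase_term \<beta> 0 \<tau>) (at_right 0)"
    using eventually_at_right_less[of 0] by eventually_elim (simp add: phase_term_def power2_eq_square)
  from * show ?thesis unfolding landau_o.big.in_cong[OF ev] .
qed

text \<open>Order 1 is not resonant, so A is - \<open>rJ 0 \<beta>\<close> / \<tau> to leading
  order; the coefficient -2 then follows from \<beta> \<open>rJ 2 \<beta>\<close> = -
  \<open>rJ 0 \<beta>\<close>.\<close>

lemma phase_term_1_s: "(\<lambda>\<tau>. phase_term \<beta> 1 \<tau> - (- 2 * \<tau>)) \<in> O[at_right 0](\<lambda>\<tau>. \<tau> * (\<tau> * ln \<tau>))"
proof -
  define q where "q = rJ 0 \<beta>"
  have q: "q \<noteq> 0" using rJ_0_nonzero by (simp add: q_def)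
  have rec: "\<beta> * rJ 2 \<beta> = - q" using rJ_rec[of 0 \<beta>] j1 by (simp add: numeral_2_eq_2 q_def)
  let ?N = "\<lambda>\<tau>. (2 * \<beta>) * (rJ 2 (\<tau> + \<beta>) * rJ 0 (\<tau> + \<beta>))"
  let ?Q = "\<lambda>\<tau>. ?N \<tau> / ((\<tau> * ampA 1 \<tau> (\<tau> + \<beta>))\<^sup>2 + (\<tau> * ampB 1 \<tau> (\<tau> + \<beta>))\<^sup>2)"
  have c: "(\<lambda>\<tau>. k - k) \<in> O[at_right 0](\<lambda>\<tau>::real. \<tau>)" for k :: real by simp
  have t: "(\<lambda>\<tau>::real. \<tau> - 0) \<in> O[at_right 0](\<lambda>\<tau>. \<tau>)" by simp
  note m = bigo_mult_const[OF _ _ t_tendsto] and m' = bigo_mult_const[OF _ _ t_ln_tendsto]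
  have N: "(\<lambda>\<tau>. ?N \<tau> - (2 * \<beta>) * (rJ 2 \<beta> * rJ 0 \<beta>)) \<in> O[at_right 0](\<lambda>\<tau>. \<tau>)"
    by (intro m c rJ_shift_bigo)
  have 1: "(\<lambda>\<tau>. rJ 0 (\<tau> + \<beta>) * (pi * (\<tau> * rY 1 \<tau>)) - rJ 0 \<beta> * (-1)) \<in> O[at_right 0](\<lambda>\<tau>. \<tau> * ln \<tau>)"
    by (rule m'[OF t_bigo[OF rJ_shift_bigo] rY_1_bigo'])
  have "(\<lambda>\<tau>. \<tau> * rJ 1 (\<tau> + \<beta>) - 0 * rJ 1 \<beta>) \<in> O[at_right 0](\<lambda>\<tau>. \<tau>)"
    by (intro m t rJ_shift_bigo)
  then have 2: "(\<lambda>\<tau>. (\<tau> * rJ 1 (\<tau> + \<beta>)) * (pi * rY 0 \<tau>)) \<in> O[at_right 0](\<lambda>\<tau>. \<tau> * ln \<tau>)"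
    by (intro t_rY_0_bigo) simp
  have ev: "eventually (\<lambda>\<tau>. (rJ 0 (\<tau> + \<beta>) * (pi * (\<tau> * rY 1 \<tau>)) - rJ 0 \<beta> * (-1)) - (\<tau> * rJ 1 (\<tau> + \<beta>)) * (pi * rY 0 \<tau>)
       = \<tau> * ampA 1 \<tau> (\<tau> + \<beta>) - (- q)) (at_right 0)"
    using eventually_at_right_less[of 0]
  proof eventually_elim
    case (elim \<tau>)
    have A: "ampA 1 \<tau> (\<tau> + \<beta>) = pi * (rJ 0 (\<tau> + \<beta>) * rY 1 \<tau> - rJ 1 (\<tau> + \<beta>) * rY 0 \<tau>)"
      using ampA_Suc[OF elim, of 0 "\<tau> + \<beta>"] by simp
    show ?case unfolding A by (simp add: q_def algebra_simps)
  qed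
  have A: "(\<lambda>\<tau>. \<tau> * ampA 1 \<tau> (\<tau> + \<beta>) - (- q)) \<in> O[at_right 0](\<lambda>\<tau>. \<tau> * ln \<tau>)"
    using sum_in_bigo(2)[OF 1 2] unfolding landau_o.big.in_cong[OF ev] .
  have "(\<lambda>\<tau>. \<tau> * ampB 1 \<tau> (\<tau> + \<beta>) - 0 * (pi * (\<beta> * rJ (Suc 1) \<beta> / fact 1))) \<in> O[at_right 0](\<lambda>\<tau>. \<tau>)"
    by (rule m[OF t ampB_bigo])
  then have B: "(\<lambda>\<tau>. \<tau> * ampB 1 \<tau> (\<tau> + \<beta>)) \<in> O[at_right 0](\<lambda>\<tau>. \<tau> * ln \<tau>)"
    by (intro t_bigo) simp
  have "(\<lambda>\<tau>. ?Q \<tau> - (2 * \<beta>) * (rJ 2 \<beta> * rJ 0 \<beta>) / (- q)\<^sup>2) \<in> O[at_right 0](\<lambda>\<tau>. \<tau> * ln \<tau>)"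
    by (rule bigo_quotient_const[OF t_bigo[OF N] A B t_ln_tendsto]) (use q in simp)
  moreover have lim: "(2 * \<beta>) * (rJ 2 \<beta> * rJ 0 \<beta>) / (- q)\<^sup>2 = - 2"
  proof -
    have "(2 * \<beta>) * (rJ 2 \<beta> * rJ 0 \<beta>) = 2 * (\<beta> * rJ 2 \<beta>) * q" by (simp add: q_def)
    also have "\<dots> = (- 2) * (- q)\<^sup>2" unfolding rec by (simp add: power2_eq_square)
    finally have E: "(2 * \<beta>) * (rJ 2 \<beta> * rJ 0 \<beta>) = (- 2) * (- q)\<^sup>2" .
    show ?thesis unfolding E using q by simp
  qed
  ultimately have *: "(\<lambda>\<tau>. \<tau> * (?Q \<tau> - (- 2))) \<in> O[at_right 0](\<lambda>\<tau>. \<tau> * (\<tau> * ln \<tau>))"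
    unfolding lim by (intro t_mult_bigo)
  have ev: "eventually (\<lambda>\<tau>. \<tau> * (?Q \<tau> - (- 2)) = phase_term \<beta> 1 \<tau> - (- 2 * \<tau>)) (at_right 0)"
    using eventually_at_right_less[of 0]
  proof eventually_elim
    case (elim \<tau>)
    have e: "(\<tau> * x)\<^sup>2 + (\<tau> * y)\<^sup>2 = \<tau> * (\<tau> * (x\<^sup>2 + y\<^sup>2))" for x y
      by (simp add: power2_eq_square algebra_simps)
    have "\<tau> * ?Q \<tau> = phase_term \<beta> 1 \<tau>" using elim phase_term_Suc[of \<beta> 0 \<tau>]
      unfolding e by (simp add: numeral_2_eq_2 mult.assoc)
    then show ?case by (simp add: algebra_simps)
  qed
  from * show ?thesis unfolding landau_o.big.in_cong[OF ev] .
qed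

text \<open>Order 2 is resonant: both terms of \<open>ampA_Suc\<close> have size 1 / \<tau> and
  contribute j each, whence 2 j. With the numerator vanishing to first order, the whole is of size
  \<tau>, as for order 1, and not of size \<tau>^2.\<close>

lemma phase_term_2_s: "(\<lambda>\<tau>. phase_term \<beta> 2 \<tau> - (- \<tau>)) \<in> O[at_right 0](\<lambda>\<tau>. \<tau> * (\<tau> * ln \<tau>))"
proof -
  define j where "j = rJ 2 \<beta>"
  have j: "j \<noteq> 0" using rJ_rec[of 0 \<beta>] j1 rJ_0_nonzero by (auto simp: numeral_2_eq_2 j_def)
  have rec: "\<beta> * rJ 3 \<beta> = 2 * j" using rJ_rec[of 1 \<beta>] j1 by (simp add: numeral_2_eq_2 numeral_3_eq_3 j_def)
  have J: "(\<lambda>\<tau>. rJ 1 (\<tau> + \<beta>) / \<tau> - (- j)) \<in> O[at_right 0](\<lambda>\<tau>. \<tau>)"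
    using rJ_1_quotient_bigo by (simp add: j_def)
  have J2: "(\<lambda>\<tau>. rJ 2 (\<tau> + \<beta>) - j) \<in> O[at_right 0](\<lambda>\<tau>. \<tau>)"
    unfolding j_def by (rule rJ_shift_bigo)
  let ?N = "\<lambda>\<tau>. (2 * \<beta>) * (rJ 3 (\<tau> + \<beta>) * (rJ 1 (\<tau> + \<beta>) / \<tau>))"
  let ?Q = "\<lambda>\<tau>. ?N \<tau> / ((\<tau> * ampA 2 \<tau> (\<tau> + \<beta>))\<^sup>2 + (\<tau> * ampB 2 \<tau> (\<tau> + \<beta>))\<^sup>2)"
  have c: "(\<lambda>\<tau>. k - k) \<in> O[at_right 0](\<lambda>\<tau>::real. \<tau>)" for k :: real by simp
  have t: "(\<lambda>\<tau>::real. \<tau> - 0) \<in> O[at_right 0](\<lambda>\<tau>. \<tau>)" by simp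
  note m = bigo_mult_const[OF _ _ t_tendsto] and m' = bigo_mult_const[OF _ _ t_ln_tendsto]
  have N: "(\<lambda>\<tau>. ?N \<tau> - (2 * \<beta>) * (rJ 3 \<beta> * (- j))) \<in> O[at_right 0](\<lambda>\<tau>. \<tau>)"
    by (intro m c J rJ_shift_bigo)
  have "(\<lambda>\<tau>. \<tau> * (pi * rY 0 \<tau>)) \<in> O[at_right 0](\<lambda>\<tau>. \<tau> * ln \<tau>)"
    by (rule t_rY_0_bigo) simp
  from sum_in_bigo(2)[OF rY_1_bigo' this]
  have Y2: "(\<lambda>\<tau>. (pi * (\<tau> * rY 1 \<tau>) - \<tau> * (pi * rY 0 \<tau>)) - (-1)) \<in> O[at_right 0](\<lambda>\<tau>. \<tau> * ln \<tau>)"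
    by (simp add: algebra_simps)
  have 1: "(\<lambda>\<tau>. (rJ 1 (\<tau> + \<beta>) / \<tau>) * (pi * (\<tau> * rY 1 \<tau>) - \<tau> * (pi * rY 0 \<tau>)) - (- j) * (-1)) \<in> O[at_right 0](\<lambda>\<tau>. \<tau> * ln \<tau>)"
    by (rule m'[OF t_bigo[OF J] Y2])
  have 2: "(\<lambda>\<tau>. rJ 2 (\<tau> + \<beta>) * (pi * (\<tau> * rY 1 \<tau>)) - j * (-1)) \<in> O[at_right 0](\<lambda>\<tau>. \<tau> * ln \<tau>)"
    by (rule m'[OF t_bigo[OF J2] rY_1_bigo'])
  have ev: "eventually (\<lambda>\<tau>. ((rJ 1 (\<tau> + \<beta>) / \<tau>) * (pi * (\<tau> * rY 1 \<tau>) - \<tau> * (pi * rY 0 \<tau>)) - (- j) * (-1))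
       - (rJ 2 (\<tau> + \<beta>) * (pi * (\<tau> * rY 1 \<tau>)) - j * (-1))
       = \<tau> * ampA 2 \<tau> (\<tau> + \<beta>) - 2 * j) (at_right 0)"
    using eventually_at_right_less[of 0]
  proof eventually_elim
    case (elim \<tau>)
    have Y: "rY 1 \<tau> = rY 0 \<tau> + \<tau> * rY 2 \<tau>"
      using rY_rec[OF elim, of 0] by (simp add: numeral_2_eq_2)
    have A: "ampA 2 \<tau> (\<tau> + \<beta>) = pi * (rJ 1 (\<tau> + \<beta>) * rY 2 \<tau> - rJ 2 (\<tau> + \<beta>) * rY 1 \<tau>)"
      using ampA_Suc[OF elim, of 1 "\<tau> + \<beta>"] by (simp add: numeral_2_eq_2)
    show ?case using elim unfolding A Y by (simp add: field_simps)
  qed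
  have A: "(\<lambda>\<tau>. \<tau> * ampA 2 \<tau> (\<tau> + \<beta>) - 2 * j) \<in> O[at_right 0](\<lambda>\<tau>. \<tau> * ln \<tau>)"
    using sum_in_bigo(2)[OF 1 2] unfolding landau_o.big.in_cong[OF ev] .
  have "(\<lambda>\<tau>. \<tau> * ampB 2 \<tau> (\<tau> + \<beta>) - 0 * (pi * (\<beta> * rJ (Suc 2) \<beta> / fact 2))) \<in> O[at_right 0](\<lambda>\<tau>. \<tau>)"
    by (rule m[OF t ampB_bigo])
  then have B: "(\<lambda>\<tau>. \<tau> * ampB 2 \<tau> (\<tau> + \<beta>)) \<in> O[at_right 0](\<lambda>\<tau>. \<tau> * ln \<tau>)"
    by (intro t_bigo) simp
  have "(\<lambda>\<tau>. ?Q \<tau> - (2 * \<beta>) * (rJ 3 \<beta> * (- j)) / (2 * j)\<^sup>2) \<in> O[at_right 0](\<lambda>\<tau>. \<tau> * ln \<tau>)"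
    by (rule bigo_quotient_const[OF t_bigo[OF N] A B t_ln_tendsto]) (use j in simp)
  moreover have lim: "(2 * \<beta>) * (rJ 3 \<beta> * (- j)) / (2 * j)\<^sup>2 = - 1"
  proof -
    have "(2 * \<beta>) * (rJ 3 \<beta> * (- j)) = - 2 * (\<beta> * rJ 3 \<beta>) * j" by simp
    then show ?thesis unfolding rec using j by (simp add: power2_eq_square)
  qed
  ultimately have *: "(\<lambda>\<tau>. \<tau> * (?Q \<tau> - (- 1))) \<in> O[at_right 0](\<lambda>\<tau>. \<tau> * (\<tau> * ln \<tau>))"
    unfolding lim by (intro t_mult_bigo)
  have ev: "eventually (\<lambda>\<tau>. \<tau> * (?Q \<tau> - (- 1)) = phase_term \<beta> 2 \<tau> - (- \<tau>)) (at_right 0)"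
    using eventually_at_right_less[of 0]
  proof eventually_elim
    case (elim \<tau>)
    have e: "(\<tau> * x)\<^sup>2 + (\<tau> * y)\<^sup>2 = \<tau> * (\<tau> * (x\<^sup>2 + y\<^sup>2))" for x y
      by (simp add: power2_eq_square algebra_simps)
    have "\<tau> * ?Q \<tau> = phase_term \<beta> 2 \<tau>" using elim phase_term_Suc[of \<beta> 1 \<tau>]
      unfolding e by (simp add: numeral_2_eq_2 numeral_3_eq_3 mult.assoc)
    then show ?case by (simp add: algebra_simps)
  qed
  from * show ?thesis unfolding landau_o.big.in_cong[OF ev] .
qed

end

section \<open>Zero-energy limit of the eigenvalues\<close>

lemma logt_at_infinity: "filterlim logt at_infinity (at_right 0)"
proof -
  have "filterlim (\<lambda>\<tau>. 2 * euler_mascheroni + ln \<tau>) at_infinity (at_right (0::real))"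
    by (intro tendsto_add_filterlim_at_infinity[OF tendsto_const] filterlim_at_bot_imp_at_infinity ln_at_0)
  then show ?thesis by (simp add: logt_def[abs_def] add.commute)
qed

text \<open>\<open>ampB\<close> has a limit and \<open>ampA\<close> is unbounded, except for n = 0
  at a zero of \<open>rJ 1\<close>: there \<open>ampA\<close> has a nonzero limit and
  \<open>ampB\<close> tends to 0.\<close>

lemma amp_quotient_at_right_0:
  assumes \<beta>: "\<beta> > 0"
  shows "((\<lambda>\<tau>. ampB n \<tau> (\<tau> + \<beta>) / ampA n \<tau> (\<tau> + \<beta>)) \<longlongrightarrow> 0) (at_right 0)"
    and "eventually (\<lambda>\<tau>. ampA n \<tau> (\<tau> + \<beta>) \<noteq> 0) (at_right 0)"
proof -
  let ?A = "\<lambda>\<tau>. ampA n \<tau> (\<tau> + \<beta>)" and ?B = "\<lambda>\<tau>. ampB n \<tau> (\<tau> + \<beta>)"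
  let ?b = "pi * (\<beta> * rJ (Suc n) \<beta> / fact n)"
  have B: "(?B \<longlongrightarrow> ?b) (at_right 0)"
    by (rule tendsto_if_bigo_diff[OF ampB_bigo t_tendsto])
  have inf: "((\<lambda>\<tau>. ?B \<tau> / ?A \<tau>) \<longlongrightarrow> 0) (at_right 0) \<and> eventually (\<lambda>\<tau>. ?A \<tau> \<noteq> 0) (at_right 0)" if "filterlim ?A at_infinity (at_right 0)"
    using tendsto_divide_0[OF B that] filterlim_at_infinity_imp_eventually_ne[OF that, of 0] by simp
  have "((\<lambda>\<tau>. ?B \<tau> / ?A \<tau>) \<longlongrightarrow> 0) (at_right 0) \<and> eventually (\<lambda>\<tau>. ?A \<tau> \<noteq> 0) (at_right 0)"
  proof (cases n)
    case 0
    note A = ampA_0_bigo[of \<beta>]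
    show ?thesis
    proof (cases "rJ 1 \<beta> = 0")
      case True
      have "(?A \<longlongrightarrow> - rJ 0 \<beta>) (at_right 0)"
        by (rule tendsto_if_bigo_diff[OF _ t_ln_tendsto]) (use A True 0 in simp)
      moreover have "- rJ 0 \<beta> \<noteq> 0" using rJ_0_nonzero[OF \<beta> True] by simp
      ultimately show ?thesis
        using tendsto_divide[OF B, of ?A "- rJ 0 \<beta>"] tendsto_imp_eventually_ne[of ?A "- rJ 0 \<beta>" _ 0] True 0 by simp
    next
      case False
      have "filterlim (\<lambda>\<tau>. (ampA 0 \<tau> (\<tau> + \<beta>) - (- rJ 0 \<beta> + (- (\<beta> * rJ 1 \<beta>)) * logt \<tau>))
          + (- rJ 0 \<beta> + (- (\<beta> * rJ 1 \<beta>)) * logt \<tau>)) at_infinity (at_right 0)"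
        using False \<beta>
        by (intro tendsto_add_filterlim_at_infinity[OF tendsto_if_bigo_diff[of _ 0, OF _ t_ln_tendsto]]
              tendsto_add_filterlim_at_infinity[OF tendsto_const]
              tendsto_mult_filterlim_at_infinity[OF tendsto_const] logt_at_infinity)
           (use A in simp_all)
      then have "filterlim ?A at_infinity (at_right 0)" by (simp add: 0)
      with inf show ?thesis by simp
    qed
  next
    case (Suc m)
    obtain c where c: "c > 0" "eventually (\<lambda>\<tau>. c * uY (if rJ m \<beta> = 0 then m else Suc m) \<tau> \<le> \<bar>ampA (Suc m) \<tau> (\<tau> + \<beta>)\<bar>) (at_right 0)"
      by (rule ampA_lower_bound[OF \<beta>]) (rule that)
    have "filterlim (\<lambda>\<tau>. norm (?A \<tau>)) at_top (at_right 0)"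
    proof (rule filterlim_at_top_mono)
      show "filterlim (\<lambda>\<tau>. c * uY (if rJ m \<beta> = 0 then m else Suc m) \<tau>) at_top (at_right 0)"
        by (rule filterlim_tendsto_pos_mult_at_top[OF tendsto_const c(1) uY_tendsto])
    qed (use c(2) Suc in simp)
    then have "filterlim ?A at_infinity (at_right 0)" by (simp add: filterlim_at_infinity_conv_norm_at_top)
    with inf show ?thesis by simp
  qed
  then show "((\<lambda>\<tau>. ?B \<tau> / ?A \<tau>) \<longlongrightarrow> 0) (at_right 0)" "eventually (\<lambda>\<tau>. ?A \<tau> \<noteq> 0) (at_right 0)" by auto
qed

text \<open>Without the limit 1 no continuous phase could start at the value 0.\<close>

lemma amp_ratio_tendsto:
  assumes \<beta>: "\<beta> > 0"
  shows "((\<lambda>\<tau>. amp_ratio n \<tau> (\<tau> + \<beta>)) \<longlongrightarrow> 1) (at_right 0)"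
proof -
  define q where "q \<tau> = complex_of_real (ampB n \<tau> (\<tau> + \<beta>) / ampA n \<tau> (\<tau> + \<beta>))" for \<tau>
  have "(q \<longlongrightarrow> of_real 0) (at_right 0)"
    unfolding q_def[abs_def] by (rule tendsto_of_real[OF amp_quotient_at_right_0(1)[OF \<beta>, of n]])
  then have "((\<lambda>\<tau>. (1 - \<i> * q \<tau>) / (1 + \<i> * q \<tau>)) \<longlongrightarrow> (1 - \<i> * of_real 0) / (1 + \<i> * of_real 0)) (at_right 0)"
    by (intro tendsto_intros) auto
  then have *: "((\<lambda>\<tau>. (1 - \<i> * q \<tau>) / (1 + \<i> * q \<tau>)) \<longlongrightarrow> 1) (at_right 0)" by simp
  show ?thesis
  proof (rule Lim_transform_eventually[OF *])
    show "eventually (\<lambda>\<tau>. (1 - \<i> * q \<tau>) / (1 + \<i> * q \<tau>) = amp_ratio n \<tau> (\<tau> + \<beta>)) (at_right 0)"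
      using amp_quotient_at_right_0(2)[OF \<beta>, of n]
    proof eventually_elim
      case (elim \<tau>)
      let ?A = "complex_of_real (ampA n \<tau> (\<tau> + \<beta>))" and ?B = "complex_of_real (ampB n \<tau> (\<tau> + \<beta>))"
      have "?A - \<i> * ?B = ?A * (1 - \<i> * q \<tau>)" "?A + \<i> * ?B = ?A * (1 + \<i> * q \<tau>)"
        using elim by (simp_all add: q_def field_simps)
      then show ?case using elim by (simp add: amp_ratio_def)
    qed
  qed
qed

subsection \<open>The scattering phase\<close>

text \<open>A continuous logarithm exists on the contractible half-line; over the unit circle it is
  purely imaginary, and subtracting its value at 0 normalises it.\<close>

lemma unit_circle_lift:
  fixes S :: "real \<Rightarrow> complex"
  assumes S: "continuous_on {0..} S" "\<And>x. x \<ge> 0 \<Longrightarrow> norm (S x) = 1" "S 0 = 1"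
  obtains g where "continuous_on {0..} g" "g 0 = 0"
    "\<And>x. x \<ge> 0 \<Longrightarrow> exp (2 * complex_of_real pi * \<i> * complex_of_real (g x)) = S x"
proof -
  have "contractible {0::real..}" by (intro convex_imp_contractible convex_real_interval)
  moreover have "S x \<noteq> 0" if "x \<in> {0..}" for x using S(2)[of x] that by auto
  ultimately obtain h where h: "continuous_on {0..} h" "\<And>x. x \<in> {0..} \<Longrightarrow> S x = exp (h x)"
    using continuous_logarithm_on_contractible[OF S(1)] by blast
  have Re: "Re (h x) = 0" if "x \<ge> 0" for x
    using S(2)[OF that] h(2)[of x] that by simp
  define g where "g x = (Im (h x) - Im (h 0)) / (2 * pi)" for x
  show ?thesis
  proof (rule that)
    show "continuous_on {0..} g" unfolding g_def[abs_def] by (intro continuous_intros h) auto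
    show "g 0 = 0" by (simp add: g_def)
    fix x :: real assume x: "x \<ge> 0"
    have "2 * complex_of_real pi * \<i> * complex_of_real (g x) = h x - h 0"
      using Re[OF x] Re[of 0] by (simp add: complex_eq_iff g_def)
    moreover have "exp (h x - h 0) = S x / S 0" using h(2)[of x] h(2)[of 0] x by (simp add: exp_diff)
    ultimately show "exp (2 * complex_of_real pi * \<i> * complex_of_real (g x)) = S x" using S(3) by simp
  qed
qed

lemma norm_amp_ratio:
  assumes "\<tau> > 0" "\<eta> > 0"
  shows "norm (amp_ratio n \<tau> \<eta>) = 1"
proof -
  define q where "q = complex_of_real (ampA n \<tau> \<eta>) + \<i> * complex_of_real (ampB n \<tau> \<eta>)"
  have "q \<noteq> 0" unfolding q_def by (rule amp_complex_nonzero[OF assms])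
  moreover have "amp_ratio n \<tau> \<eta> = cnj q / q" by (simp add: amp_ratio_def q_def)
  ultimately show ?thesis by (simp add: norm_divide)
qed

context
  fixes a \<rho> :: real
  assumes a: "a > 0" and \<rho>: "\<rho> > 0"
begin

abbreviation (input) \<beta> :: real where "\<beta> \<equiv> a\<^sup>2 * \<rho>\<^sup>2 / 4"
abbreviation (input) tau :: "real \<Rightarrow> real" where "tau \<kappa> \<equiv> \<kappa>\<^sup>2 * \<rho>\<^sup>2 / 4"

lemma \<beta>_pos: "\<beta> > 0" using a \<rho> by simp

lemma tau_pos: "\<kappa> > 0 \<Longrightarrow> tau \<kappa> > 0" using \<rho> by simp

lemma tau_at_right_0: "filterlim tau (at_right 0) (at_right 0)"
proof -
  have "(tau \<longlongrightarrow> 0\<^sup>2 * \<rho>\<^sup>2 / 4) (at_right 0)" by (intro tendsto_intros) auto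
  moreover have "eventually (\<lambda>\<kappa>. tau \<kappa> > 0) (at_right 0)"
    using eventually_at_right_less[of 0] by eventually_elim (rule tau_pos)
  ultimately show ?thesis unfolding filterlim_at by (auto elim!: eventually_mono)
qed

lemma scattering_eigenvalue_amp:
  assumes "\<kappa> > 0"
  shows "scattering_eigenvalue a \<rho> l \<kappa> = amp_ratio (nat \<bar>l\<bar>) (tau \<kappa>) (tau \<kappa> + \<beta>)"
proof -
  interpret square_well a \<rho> \<kappa> using a \<rho> assms by unfold_locales
  have "\<eta> = tau \<kappa> + \<beta>" by (simp add: \<eta>_def algebra_simps add_divide_distrib)
  then show ?thesis using scattering_eigenvalue_eq[of l] by (simp only: \<tau>_def)
qed

lemma amp_chain_deriv:
  assumes "\<kappa> > 0"
  shows "((\<lambda>\<kappa>. ampA n (tau \<kappa>) (tau \<kappa> + \<beta>)) has_real_derivative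
      pi * (\<beta> * rJ (Suc n) (tau \<kappa> + \<beta>) * rY (Suc n) (tau \<kappa>) - of_nat n * rJ n (tau \<kappa> + \<beta>) * rY (Suc n) (tau \<kappa>) + of_nat n * rJ (Suc n) (tau \<kappa> + \<beta>) * rY n (tau \<kappa>)) * (\<kappa> * \<rho>\<^sup>2 / 2)) (at \<kappa>)"
    and "((\<lambda>\<kappa>. ampB n (tau \<kappa>) (tau \<kappa> + \<beta>)) has_real_derivative
      - pi * (\<beta> * rJ (Suc n) (tau \<kappa> + \<beta>) * rJ (Suc n) (tau \<kappa>) - of_nat n * rJ n (tau \<kappa> + \<beta>) * rJ (Suc n) (tau \<kappa>) + of_nat n * rJ (Suc n) (tau \<kappa> + \<beta>) * rJ n (tau \<kappa>)) * (\<kappa> * \<rho>\<^sup>2 / 2)) (at \<kappa>)"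
proof -
  have t: "(tau has_real_derivative \<kappa> * \<rho>\<^sup>2 / 2) (at \<kappa>)"
    by (auto intro!: derivative_eq_intros)
  show "((\<lambda>\<kappa>. ampA n (tau \<kappa>) (tau \<kappa> + \<beta>)) has_real_derivative
      pi * (\<beta> * rJ (Suc n) (tau \<kappa> + \<beta>) * rY (Suc n) (tau \<kappa>) - of_nat n * rJ n (tau \<kappa> + \<beta>) * rY (Suc n) (tau \<kappa>) + of_nat n * rJ (Suc n) (tau \<kappa> + \<beta>) * rY n (tau \<kappa>)) * (\<kappa> * \<rho>\<^sup>2 / 2)) (at \<kappa>)"
    by (rule DERIV_chain2[OF amp_deriv(1)[OF tau_pos[OF assms]] t])
  show "((\<lambda>\<kappa>. ampB n (tau \<kappa>) (tau \<kappa> + \<beta>)) has_real_derivative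
      - pi * (\<beta> * rJ (Suc n) (tau \<kappa> + \<beta>) * rJ (Suc n) (tau \<kappa>) - of_nat n * rJ n (tau \<kappa> + \<beta>) * rJ (Suc n) (tau \<kappa>) + of_nat n * rJ (Suc n) (tau \<kappa> + \<beta>) * rJ n (tau \<kappa>)) * (\<kappa> * \<rho>\<^sup>2 / 2)) (at \<kappa>)"
    by (rule DERIV_chain2[OF amp_deriv(2)[OF tau_pos[OF assms]] t])
qed

text \<open>Supplies the witness that \<open>SOME\<close> needs: the eigenvalue, continued by 1 to
  \<kappa> = 0, is continuous on the closed half-line and has modulus one.\<close>

lemma partial_phase_spec:
  "continuous_on {0..} (partial_phase a \<rho> l) \<and> partial_phase a \<rho> l 0 = 0 \<and>
     (\<forall>\<kappa>>0. exp (2 * complex_of_real pi * \<i> * complex_of_real (partial_phase a \<rho> l \<kappa>)) = scattering_eigenvalue a \<rho> l \<kappa>)"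
proof -
  define n where "n = nat \<bar>l\<bar>"
  define S where "S \<kappa> = (if \<kappa> = 0 then 1 else amp_ratio n (tau \<kappa>) (tau \<kappa> + \<beta>))" for \<kappa> :: real
  have "continuous (at \<kappa> within {0..}) S" if "\<kappa> \<ge> 0" for \<kappa>
  proof (cases "\<kappa> = 0")
    case True
    have "((\<lambda>\<kappa>. amp_ratio n (tau \<kappa>) (tau \<kappa> + \<beta>)) \<longlongrightarrow> 1) (at_right 0)"
      by (rule filterlim_compose[OF amp_ratio_tendsto[OF \<beta>_pos] tau_at_right_0])
    moreover have "eventually (\<lambda>\<kappa>. amp_ratio n (tau \<kappa>) (tau \<kappa> + \<beta>) = S \<kappa>) (at_right 0)"
      using eventually_at_right_less[of 0] by eventually_elim (simp add: S_def)
    ultimately have "(S \<longlongrightarrow> 1) (at_right 0)" by (rule Lim_transform_eventually)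
    then show ?thesis unfolding continuous_within True at_within_Ici_at_right by (simp add: S_def)
  next
    case False
    then have k: "\<kappa> > 0" using that by simp
    have nz: "complex_of_real (ampA n (tau \<kappa>) (tau \<kappa> + \<beta>)) + \<i> * complex_of_real (ampB n (tau \<kappa>) (tau \<kappa> + \<beta>)) \<noteq> 0"
      by (intro amp_complex_nonzero tau_pos add_pos_pos \<beta>_pos k)
    have "isCont (\<lambda>\<kappa>. amp_ratio n (tau \<kappa>) (tau \<kappa> + \<beta>)) \<kappa>"
      unfolding amp_ratio_def
      by (intro continuous_intros DERIV_isCont[OF amp_chain_deriv(1)[OF k]] DERIV_isCont[OF amp_chain_deriv(2)[OF k]] nz)
    moreover have "eventually (\<lambda>y. y \<in> {0<..}) (nhds \<kappa>)" using k by (intro eventually_nhds_in_open) auto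
    then have ev: "eventually (\<lambda>\<kappa>. amp_ratio n (tau \<kappa>) (tau \<kappa> + \<beta>) = S \<kappa>) (nhds \<kappa>)"
      by eventually_elim (simp add: S_def)
    ultimately have "isCont S \<kappa>" by (simp only: isCont_cong[OF ev])
    then show ?thesis by (rule continuous_at_imp_continuous_at_within)
  qed
  then have cont: "continuous_on {0..} S" by (simp add: continuous_on_eq_continuous_within)
  have norm: "norm (S \<kappa>) = 1" if "\<kappa> \<ge> 0" for \<kappa>
    using that norm_amp_ratio[OF tau_pos add_pos_pos[OF tau_pos \<beta>_pos], of \<kappa> \<kappa> n] by (simp add: S_def)
  obtain g where g: "continuous_on {0..} g" "g 0 = 0"
    "\<And>x. x \<ge> 0 \<Longrightarrow> exp (2 * complex_of_real pi * \<i> * complex_of_real (g x)) = S x"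
    using unit_circle_lift[OF cont norm] by (auto simp: S_def)
  have "continuous_on {0..} g \<and> g 0 = 0 \<and>
     (\<forall>\<kappa>>0. exp (2 * complex_of_real pi * \<i> * complex_of_real (g \<kappa>)) = scattering_eigenvalue a \<rho> l \<kappa>)"
    using g by (simp add: scattering_eigenvalue_amp n_def[symmetric] S_def)
  then show ?thesis unfolding partial_phase_def
    by (rule someI[where P = "\<lambda>g. continuous_on {0..} g \<and> g 0 = 0 \<and>
     (\<forall>\<kappa>>0. exp (2 * complex_of_real pi * \<i> * complex_of_real (g \<kappa>)) = scattering_eigenvalue a \<rho> l \<kappa>)"])
qed

text \<open>The eigenvalues for \<kappa> > 0 agree, so the predicates under \<open>SOME\<close> are
  equal and the chosen functions coincide, negative arguments included.\<close>

lemma partial_phase_abs: "partial_phase a \<rho> l = partial_phase a \<rho> (int (nat \<bar>l\<bar>))"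
proof -
  have "scattering_eigenvalue a \<rho> l \<kappa> = scattering_eigenvalue a \<rho> (int (nat \<bar>l\<bar>)) \<kappa>" if "\<kappa> > 0" for \<kappa>
    using that by (simp add: scattering_eigenvalue_amp)
  then show ?thesis unfolding partial_phase_def by (simp cong: conj_cong)
qed

lemma partial_phase_deriv:
  assumes k: "\<kappa> > 0"
  shows "(partial_phase a \<rho> (int n) has_real_derivative phase_term \<beta> n (tau \<kappa>) / \<kappa>) (at \<kappa>)"
proof -
  let ?g = "partial_phase a \<rho> (int n)"
  let ?A = "\<lambda>\<kappa>. ampA n (tau \<kappa>) (tau \<kappa> + \<beta>)" and ?B = "\<lambda>\<kappa>. ampB n (tau \<kappa>) (tau \<kappa> + \<beta>)"
  define A where "A = ?A \<kappa>"
  define B where "B = ?B \<kappa>"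
  define t where "t = tau \<kappa>"
  define j where "j = rJ n (t + \<beta>)"
  define j' where "j' = rJ (Suc n) (t + \<beta>)"
  \<comment> \<open>The derivative of \<open>tau\<close> at \<kappa>, rewritten below as 2 t /
    \<kappa>; its factor t lowers \<tau>^(n + 1) of the Wronskian identity to \<tau>^n.\<close>
  define c where "c = \<kappa> * \<rho>\<^sup>2 / 2"
  define A' where "A' = pi * (\<beta> * j' * rY (Suc n) t - of_nat n * j * rY (Suc n) t + of_nat n * j' * rY n t)"
  define B' where "B' = - pi * (\<beta> * j' * rJ (Suc n) t - of_nat n * j * rJ (Suc n) t + of_nat n * j' * rJ n t)"
  have t: "t > 0" using k \<rho> by (simp add: t_def)
  have c: "c = 2 * t / \<kappa>" using k by (simp add: c_def t_def power2_eq_square)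
  have nz: "A \<noteq> 0 \<or> B \<noteq> 0"
    unfolding A_def B_def by (intro amp_not_both_0 tau_pos add_pos_pos \<beta>_pos k)
  then have M: "A\<^sup>2 + B\<^sup>2 > 0" by (simp add: sum_power2_gt_zero_iff)
  have W: "t ^ Suc n * (A * B' - A' * B) = - pi * (\<beta> * j' * (of_nat n * j - (t + \<beta>) * j'))"
    using amp_Wronskian[OF t, of n \<beta>] by (simp only: A_def B_def A'_def B'_def j_def j'_def t_def)
  have "isCont ?g \<kappa>"
  proof (rule continuous_on_interior)
    show "continuous_on {0..} ?g" using partial_phase_spec by blast
    show "\<kappa> \<in> interior {0..}" using k by (simp add: interior_real_atLeast)
  qed
  moreover have "eventually (\<lambda>y. exp (2 * complex_of_real pi * \<i> * complex_of_real (?g y)) = (of_real (?A y) - \<i> * of_real (?B y)) / (of_real (?A y) + \<i> * of_real (?B y))) (nhds \<kappa>)"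
  proof -
    have "eventually (\<lambda>y. y \<in> {0<..}) (nhds \<kappa>)" using k by (intro eventually_nhds_in_open) auto
    then show ?thesis
    proof eventually_elim
      case (elim y)
      then have y: "y > 0" by simp
      have "exp (2 * complex_of_real pi * \<i> * complex_of_real (?g y)) = scattering_eigenvalue a \<rho> (int n) y"
        using partial_phase_spec[of "int n"] y by blast
      also have "\<dots> = amp_ratio n (tau y) (tau y + \<beta>)" using scattering_eigenvalue_amp[OF y, of "int n"] by simp
      finally show ?case by (simp only: amp_ratio_def)
    qed
  qed
  ultimately have "(?g has_real_derivative - (?A \<kappa> * (B' * c) - A' * c * ?B \<kappa>) / (pi * ((?A \<kappa>)\<^sup>2 + (?B \<kappa>)\<^sup>2))) (at \<kappa>)"
    by (rule phase_has_derivative)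
       (use amp_chain_deriv[OF k, of n] nz in \<open>simp_all only: A_def B_def A'_def B'_def j_def j'_def t_def c_def\<close>)
  then have "(?g has_real_derivative - (A * (B' * c) - A' * c * B) / (pi * (A\<^sup>2 + B\<^sup>2))) (at \<kappa>)"
    by (simp only: A_def B_def)
  moreover have "- (A * (B' * c) - A' * c * B) / (pi * (A\<^sup>2 + B\<^sup>2)) = phase_term \<beta> n (tau \<kappa>) / \<kappa>"
  proof -
    have cancel: "pi * x * (2 * t / \<kappa>) / t ^ Suc n / (pi * m) = 2 * x / (t ^ n * m) / \<kappa>" if "m > 0" for x m
      using t k that by (simp add: field_simps)
    define K where "K = \<beta> * j' * (of_nat n * j - (t + \<beta>) * j')"
    have "A * B' - A' * B = - pi * K / t ^ Suc n" using W t unfolding K_def[symmetric] by (simp add: field_simps)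
    moreover have "- (A * (B' * c) - A' * c * B) = - (A * B' - A' * B) * c" by (simp add: algebra_simps)
    ultimately have "- (A * (B' * c) - A' * c * B) = pi * K * c / t ^ Suc n" by (simp only:) simp
    then have "- (A * (B' * c) - A' * c * B) / (pi * (A\<^sup>2 + B\<^sup>2)) = pi * K * c / t ^ Suc n / (pi * (A\<^sup>2 + B\<^sup>2))" by simp
    also have "\<dots> = 2 * K / (t ^ n * (A\<^sup>2 + B\<^sup>2)) / \<kappa>"
      unfolding c using cancel[OF M] .
    also have "2 * K / (t ^ n * (A\<^sup>2 + B\<^sup>2)) = phase_term \<beta> n (tau \<kappa>)"
      by (simp add: phase_term_def K_def A_def B_def j_def j'_def t_def mult.assoc)
    finally show ?thesis .
  qed
  ultimately show ?thesis by (simp only:)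
qed

end

section \<open>Summation over the angular momenta\<close>

lemma has_sum_int_abs:
  fixes h :: "nat \<Rightarrow> real"
  assumes "summable (\<lambda>n. norm (h (Suc n)))"
  shows "((\<lambda>l::int. h (nat \<bar>l\<bar>)) has_sum (h 0 + 2 * (\<Sum>n. h (Suc n)))) UNIV"
proof -
  let ?p = "\<lambda>n. int (Suc n)" and ?m = "\<lambda>n. - int (Suc n)"
  let ?s = "\<Sum>n. h (Suc n)"
  have s: "((\<lambda>n. h (Suc n)) has_sum ?s) UNIV"
    by (rule norm_summable_imp_has_sum[OF assms summable_sums[OF summable_norm_cancel[OF assms]]])
  have "inj ?p" "inj ?m" by (auto simp: inj_def)
  then have PM: "((\<lambda>l::int. h (nat \<bar>l\<bar>)) has_sum ?s) (range ?p)" "((\<lambda>l::int. h (nat \<bar>l\<bar>)) has_sum ?s) (range ?m)"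
    using s by (simp_all add: has_sum_reindex o_def nat_add_distrib del: of_nat_Suc)
  have "((\<lambda>l::int. h (nat \<bar>l\<bar>)) has_sum (?s + ?s)) (range ?p \<union> range ?m)"
    by (rule has_sum_Un_disjoint[OF PM]) auto
  then have PM': "((\<lambda>l::int. h (nat \<bar>l\<bar>)) has_sum (?s + ?s)) (range ?p \<union> range ?m)" .
  have Z: "((\<lambda>l::int. h (nat \<bar>l\<bar>)) has_sum h 0) {0}"
    using has_sum_finite[of "{0::int}" "\<lambda>l. h (nat \<bar>l\<bar>)"] by simp
  have "((\<lambda>l::int. h (nat \<bar>l\<bar>)) has_sum (h 0 + (?s + ?s))) ({0} \<union> (range ?p \<union> range ?m))"
    by (rule has_sum_Un_disjoint[OF Z PM']) auto
  moreover have "{0} \<union> (range ?p \<union> range ?m) = UNIV"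
  proof -
    have "l \<in> {0} \<union> (range ?p \<union> range ?m)" for l :: int
    proof -
      consider "l = 0" | "l = ?p (nat (l - 1))" | "l = ?m (nat (- l - 1))" by linarith
      then show ?thesis by cases blast+
    qed
    then show ?thesis by blast
  qed
  ultimately show ?thesis by simp
qed

lemma phase_term_summable:
  assumes "b > 0" "uY_small \<tau>"
  shows "summable (\<lambda>n. phase_term b (n + k) \<tau>)"
proof -
  obtain N where N: "\<And>n \<tau>. n \<ge> N \<Longrightarrow> uY_small \<tau> \<Longrightarrow> \<bar>phase_term b n \<tau>\<bar> \<le> 8 * b * (4 * \<tau>) ^ n"
    by (rule phase_term_tail_bound[OF assms(1)]) (rule that)
  have "0 < \<tau>" "\<tau> < 1 / 8" using assms(2) by (auto simp: uY_small_def)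
  then have "summable (\<lambda>n. 8 * b * (4 * \<tau>) ^ n)" by (intro summable_mult summable_geometric) auto
  then have "summable (\<lambda>n. phase_term b n \<tau>)"
    by (rule summable_comparison_test[rotated]) (use N[OF _ assms(2)] in auto)
  then show ?thesis using summable_iff_shift[of "\<lambda>n. phase_term b n \<tau>" k] by simp
qed

text \<open>Finitely many orders n \<ge> 3 are treated one by one, each of size \<tau>^(n - 1) by
  \<open>phase_term_bigo\<close>; from N + 3 on the geometric bound takes over, which holds for one
  range of \<tau> common to all orders.\<close>

lemma phase_term_tail_bigo:
  assumes b: "b > 0"
  shows "(\<lambda>\<tau>. \<Sum>n. phase_term b (n + 3) \<tau>) \<in> O[at_right 0](\<lambda>\<tau>. \<tau>\<^sup>2)"
proof -
  obtain N where N: "\<And>n \<tau>. n \<ge> N \<Longrightarrow> uY_small \<tau> \<Longrightarrow> \<bar>phase_term b n \<tau>\<bar> \<le> 8 * b * (4 * \<tau>) ^ n"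
    by (rule phase_term_tail_bound[OF b]) (rule that)
  have small: "phase_term b (n + 3) \<in> O[at_right 0](\<lambda>\<tau>. \<tau>\<^sup>2)" for n
  proof -
    have "(\<lambda>\<tau>::real. \<tau> ^ Suc (Suc n)) \<in> O[at_right 0](\<lambda>\<tau>. \<tau>\<^sup>2)"
    proof (rule bigoI[where c = 1])
      have "eventually (\<lambda>t. t \<in> {0<..<1}) (at_right (0::real))" by (rule eventually_at_right_real) simp
      then show "eventually (\<lambda>\<tau>::real. norm (\<tau> ^ Suc (Suc n)) \<le> 1 * norm (\<tau>\<^sup>2)) (at_right 0)"
        by eventually_elim (simp add: power2_eq_square abs_mult mult_left_le power_le_one flip: mult.assoc)
    qed
    with phase_term_bigo[OF b, of "Suc n"] have "phase_term b (Suc (Suc (Suc n))) \<in> O[at_right 0](\<lambda>\<tau>. \<tau>\<^sup>2)"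
      by (rule landau_o.big_trans)
    then show ?thesis by (simp add: numeral_3_eq_3)
  qed
  have "(\<lambda>\<tau>. \<Sum>n. phase_term b (n + N + 3) \<tau>) \<in> O[at_right 0](\<lambda>\<tau>. \<tau>\<^sup>2)"
  proof (rule bigoI)
    \<comment> \<open>The constant is 8 b from the tail bound, times 16 from (4 \<tau>)^2, times 2
      from the geometric series of ratio 1 / 2.\<close>
    show "eventually (\<lambda>\<tau>. norm (\<Sum>n. phase_term b (n + N + 3) \<tau>) \<le> (256 * b) * norm (\<tau>\<^sup>2)) (at_right 0)"
      using eventually_uY_small
    proof eventually_elim
      case (elim \<tau>)
      then have t: "0 < \<tau>" "\<tau> < 1 / 8" by (auto simp: uY_small_def)
      have "norm (\<Sum>n. phase_term b (n + N + 3) \<tau>) \<le> (\<Sum>n. (128 * b * \<tau>\<^sup>2) * (1 / 2) ^ n)"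
      proof (rule norm_suminf_le)
        fix n
        have "(4 * \<tau>) ^ (n + N + 3) = (4 * \<tau>)\<^sup>2 * ((4 * \<tau>) ^ n * (4 * \<tau>) ^ Suc N)"
          by (simp add: power_add power2_eq_square power3_eq_cube)
        also have "\<dots> \<le> (4 * \<tau>)\<^sup>2 * ((1 / 2) ^ n * 1)"
          using t by (intro mult_left_mono mult_mono power_mono power_le_one) auto
        finally have "8 * b * (4 * \<tau>) ^ (n + N + 3) \<le> 8 * b * ((4 * \<tau>)\<^sup>2 * ((1 / 2) ^ n * 1))"
          using b by (intro mult_left_mono) auto
        also have "\<dots> = (128 * b * \<tau>\<^sup>2) * (1 / 2) ^ n" by (simp add: power_mult_distrib)
        finally show "norm (phase_term b (n + N + 3) \<tau>) \<le> (128 * b * \<tau>\<^sup>2) * (1 / 2) ^ n"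
          using N[OF _ elim, of "n + N + 3"] by (simp only: real_norm_def) linarith
      qed (intro summable_mult summable_geometric, simp)
      also have "\<dots> = (128 * b * \<tau>\<^sup>2) * (\<Sum>n. (1 / 2) ^ n)"
        by (intro suminf_mult summable_geometric) simp
      also have "(\<Sum>n. (1 / 2 :: real) ^ n) = 2" by (simp add: suminf_geometric)
      finally show ?case by simp
    qed
  qed
  moreover have "(\<lambda>\<tau>. \<Sum>n<N. phase_term b (n + 3) \<tau>) \<in> O[at_right 0](\<lambda>\<tau>. \<tau>\<^sup>2)"
    by (intro big_sum_in_bigo small)
  ultimately have *: "(\<lambda>\<tau>. (\<Sum>n. phase_term b (n + N + 3) \<tau>) + (\<Sum>n<N. phase_term b (n + 3) \<tau>)) \<in> O[at_right 0](\<lambda>\<tau>. \<tau>\<^sup>2)"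
    by (rule sum_in_bigo)
  have ev: "eventually (\<lambda>\<tau>. (\<Sum>n. phase_term b (n + N + 3) \<tau>) + (\<Sum>n<N. phase_term b (n + 3) \<tau>) = (\<Sum>n. phase_term b (n + 3) \<tau>)) (at_right 0)"
    using eventually_uY_small
  proof eventually_elim
    case (elim \<tau>)
    show ?case using suminf_split_initial_segment[OF phase_term_summable[OF b elim, of 3], of N] by simp
  qed
  from * show ?thesis unfolding landau_o.big.in_cong[OF ev] .
qed

text \<open>\<kappa> times the derivative of the scattering phase, with l and -l taken
  together.\<close>

definition phase_sum :: "real \<Rightarrow> real \<Rightarrow> real" where
  "phase_sum b \<tau> = phase_term b 0 \<tau> + 2 * (\<Sum>n. phase_term b (Suc n) \<tau>)"

lemma phase_sum_bigo:
  assumes b: "b > 0"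
    and p: "(\<lambda>\<tau>. phase_term b 0 \<tau> + 2 * phase_term b 1 \<tau> + 2 * phase_term b 2 \<tau> - g \<tau>) \<in> O[at_right 0](e)"
    and e: "(\<lambda>\<tau>. \<tau>\<^sup>2) \<in> O[at_right 0](e)"
  shows "(\<lambda>\<tau>. phase_sum b \<tau> - g \<tau>) \<in> O[at_right 0](e)"
proof -
  have "(\<lambda>\<tau>. 2 * (\<Sum>n. phase_term b (n + 3) \<tau>)) \<in> O[at_right 0](e)"
    using landau_o.big_trans[OF phase_term_tail_bigo[OF b] e] by simp
  from sum_in_bigo(1)[OF p this]
  have *: "(\<lambda>\<tau>. (phase_term b 0 \<tau> + 2 * phase_term b 1 \<tau> + 2 * phase_term b 2 \<tau> - g \<tau>) + 2 * (\<Sum>n. phase_term b (n + 3) \<tau>)) \<in> O[at_right 0](e)" .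
  have ev: "eventually (\<lambda>\<tau>. (phase_term b 0 \<tau> + 2 * phase_term b 1 \<tau> + 2 * phase_term b 2 \<tau> - g \<tau>) + 2 * (\<Sum>n. phase_term b (n + 3) \<tau>) = phase_sum b \<tau> - g \<tau>) (at_right 0)"
    using eventually_uY_small
  proof eventually_elim
    case (elim \<tau>)
    show ?case using suminf_split_initial_segment[OF phase_term_summable[OF b elim, of 1], of 2]
      by (simp add: phase_sum_def numeral_2_eq_2 numeral_3_eq_3)
  qed
  from * show ?thesis unfolding landau_o.big.in_cong[OF ev] .
qed

text \<open>Term-by-term differentiation needs a majorant on a whole interval to the right of 0. The
  division by \<kappa> is harmless because all tail terms carry a factor \<tau>, which is quadratic
  in \<kappa>.\<close>

lemma scattering_phase_deriv:
  assumes a: "a > 0" and \<rho>: "\<rho> > 0"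
  shows "eventually (\<lambda>\<kappa>. (scattering_phase a \<rho> has_real_derivative phase_sum (a\<^sup>2 * \<rho>\<^sup>2 / 4) (\<kappa>\<^sup>2 * \<rho>\<^sup>2 / 4) / \<kappa>) (at \<kappa>)) (at_right 0)"
proof -
  define b where "b = a\<^sup>2 * \<rho>\<^sup>2 / 4"
  define T where "T \<kappa> = \<kappa>\<^sup>2 * \<rho>\<^sup>2 / 4" for \<kappa> :: real
  define h where "h n = partial_phase a \<rho> (int n)" for n
  have b: "b > 0" using a \<rho> by (simp add: b_def)
  have h': "(h n has_real_derivative phase_term b n (T \<kappa>) / \<kappa>) (at \<kappa>)" if "\<kappa> > 0" for n \<kappa>
    unfolding h_def b_def T_def by (rule partial_phase_deriv[OF a \<rho> that])
  have h_cont: "continuous_on {0..} (h n)" "h n 0 = 0" for n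
    using partial_phase_spec[OF a \<rho>, of "int n"] by (auto simp: h_def)
  obtain N where N: "\<And>n \<tau>. n \<ge> N \<Longrightarrow> uY_small \<tau> \<Longrightarrow> \<bar>phase_term b n \<tau>\<bar> \<le> 8 * b * (4 * \<tau>) ^ n"
    by (rule phase_term_tail_bound[OF b]) (rule that)
  have "eventually (\<lambda>\<kappa>. uY_small (T \<kappa>)) (at_right 0)"
    unfolding T_def by (rule eventually_compose_filterlim[OF eventually_uY_small tau_at_right_0[OF a \<rho>]])
  then obtain \<delta> where \<delta>: "\<delta> > 0" "\<And>\<kappa>. 0 < \<kappa> \<Longrightarrow> \<kappa> < \<delta> \<Longrightarrow> uY_small (T \<kappa>)"
    unfolding eventually_at_right_field by auto
  \<comment> \<open>From (4 \<open>T \<kappa>\<close>)^(n + 1) / \<kappa> = \<rho>^2 \<kappa> (4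
    \<open>T \<kappa>\<close>)^n, with \<kappa> < \<delta> and 4 \<open>T \<kappa>\<close> < 1 /
    2.\<close>
  define K where "K = 8 * b * \<rho>\<^sup>2 * \<delta>"
  have K: "K > 0" using b \<rho> \<delta> by (simp add: K_def)
  have bound: "norm (phase_term b (Suc n) (T \<kappa>) / \<kappa>) \<le> K * (1 / 2) ^ n" if k: "0 < \<kappa>" "\<kappa> < \<delta>" and n: "n \<ge> N" for n \<kappa>
  proof -
    have t: "0 < T \<kappa>" "T \<kappa> < 1 / 8" using \<delta>(2)[OF k] by (auto simp: uY_small_def)
    have "norm (phase_term b (Suc n) (T \<kappa>) / \<kappa>) = \<bar>phase_term b (Suc n) (T \<kappa>)\<bar> / \<kappa>" using k by simp
    also have "\<dots> \<le> 8 * b * (4 * T \<kappa>) ^ Suc n / \<kappa>"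
      using N[OF _ \<delta>(2)[OF k], of "Suc n"] n k by (intro divide_right_mono) auto
    also have "\<dots> = 8 * b * \<rho>\<^sup>2 * \<kappa> * (4 * T \<kappa>) ^ n" using k by (simp add: T_def power2_eq_square)
    also have "\<dots> \<le> 8 * b * \<rho>\<^sup>2 * \<delta> * (1 / 2) ^ n"
      using t k b \<rho> \<delta>(1) by (intro mult_mono mult_left_mono power_mono) auto
    finally show ?thesis by (simp add: K_def)
  qed
  \<comment> \<open>Summability of the phases follows from that of their derivatives by the mean
    value theorem on [0, \<kappa>]; here the normalisation of all branches at 0 enters.\<close>
  have hbound: "norm (h (Suc n) \<kappa>) \<le> \<delta> * K * (1 / 2) ^ n" if k: "0 < \<kappa>" "\<kappa> < \<delta>" and n: "n \<ge> N" for n \<kappa>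
  proof -
    have "continuous_on {0..\<kappa>} (h (Suc n))" by (rule continuous_on_subset[OF h_cont(1)]) auto
    moreover have "(h (Suc n) has_derivative (*) (phase_term b (Suc n) (T x) / x)) (at x)" if "0 < x" "x < \<kappa>" for x
      using h'[OF that(1), of "Suc n"] by (rule has_field_derivative_imp_has_derivative)
    ultimately obtain x where x: "0 < x" "x < \<kappa>" "h (Suc n) \<kappa> - h (Suc n) 0 = phase_term b (Suc n) (T x) / x * (\<kappa> - 0)"
      by (rule mvt[OF k(1)])
    have "norm (h (Suc n) \<kappa>) = norm (phase_term b (Suc n) (T x) / x) * \<kappa>"
      using x(3) h_cont(2) k by (simp add: abs_mult)
    also have "\<dots> \<le> (K * (1 / 2) ^ n) * \<delta>"
      using bound[of x n] x k n K by (intro mult_mono) auto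
    finally show ?thesis by (simp add: mult_ac)
  qed
  have geo: "summable (\<lambda>n. c * (1 / 2) ^ n)" for c :: real by (intro summable_mult summable_geometric) simp
  have summ: "summable (\<lambda>n. norm (h (Suc n) \<kappa>))" if "0 < \<kappa>" "\<kappa> < \<delta>" for \<kappa>
    by (rule summable_comparison_test[OF _ geo[of "\<delta> * K"]]) (use hbound[OF that] in auto)
  have phase: "scattering_phase a \<rho> \<kappa> = h 0 \<kappa> + 2 * (\<Sum>n. h (Suc n) \<kappa>)" if "0 < \<kappa>" "\<kappa> < \<delta>" for \<kappa>
  proof -
    have "partial_phase a \<rho> l \<kappa> = h (nat \<bar>l\<bar>) \<kappa>" for l
      unfolding h_def partial_phase_abs[OF a \<rho>, of l] ..
    then show ?thesis unfolding scattering_phase_def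
      using infsumI[OF has_sum_int_abs[OF summ[OF that]]] by simp
  qed
  have "(scattering_phase a \<rho> has_real_derivative phase_sum b (T \<kappa>) / \<kappa>) (at \<kappa>)" if k: "0 < \<kappa>" "\<kappa> < \<delta>" for \<kappa>
  proof -
    have "((\<lambda>\<kappa>. \<Sum>n. h (Suc n) \<kappa>) has_field_derivative (\<Sum>n. phase_term b (Suc n) (T \<kappa>) / \<kappa>)) (at \<kappa>)"
    proof (rule has_field_derivative_series'(2))
      show "convex {0<..<\<delta>}" by simp
      show "(h (Suc n) has_field_derivative phase_term b (Suc n) (T x) / x) (at x within {0<..<\<delta>})" if "x \<in> {0<..<\<delta>}" for n x
        using h'[of x "Suc n"] that by (auto intro: has_field_derivative_at_within)
      show "uniformly_convergent_on {0<..<\<delta>} (\<lambda>n x. \<Sum>i<n. phase_term b (Suc i) (T x) / x)"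
      proof (rule Weierstrass_m_test'_ev[OF _ geo[of K]])
        show "\<forall>\<^sub>F n in sequentially. \<forall>x\<in>{0<..<\<delta>}. norm (phase_term b (Suc n) (T x) / x) \<le> K * (1 / 2) ^ n"
          using eventually_ge_at_top[of N] by eventually_elim (use bound in auto)
      qed
      show "\<kappa> \<in> {0<..<\<delta>}" "\<kappa> \<in> interior {0<..<\<delta>}" using k by (auto simp: interior_open)
      show "summable (\<lambda>n. h (Suc n) \<kappa>)" using summ[OF k] by (rule summable_norm_cancel)
    qed
    from DERIV_add[OF h'[OF k(1), of 0] DERIV_cmult[OF this, of 2]]
    have "((\<lambda>\<kappa>. h 0 \<kappa> + 2 * (\<Sum>n. h (Suc n) \<kappa>)) has_real_derivative phase_sum b (T \<kappa>) / \<kappa>) (at \<kappa>)"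
      using suminf_divide[OF phase_term_summable[OF b \<delta>(2)[OF k], of 1], of \<kappa>]
      by (simp add: phase_sum_def add_divide_distrib)
    then show ?thesis
      by (rule has_field_derivative_transform_within_open[where S = "{0<..<\<delta>}"]) (use k phase in auto)
  qed
  with \<delta>(1) show ?thesis unfolding eventually_at_right_field T_def b_def by blast
qed

text \<open>The factor 2, due to \<tau> being quadratic in \<kappa>, is the origin of the 4 in front
  of the squared logarithm.\<close>

lemma logt_tau:
  assumes "\<kappa> > 0" "\<rho> > 0"
  shows "logt (\<kappa>\<^sup>2 * \<rho>\<^sup>2 / 4) = 2 * (ln \<kappa> + ln (\<rho> / 2) + euler_mascheroni)"
proof -
  have "\<kappa>\<^sup>2 * \<rho>\<^sup>2 / 4 = (\<kappa> * (\<rho> / 2))\<^sup>2" by (simp add: power2_eq_square)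
  then have "ln (\<kappa>\<^sup>2 * \<rho>\<^sup>2 / 4) = 2 * ln (\<kappa> * (\<rho> / 2))" using assms by (simp add: ln_realpow)
  also have "ln (\<kappa> * (\<rho> / 2)) = ln \<kappa> + ln (\<rho> / 2)" by (rule ln_mult_pos) (use assms in simp_all)
  finally show ?thesis by (simp add: logt_def)
qed

lemma scattering_phase_deriv_bigo:
  assumes a: "a > 0" and \<rho>: "\<rho> > 0"
    and g: "(\<lambda>\<tau>. phase_sum (a\<^sup>2 * \<rho>\<^sup>2 / 4) \<tau> - g \<tau>) \<in> O[at_right 0](e)"
    and G: "\<And>\<kappa>. \<kappa> > 0 \<Longrightarrow> g (\<kappa>\<^sup>2 * \<rho>\<^sup>2 / 4) / \<kappa> = G \<kappa>"
    and E: "(\<lambda>\<kappa>. e (\<kappa>\<^sup>2 * \<rho>\<^sup>2 / 4) / \<kappa>) \<in> O[at_right 0](E)"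
  shows "(\<lambda>\<kappa>. deriv (scattering_phase a \<rho>) \<kappa> - G \<kappa>) \<in> O[at_right 0](E)"
proof -
  have "(\<lambda>\<kappa>. phase_sum (a\<^sup>2 * \<rho>\<^sup>2 / 4) (\<kappa>\<^sup>2 * \<rho>\<^sup>2 / 4) - g (\<kappa>\<^sup>2 * \<rho>\<^sup>2 / 4)) \<in> O[at_right 0](\<lambda>\<kappa>. e (\<kappa>\<^sup>2 * \<rho>\<^sup>2 / 4))"
    by (rule landau_o.big.compose[OF g tau_at_right_0[OF a \<rho>]])
  then have "(\<lambda>\<kappa>. (phase_sum (a\<^sup>2 * \<rho>\<^sup>2 / 4) (\<kappa>\<^sup>2 * \<rho>\<^sup>2 / 4) - g (\<kappa>\<^sup>2 * \<rho>\<^sup>2 / 4)) * (1 / \<kappa>)) \<in> O[at_right 0](\<lambda>\<kappa>. e (\<kappa>\<^sup>2 * \<rho>\<^sup>2 / 4) * (1 / \<kappa>))"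
    by (intro landau_o.big.mult landau_o.big_refl)
  with E have *: "(\<lambda>\<kappa>. (phase_sum (a\<^sup>2 * \<rho>\<^sup>2 / 4) (\<kappa>\<^sup>2 * \<rho>\<^sup>2 / 4) - g (\<kappa>\<^sup>2 * \<rho>\<^sup>2 / 4)) * (1 / \<kappa>)) \<in> O[at_right 0](E)"
    using landau_o.big_trans by simp
  have ev: "eventually (\<lambda>\<kappa>. (phase_sum (a\<^sup>2 * \<rho>\<^sup>2 / 4) (\<kappa>\<^sup>2 * \<rho>\<^sup>2 / 4) - g (\<kappa>\<^sup>2 * \<rho>\<^sup>2 / 4)) * (1 / \<kappa>) = deriv (scattering_phase a \<rho>) \<kappa> - G \<kappa>) (at_right 0)"
    using scattering_phase_deriv[OF a \<rho>] eventually_at_right_less[of 0]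
  proof eventually_elim
    case (elim \<kappa>)
    show ?case using DERIV_imp_deriv[OF elim(1)] G[OF elim(2)] by (simp add: diff_divide_distrib)
  qed
  from * show ?thesis unfolding landau_o.big.in_cong[OF ev] .
qed

lemma bigo_double: "f \<in> O[F](g) \<Longrightarrow> (\<lambda>x. 2 * f x :: real) \<in> O[F](g)"
  by simp

theorem theorem1p3:
  fixes a \<rho> \<gamma> :: real
  assumes "a > 0" and "\<rho> > 0"
    and "\<gamma> = - deriv Gamma 1"
  shows
    "(\<forall>\<^sub>F \<kappa> in at_right 0. scattering_phase a \<rho> differentiable (at \<kappa>)) \<and>
     (\<not> zero_resonance a \<rho> \<longrightarrow>
        (\<exists>b::real.
          (\<lambda>\<kappa>. deriv (scattering_phase a \<rho>) \<kappa>
               - (- 1 / \<kappa>) * (2 / (4 * (ln \<kappa> + b)\<^sup>2 + pi\<^sup>2)))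
            \<in> O[at_right 0](\<lambda>\<kappa>. \<kappa>))) \<and>
     (p_resonance a \<rho> \<longrightarrow>
          (\<lambda>\<kappa>. deriv (scattering_phase a \<rho>) \<kappa>
               - (- 1 / \<kappa>) * (2 / (4 * (ln \<kappa> + ln (\<rho> / 2) + \<gamma>)\<^sup>2 + pi\<^sup>2)
                               + 1 / ((ln \<kappa> + ln (\<rho> / 2) + \<gamma> - 1 / 2)\<^sup>2 + pi\<^sup>2 / 4)))
            \<in> O[at_right 0](\<lambda>\<kappa>. \<kappa>)) \<and>
     (s_resonance a \<rho> \<longrightarrow>
          (\<lambda>\<kappa>. deriv (scattering_phase a \<rho>) \<kappa> - (- (3 / 2) * \<rho>\<^sup>2 * \<kappa>))
            \<in> O[at_right 0](\<lambda>\<kappa>. \<kappa> ^ 3 * ln \<kappa>))"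
proof -
  define \<beta> where "\<beta> = a\<^sup>2 * \<rho>\<^sup>2 / 4"
  have \<beta>: "\<beta> > 0" using assms by (simp add: \<beta>_def)
  note main = scattering_phase_deriv_bigo[OF assms(1,2), folded \<beta>_def]
  have \<gamma>: "\<gamma> = euler_mascheroni"
  proof -
    have "(Gamma has_field_derivative Gamma 1 * Digamma 1) (at (1::real))"
      by (rule has_field_derivative_Gamma) simp
    then show ?thesis using assms(3) by (simp add: DERIV_imp_deriv)
  qed
  have E1: "(\<lambda>\<kappa>. \<kappa>\<^sup>2 * \<rho>\<^sup>2 / 4 / \<kappa>) \<in> O[at_right 0](\<lambda>\<kappa>. \<kappa>)"
    by (rule bigoI[where c = "\<rho>\<^sup>2 / 4"]) (auto simp: power2_eq_square abs_mult intro!: always_eventually)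
  have t2: "(\<lambda>\<tau>::real. \<tau>\<^sup>2) \<in> O[at_right 0](\<lambda>\<tau>. \<tau>)" "(\<lambda>\<tau>::real. \<tau>\<^sup>2) \<in> O[at_right 0](\<lambda>\<tau>. \<tau> * (\<tau> * ln \<tau>))"
    by real_asymp+
  have p2: "(\<lambda>\<tau>. 2 * phase_term \<beta> 2 \<tau>) \<in> O[at_right 0](\<lambda>\<tau>. \<tau>)"
    using phase_term_bigo[OF \<beta>, of 0] by (simp add: numeral_2_eq_2)
  have "\<forall>\<^sub>F \<kappa> in at_right 0. scattering_phase a \<rho> differentiable (at \<kappa>)"
    using scattering_phase_deriv[OF assms(1,2)] by eventually_elim (auto simp: real_differentiable_def)
  moreover have "\<exists>b::real. (\<lambda>\<kappa>. deriv (scattering_phase a \<rho>) \<kappa> - (- 1 / \<kappa>) * (2 / (4 * (ln \<kappa> + b)\<^sup>2 + pi\<^sup>2))) \<in> O[at_right 0](\<lambda>\<kappa>. \<kappa>)"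
    if nores: "\<not> zero_resonance a \<rho>"
  proof -
    have j: "rJ 0 \<beta> \<noteq> 0" "rJ 1 \<beta> \<noteq> 0"
      using zero_resonanceI[OF assms(2,1)] nores by (auto simp: \<beta>_def)
    \<comment> \<open>In terms of \<kappa>, \<open>logt\<close> + q is 2 (ln \<kappa> + b) with b =
      ln (\<rho> / 2) + \<gamma> + q / 2.\<close>
    define q where "q = rJ 0 \<beta> / (\<beta> * rJ 1 \<beta>)"
    have p0: "(\<lambda>\<tau>. phase_term \<beta> 0 \<tau> - (- 2 / ((logt \<tau> + q)\<^sup>2 + pi\<^sup>2))) \<in> O[at_right 0](\<lambda>\<tau>. \<tau>)"
      unfolding q_def by (rule phase_term_0_log[OF \<beta> j(2)])
    have p1: "(\<lambda>\<tau>. 2 * phase_term \<beta> 1 \<tau>) \<in> O[at_right 0](\<lambda>\<tau>. \<tau>)"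
      using phase_term_nonresonant_bigo[OF \<beta> j(1)] by simp
    have F: "(\<lambda>\<tau>. phase_term \<beta> 0 \<tau> + 2 * phase_term \<beta> 1 \<tau> + 2 * phase_term \<beta> 2 \<tau> - (- 2 / ((logt \<tau> + q)\<^sup>2 + pi\<^sup>2))) \<in> O[at_right 0](\<lambda>\<tau>. \<tau>)"
      using sum_in_bigo(1)[OF sum_in_bigo(1)[OF p0 p1] p2] by (simp add: algebra_simps)
    have "(\<lambda>\<kappa>. deriv (scattering_phase a \<rho>) \<kappa> - (- 1 / \<kappa>) * (2 / (4 * (ln \<kappa> + (ln (\<rho> / 2) + \<gamma> + q / 2))\<^sup>2 + pi\<^sup>2))) \<in> O[at_right 0](\<lambda>\<kappa>. \<kappa>)"
    proof (rule main[OF phase_sum_bigo[OF \<beta> F t2(1)] _ E1])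
      fix \<kappa> :: real assume "\<kappa> > 0"
      have "logt (\<kappa>\<^sup>2 * \<rho>\<^sup>2 / 4) + q = 2 * (ln \<kappa> + (ln (\<rho> / 2) + \<gamma> + q / 2))"
        using logt_tau[OF \<open>\<kappa> > 0\<close> assms(2)] \<gamma> by simp
      then have "(logt (\<kappa>\<^sup>2 * \<rho>\<^sup>2 / 4) + q)\<^sup>2 = 4 * (ln \<kappa> + (ln (\<rho> / 2) + \<gamma> + q / 2))\<^sup>2"
        by (simp only: power_mult_distrib) simp
      then show "- 2 / ((logt (\<kappa>\<^sup>2 * \<rho>\<^sup>2 / 4) + q)\<^sup>2 + pi\<^sup>2) / \<kappa> = (- 1 / \<kappa>) * (2 / (4 * (ln \<kappa> + (ln (\<rho> / 2) + \<gamma> + q / 2))\<^sup>2 + pi\<^sup>2))"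
        by (simp only:) simp
    qed
    then show ?thesis by blast
  qed
  moreover have "(\<lambda>\<kappa>. deriv (scattering_phase a \<rho>) \<kappa>
               - (- 1 / \<kappa>) * (2 / (4 * (ln \<kappa> + ln (\<rho> / 2) + \<gamma>)\<^sup>2 + pi\<^sup>2)
                               + 1 / ((ln \<kappa> + ln (\<rho> / 2) + \<gamma> - 1 / 2)\<^sup>2 + pi\<^sup>2 / 4))) \<in> O[at_right 0](\<lambda>\<kappa>. \<kappa>)"
    if res: "p_resonance a \<rho>"
  proof -
    have j0: "rJ 0 \<beta> = 0" using p_resonance_imp[OF res assms(2)] by (simp add: \<beta>_def)
    have j1: "rJ 1 \<beta> \<noteq> 0" using rJ_not_both_0[OF \<beta> j0] by simp
    have p0: "(\<lambda>\<tau>. phase_term \<beta> 0 \<tau> - (- 2 / ((logt \<tau>)\<^sup>2 + pi\<^sup>2))) \<in> O[at_right 0](\<lambda>\<tau>. \<tau>)"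
      using phase_term_0_log[OF \<beta> j1] j0 by simp
    have "(\<lambda>\<tau>. 2 * (phase_term \<beta> 1 \<tau> - (- 2 / ((logt \<tau> - 1)\<^sup>2 + pi\<^sup>2)))) \<in> O[at_right 0](\<lambda>\<tau>. \<tau>)"
      by (rule bigo_double[OF phase_term_1_log[OF \<beta> j0]])
    from sum_in_bigo(1)[OF sum_in_bigo(1)[OF p0 this] p2]
    have F: "(\<lambda>\<tau>. phase_term \<beta> 0 \<tau> + 2 * phase_term \<beta> 1 \<tau> + 2 * phase_term \<beta> 2 \<tau>
        - (- 2 / ((logt \<tau>)\<^sup>2 + pi\<^sup>2) + 2 * (- 2 / ((logt \<tau> - 1)\<^sup>2 + pi\<^sup>2)))) \<in> O[at_right 0](\<lambda>\<tau>. \<tau>)"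
      by (simp add: algebra_simps)
    show ?thesis
    proof (rule main[OF phase_sum_bigo[OF \<beta> F t2(1)] _ E1])
      fix \<kappa> :: real assume "\<kappa> > 0"
      define L where "L = ln \<kappa> + ln (\<rho> / 2) + \<gamma>"
      have L: "logt (\<kappa>\<^sup>2 * \<rho>\<^sup>2 / 4) = 2 * L"
        using logt_tau[OF \<open>\<kappa> > 0\<close> assms(2)] \<gamma> by (simp add: L_def)
      \<comment> \<open>Order 1 counts twice, for l = 1 and l = -1; twice 2 / 4 is the numerator 1
        of the second fraction.\<close>
      have q: "(2 * L - 1)\<^sup>2 + pi\<^sup>2 = 4 * ((L - 1 / 2)\<^sup>2 + pi\<^sup>2 / 4)"
        by (simp add: power2_eq_square algebra_simps)
      have z: "2 * (- 2 / (4 * z)) = - (1 / z)" for z :: real by simp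
      have e: "2 * (- 2 / ((2 * L - 1)\<^sup>2 + pi\<^sup>2)) = - (1 / ((L - 1 / 2)\<^sup>2 + pi\<^sup>2 / 4))"
        unfolding q by (rule z)
      have s: "(- 2 / x + - y) / \<kappa> = (- 1 / \<kappa>) * (2 / x + y)" for x y :: real
        by (simp add: add_divide_distrib diff_divide_distrib)
      have e': "(2 * L)\<^sup>2 = 4 * L\<^sup>2" by (simp add: power_mult_distrib)
      show "(- 2 / ((logt (\<kappa>\<^sup>2 * \<rho>\<^sup>2 / 4))\<^sup>2 + pi\<^sup>2) + 2 * (- 2 / ((logt (\<kappa>\<^sup>2 * \<rho>\<^sup>2 / 4) - 1)\<^sup>2 + pi\<^sup>2))) / \<kappa>
         = (- 1 / \<kappa>) * (2 / (4 * (ln \<kappa> + ln (\<rho> / 2) + \<gamma>)\<^sup>2 + pi\<^sup>2) + 1 / ((ln \<kappa> + ln (\<rho> / 2) + \<gamma> - 1 / 2)\<^sup>2 + pi\<^sup>2 / 4))"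
        unfolding L e e' L_def[symmetric] by (rule s)
    qed
  qed
  moreover have "(\<lambda>\<kappa>. deriv (scattering_phase a \<rho>) \<kappa> - (- (3 / 2) * \<rho>\<^sup>2 * \<kappa>)) \<in> O[at_right 0](\<lambda>\<kappa>. \<kappa> ^ 3 * ln \<kappa>)"
    if res: "s_resonance a \<rho>"
  proof -
    have j1: "rJ 1 \<beta> = 0" using s_resonance_imp[OF res assms(2,1)] by (simp add: \<beta>_def)
    have "(\<lambda>\<tau>. 2 * (phase_term \<beta> 1 \<tau> - (- 2 * \<tau>))) \<in> O[at_right 0](\<lambda>\<tau>. \<tau> * (\<tau> * ln \<tau>))"
      "(\<lambda>\<tau>. 2 * (phase_term \<beta> 2 \<tau> - (- \<tau>))) \<in> O[at_right 0](\<lambda>\<tau>. \<tau> * (\<tau> * ln \<tau>))"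
      by (rule bigo_double[OF phase_term_1_s[OF \<beta> j1]], rule bigo_double[OF phase_term_2_s[OF \<beta> j1]])
    from sum_in_bigo(1)[OF sum_in_bigo(1)[OF phase_term_0_s[OF \<beta> j1] this(1)] this(2)]
    \<comment> \<open>The orders 1 and 2, each for both signs of l, give 2 (-2 \<tau>) + 2 (-\<tau>)
      = -6 \<tau>. With \<tau> = \<kappa>^2 \<rho>^2 / 4, division by \<kappa> yields -(3/2)
      \<rho>^2 \<kappa>.\<close>
    have *: "(\<lambda>\<tau>. phase_term \<beta> 0 \<tau> + 2 * phase_term \<beta> 1 \<tau> + 2 * phase_term \<beta> 2 \<tau> - (- 6 * \<tau>)) \<in> O[at_right 0](\<lambda>\<tau>. \<tau> * (\<tau> * ln \<tau>))"
      by (simp add: algebra_simps)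
    have E3: "(\<lambda>\<kappa>. (\<kappa>\<^sup>2 * \<rho>\<^sup>2 / 4) * ((\<kappa>\<^sup>2 * \<rho>\<^sup>2 / 4) * ln (\<kappa>\<^sup>2 * \<rho>\<^sup>2 / 4)) / \<kappa>) \<in> O[at_right 0](\<lambda>\<kappa>. \<kappa> ^ 3 * ln \<kappa>)"
      using assms(2) by real_asymp
    show ?thesis
      by (rule main[OF phase_sum_bigo[OF \<beta> * t2(2)] _ E3]) (simp add: power2_eq_square field_simps)
  qed
  ultimately show ?thesis by blast
qed

end
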